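(* Let $(G,\tau)$ be an admissible $\sigma$-locally compact right topological group. Then $B(G)$ and $A(G)$ are commutative Banach algebras satisfying the following: 1. $B(G)$ is closed under translations on $G$; 2. $B(G,\sigma)=B(G/N(G))$ (functions on $G/N(G)$ being identified with functions on $G$ via the quotient map) and $A(G)=A(G,\sigma)$; 3. $B(G)$ separates points from closed sets if and only if $G$ is a topological group; 4. $A(G)$ separates points in $G$ if and only if $G$ is a topological group.
   Context: A right topological group is a group $G$ with a topology $\tau$ such that for every $x\in G$ the map $g\mapsto gx$ is continuous. Its topological center is $\Lambda(G)=\{x\in G : g\mapsto xg \text{ is continuous}\}$; $G$ is admissible if $\Lambda(G)$ is dense. "$\sigma$-locally compact" means locally compact and $\sigma$-compact. The $\sigma$-topology on $G$ is the quotient topology on $G$ induced by $(G,\tau)\times(G,\tau)\to G$, $(x,y)\mapsto x^{-1}y$. $N(G)$ is the intersection of all closed neighbourhoods of $e$ in $(G,\sigma)$; it is a normal subgroup, and $G/N(G)$ is the quotient group with the quotient topology. $C(G,\sigma)$ denotes the $\sigma$-continuous complex functions on $G$; $C_b(G)$ and $C_c(G)$ are the bounded continuous functions and the compactly supported continuous functions on $(G,\tau)$. Let $G_d$ be $G$ with the discrete topology. $B(G_d)$ is the Fourier–Stieltjes algebra of the discrete group $G_d$, i.e. the linear span of the positive definite functions on $G$, with the norm it has as the dual of the group $C^*$-algebra $C^*(G_d)$ (the completion of $\ell_1(G)$ in the norm $\|f\|_*=\sup_\pi\|\pi(f)\|$ over non-degenerate $*$-representations), and pointwise multiplication. Define $B(G)=B(G_d)\cap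 C_b(G)$ with the norm of $B(G_d)$; $A(G)$ is the closure of $B(G_d)\cap C_c(G)$ in $B(G)$; $B(G,\sigma)=B(G)\cap C(G,\sigma)$; $A(G,\sigma)=A(G)\cap C(G,\sigma)$. $B(G/N(G))$ is defined in the same way for the group $G/N(G)$. Translations of $f$ are $L_gf(x)=f(gx)$ and $R_gf(x)=f(xg)$, $g\in G$. A family of functions separates points from closed sets if for every closed $M\subset G$ and $x\notin M$ there is $f$ in the family with $f(x)\notin\overline{f(M)}$.
   Formalization: The topology of G is assumed to be Hausdorff; without this, item 4 fails for the two-element group with the indiscrete topology, where A(G) contains only constants although G is a topological group. *)

theory Defs
  imports "HOL-Analysis.Analysis" "HOL-Algebra.Coset" "HOL-Library.Function_Algebras"
begin

section \<open>Right topological groups\<close>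

definition right_topological_group :: "('a, 'm) monoid_scheme \<Rightarrow> 'a topology \<Rightarrow> bool" where
  "right_topological_group G T \<longleftrightarrow>
     group G \<and> topspace T = carrier G \<and>
     (\<forall>x\<in>carrier G. continuous_map T T (\<lambda>g. g \<otimes>\<^bsub>G\<^esub> x))"

definition topological_center :: "('a, 'm) monoid_scheme \<Rightarrow> 'a topology \<Rightarrow> 'a set" where
  "topological_center G T = {x \<in> carrier G. continuous_map T T (\<lambda>g. x \<otimes>\<^bsub>G\<^esub> g)}"

definition admissible :: "('a, 'm) monoid_scheme \<Rightarrow> 'a topology \<Rightarrow> bool" where
  "admissible G T \<longleftrightarrow> Abstract_Topology.closure_of T (topological_center G T) = topspace T"

definition sigma_locally_compact :: "'a topology \<Rightarrow> bool" where
  "sigma_locally_compact T \<longleftrightarrow>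
     locally_compact_space T \<and>
     (\<exists>K :: nat \<Rightarrow> 'a set. (\<forall>n. compactin T (K n)) \<and> (\<Union>n. K n) = topspace T)"

definition topological_group :: "('a, 'm) monoid_scheme \<Rightarrow> 'a topology \<Rightarrow> bool" where
  "topological_group G T \<longleftrightarrow>
     group G \<and> topspace T = carrier G \<and>
     continuous_map (prod_topology T T) T (\<lambda>(x, y). x \<otimes>\<^bsub>G\<^esub> y) \<and>
     continuous_map T T (\<lambda>x. inv\<^bsub>G\<^esub> x)"

definition quotient_topology :: "'a topology \<Rightarrow> ('a \<Rightarrow> 'b) \<Rightarrow> 'b topology" where
  "quotient_topology X f =
     topology (\<lambda>U. U \<subseteq> f ` topspace X \<and> openin X {x \<in> topspace X. f x \<in> U})"

lemma openin_quotient_topology: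
  "openin (quotient_topology X f) U \<longleftrightarrow>
     U \<subseteq> f ` topspace X \<and> openin X {x \<in> topspace X. f x \<in> U}"
proof -
  let ?P = "\<lambda>U. U \<subseteq> f ` topspace X \<and> openin X {x \<in> topspace X. f x \<in> U}"
  have "?P (S \<inter> S')" if "?P S" "?P S'" for S S'
  proof -
    have "{x \<in> topspace X. f x \<in> S \<inter> S'} =
          {x \<in> topspace X. f x \<in> S} \<inter> {x \<in> topspace X. f x \<in> S'}" by blast
    moreover have "openin X ({x \<in> topspace X. f x \<in> S} \<inter> {x \<in> topspace X. f x \<in> S'})"
      using that by (intro openin_Int) simp_all
    ultimately show ?thesis using that(1) by (simp add: le_infI1)
  qed
  moreover have "?P (\<Union>\<K>)" if "\<forall>K\<in>\<K>. ?P K" for \<K>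
  proof -
    have "{x \<in> topspace X. f x \<in> \<Union>\<K>} = (\<Union>K\<in>\<K>. {x \<in> topspace X. f x \<in> K})" by blast
    moreover have "openin X (\<Union>K\<in>\<K>. {x \<in> topspace X. f x \<in> K})"
      using that by (intro openin_Union) blast
    ultimately show ?thesis using that by (simp add: Sup_le_iff)
  qed
  ultimately have "istopology ?P"
    unfolding istopology_def by (intro conjI allI impI) simp_all
  then show ?thesis
    by (simp add: quotient_topology_def topology_inverse')
qed

lemma quotient_map_quotient_topology: "quotient_map X (quotient_topology X f) f"
proof -
  have "topspace (quotient_topology X f) = f ` topspace X"
  proof
    show "topspace (quotient_topology X f) \<subseteq> f ` topspace X"
      using openin_quotient_topology[of X f "topspace (quotient_topology X f)"] by simp
    have "{x \<in> topspace X. f x \<in> f ` topspace X} = topspace X" by blast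
    then have "openin (quotient_topology X f) (f ` topspace X)"
      by (simp add: openin_quotient_topology)
    then show "f ` topspace X \<subseteq> topspace (quotient_topology X f)"
      by (rule openin_subset)
  qed
  then show ?thesis
    by (simp add: quotient_map_def openin_quotient_topology)
qed

definition sigma_topology :: "('a, 'm) monoid_scheme \<Rightarrow> 'a topology \<Rightarrow> 'a topology" where
  "sigma_topology G T =
     quotient_topology (prod_topology T T) (\<lambda>(x, y). inv\<^bsub>G\<^esub> x \<otimes>\<^bsub>G\<^esub> y)"

definition N_subgroup :: "('a, 'm) monoid_scheme \<Rightarrow> 'a topology \<Rightarrow> 'a set" where
  "N_subgroup G T =
     \<Inter>{V. closedin (sigma_topology G T) V \<and>
         (\<exists>U. openin (sigma_topology G T) U \<and> \<one>\<^bsub>G\<^esub> \<in> U \<and> U \<subseteq> V)}"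

definition quotient_group_topology ::
  "('a, 'm) monoid_scheme \<Rightarrow> 'a topology \<Rightarrow> 'a set \<Rightarrow> 'a set topology" where
  "quotient_group_topology G T N = quotient_topology T (\<lambda>x. N #>\<^bsub>G\<^esub> x)"


section \<open>Complex normed spaces of functions\<close>

text \<open>A complex function on a group \<open>G\<close> is represented by a function on the ambient type
  vanishing off \<open>carrier G\<close>, so that the vector space operations and the pointwise product
  are those of \<^typ>\<open>'a \<Rightarrow> complex\<close>.\<close>

definition functions_on :: "('a, 'm) monoid_scheme \<Rightarrow> ('a \<Rightarrow> complex) set" where
  "functions_on G = {f. \<forall>x. x \<notin> carrier G \<longrightarrow> f x = 0}"

definition fscale :: "complex \<Rightarrow> ('b \<Rightarrow> complex) \<Rightarrow> 'b \<Rightarrow> complex" where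
  "fscale c f = (\<lambda>x. c * f x)"

definition complex_subspace :: "('b \<Rightarrow> complex) set \<Rightarrow> bool" where
  "complex_subspace V \<longleftrightarrow>
     0 \<in> V \<and> (\<forall>u\<in>V. \<forall>v\<in>V. u + v \<in> V) \<and> (\<forall>c. \<forall>v\<in>V. fscale c v \<in> V)"

definition norm_on :: "('b \<Rightarrow> complex) set \<Rightarrow> (('b \<Rightarrow> complex) \<Rightarrow> real) \<Rightarrow> bool" where
  "norm_on V n \<longleftrightarrow>
     (\<forall>v\<in>V. 0 \<le> n v) \<and> (\<forall>v\<in>V. n v = 0 \<longleftrightarrow> v = 0) \<and>
     (\<forall>c. \<forall>v\<in>V. n (fscale c v) = cmod c * n v) \<and>
     (\<forall>u\<in>V. \<forall>v\<in>V. n (u + v) \<le> n u + n v)"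

definition complete_on :: "('b \<Rightarrow> complex) set \<Rightarrow> (('b \<Rightarrow> complex) \<Rightarrow> real) \<Rightarrow> bool" where
  "complete_on V n \<longleftrightarrow>
     (\<forall>s :: nat \<Rightarrow> 'b \<Rightarrow> complex.
        (\<forall>k. s k \<in> V) \<and> (\<forall>e>0. \<exists>M. \<forall>j\<ge>M. \<forall>k\<ge>M. n (s j - s k) < e) \<longrightarrow>
        (\<exists>l\<in>V. (\<lambda>k. n (s k - l)) \<longlonglongrightarrow> 0))"

text \<open>Banach algebras are not required to have a unit. Commutativity and the other ring laws
  hold automatically for the pointwise product.\<close>

definition commutative_banach_algebra ::
  "('b \<Rightarrow> complex) set \<Rightarrow> (('b \<Rightarrow> complex) \<Rightarrow> real) \<Rightarrow> bool" where
  "commutative_banach_algebra B n \<longleftrightarrow>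
     complex_subspace B \<and> norm_on B n \<and> complete_on B n \<and>
     (\<forall>f\<in>B. \<forall>g\<in>B. f * g \<in> B \<and> n (f * g) \<le> n f * n g)"


section \<open>Representations of the group algebra and the norm of the group C*-algebra\<close>

text \<open>The vectors are functions and the linear structure is the pointwise one, but the inner
  product \<open>ip\<close> (linear in the first argument) is arbitrary: this is merely a choice of
  underlying set, and every Hilbert space whose algebraic dimension does not exceed that of
  \<^typ>\<open>'b \<Rightarrow> complex\<close> is isomorphic to one of this form.\<close>

definition ip_norm ::
  "(('b \<Rightarrow> complex) \<Rightarrow> ('b \<Rightarrow> complex) \<Rightarrow> complex) \<Rightarrow> ('b \<Rightarrow> complex) \<Rightarrow> real" where
  "ip_norm ip v = sqrt (Re (ip v v))"

definition hilbert_space ::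
  "('b \<Rightarrow> complex) set \<Rightarrow> (('b \<Rightarrow> complex) \<Rightarrow> ('b \<Rightarrow> complex) \<Rightarrow> complex) \<Rightarrow> bool" where
  "hilbert_space V ip \<longleftrightarrow>
     complex_subspace V \<and>
     (\<forall>u\<in>V. \<forall>v\<in>V. \<forall>w\<in>V. ip (u + v) w = ip u w + ip v w) \<and>
     (\<forall>c. \<forall>u\<in>V. \<forall>v\<in>V. ip (fscale c u) v = c * ip u v) \<and>
     (\<forall>u\<in>V. \<forall>v\<in>V. ip v u = cnj (ip u v)) \<and>
     (\<forall>v\<in>V. v \<noteq> 0 \<longrightarrow> Re (ip v v) > 0) \<and>
     complete_on V (ip_norm ip)"

definition bounded_operator ::
  "('b \<Rightarrow> complex) set \<Rightarrow> (('b \<Rightarrow> complex) \<Rightarrow> ('b \<Rightarrow> complex) \<Rightarrow> complex) \<Rightarrow>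
   (('b \<Rightarrow> complex) \<Rightarrow> 'b \<Rightarrow> complex) \<Rightarrow> bool" where
  "bounded_operator V ip A \<longleftrightarrow>
     (\<forall>v\<in>V. A v \<in> V) \<and>
     (\<forall>u\<in>V. \<forall>v\<in>V. A (u + v) = A u + A v) \<and>
     (\<forall>c. \<forall>v\<in>V. A (fscale c v) = fscale c (A v)) \<and>
     (\<exists>C. \<forall>v\<in>V. ip_norm ip (A v) \<le> C * ip_norm ip v)"

definition operator_norm ::
  "('b \<Rightarrow> complex) set \<Rightarrow> (('b \<Rightarrow> complex) \<Rightarrow> ('b \<Rightarrow> complex) \<Rightarrow> complex) \<Rightarrow>
   (('b \<Rightarrow> complex) \<Rightarrow> 'b \<Rightarrow> complex) \<Rightarrow> real" where
  "operator_norm V ip A = Sup {ip_norm ip (A v) | v. v \<in> V \<and> ip_norm ip v \<le> 1}"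

definition ell1 :: "('a, 'm) monoid_scheme \<Rightarrow> ('a \<Rightarrow> complex) set" where
  "ell1 G = {f \<in> functions_on G. (\<lambda>x. cmod (f x)) summable_on carrier G}"

definition convolution ::
  "('a, 'm) monoid_scheme \<Rightarrow> ('a \<Rightarrow> complex) \<Rightarrow> ('a \<Rightarrow> complex) \<Rightarrow> 'a \<Rightarrow> complex" where
  "convolution G f g =
     (\<lambda>x. if x \<in> carrier G
          then \<Sum>\<^sub>\<infinity>y\<in>carrier G. f y * g (inv\<^bsub>G\<^esub> y \<otimes>\<^bsub>G\<^esub> x) else 0)"

definition involution :: "('a, 'm) monoid_scheme \<Rightarrow> ('a \<Rightarrow> complex) \<Rightarrow> 'a \<Rightarrow> complex" where
  "involution G f = (\<lambda>x. if x \<in> carrier G then cnj (f (inv\<^bsub>G\<^esub> x)) else 0)"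

definition nondegenerate_star_rep ::
  "('a, 'm) monoid_scheme \<Rightarrow>
   ('b \<Rightarrow> complex) set \<Rightarrow> (('b \<Rightarrow> complex) \<Rightarrow> ('b \<Rightarrow> complex) \<Rightarrow> complex) \<Rightarrow>
   (('a \<Rightarrow> complex) \<Rightarrow> ('b \<Rightarrow> complex) \<Rightarrow> 'b \<Rightarrow> complex) \<Rightarrow> bool" where
  "nondegenerate_star_rep G V ip \<pi> \<longleftrightarrow>
     hilbert_space V ip \<and>
     (\<forall>f\<in>ell1 G. bounded_operator V ip (\<pi> f)) \<and>
     (\<forall>f\<in>ell1 G. \<forall>g\<in>ell1 G. \<forall>v\<in>V. \<pi> (f + g) v = \<pi> f v + \<pi> g v) \<and>
     (\<forall>c. \<forall>f\<in>ell1 G. \<forall>v\<in>V. \<pi> (fscale c f) v = fscale c (\<pi> f v)) \<and>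
     (\<forall>f\<in>ell1 G. \<forall>g\<in>ell1 G. \<forall>v\<in>V. \<pi> (convolution G f g) v = \<pi> f (\<pi> g v)) \<and>
     (\<forall>f\<in>ell1 G. \<forall>u\<in>V. \<forall>v\<in>V. ip (\<pi> f u) v = ip u (\<pi> (involution G f) v)) \<and>
     (\<forall>v\<in>V. \<forall>e>0. \<exists>(k :: nat) f w.
        (\<forall>i<k. f i \<in> ell1 G \<and> w i \<in> V) \<and> ip_norm ip (v - (\<Sum>i<k. \<pi> (f i) (w i))) < e)"

text \<open>HOL cannot quantify over all Hilbert spaces, so the supremum is taken over those whose
  vectors are functions \<^typ>\<open>'a \<Rightarrow> complex\<close>. Nothing is lost: the supremum over all
  representations equals the supremum over the cyclic ones, and a representation with cyclic
  vector \<open>\<xi>\<close> is transported to such a space by the injective linear map sending \<open>v\<close> to the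
  function \<open>x \<mapsto> \<langle>v, \<pi>(\<delta>\<^sub>x) \<xi>\<rangle>\<close>.\<close>

definition cstar_norm :: "('a, 'm) monoid_scheme \<Rightarrow> ('a \<Rightarrow> complex) \<Rightarrow> real" where
  "cstar_norm G f =
     Sup {operator_norm V ip (\<pi> f) |
            (V :: ('a \<Rightarrow> complex) set) ip \<pi>. nondegenerate_star_rep G V ip \<pi>}"


section \<open>Fourier-Stieltjes and Fourier algebras\<close>

definition positive_definite :: "('a, 'm) monoid_scheme \<Rightarrow> ('a \<Rightarrow> complex) \<Rightarrow> bool" where
  "positive_definite G p \<longleftrightarrow>
     p \<in> functions_on G \<and>
     (\<forall>(n :: nat) c x. (\<forall>i<n. x i \<in> carrier G) \<longrightarrow>
        (\<Sum>i<n. \<Sum>j<n. c i * cnj (c j) * p (inv\<^bsub>G\<^esub> (x j) \<otimes>\<^bsub>G\<^esub> x i)) \<in> \<real>\<^sub>\<ge>\<^sub>0)"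

definition B_discrete :: "('a, 'm) monoid_scheme \<Rightarrow> ('a \<Rightarrow> complex) set" where
  "B_discrete G =
     {f. \<exists>(n :: nat) c p. (\<forall>i<n. positive_definite G (p i)) \<and> f = (\<Sum>i<n. fscale (c i) (p i))}"

text \<open>The function \<open>f\<close> acts on \<open>C*(G\<^sub>d)\<close> by \<open>h \<mapsto> (\<Sum>x. f x * h x)\<close> for \<open>h\<close> in the dense subspace
  \<open>\<ell>\<^sub>1(G)\<close>, on which its dual norm can be computed.\<close>

definition B_norm :: "('a, 'm) monoid_scheme \<Rightarrow> ('a \<Rightarrow> complex) \<Rightarrow> real" where
  "B_norm G f =
     Sup {cmod (\<Sum>\<^sub>\<infinity>x\<in>carrier G. f x * h x) | h. h \<in> ell1 G \<and> cstar_norm G h \<le> 1}"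

definition continuous_functions :: "'a topology \<Rightarrow> ('a \<Rightarrow> complex) set" where
  "continuous_functions T = {f. continuous_map T euclidean f}"

definition bounded_continuous_functions :: "'a topology \<Rightarrow> ('a \<Rightarrow> complex) set" where
  "bounded_continuous_functions T = {f \<in> continuous_functions T. bounded (f ` topspace T)}"

definition compactly_supported_functions :: "'a topology \<Rightarrow> ('a \<Rightarrow> complex) set" where
  "compactly_supported_functions T =
     {f \<in> continuous_functions T. compactin T (Abstract_Topology.closure_of T {x \<in> topspace T. f x \<noteq> 0})}"

definition B_alg :: "('a, 'm) monoid_scheme \<Rightarrow> 'a topology \<Rightarrow> ('a \<Rightarrow> complex) set" where
  "B_alg G T = B_discrete G \<inter> bounded_continuous_functions T"

definition A_alg :: "('a, 'm) monoid_scheme \<Rightarrow> 'a topology \<Rightarrow> ('a \<Rightarrow> complex) set" where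
  "A_alg G T =
     {f \<in> B_alg G T.
        \<forall>e>0. \<exists>g \<in> B_discrete G \<inter> compactly_supported_functions T. B_norm G (f - g) < e}"

definition B_sigma :: "('a, 'm) monoid_scheme \<Rightarrow> 'a topology \<Rightarrow> ('a \<Rightarrow> complex) set" where
  "B_sigma G T = B_alg G T \<inter> continuous_functions (sigma_topology G T)"

definition A_sigma :: "('a, 'm) monoid_scheme \<Rightarrow> 'a topology \<Rightarrow> ('a \<Rightarrow> complex) set" where
  "A_sigma G T = A_alg G T \<inter> continuous_functions (sigma_topology G T)"

definition left_translate ::
  "('a, 'm) monoid_scheme \<Rightarrow> 'a \<Rightarrow> ('a \<Rightarrow> complex) \<Rightarrow> 'a \<Rightarrow> complex" where
  "left_translate G g f = (\<lambda>x. if x \<in> carrier G then f (g \<otimes>\<^bsub>G\<^esub> x) else 0)"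

definition right_translate ::
  "('a, 'm) monoid_scheme \<Rightarrow> 'a \<Rightarrow> ('a \<Rightarrow> complex) \<Rightarrow> 'a \<Rightarrow> complex" where
  "right_translate G g f = (\<lambda>x. if x \<in> carrier G then f (x \<otimes>\<^bsub>G\<^esub> g) else 0)"

definition pullback_quotient ::
  "('a, 'm) monoid_scheme \<Rightarrow> 'a set \<Rightarrow> ('a set \<Rightarrow> complex) \<Rightarrow> 'a \<Rightarrow> complex" where
  "pullback_quotient G N f = (\<lambda>x. if x \<in> carrier G then f (N #>\<^bsub>G\<^esub> x) else 0)"

definition separates_points_from_closed_sets ::
  "'a topology \<Rightarrow> ('a \<Rightarrow> complex) set \<Rightarrow> bool" where
  "separates_points_from_closed_sets T F \<longleftrightarrow>
     (\<forall>M x. closedin T M \<and> x \<in> topspace T - M \<longrightarrow> (\<exists>f\<in>F. f x \<notin> closure (f ` M)))"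

definition separates_points :: "'a set \<Rightarrow> ('a \<Rightarrow> complex) set \<Rightarrow> bool" where
  "separates_points S F \<longleftrightarrow> (\<forall>x\<in>S. \<forall>y\<in>S. x \<noteq> y \<longrightarrow> (\<exists>f\<in>F. f x \<noteq> f y))"

end

theory Submission
  imports Defs
begin

text \<open>The unit ball of \<open>B(G\<^sub>d)\<close> consists of the coefficients \<open>\<phi> x = \<langle>\<pi>(x) \<xi>, \<eta>\<rangle>\<close> with
  \<open>\<parallel>\<xi>\<parallel> \<parallel>\<eta>\<parallel> \<le> 1\<close>: these form a convex set, compact for pointwise convergence and closed under products,
  so a separating functional compares it with the polar of the unit ball of \<open>C\<^sup>*(G\<^sub>d)\<close>.

  If \<open>f\<close> is continuous and \<open>\<xi>\<close> is cyclic, then \<open>q x = \<langle>\<pi>(x) \<eta>, \<eta>\<rangle>\<close> is a uniform limit of combinations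
  of right translates of \<open>f\<close>, hence continuous. Uniformly in \<open>y\<close>, the difference of
  \<open>f (s\<^sup>-\<^sup>1 y)\<close> and \<open>f (t\<^sup>-\<^sup>1 y)\<close> is at most a multiple of \<open>(q 1 - Re q (s\<^sup>-\<^sup>1 t))\<^sup>1\<^sup>/\<^sup>2\<close>; with the density
  of the center this makes \<open>f (x\<^sup>-\<^sup>1 y)\<close> jointly continuous, that is, \<open>f\<close> is \<open>\<sigma>\<close>-continuous and constant on the cosets
  of \<open>N(G)\<close>. Projecting \<open>\<xi>\<close> to the \<open>N(G)\<close>-fixed vectors shows that passing to \<open>G/N(G)\<close> preserves the
  norm.

  If \<open>B(G)\<close> separates points from closed sets, or \<open>A(G)\<close> separates points, then \<open>\<sigma> = \<tau>\<close>, which forces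
  \<open>G\<close> to be a topological group. Conversely, a locally compact group has a Haar integral, and the
  autocorrelations of continuous functions of small support are positive definite, continuous and of
  small support.\<close>

subsection \<open>Semi-inner product spaces\<close>

text \<open>The norm of \<open>B(G_d)\<close> is a supremum over functions whose own norm is a
  supremum over representations, which is unwieldy for estimates. Everything therefore passes
  through \<open>coef G C\<close>, which mentions no Hilbert space: \<phi> belongs to it if a
  positive definite \<open>p\<close> with \<open>Re (p \<one>) \<le> C\<close> controls pairing with
  \<phi> on finitely supported functions. Keeping \<open>p\<close> as a witness makes these sets
  stable: sums, Schur products, translates and averages act on \<open>p\<close>, and the pairs of
  \<open>p\<close> and \<phi> form a compact set. Once \<open>B_norm_le_iff\<close> identifies
  \<open>coef G C\<close> with the ball of radius \<open>C\<close>, completeness,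
  submultiplicativity and the isometry with the quotient group are statements about
  \<open>coef\<close>. The Hilbert space of \<open>p\<close> is realised by functions on the group
  itself, so that its representation is among those over which \<open>cstar_norm\<close> is a
  supremum. The converse separation statements need enough continuous coefficients; their integral
  is obtained from Haar's covering numbers by a compactness argument.\<close>

lemma complex_subspaceD:
  assumes "complex_subspace V"
  shows "0 \<in> V" "\<And>u v. u \<in> V \<Longrightarrow> v \<in> V \<Longrightarrow> u + v \<in> V" "\<And>c v. v \<in> V \<Longrightarrow> fscale c v \<in> V"
    and "\<And>u v. u \<in> V \<Longrightarrow> v \<in> V \<Longrightarrow> u - v \<in> V"
    and "\<And>A f. (\<And>i. i \<in> A \<Longrightarrow> f i \<in> V) \<Longrightarrow> sum f A \<in> V"
proof -
  show *: "0 \<in> V" "\<And>u v. u \<in> V \<Longrightarrow> v \<in> V \<Longrightarrow> u + v \<in> V" "\<And>c v. v \<in> V \<Longrightarrow> fscale c v \<in> V"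
    using assms unfolding complex_subspace_def by blast+
  show "u - v \<in> V" if "u \<in> V" "v \<in> V" for u v
  proof -
    have "u - v = u + fscale (-1) v" by (rule ext) (simp add: fscale_def)
    then show ?thesis using * that by metis
  qed
  show "sum f A \<in> V" if "\<And>i. i \<in> A \<Longrightarrow> f i \<in> V" for A and f :: "'c \<Rightarrow> 'a \<Rightarrow> complex"
    using that by (induction A rule: infinite_finite_induct) (auto intro: *)
qed

lemma sum_fun_apply: "(\<Sum>i\<in>A. f i) x = (\<Sum>i\<in>A. f i x)"
  by (induction A rule: infinite_finite_induct) auto

lemma fscale_apply: "fscale c f x = c * f x"
  by (simp add: fscale_def)

lemma fscale_algebra:
  "fscale 1 f = f" "fscale 0 f = 0" "fscale c 0 = 0" "fscale c (fscale d f) = fscale (c * d) f"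
  "fscale c (f + g) = fscale c f + fscale c g" "fscale c (f - g) = fscale c f - fscale c g"
  "fscale (-1) f = - f"
  by (auto simp: fun_eq_iff fscale_apply algebra_simps)

text \<open>The discriminant criterion with \<open>r\<close> restricted to \<open>r \<ge> 0\<close>.
  The minimum sits at \<open>r = m / b\<^sup>2\<close>; if \<open>b = 0\<close>, the expression is
  affine in \<open>r\<close> and a large \<open>r\<close> refutes \<open>m > 0\<close>. The case
  \<open>b = 0\<close> occurs, since \<open>nrm\<close> may vanish on nonzero vectors.\<close>

lemma quadratic_nonneg_imp_le:
  fixes a b m :: real
  assumes "a \<ge> 0" "b \<ge> 0" "\<And>r. r \<ge> 0 \<Longrightarrow> 0 \<le> a\<^sup>2 - 2 * r * m + r\<^sup>2 * b\<^sup>2"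
  shows "m \<le> a * b"
proof (cases "m \<le> 0")
  case True
  then show ?thesis using assms mult_nonneg_nonneg[of a b] by linarith
next
  case False
  show ?thesis
  proof (cases "b = 0")
    case True
    have "0 \<le> a\<^sup>2 - 2 * ((a\<^sup>2 + 1) / m) * m"
      using assms(3)[of "(a\<^sup>2 + 1) / m"] False True by simp
    then have "0 \<le> - a\<^sup>2 - 2" using False by simp
    then show ?thesis using zero_le_power2[of a] by linarith
  next
    case b: False
    have "0 \<le> a\<^sup>2 - 2 * (m / b\<^sup>2) * m + (m / b\<^sup>2)\<^sup>2 * b\<^sup>2"
      using assms(3)[of "m / b\<^sup>2"] False b by simp
    also have "\<dots> = a\<^sup>2 - m\<^sup>2 / b\<^sup>2"
      using b by (simp add: field_simps power2_eq_square)
    finally have "m\<^sup>2 / b\<^sup>2 \<le> a\<^sup>2" by simp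
    then have "m\<^sup>2 \<le> (a * b)\<^sup>2" using b by (simp add: field_simps power_mult_distrib)
    then show ?thesis by (rule power2_le_imp_le) (use assms(1,2) in simp)
  qed
qed

text \<open>Neither definiteness nor completeness is assumed: the basic instance is a kernel form on
  finitely supported functions, which may have null vectors and need not be complete.\<close>

locale semi_ip =
  fixes V :: "('b \<Rightarrow> complex) set" and ip :: "('b \<Rightarrow> complex) \<Rightarrow> ('b \<Rightarrow> complex) \<Rightarrow> complex"
  assumes subspace: "complex_subspace V"
    and ip_add_left: "\<And>u v w. u \<in> V \<Longrightarrow> v \<in> V \<Longrightarrow> w \<in> V \<Longrightarrow> ip (u + v) w = ip u w + ip v w"
    and ip_scale_left: "\<And>c u v. u \<in> V \<Longrightarrow> v \<in> V \<Longrightarrow> ip (fscale c u) v = c * ip u v"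
    and ip_herm: "\<And>u v. u \<in> V \<Longrightarrow> v \<in> V \<Longrightarrow> ip v u = cnj (ip u v)"
    and ip_nonneg: "\<And>v. v \<in> V \<Longrightarrow> 0 \<le> Re (ip v v)"
begin

lemmas mem_rules = complex_subspaceD[OF subspace]

abbreviation nrm where "nrm \<equiv> ip_norm ip"

lemma ip_add_right: "u \<in> V \<Longrightarrow> v \<in> V \<Longrightarrow> w \<in> V \<Longrightarrow> ip w (u + v) = ip w u + ip w v"
  by (metis complex_cnj_add ip_add_left ip_herm mem_rules(2))

lemma ip_scale_right: "u \<in> V \<Longrightarrow> v \<in> V \<Longrightarrow> ip u (fscale c v) = cnj c * ip u v"
  by (metis complex_cnj_mult ip_scale_left ip_herm mem_rules(3))

lemma diff_conv: "u - v = u + fscale (-1) v"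
  by (rule ext) (simp add: fscale_apply)

lemma ip_diff_left: "u \<in> V \<Longrightarrow> v \<in> V \<Longrightarrow> w \<in> V \<Longrightarrow> ip (u - v) w = ip u w - ip v w"
  unfolding diff_conv by (simp add: ip_add_left ip_scale_left mem_rules)

lemma ip_diff_right: "u \<in> V \<Longrightarrow> v \<in> V \<Longrightarrow> w \<in> V \<Longrightarrow> ip w (u - v) = ip w u - ip w v"
  unfolding diff_conv by (simp add: ip_add_right ip_scale_right mem_rules)

lemma ip_zero: "v \<in> V \<Longrightarrow> ip 0 v = 0" "v \<in> V \<Longrightarrow> ip v 0 = 0"
  using ip_scale_left[of v v 0] ip_scale_right[of v v 0] by (simp_all add: fscale_algebra)

lemma ip_sum_left:
  "(\<And>i. i \<in> A \<Longrightarrow> f i \<in> V) \<Longrightarrow> w \<in> V \<Longrightarrow> ip (\<Sum>i\<in>A. f i) w = (\<Sum>i\<in>A. ip (f i) w)"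
  by (induction A rule: infinite_finite_induct) (auto simp: ip_zero ip_add_left mem_rules)

lemma ip_sum_right:
  "(\<And>i. i \<in> A \<Longrightarrow> f i \<in> V) \<Longrightarrow> w \<in> V \<Longrightarrow> ip w (\<Sum>i\<in>A. f i) = (\<Sum>i\<in>A. ip w (f i))"
  by (induction A rule: infinite_finite_induct) (auto simp: ip_zero ip_add_right mem_rules)

lemma nrm_nonneg: "v \<in> V \<Longrightarrow> 0 \<le> nrm v"
  by (simp add: ip_norm_def ip_nonneg)

lemma nrm_sq: "v \<in> V \<Longrightarrow> (nrm v)\<^sup>2 = Re (ip v v)"
  by (simp add: ip_norm_def ip_nonneg)

lemma ip_self: "v \<in> V \<Longrightarrow> ip v v = of_real ((nrm v)\<^sup>2)"
proof -
  assume v: "v \<in> V"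
  have "Im (ip v v) = 0" using arg_cong[OF ip_herm[OF v v], of Im] by simp
  then show ?thesis using nrm_sq[OF v] by (simp add: complex_eq_iff)
qed

lemma nrm_add_sq:
  assumes "u \<in> V" "v \<in> V"
  shows "(nrm (u + v))\<^sup>2 = (nrm u)\<^sup>2 + 2 * Re (ip u v) + (nrm v)\<^sup>2"
  using assms ip_herm[of u v] by (simp add: nrm_sq mem_rules ip_add_left ip_add_right)

lemma nrm_scale_sq: "v \<in> V \<Longrightarrow> (nrm (fscale c v))\<^sup>2 = (cmod c)\<^sup>2 * (nrm v)\<^sup>2"
proof -
  assume v: "v \<in> V"
  have "ip (fscale c v) (fscale c v) = (c * cnj c) * ip v v"
    using v by (simp add: ip_scale_left ip_scale_right mem_rules)
  also have "c * cnj c = of_real ((cmod c)\<^sup>2)" by (simp add: complex_norm_square[symmetric])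
  finally have "Re (ip (fscale c v) (fscale c v)) = Re (of_real ((cmod c)\<^sup>2) * ip v v)"
    by (rule arg_cong)
  then show ?thesis using v by (simp add: nrm_sq mem_rules del: of_real_power)
qed

lemma nrm_scale: "v \<in> V \<Longrightarrow> nrm (fscale c v) = cmod c * nrm v"
  by (rule power2_eq_imp_eq) (simp_all add: nrm_scale_sq power_mult_distrib nrm_nonneg mem_rules)

lemma nrm_diff_sq:
  assumes "u \<in> V" "v \<in> V"
  shows "(nrm (u - v))\<^sup>2 = (nrm u)\<^sup>2 - 2 * Re (ip u v) + (nrm v)\<^sup>2"
  unfolding diff_conv using assms
  by (simp add: nrm_add_sq nrm_scale_sq mem_rules ip_scale_right nrm_scale)

text \<open>Moving along \<open>v\<close> with the phase \<open>sgn z\<close> turns a complex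
  first-order term into a real one: for \<open>z = ip u v\<close> it becomes \<open>cmod z\<close>.
  The factor with \<open>z = 0\<close> records that \<open>sgn 0 = 0\<close>.\<close>

lemma nrm_perturb:
  fixes z :: complex and r :: real
  assumes "u \<in> V" "v \<in> V"
  shows "(nrm (u + fscale (- of_real r * sgn z) v))\<^sup>2 = (nrm u)\<^sup>2 - 2 * r * Re (cnj (sgn z) * ip u v)
           + r\<^sup>2 * (if z = 0 then 0 else 1) * (nrm v)\<^sup>2"
proof -
  have "ip u (fscale (- of_real r * sgn z) v) = of_real (- r) * (cnj (sgn z) * ip u v)"
    unfolding ip_scale_right[OF assms] by (simp add: mult.assoc)
  then have "Re (ip u (fscale (- of_real r * sgn z) v)) = - r * Re (cnj (sgn z) * ip u v)"
    by (simp only: times_complex.sel Re_complex_of_real Im_complex_of_real mult_zero_left diff_zero)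
  then show ?thesis using assms
    by (simp add: nrm_add_sq nrm_scale_sq mem_rules norm_mult power_mult_distrib norm_sgn)
qed

lemma cnj_sgn_mult: "cnj (sgn z) * z = of_real (cmod z)"
proof (cases "z = 0")
  case False
  have "cnj (sgn z) * z = (z * cnj z) / of_real (cmod z)"
    by (simp add: sgn_eq)
  also have "\<dots> = of_real (cmod z)"
    using False by (simp add: complex_norm_square[symmetric] power2_eq_square)
  finally show ?thesis .
qed simp

lemma Cauchy_Schwarz:
  assumes "u \<in> V" "v \<in> V"
  shows "cmod (ip u v) \<le> nrm u * nrm v"
proof (rule quadratic_nonneg_imp_le)
  fix r :: real assume "r \<ge> 0"
  show "0 \<le> (nrm u)\<^sup>2 - 2 * r * cmod (ip u v) + r\<^sup>2 * (nrm v)\<^sup>2"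
  proof -
    have "0 \<le> (nrm (u + fscale (- of_real r * sgn (ip u v)) v))\<^sup>2" by simp
    also have "\<dots> \<le> (nrm u)\<^sup>2 - 2 * r * cmod (ip u v) + r\<^sup>2 * (nrm v)\<^sup>2"
      unfolding nrm_perturb[OF assms] cnj_sgn_mult by simp
    finally show ?thesis .
  qed
qed (use assms nrm_nonneg in auto)

lemma nrm_triangle:
  assumes "u \<in> V" "v \<in> V"
  shows "nrm (u + v) \<le> nrm u + nrm v"
proof (rule power2_le_imp_le)
  have "Re (ip u v) \<le> nrm u * nrm v"
    using Cauchy_Schwarz[OF assms] complex_Re_le_cmod[of "ip u v"] by linarith
  then show "(nrm (u + v))\<^sup>2 \<le> (nrm u + nrm v)\<^sup>2"
    unfolding nrm_add_sq[OF assms] by (simp add: power2_sum)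
qed (use assms nrm_nonneg in \<open>simp add: mem_rules\<close>)

lemma nrm_minus_commute: "u \<in> V \<Longrightarrow> v \<in> V \<Longrightarrow> nrm (u - v) = nrm (v - u)"
proof -
  assume "u \<in> V" "v \<in> V"
  moreover have "u - v = fscale (-1) (v - u)" by (rule ext) (simp add: fscale_apply)
  ultimately show ?thesis by (simp add: nrm_scale mem_rules)
qed

lemma polarization:
  assumes "u \<in> V" "v \<in> V"
  shows "ip u v = of_real (((nrm (u + v))\<^sup>2 - (nrm (u - v))\<^sup>2) / 4)
      + \<i> * of_real (((nrm (u + fscale \<i> v))\<^sup>2 - (nrm (u - fscale \<i> v))\<^sup>2) / 4)"
  using assms
  by (simp add: nrm_add_sq nrm_diff_sq mem_rules ip_scale_right complex_eq_iff nrm_scale)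

text \<open>Without completeness an exact representing vector need not exist. It would minimize
  \<open>J\<close>, which is bounded below by \<open>- C\<^sup>2\<close>; a vector within
  \<open>e\<^sup>2\<close> of the infimum has first variation at most \<open>e * nrm v\<close>, by
  the discriminant criterion.\<close>

lemma approx_Riesz:
  fixes l :: "('b \<Rightarrow> complex) \<Rightarrow> complex"
  assumes l_add: "\<And>u v. u \<in> V \<Longrightarrow> v \<in> V \<Longrightarrow> l (u + v) = l u + l v"
    and l_scale: "\<And>c v. v \<in> V \<Longrightarrow> l (fscale c v) = c * l v"
    and bound: "\<And>v. v \<in> V \<Longrightarrow> cmod (l v) \<le> C * nrm v"
    and "e > 0"
  obtains d where "d \<in> V" "\<And>v. v \<in> V \<Longrightarrow> cmod (l v - ip v d) \<le> e * nrm v"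
proof -
  define J where "J v = (nrm v)\<^sup>2 - 2 * Re (l v)" for v
  have J_lower: "- C\<^sup>2 \<le> J v" if "v \<in> V" for v
  proof -
    have "Re (l v) \<le> C * nrm v"
      using bound[OF that] complex_Re_le_cmod[of "l v"] by linarith
    moreover have "0 \<le> (nrm v - C)\<^sup>2" by simp
    ultimately show ?thesis unfolding J_def by (simp add: power2_diff algebra_simps)
  qed
  have bdd: "bdd_below (J ` V)"
    by (rule bdd_belowI2[of _ "- C\<^sup>2"]) (rule J_lower)
  have "V \<noteq> {}" using mem_rules(1) by blast
  then obtain d where d: "d \<in> V" "J d < Inf (J ` V) + e\<^sup>2"
    using cInf_lessD[of "J ` V" "Inf (J ` V) + e\<^sup>2"] \<open>e > 0\<close> by auto
  have "cmod (l v - ip v d) \<le> e * nrm v" if v: "v \<in> V" for v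
  proof (rule quadratic_nonneg_imp_le)
    fix r :: real assume "r \<ge> 0"
    \<comment> \<open>\<open>z\<close> is the conjugate of the error \<open>ip v d - l v\<close>, so
      this phase makes the first-order term of \<open>J\<close> equal to
      \<open>- 2 * r * cmod (l v - ip v d)\<close>.\<close>
    define z where "z = ip d v - cnj (l v)"
    define w where "w = fscale (- of_real r * sgn z) v"
    have "Inf (J ` V) \<le> J (d + w)"
      by (rule cInf_lower[OF _ bdd]) (use d v in \<open>simp add: w_def mem_rules\<close>)
    with d have "0 \<le> J (d + w) - J d + e\<^sup>2" by simp
    also have "J (d + w) - J d = (nrm (d + w))\<^sup>2 - (nrm d)\<^sup>2 - 2 * Re (l w)"
      using d v by (simp add: J_def w_def l_add mem_rules)
    also have "(nrm (d + w))\<^sup>2 - (nrm d)\<^sup>2 - 2 * Re (l w)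
        = - 2 * r * (Re (cnj (sgn z) * ip d v) - Re (sgn z * l v))
          + r\<^sup>2 * (if z = 0 then 0 else 1) * (nrm v)\<^sup>2"
      unfolding w_def nrm_perturb[OF d(1) v] using v by (simp add: l_scale algebra_simps)
    also have "Re (cnj (sgn z) * ip d v) - Re (sgn z * l v) = Re (cnj (sgn z) * z)"
    proof -
      have "Re (sgn z * l v) = Re (cnj (sgn z * l v))" by simp
      also have "\<dots> = Re (cnj (sgn z) * cnj (l v))" by (simp only: complex_cnj_mult)
      finally have "Re (cnj (sgn z) * ip d v) - Re (sgn z * l v)
          = Re (cnj (sgn z) * ip d v - cnj (sgn z) * cnj (l v))" by simp
      also have "\<dots> = Re (cnj (sgn z) * (ip d v - cnj (l v)))" by (simp only: right_diff_distrib)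
      finally show ?thesis by (simp only: z_def)
    qed
    also have "\<dots> = cmod z" by (simp add: cnj_sgn_mult)
    also have "cmod z = cmod (l v - ip v d)"
    proof -
      have "z = cnj (ip v d - l v)" unfolding z_def using ip_herm[OF v d(1)] by simp
      then show ?thesis by (metis complex_mod_cnj norm_minus_commute)
    qed
    finally have *: "0 \<le> - 2 * r * cmod (l v - ip v d) + r\<^sup>2 * (if z = 0 then 0 else 1) * (nrm v)\<^sup>2 + e\<^sup>2" .
    have "r\<^sup>2 * (if z = 0 then 0 else 1) * (nrm v)\<^sup>2 \<le> r\<^sup>2 * (nrm v)\<^sup>2" by simp
    with * show "0 \<le> e\<^sup>2 - 2 * r * cmod (l v - ip v d) + r\<^sup>2 * (nrm v)\<^sup>2" by linarith
  qed (use \<open>e > 0\<close> v nrm_nonneg in auto)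
  with d(1) that show thesis by blast
qed

end

lemma hilbert_space_imp_semi_ip:
  assumes "hilbert_space V ip"
  shows "semi_ip V ip"
proof
  show "0 \<le> Re (ip v v)" if "v \<in> V" for v
  proof (cases "v = 0")
    case True
    have "ip (fscale 0 v) v = 0 * ip v v"
      using assms that unfolding hilbert_space_def by blast
    then show ?thesis using True by (simp add: fscale_algebra)
  next
    case False
    then have "Re (ip v v) > 0" using assms that unfolding hilbert_space_def by blast
    then show ?thesis by simp
  qed
  show "ip v u = cnj (ip u v)" if "u \<in> V" "v \<in> V" for u v
    using assms that unfolding hilbert_space_def by blast
qed (use assms in \<open>unfold hilbert_space_def, blast+\<close>)

subsection \<open>Positive semidefinite kernels\<close>

definition fin_supp :: "'a set \<Rightarrow> ('a \<Rightarrow> complex) set" where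
  "fin_supp X = {c. finite {x. c x \<noteq> 0} \<and> {x. c x \<noteq> 0} \<subseteq> X}"

text \<open>The bilinear duality, without conjugation, between functions of finite support and
  arbitrary functions. It looks at finitely many values of \<open>F\<close>, hence is continuous for
  pointwise convergence.\<close>

definition pairing :: "('a \<Rightarrow> complex) \<Rightarrow> ('a \<Rightarrow> complex) \<Rightarrow> complex" where
  "pairing c F = (\<Sum>x\<in>{x. c x \<noteq> 0}. c x * F x)"

text \<open>Iterated pairings instead of a double sum: linearity in each coefficient function
  (conjugate in the second) and in the kernel is inherited from \<open>pairing\<close>;
  \<open>kform_superset\<close> recovers the double sum.\<close>

definition kform :: "('a \<Rightarrow> 'a \<Rightarrow> complex) \<Rightarrow> ('a \<Rightarrow> complex) \<Rightarrow> ('a \<Rightarrow> complex) \<Rightarrow> complex" where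
  "kform k c d = pairing c (\<lambda>x. pairing (\<lambda>y. cnj (d y)) (k x))"

definition psd_kernel :: "'a set \<Rightarrow> ('a \<Rightarrow> 'a \<Rightarrow> complex) \<Rightarrow> bool" where
  "psd_kernel X k \<longleftrightarrow> (\<forall>c\<in>fin_supp X. kform k c c \<in> \<real>\<^sub>\<ge>\<^sub>0)"

definition delta :: "'a \<Rightarrow> 'a \<Rightarrow> complex" where
  "delta x = (\<lambda>y. if y = x then 1 else 0)"

lemma pairing_superset:
  assumes "finite A" "{x. c x \<noteq> 0} \<subseteq> A"
  shows "pairing c F = (\<Sum>x\<in>A. c x * F x)"
  unfolding pairing_def by (rule sum.mono_neutral_left) (use assms in auto)

lemma kform_superset:
  assumes "finite A" "{x. c x \<noteq> 0} \<subseteq> A" "finite B" "{x. d x \<noteq> 0} \<subseteq> B"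
  shows "kform k c d = (\<Sum>x\<in>A. \<Sum>y\<in>B. c x * cnj (d y) * k x y)"
proof -
  have "pairing (\<lambda>y. cnj (d y)) (k x) = (\<Sum>y\<in>B. cnj (d y) * k x y)" for x
    by (rule pairing_superset) (use assms in auto)
  then show ?thesis
    unfolding kform_def by (simp add: pairing_superset[OF assms(1,2)] sum_distrib_left mult.assoc)
qed

lemma complex_subspace_fin_supp: "complex_subspace (fin_supp X)"
proof -
  have "finite {x. u x + v x \<noteq> 0} \<and> {x. u x + v x \<noteq> 0} \<subseteq> X"
    if "finite {x. u x \<noteq> 0}" "{x. u x \<noteq> 0} \<subseteq> X" "finite {x. v x \<noteq> 0}" "{x. v x \<noteq> 0} \<subseteq> X"
    for u v :: "'a \<Rightarrow> complex"
  proof -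
    have "{x. u x + v x \<noteq> 0} \<subseteq> {x. u x \<noteq> 0} \<union> {x. v x \<noteq> 0}" by auto
    then show ?thesis using that by (meson finite_Un finite_subset le_sup_iff order_trans sup.bounded_iff)
  qed
  moreover have "finite {x. c * u x \<noteq> 0}" if "finite {x. u x \<noteq> 0}" for c and u :: "'a \<Rightarrow> complex"
    by (rule finite_subset[OF _ that]) auto
  ultimately show ?thesis
    unfolding complex_subspace_def fin_supp_def by (auto simp: fscale_apply)
qed

lemmas fin_supp_rules = complex_subspaceD[OF complex_subspace_fin_supp]

lemma delta_in_fin_supp: "x \<in> X \<Longrightarrow> delta x \<in> fin_supp X"
  by (auto simp: fin_supp_def delta_def)

lemma delta_support: "{y. delta x y \<noteq> 0} = {x}"
  by (auto simp: delta_def)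

lemma pairing_delta [simp]: "pairing (delta x) F = F x"
  unfolding pairing_def delta_support by (simp add: delta_def)

lemma pairing_add_left:
  assumes "c \<in> fin_supp X" "d \<in> fin_supp X"
  shows "pairing (c + d) F = pairing c F + pairing d F"
proof -
  let ?A = "{x. c x \<noteq> 0} \<union> {x. d x \<noteq> 0}"
  have A: "finite ?A" using assms by (auto simp: fin_supp_def)
  have "pairing (c + d) F = (\<Sum>x\<in>?A. (c + d) x * F x)"
    by (rule pairing_superset[OF A]) auto
  moreover have "pairing c F = (\<Sum>x\<in>?A. c x * F x)" by (rule pairing_superset[OF A]) auto
  moreover have "pairing d F = (\<Sum>x\<in>?A. d x * F x)" by (rule pairing_superset[OF A]) auto
  ultimately show ?thesis by (simp add: sum.distrib algebra_simps)
qed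

lemma pairing_scale_left: "pairing (fscale t c) F = t * pairing c F"
proof (cases "t = 0")
  case False
  then show ?thesis by (simp add: pairing_def fscale_apply sum_distrib_left mult.assoc)
qed (simp add: pairing_def fscale_apply)

lemma pairing_zero_left [simp]: "pairing 0 F = 0"
  by (simp add: pairing_def)

lemma pairing_sum_left:
  "(\<And>i. i \<in> A \<Longrightarrow> f i \<in> fin_supp X) \<Longrightarrow> pairing (\<Sum>i\<in>A. f i) F = (\<Sum>i\<in>A. pairing (f i) F)"
proof (induction A rule: infinite_finite_induct)
  case (insert x A)
  then show ?case
    using pairing_add_left[of "f x" X "sum f A" F] fin_supp_rules(5)[of A f X]
    by (simp only: sum.insert insert_iff simp_thms)
qed auto

lemma pairing_add_right: "pairing c (\<lambda>x. F x + H x) = pairing c F + pairing c H"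
  by (simp add: pairing_def algebra_simps sum.distrib)

lemma pairing_diff_right: "pairing c (\<lambda>x. F x - H x) = pairing c F - pairing c H"
  by (simp add: pairing_def algebra_simps sum_subtractf)

lemma pairing_scale_right: "pairing c (\<lambda>x. t * F x) = t * pairing c F"
  by (simp add: pairing_def algebra_simps sum_distrib_left)

lemma pairing_cnj: "pairing (\<lambda>x. cnj (c x)) (\<lambda>x. cnj (F x)) = cnj (pairing c F)"
  by (simp add: pairing_def)

lemma pairing_cong: "c \<in> fin_supp X \<Longrightarrow> (\<And>x. x \<in> X \<Longrightarrow> F x = H x) \<Longrightarrow> pairing c F = pairing c H"
  unfolding pairing_def by (rule sum.cong) (auto simp: fin_supp_def)

lemma kform_cong:
  assumes "c \<in> fin_supp X" "d \<in> fin_supp X" "\<And>x y. x \<in> X \<Longrightarrow> y \<in> X \<Longrightarrow> k x y = k' x y"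
  shows "kform k c d = kform k' c d"
proof -
  have "(\<lambda>y. cnj (d y)) \<in> fin_supp X" using assms(2) by (simp add: fin_supp_def)
  then show ?thesis unfolding kform_def
    by (intro pairing_cong[OF assms(1)] pairing_cong[of _ X]) (use assms(3) in blast)+
qed

lemma kform_delta [simp]: "kform k (delta x) (delta y) = k x y"
proof -
  have "(\<lambda>z. cnj (delta y z)) = delta y" by (auto simp: delta_def)
  then show ?thesis by (simp add: kform_def)
qed

lemma kform_delta_right: "kform k c (delta y) = pairing c (\<lambda>x. k x y)"
proof -
  have "(\<lambda>z. cnj (delta y z)) = delta y" by (auto simp: delta_def)
  then show ?thesis by (simp add: kform_def)
qed

lemma kform_add_kernel: "kform (\<lambda>x y. k x y + k' x y) c d = kform k c d + kform k' c d"
  by (simp add: kform_def pairing_add_right)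

lemma kform_diff_kernel: "kform (\<lambda>x y. k x y - k' x y) c d = kform k c d - kform k' c d"
  by (simp add: kform_def pairing_diff_right)

lemma kform_scale_kernel: "kform (\<lambda>x y. t * k x y) c d = t * kform k c d"
  by (simp add: kform_def pairing_scale_right)

lemma kform_rank_one: "kform (\<lambda>x y. f x * cnj (f y)) c c = of_real ((cmod (pairing c f))\<^sup>2)"
proof -
  have "kform (\<lambda>x y. f x * cnj (f y)) c c = pairing c (\<lambda>x. f x * cnj (pairing c f))"
    unfolding kform_def pairing_scale_right pairing_cnj ..
  also have "\<dots> = pairing c (\<lambda>x. cnj (pairing c f) * f x)" by (simp only: mult.commute)
  also have "\<dots> = pairing c f * cnj (pairing c f)" by (simp add: pairing_scale_right)
  finally show ?thesis by (simp add: complex_norm_square[symmetric])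
qed

lemma kform_add_left:
  "c \<in> fin_supp X \<Longrightarrow> d \<in> fin_supp X \<Longrightarrow> kform k (c + d) e = kform k c e + kform k d e"
  by (simp add: kform_def pairing_add_left)

lemma kform_add_right:
  assumes "c \<in> fin_supp X" "d \<in> fin_supp X"
  shows "kform k e (c + d) = kform k e c + kform k e d"
proof -
  have "(\<lambda>y. cnj (c y)) \<in> fin_supp X" "(\<lambda>y. cnj (d y)) \<in> fin_supp X"
    using assms by (simp_all add: fin_supp_def)
  moreover have "(\<lambda>y. cnj ((c + d) y)) = (\<lambda>y. cnj (c y)) + (\<lambda>y. cnj (d y))" by auto
  ultimately show ?thesis by (simp only: kform_def pairing_add_left pairing_add_right)
qed

lemma kform_scale_left: "kform k (fscale t c) e = t * kform k c e"
  by (simp add: kform_def pairing_scale_left)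

lemma kform_scale_right: "kform k e (fscale t c) = cnj t * kform k e c"
proof -
  have "(\<lambda>y. cnj (fscale t c y)) = fscale (cnj t) (\<lambda>y. cnj (c y))" by (auto simp: fscale_apply)
  then show ?thesis by (simp only: kform_def pairing_scale_left pairing_scale_right)
qed

lemma kform_sum_left:
  "(\<And>i. i \<in> A \<Longrightarrow> f i \<in> fin_supp X) \<Longrightarrow> kform k (\<Sum>i\<in>A. f i) e = (\<Sum>i\<in>A. kform k (f i) e)"
  unfolding kform_def by (rule pairing_sum_left)

lemma kform_zero_right [simp]: "kform k e 0 = 0"
  by (simp add: kform_def pairing_def)

lemma kform_sum_right:
  "(\<And>i. i \<in> A \<Longrightarrow> f i \<in> fin_supp X) \<Longrightarrow> kform k e (\<Sum>i\<in>A. f i) = (\<Sum>i\<in>A. kform k e (f i))"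
proof (induction A rule: infinite_finite_induct)
  case (insert x A)
  then show ?case
    using kform_add_right[of "f x" X "sum f A" k e] fin_supp_rules(5)[of A f X]
    by (simp only: sum.insert insert_iff simp_thms)
qed auto

lemma kform_deltas:
  assumes "\<And>i. i \<in> I \<Longrightarrow> x i \<in> X"
  shows "kform k (\<Sum>i\<in>I. fscale (c i) (delta (x i))) (\<Sum>i\<in>I. fscale (c i) (delta (x i)))
       = (\<Sum>i\<in>I. \<Sum>j\<in>I. c i * cnj (c j) * k (x i) (x j))"
proof -
  have "kform k (\<Sum>i\<in>I. fscale (c i) (delta (x i))) (\<Sum>i\<in>I. fscale (c i) (delta (x i)))
      = (\<Sum>i\<in>I. kform k (fscale (c i) (delta (x i))) (\<Sum>j\<in>I. fscale (c j) (delta (x j))))"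
    by (rule kform_sum_left[of _ _ X]) (intro fin_supp_rules delta_in_fin_supp assms)
  also have "\<dots> = (\<Sum>i\<in>I. \<Sum>j\<in>I. kform k (fscale (c i) (delta (x i))) (fscale (c j) (delta (x j))))"
    by (intro sum.cong refl kform_sum_right[of _ _ X] fin_supp_rules delta_in_fin_supp assms)
  finally show ?thesis by (simp add: kform_scale_left kform_scale_right mult_ac)
qed

lemma deltas_in_fin_supp:
  "(\<And>i. i \<in> I \<Longrightarrow> x i \<in> X) \<Longrightarrow> (\<Sum>i\<in>I. fscale (c i) (delta (x i))) \<in> fin_supp X"
  by (intro fin_supp_rules delta_in_fin_supp)

lemma nonneg_Reals_iff: "z \<in> \<real>\<^sub>\<ge>\<^sub>0 \<longleftrightarrow> Im z = 0 \<and> Re z \<ge> 0"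
  by (auto simp: complex_nonneg_Reals_iff)

text \<open>Reality of the form at \<open>delta x + fscale t (delta y)\<close> is enough:
  \<open>t = 1\<close> and \<open>t = -1\<close> make the imaginary parts opposite,
  \<open>t = \<i>\<close> makes the real parts equal.\<close>

lemma psd_kernel_hermitian:
  assumes k: "psd_kernel X k" and "x \<in> X" "y \<in> X"
  shows "k y x = cnj (k x y)"
proof -
  have *: "Im (k x x + t * cnj t * k y y + (t * k y x + cnj t * k x y)) = 0" for t
  proof -
    have "delta x + fscale t (delta y) \<in> fin_supp X"
      using assms by (intro fin_supp_rules delta_in_fin_supp)
    then have "Im (kform k (delta x + fscale t (delta y)) (delta x + fscale t (delta y))) = 0"
      using k unfolding psd_kernel_def nonneg_Reals_iff by blast
    also have "kform k (delta x + fscale t (delta y)) (delta x + fscale t (delta y))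
      = k x x + t * cnj t * k y y + (t * k y x + cnj t * k x y)"
      using assms(2,3)
      by (simp add: kform_add_left[of _ X] kform_add_right[of _ X] kform_scale_left kform_scale_right
          fin_supp_rules delta_in_fin_supp algebra_simps)
    finally show ?thesis .
  qed
  have "Im (k x x) = 0" using *[of 0] by simp
  moreover have "Im (k y y) + (Im (k y x) + Im (k x y)) = 0"
    using *[of 1] calculation by simp
  moreover have "Im (k y y) + (Re (k y x) - Re (k x y)) = 0"
    using *[of "\<i>"] \<open>Im (k x x) = 0\<close> by simp
  moreover have "Im (k y y) - (Im (k y x) + Im (k x y)) = 0"
    using *[of "-1"] \<open>Im (k x x) = 0\<close> by simp
  ultimately show ?thesis by (simp add: complex_eq_iff)
qed

lemma psd_kernel_semi_ip:
  assumes "psd_kernel X k"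
  shows "semi_ip (fin_supp X) (kform k)"
proof
  fix u v :: "'a \<Rightarrow> complex" assume uv: "u \<in> fin_supp X" "v \<in> fin_supp X"
  let ?A = "{x. u x \<noteq> 0}" and ?B = "{x. v x \<noteq> 0}"
  have fin: "finite ?A" "finite ?B" "?A \<subseteq> X" "?B \<subseteq> X" using uv by (auto simp: fin_supp_def)
  have "kform k v u = (\<Sum>x\<in>?B. \<Sum>y\<in>?A. v x * cnj (u y) * k x y)"
    by (rule kform_superset) (use fin in auto)
  also have "\<dots> = (\<Sum>x\<in>?B. \<Sum>y\<in>?A. cnj (u y * cnj (v x) * k y x))"
  proof (intro sum.cong refl)
    fix x y assume "x \<in> ?B" "y \<in> ?A"
    then have "k x y = cnj (k y x)" using psd_kernel_hermitian[OF assms] fin by blast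
    then show "v x * cnj (u y) * k x y = cnj (u y * cnj (v x) * k y x)" by (simp add: mult_ac)
  qed
  also have "\<dots> = cnj (\<Sum>y\<in>?A. \<Sum>x\<in>?B. u y * cnj (v x) * k y x)"
    by (subst sum.swap) simp
  also have "(\<Sum>y\<in>?A. \<Sum>x\<in>?B. u y * cnj (v x) * k y x) = kform k u v"
    by (rule kform_superset[symmetric]) (use fin in auto)
  finally show "kform k v u = cnj (kform k u v)" .
qed (use assms in \<open>auto simp: complex_subspace_fin_supp kform_add_left kform_scale_left
      psd_kernel_def nonneg_Reals_iff\<close>)

lemma psd_kernel_rank_one: "psd_kernel X (\<lambda>x y. f x * cnj (f y))"
  unfolding psd_kernel_def kform_rank_one nonneg_Reals_iff by simp

text \<open>The twist amounts to replacing the coefficients \<open>c x\<close> by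
  \<open>c x * f x\<close>.\<close>

lemma psd_kernel_twist:
  assumes "psd_kernel X k"
  shows "psd_kernel X (\<lambda>x y. f x * cnj (f y) * k x y)"
  unfolding psd_kernel_def
proof
  fix c assume c: "c \<in> fin_supp X"
  let ?A = "{x. c x \<noteq> 0}"
  have A: "finite ?A" "?A \<subseteq> X" using c by (auto simp: fin_supp_def)
  have "kform (\<lambda>x y. f x * cnj (f y) * k x y) c c = kform k (\<lambda>x. c x * f x) (\<lambda>x. c x * f x)"
    by (subst (1 2) kform_superset[of ?A _ ?A]) (use A in \<open>auto intro!: sum.cong simp: mult_ac\<close>)
  moreover have "(\<lambda>x. c x * f x) \<in> fin_supp X"
  proof -
    have "{x. c x * f x \<noteq> 0} \<subseteq> ?A" by auto
    then show ?thesis unfolding fin_supp_def using A by (simp add: finite_subset subset_trans)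
  qed
  ultimately show "kform (\<lambda>x y. f x * cnj (f y) * k x y) c c \<in> \<real>\<^sub>\<ge>\<^sub>0"
    using assms by (simp add: psd_kernel_def)
qed

text \<open>A Schur complement splits a rank-one kernel off the first factor and makes one more of its
  diagonal entries vanish.\<close>

theorem Schur_product:
  assumes "psd_kernel X k" "psd_kernel X l"
  shows "psd_kernel X (\<lambda>x y. k x y * l x y)"
  unfolding psd_kernel_def
proof
  fix c assume c: "c \<in> fin_supp X"
  define A where "A = {x. c x \<noteq> 0}"
  have A: "finite A" "A \<subseteq> X" using c by (auto simp: fin_supp_def A_def)
  show "kform (\<lambda>x y. k x y * l x y) c c \<in> \<real>\<^sub>\<ge>\<^sub>0"
    using assms(1)
  \<comment> \<open>The kernel \<open>k\<close> varies while \<open>c\<close> is fixed: only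
    diagonal entries of \<open>k\<close> on the support of \<open>c\<close> are counted.\<close>
  proof (induction "card {x\<in>A. k x x \<noteq> 0}" arbitrary: k rule: less_induct)
    case less
    interpret semi_ip "fin_supp X" "kform k" by (rule psd_kernel_semi_ip) fact
    have entry: "cmod (pairing d (\<lambda>x. k x y)) \<le> nrm d * nrm (delta y)" if "d \<in> fin_supp X" "y \<in> X" for d y
      using Cauchy_Schwarz[OF that(1) delta_in_fin_supp[OF that(2)]] by (simp add: kform_delta_right)
    have nrm_delta: "(nrm (delta y))\<^sup>2 = Re (k y y)" if "y \<in> X" for y
      using nrm_sq[OF delta_in_fin_supp[OF that]] by simp
    have diag_real: "k y y = of_real (Re (k y y))" if "y \<in> X" for y
      using psd_kernel_hermitian[OF less.prems that that] by (simp add: complex_eq_iff)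
    have nrm_delta0: "nrm (delta y) = 0" if "y \<in> X" "k y y = 0" for y
      using nrm_delta[OF that(1)] that(2) by simp
    \<comment> \<open>A zero diagonal entry says that \<open>delta y\<close> has norm zero, and
      Cauchy-Schwarz then kills its whole column.\<close>
    have entry0: "k x y = 0" if "x \<in> X" "y \<in> X" "k y y = 0" for x y
      using entry[OF delta_in_fin_supp[OF that(1)] that(2)] nrm_delta0[OF that(2,3)] by simp
    show ?case
    proof (cases "{x\<in>A. k x x \<noteq> 0} = {}")
      case True
      then have "kform (\<lambda>x y. k x y * l x y) c c = (\<Sum>x\<in>A. \<Sum>y\<in>A. 0)"
        by (subst kform_superset[of A _ A]) (use A entry0 in \<open>auto simp: A_def subset_iff intro!: sum.neutral\<close>)
      then show ?thesis by simp
    next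
      case False
      then obtain z where z: "z \<in> A" "k z z \<noteq> 0" by blast
      with A have zX: "z \<in> X" by blast
      define t where "t = Re (k z z)"
      have kzz: "k z z = of_real t" using diag_real[OF zX] by (simp add: t_def)
      have t: "t > 0" using nrm_delta[OF zX] z(2) kzz by (metis of_real_0 order_le_less t_def zero_le_power2)
      define k' where "k' x y = k x y - (k x z / of_real (sqrt t)) * cnj (k y z / of_real (sqrt t))" for x y
      let ?f = "\<lambda>x. k x z / of_real (sqrt t)"
      \<comment> \<open>The rank-one part contributes at \<open>d\<close> the squared modulus of the
        inner product with \<open>delta z\<close>, divided by \<open>t\<close>. As \<open>t\<close>
        is the squared norm of \<open>delta z\<close>, Cauchy-Schwarz bounds this by the squared
        norm of \<open>d\<close>.\<close>
      have k'_psd: "psd_kernel X k'"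
        unfolding psd_kernel_def
      proof
        fix d assume d: "d \<in> fin_supp X"
        have "cmod (pairing d (\<lambda>x. k x z)) \<le> nrm d * sqrt t"
          using entry[OF d zX] nrm_delta[OF zX] t_def nrm_nonneg[OF delta_in_fin_supp[OF zX]]
          by (metis real_sqrt_abs abs_of_nonneg)
        then have "cmod (pairing d (\<lambda>x. k x z / of_real (sqrt t))) \<le> nrm d"
          using t pairing_scale_right[of d "1 / of_real (sqrt t)" "\<lambda>x. k x z"]
          by (simp add: norm_divide divide_le_eq)
        then have "(cmod (pairing d (\<lambda>x. k x z / of_real (sqrt t))))\<^sup>2 \<le> (nrm d)\<^sup>2"
          by (rule power_mono) simp
        moreover have "kform k' d d = kform k d d - kform (\<lambda>x y. ?f x * cnj (?f y)) d d"
          unfolding k'_def by (rule kform_diff_kernel)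
        ultimately show "kform k' d d \<in> \<real>\<^sub>\<ge>\<^sub>0"
          by (simp only: kform_rank_one ip_self[OF d] nonneg_Reals_iff) simp
      qed
      have "k' x x = 0" if "x \<in> X" "k x x = 0" for x
        unfolding k'_def using that entry0[OF zX that] psd_kernel_hermitian[OF less.prems zX that(1)]
        by simp
      moreover have "k' z z = 0"
      proof -
        have "k' z z = of_real (t - (t / sqrt t) * (t / sqrt t))" by (simp add: k'_def kzz flip: of_real_divide of_real_mult of_real_diff)
        also have "t - (t / sqrt t) * (t / sqrt t) = 0" using t by (simp add: real_div_sqrt)
        finally show ?thesis by simp
      qed
      ultimately have "{x\<in>A. k' x x \<noteq> 0} \<subset> {x\<in>A. k x x \<noteq> 0}"
        using z A by blast
      then have "card {x\<in>A. k' x x \<noteq> 0} < card {x\<in>A. k x x \<noteq> 0}"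
        using A by (simp add: psubset_card_mono)
      then have 1: "kform (\<lambda>x y. k' x y * l x y) c c \<in> \<real>\<^sub>\<ge>\<^sub>0"
        using less.hyps k'_psd by blast
      have 2: "kform (\<lambda>x y. ?f x * cnj (?f y) * l x y) c c \<in> \<real>\<^sub>\<ge>\<^sub>0"
        using psd_kernel_twist[OF assms(2), of ?f] c unfolding psd_kernel_def by blast
      have "(\<lambda>x y. k x y * l x y) = (\<lambda>x y. k' x y * l x y + ?f x * cnj (?f y) * l x y)"
        by (intro ext) (simp add: k'_def algebra_simps)
      then have "kform (\<lambda>x y. k x y * l x y) c c
          = kform (\<lambda>x y. k' x y * l x y) c c + kform (\<lambda>x y. ?f x * cnj (?f y) * l x y) c c"
        by (simp only: kform_add_kernel)
      then show ?thesis using 1 2 by (simp add: nonneg_Reals_iff)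
    qed
  qed
qed

subsection \<open>Coefficients of positive definite functions\<close>

text \<open>The kernel is invariant under simultaneous left translation of both arguments; this will
  make translations unitary on its Hilbert space.\<close>

definition gker :: "('a, 'm) monoid_scheme \<Rightarrow> ('a \<Rightarrow> complex) \<Rightarrow> 'a \<Rightarrow> 'a \<Rightarrow> complex" where
  "gker G p x y = p (inv\<^bsub>G\<^esub> y \<otimes>\<^bsub>G\<^esub> x)"

text \<open>Up to the scaling of \<open>p\<close>, the condition on \<open>\<phi>\<close> says that \<open>\<phi> x = \<langle>\<pi>(x) \<xi>, \<eta>\<rangle>\<close> with \<open>\<pi>\<close>,
  \<open>\<xi>\<close> the cyclic representation of \<open>p\<close> and \<open>\<parallel>\<xi>\<parallel> \<parallel>\<eta>\<parallel> \<le> C\<close>; it is linear enough in \<open>p\<close> to be stable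
  under limits, sums and products.\<close>

definition dominates :: "('a, 'm) monoid_scheme \<Rightarrow> real \<Rightarrow> ('a \<Rightarrow> complex) \<Rightarrow> ('a \<Rightarrow> complex) \<Rightarrow> bool" where
  "dominates G C p \<phi> \<longleftrightarrow>
     positive_definite G p \<and> Re (p \<one>\<^bsub>G\<^esub>) \<le> C \<and>
     (\<forall>c\<in>fin_supp (carrier G). (cmod (pairing c \<phi>))\<^sup>2 \<le> C * Re (kform (gker G p) c c))"

text \<open>For \<open>C \<ge> 0\<close> this turns out to be the closed ball of radius
  \<open>C\<close> in \<open>B(G_d)\<close>, by \<open>B_norm_le_iff\<close>.\<close>

definition coef :: "('a, 'm) monoid_scheme \<Rightarrow> real \<Rightarrow> ('a \<Rightarrow> complex) set" where
  "coef G C = {\<phi> \<in> functions_on G. \<exists>p. dominates G C p \<phi>}"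

lemma functions_on_subspace: "complex_subspace (functions_on G)"
  by (auto simp: complex_subspace_def functions_on_def fscale_apply)

lemma functions_on_mult: "f \<in> functions_on G \<Longrightarrow> f * g \<in> functions_on G"
  by (auto simp: functions_on_def)

context group
begin

lemma positive_definiteD:
  fixes n :: nat
  assumes "positive_definite G p" "\<forall>i<n. x i \<in> carrier G"
  shows "(\<Sum>i<n. \<Sum>j<n. c i * cnj (c j) * p (inv (x j) \<otimes> x i)) \<in> \<real>\<^sub>\<ge>\<^sub>0"
  using assms(1)[unfolded positive_definite_def, THEN conjunct2, rule_format, of n x c] assms(2)
  by simp

text \<open>The definition tests families in which points may repeat; repeated points merge in a sum
  of \<open>delta\<close> functions, so one coefficient per point suffices.\<close>

lemma positive_definite_iff:
  "positive_definite G p \<longleftrightarrow> p \<in> functions_on G \<and> psd_kernel (carrier G) (gker G p)"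
proof
  assume p: "positive_definite G p"
  have "kform (gker G p) c c \<in> \<real>\<^sub>\<ge>\<^sub>0" if c: "c \<in> fin_supp (carrier G)" for c
  proof -
    let ?A = "{x. c x \<noteq> 0}"
    have A: "finite ?A" "?A \<subseteq> carrier G" using c by (auto simp: fin_supp_def)
    obtain h where h: "bij_betw h {0..<card ?A} ?A"
      using ex_bij_betw_nat_finite[OF A(1)] by blast
    have "kform (gker G p) c c = (\<Sum>x\<in>?A. \<Sum>y\<in>?A. c x * cnj (c y) * p (inv y \<otimes> x))"
      using kform_superset[OF A(1) order_refl A(1) order_refl, of "gker G p"] by (simp add: gker_def)
    also have "\<dots> = (\<Sum>i<card ?A. \<Sum>j<card ?A. c (h i) * cnj (c (h j)) * p (inv (h j) \<otimes> h i))"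
      unfolding sum.reindex_bij_betw[OF h, symmetric] by (simp add: atLeast0LessThan)
    also have "\<dots> \<in> \<real>\<^sub>\<ge>\<^sub>0"
    proof -
      have "h i \<in> carrier G" if "i < card ?A" for i
        using bij_betw_apply[OF h, of i] that A(2) by auto
      then have "\<forall>i<card ?A. h i \<in> carrier G" by blast
      then show ?thesis using p by (rule positive_definiteD[rotated])
    qed
    finally show ?thesis .
  qed
  then show "p \<in> functions_on G \<and> psd_kernel (carrier G) (gker G p)"
    using p by (simp add: psd_kernel_def positive_definite_def)
next
  assume p: "p \<in> functions_on G \<and> psd_kernel (carrier G) (gker G p)"
  have "(\<Sum>i<n. \<Sum>j<n. c i * cnj (c j) * p (inv (x j) \<otimes> x i)) \<in> \<real>\<^sub>\<ge>\<^sub>0"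
    if x: "\<forall>i<n. x i \<in> carrier G" for n :: nat and c x
  proof -
    have x': "\<And>i. i \<in> {..<n} \<Longrightarrow> x i \<in> carrier G" using x by simp
    have "(\<Sum>i<n. \<Sum>j<n. c i * cnj (c j) * p (inv (x j) \<otimes> x i))
      = kform (gker G p) (\<Sum>i<n. fscale (c i) (delta (x i))) (\<Sum>i<n. fscale (c i) (delta (x i)))"
      by (subst kform_deltas[where X = "carrier G"]) (use x in \<open>simp_all add: gker_def\<close>)
    then show ?thesis using p deltas_in_fin_supp[of "{..<n}" x "carrier G" c, OF x'] by (simp add: psd_kernel_def)
  qed
  then show "positive_definite G p"
    using p by (simp add: positive_definite_def)
qed

lemma psd_gker: "positive_definite G p \<Longrightarrow> psd_kernel (carrier G) (gker G p)"
  by (simp add: positive_definite_iff)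

lemma positive_definite_semi_ip:
  "positive_definite G p \<Longrightarrow> semi_ip (fin_supp (carrier G)) (kform (gker G p))"
  by (intro psd_kernel_semi_ip psd_gker)

lemma delta_mem: "x \<in> carrier G \<Longrightarrow> delta x \<in> fin_supp (carrier G)"
  by (rule delta_in_fin_supp)

lemma kform_gker_diag: "x \<in> carrier G \<Longrightarrow> kform (gker G p) (delta x) (delta x) = p \<one>"
  by (simp add: gker_def)

lemma positive_definite_one:
  assumes "positive_definite G p"
  shows "p \<one> = of_real (Re (p \<one>))" "0 \<le> Re (p \<one>)"
proof -
  have "kform (gker G p) (delta \<one>) (delta \<one>) \<in> \<real>\<^sub>\<ge>\<^sub>0"
    using psd_gker[OF assms] delta_mem[OF one_closed] unfolding psd_kernel_def by blast
  then show "p \<one> = of_real (Re (p \<one>))" "0 \<le> Re (p \<one>)"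
    by (auto simp: gker_def nonneg_Reals_iff complex_eq_iff)
qed

lemma positive_definite_inv:
  assumes "positive_definite G p" "x \<in> carrier G"
  shows "p (inv x) = cnj (p x)"
  using psd_kernel_hermitian[OF psd_gker[OF assms(1)] assms(2) one_closed] assms(2)
  by (simp add: gker_def)

lemma positive_definite_cmod_le:
  assumes "positive_definite G p" "x \<in> carrier G"
  shows "cmod (p x) \<le> Re (p \<one>)"
proof -
  interpret semi_ip "fin_supp (carrier G)" "kform (gker G p)"
    by (rule positive_definite_semi_ip) fact
  have "cmod (p x) \<le> nrm (delta x) * nrm (delta \<one>)"
    using Cauchy_Schwarz[of "delta x" "delta \<one>"] assms(2) by (simp add: delta_mem gker_def)
  also have "\<dots> = sqrt (Re (p \<one>)) * sqrt (Re (p \<one>))"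
    using assms(2) by (simp add: ip_norm_def gker_def)
  finally show ?thesis using positive_definite_one[OF assms(1)] by simp
qed

text \<open>Cauchy-Schwarz for \<open>delta x\<close> and \<open>delta s - delta t\<close>, the
  latter of squared norm \<open>2 * (Re (p \<one>) - Re (p (inv s \<otimes> t)))\<close>. The bound
  does not involve \<open>x\<close>, so the behaviour of \<open>p\<close> near the unit controls
  \<open>p\<close> uniformly.\<close>

lemma Krein:
  assumes p: "positive_definite G p" and x: "x \<in> carrier G" and s: "s \<in> carrier G" and t: "t \<in> carrier G"
  shows "(cmod (p (inv s \<otimes> x) - p (inv t \<otimes> x)))\<^sup>2
           \<le> 2 * Re (p \<one>) * (Re (p \<one>) - Re (p (inv s \<otimes> t)))"
proof -
  interpret semi_ip "fin_supp (carrier G)" "kform (gker G p)"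
    by (rule positive_definite_semi_ip) fact
  have "cmod (p (inv s \<otimes> x) - p (inv t \<otimes> x)) \<le> nrm (delta x) * nrm (delta s - delta t)"
    using Cauchy_Schwarz[of "delta x" "delta s - delta t"] x s t
    by (simp add: delta_mem mem_rules ip_diff_right gker_def)
  then have "(cmod (p (inv s \<otimes> x) - p (inv t \<otimes> x)))\<^sup>2 \<le> (nrm (delta x))\<^sup>2 * (nrm (delta s - delta t))\<^sup>2"
    by (metis norm_ge_zero power_mono power_mult_distrib)
  also have "(nrm (delta x))\<^sup>2 = Re (p \<one>)"
    using x by (simp add: nrm_sq delta_mem gker_def)
  also have "(nrm (delta s - delta t))\<^sup>2 = 2 * (Re (p \<one>) - Re (p (inv s \<otimes> t)))"
  proof -
    have "Re (p (inv t \<otimes> s)) = Re (p (inv s \<otimes> t))"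
      using psd_kernel_hermitian[OF psd_gker[OF p] s t] by (simp add: gker_def)
    then show ?thesis using s t by (simp add: nrm_diff_sq nrm_sq delta_mem gker_def)
  qed
  finally show ?thesis by (simp add: algebra_simps)
qed

lemma positive_definite_add:
  assumes "positive_definite G p" "positive_definite G q"
  shows "positive_definite G (p + q)"
proof -
  have "gker G (p + q) = (\<lambda>x y. gker G p x y + gker G q x y)" by (intro ext) (simp add: gker_def)
  then show ?thesis using assms
    by (simp add: positive_definite_iff psd_kernel_def kform_add_kernel complex_subspaceD[OF functions_on_subspace])
qed

lemma gker_fscale: "gker G (fscale t p) = (\<lambda>x y. t * gker G p x y)"
  by (intro ext) (simp add: gker_def fscale_apply)

lemma positive_definite_scale:
  assumes "positive_definite G p" "r \<ge> 0"
  shows "positive_definite G (fscale (of_real r) p)"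
  using assms unfolding positive_definite_iff gker_fscale
  by (simp add: psd_kernel_def kform_scale_kernel complex_subspaceD[OF functions_on_subspace])

lemma positive_definite_zero: "positive_definite G 0"
  by (simp add: positive_definite_def functions_on_def)

lemma positive_definite_mult:
  assumes "positive_definite G p" "positive_definite G q"
  shows "positive_definite G (p * q)"
proof -
  have "gker G (p * q) = (\<lambda>x y. gker G p x y * gker G q x y)" by (intro ext) (simp add: gker_def)
  then show ?thesis
    using assms Schur_product[of "carrier G" "gker G p" "gker G q"]
    by (simp add: positive_definite_iff functions_on_mult)
qed

lemma kform_nonneg: "positive_definite G p \<Longrightarrow> c \<in> fin_supp (carrier G) \<Longrightarrow> 0 \<le> Re (kform (gker G p) c c)"
  using psd_gker unfolding psd_kernel_def nonneg_Reals_iff by blast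

lemma dominates_nonneg: "dominates G C p \<phi> \<Longrightarrow> 0 \<le> C"
  using positive_definite_one(2)[of p] by (auto simp: dominates_def)

lemma coef_nonneg: "\<phi> \<in> coef G C \<Longrightarrow> 0 \<le> C"
  using dominates_nonneg by (auto simp: coef_def)

lemma coef_functions_on: "\<phi> \<in> coef G C \<Longrightarrow> \<phi> \<in> functions_on G"
  by (simp add: coef_def)

lemma coef_cmod_le:
  assumes "\<phi> \<in> coef G C"
  shows "cmod (\<phi> x) \<le> C"
proof (cases "x \<in> carrier G")
  case True
  obtain p where p: "dominates G C p \<phi>" using assms by (auto simp: coef_def)
  then have "(cmod (pairing (delta x) \<phi>))\<^sup>2 \<le> C * Re (kform (gker G p) (delta x) (delta x))"
    using delta_mem[OF True] unfolding dominates_def by blast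
  also have "\<dots> \<le> C * C"
    unfolding kform_gker_diag[OF True] using p dominates_nonneg[OF p]
    by (intro mult_left_mono) (auto simp: dominates_def)
  finally have "(cmod (\<phi> x))\<^sup>2 \<le> C\<^sup>2" by (simp add: power2_eq_square)
  then show ?thesis using dominates_nonneg[OF p] by (rule power2_le_imp_le)
next
  case False
  then show ?thesis using assms coef_nonneg[OF assms] by (simp add: coef_def functions_on_def)
qed

lemma coef_zero: "C \<ge> 0 \<Longrightarrow> 0 \<in> coef G C"
proof -
  assume C: "C \<ge> 0"
  have "dominates G C 0 0"
    unfolding dominates_def
    using C by (simp add: positive_definite_zero kform_nonneg pairing_def)
  then show ?thesis unfolding coef_def functions_on_def by auto
qed

lemma coef_scale:
  assumes "\<phi> \<in> coef G C"
  shows "fscale t \<phi> \<in> coef G (cmod t * C)"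
proof -
  obtain p where p: "dominates G C p \<phi>" using assms by (auto simp: coef_def)
  \<comment> \<open>Of the two factors \<open>cmod t\<close> that are required, one comes from
    scaling \<open>p\<close> and the other from the new constant \<open>cmod t * C\<close>.\<close>
  have "dominates G (cmod t * C) (fscale (of_real (cmod t)) p) (fscale t \<phi>)"
    unfolding dominates_def
  proof (intro conjI ballI)
    show "positive_definite G (fscale (of_real (cmod t)) p)"
      using p by (intro positive_definite_scale) (auto simp: dominates_def)
    show "Re (fscale (of_real (cmod t)) p \<one>) \<le> cmod t * C"
      using p by (auto simp: dominates_def fscale_apply intro: mult_left_mono)
    fix c assume "c \<in> fin_supp (carrier G)"
    then have "(cmod (pairing c \<phi>))\<^sup>2 \<le> C * Re (kform (gker G p) c c)"
      using p by (simp add: dominates_def)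
    then have "(cmod t)\<^sup>2 * (cmod (pairing c \<phi>))\<^sup>2 \<le> (cmod t)\<^sup>2 * (C * Re (kform (gker G p) c c))"
      by (intro mult_left_mono) auto
    then show "(cmod (pairing c (fscale t \<phi>)))\<^sup>2
        \<le> cmod t * C * Re (kform (gker G (fscale (of_real (cmod t)) p)) c c)"
      unfolding gker_fscale kform_scale_kernel fscale_def[of t] pairing_scale_right
      by (simp add: norm_mult power_mult_distrib power2_eq_square mult_ac)
  qed
  then show ?thesis using assms complex_subspaceD(3)[OF functions_on_subspace]
    unfolding coef_def by blast
qed

text \<open>The function \<open>p + q\<close> plays the role of the direct sum of the two
  representations.\<close>

lemma coef_add:
  assumes "\<phi> \<in> coef G C" "\<psi> \<in> coef G D"
  shows "\<phi> + \<psi> \<in> coef G (C + D)"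
proof -
  obtain p q where p: "dominates G C p \<phi>" and q: "dominates G D q \<psi>"
    using assms by (auto simp: coef_def)
  \<comment> \<open>Cauchy-Schwarz in the plane: \<open>a * b\<close> is at most the geometric mean
    of \<open>C * S'\<close> and \<open>D * S\<close>, so twice it is at most their sum.\<close>
  have ineq: "(a + b)\<^sup>2 \<le> (C + D) * (S + S')"
    if "a\<^sup>2 \<le> C * S" "b\<^sup>2 \<le> D * S'" "0 \<le> a" "0 \<le> b" "0 \<le> S" "0 \<le> S'" for a b S S' :: real
  proof -
    have CD: "0 \<le> C" "0 \<le> D" using p q dominates_nonneg by auto
    have "(2 * (a * b))\<^sup>2 = 4 * (a\<^sup>2 * b\<^sup>2)" by (simp add: power_mult_distrib)
    also have "\<dots> \<le> 4 * ((C * S) * (D * S'))"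
      using that CD by (intro mult_left_mono mult_mono) auto
    also have "\<dots> \<le> (C * S' + D * S)\<^sup>2"
      using zero_le_power2[of "C * S' - D * S"] by (simp add: power2_sum power2_diff algebra_simps)
    finally have "2 * (a * b) \<le> C * S' + D * S"
      by (rule power2_le_imp_le) (use CD that in simp)
    then show ?thesis using that by (simp add: power2_sum algebra_simps)
  qed
  have "dominates G (C + D) (p + q) (\<phi> + \<psi>)"
    unfolding dominates_def
  proof (intro conjI ballI)
    show "positive_definite G (p + q)"
      using p q by (intro positive_definite_add) (auto simp: dominates_def)
    show "Re ((p + q) \<one>) \<le> C + D"
      using p q by (auto simp: dominates_def)
    fix c assume c: "c \<in> fin_supp (carrier G)"
    have g: "gker G (p + q) = (\<lambda>x y. gker G p x y + gker G q x y)" by (intro ext) (simp add: gker_def)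
    have "pairing c (\<phi> + \<psi>) = pairing c \<phi> + pairing c \<psi>"
      using pairing_add_right[of c \<phi> \<psi>] by (simp add: plus_fun_def)
    then have "(cmod (pairing c (\<phi> + \<psi>)))\<^sup>2 \<le> (cmod (pairing c \<phi>) + cmod (pairing c \<psi>))\<^sup>2"
      by (simp add: norm_triangle_ineq power_mono)
    also have "\<dots> \<le> (C + D) * (Re (kform (gker G p) c c) + Re (kform (gker G q) c c))"
      using p q c by (intro ineq) (auto simp: dominates_def kform_nonneg)
    finally show "(cmod (pairing c (\<phi> + \<psi>)))\<^sup>2 \<le> (C + D) * Re (kform (gker G (p + q)) c c)"
      by (simp add: g kform_add_kernel)
  qed
  then show ?thesis using assms complex_subspaceD(2)[OF functions_on_subspace]
    unfolding coef_def by blast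
qed

lemma coef_mono:
  assumes "\<phi> \<in> coef G C" "C \<le> D"
  shows "\<phi> \<in> coef G D"
  using coef_add[OF assms(1) coef_zero[of "D - C"]] assms(2) by simp

lemma coef_sum:
  "(\<And>i. i \<in> A \<Longrightarrow> f i \<in> coef G (C i)) \<Longrightarrow> sum f A \<in> coef G (sum C A)"
  by (induction A rule: infinite_finite_induct) (auto intro: coef_zero coef_add)

text \<open>Domination says that \<open>of_real C * gker G p x y - \<phi> x * cnj (\<phi> y)\<close>
  is a positive semidefinite kernel \<open>?K\<close>, and \<open>?L\<close> is the one for
  \<open>q\<close> and \<psi>. The kernel wanted for the product is \<open>?K\<close> times
  \<open>of_real D * gker G q\<close> plus the rank-one kernel of \<phi> times \<open>?L\<close>:
  two Schur products.\<close>

lemma coef_mult: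
  assumes "\<phi> \<in> coef G C" "\<psi> \<in> coef G D"
  shows "\<phi> * \<psi> \<in> coef G (C * D)"
proof -
  obtain p q where p: "dominates G C p \<phi>" and q: "dominates G D q \<psi>"
    using assms by (auto simp: coef_def)
  have CD: "0 \<le> C" "0 \<le> D" using p q dominates_nonneg by auto
  have psd: "psd_kernel (carrier G) (\<lambda>x y. of_real E * gker G r x y - \<theta> x * cnj (\<theta> y))"
    if "dominates G E r \<theta>" for E r \<theta>
    unfolding psd_kernel_def
  proof
    fix c assume c: "c \<in> fin_supp (carrier G)"
    have "kform (gker G r) c c \<in> \<real>\<^sub>\<ge>\<^sub>0"
      using that c psd_gker unfolding dominates_def psd_kernel_def by blast
    moreover have "(cmod (pairing c \<theta>))\<^sup>2 \<le> E * Re (kform (gker G r) c c)"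
      using that c unfolding dominates_def by blast
    ultimately show "kform (\<lambda>x y. of_real E * gker G r x y - \<theta> x * cnj (\<theta> y)) c c \<in> \<real>\<^sub>\<ge>\<^sub>0"
      by (simp add: kform_diff_kernel kform_scale_kernel kform_rank_one nonneg_Reals_iff)
  qed
  let ?K = "\<lambda>x y. of_real C * gker G p x y - \<phi> x * cnj (\<phi> y)"
  let ?L = "\<lambda>x y. of_real D * gker G q x y - \<psi> x * cnj (\<psi> y)"
  have "psd_kernel (carrier G) (\<lambda>x y. of_real D * gker G q x y)"
    using q CD psd_gker[of q] unfolding dominates_def psd_kernel_def kform_scale_kernel by simp
  note 1 = Schur_product[OF psd[OF p] this]
  note 2 = Schur_product[OF psd_kernel_rank_one[of _ \<phi>] psd[OF q]]
  have "dominates G (C * D) (p * q) (\<phi> * \<psi>)"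
    unfolding dominates_def
  proof (intro conjI ballI)
    show "positive_definite G (p * q)"
      using p q by (intro positive_definite_mult) (auto simp: dominates_def)
    show "Re ((p * q) \<one>) \<le> C * D"
    proof -
      have pq: "positive_definite G p" "positive_definite G q" "Re (p \<one>) \<le> C" "Re (q \<one>) \<le> D"
        using p q by (auto simp: dominates_def)
      then have "Im (p \<one>) = 0" by (metis Im_complex_of_real positive_definite_one(1))
      then show ?thesis using pq positive_definite_one(2) by (auto intro!: mult_mono simp: CD)
    qed
    fix c assume c: "c \<in> fin_supp (carrier G)"
    have "(\<lambda>x y. of_real (C * D) * gker G (p * q) x y - (\<phi> * \<psi>) x * cnj ((\<phi> * \<psi>) y))
        = (\<lambda>x y. ?K x y * (of_real D * gker G q x y) + (\<phi> x * cnj (\<phi> y)) * ?L x y)"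
      by (intro ext) (simp add: gker_def algebra_simps)
    then have "kform (\<lambda>x y. of_real (C * D) * gker G (p * q) x y - (\<phi> * \<psi>) x * cnj ((\<phi> * \<psi>) y)) c c \<in> \<real>\<^sub>\<ge>\<^sub>0"
      using 1 2 c unfolding psd_kernel_def by (simp only: kform_add_kernel nonneg_Reals_add_I)
    then have "0 \<le> Re (kform (\<lambda>x y. of_real (C * D) * gker G (p * q) x y - (\<phi> * \<psi>) x * cnj ((\<phi> * \<psi>) y)) c c)"
      by (simp only: nonneg_Reals_iff)
    also have "\<dots> = C * D * Re (kform (gker G (p * q)) c c) - (cmod (pairing c (\<phi> * \<psi>)))\<^sup>2"
      by (simp only: kform_diff_kernel kform_scale_kernel kform_rank_one)
        (simp add: times_fun_def)
    finally show "(cmod (pairing c (\<phi> * \<psi>)))\<^sup>2 \<le> C * D * Re (kform (gker G (p * q)) c c)" by simp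
  qed
  then show ?thesis using assms functions_on_mult unfolding coef_def by blast
qed

text \<open>Pairing with \<open>p\<close> is the inner product with \<open>delta \<one>\<close>,
  whose squared norm is \<open>p \<one>\<close>.\<close>

lemma positive_definite_coef:
  assumes p: "positive_definite G p"
  shows "p \<in> coef G (Re (p \<one>))"
proof -
  interpret semi_ip "fin_supp (carrier G)" "kform (gker G p)"
    by (rule positive_definite_semi_ip) fact
  have "(cmod (pairing c p))\<^sup>2 \<le> Re (p \<one>) * Re (kform (gker G p) c c)" if c: "c \<in> fin_supp (carrier G)" for c
  proof -
    have "pairing c p = kform (gker G p) c (delta \<one>)"
      unfolding kform_delta_right by (rule pairing_cong[OF c]) (simp add: gker_def)
    then have "cmod (pairing c p) \<le> nrm c * nrm (delta \<one>)"
      using Cauchy_Schwarz[OF c delta_mem[OF one_closed]] by simp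
    then have "(cmod (pairing c p))\<^sup>2 \<le> (nrm c)\<^sup>2 * (nrm (delta \<one>))\<^sup>2"
      by (metis norm_ge_zero power_mono power_mult_distrib)
    then show ?thesis using c by (simp add: nrm_sq delta_mem gker_def mult.commute)
  qed
  then have "dominates G (Re (p \<one>)) p p" using p by (simp add: dominates_def)
  then show ?thesis using p by (auto simp: coef_def positive_definite_def)
qed

lemma B_discrete_imp_coef:
  assumes "f \<in> B_discrete G"
  obtains C where "f \<in> coef G C"
proof -
  obtain n :: nat and c p where f: "\<forall>i<n. positive_definite G (p i)" "f = (\<Sum>i<n. fscale (c i) (p i))"
    using assms unfolding B_discrete_def by blast
  have "f \<in> coef G (\<Sum>i<n. cmod (c i) * Re (p i \<one>))"
    unfolding f(2) by (rule coef_sum, rule coef_scale, rule positive_definite_coef) (use f(1) in simp)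
  then show thesis by (rule that)
qed

end

subsection \<open>Reproducing kernel Hilbert spaces\<close>

text \<open>The Hilbert space with reproducing kernel \<open>k\<close>, described without completing anything: it
  consists of the functions that are bounded as functionals on the finitely supported ones.\<close>

locale rkhs =
  fixes X :: "'a set" and k :: "'a \<Rightarrow> 'a \<Rightarrow> complex"
  assumes psd: "psd_kernel X k"
begin

sublocale F: semi_ip "fin_supp X" "kform k"
  by (rule psd_kernel_semi_ip) (rule psd)

text \<open>A vector is identified with the functional it defines. The conjugate on \<open>u\<close>
  is there because inner products are conjugate linear in the second argument.\<close>

definition hbound :: "('a \<Rightarrow> complex) \<Rightarrow> real \<Rightarrow> bool" where
  "hbound u C \<longleftrightarrow> C \<ge> 0 \<and> (\<forall>c\<in>fin_supp X. cmod (pairing c (\<lambda>x. cnj (u x))) \<le> C * F.nrm c)"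

definition H :: "('a \<Rightarrow> complex) set" where
  "H = {u. (\<forall>x. x \<notin> X \<longrightarrow> u x = 0) \<and> (\<exists>C. hbound u C)}"

definition hn :: "('a \<Rightarrow> complex) \<Rightarrow> real" where
  "hn u = Inf {C. hbound u C}"

text \<open>By hermitian symmetry this is the sum of \<open>d y * k y x\<close>, a combination of
  kernel functions, hence linear in \<open>d\<close>.\<close>

definition J :: "('a \<Rightarrow> complex) \<Rightarrow> 'a \<Rightarrow> complex" where
  "J d x = (if x \<in> X then pairing d (\<lambda>y. cnj (k x y)) else 0)"

text \<open>Only the norm \<open>hn\<close> is available at this point, so the inner product is
  defined by polarization; its linearity is later obtained by approximation.\<close>

definition hip :: "('a \<Rightarrow> complex) \<Rightarrow> ('a \<Rightarrow> complex) \<Rightarrow> complex" where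
  "hip u v = of_real (((hn (u + v))\<^sup>2 - (hn (u - v))\<^sup>2) / 4)
      + \<i> * of_real (((hn (u + fscale \<i> v))\<^sup>2 - (hn (u - fscale \<i> v))\<^sup>2) / 4)"

lemma hn_le: "hbound u C \<Longrightarrow> hn u \<le> C"
  unfolding hn_def by (rule cInf_lower) (auto simp: hbound_def intro!: bdd_belowI[of _ 0])

lemma hn_bound: "u \<in> H \<Longrightarrow> hbound u (hn u)"
proof -
  assume "u \<in> H"
  then obtain C0 where C0: "hbound u C0" by (auto simp: H_def)
  have nonneg: "0 \<le> hn u"
    unfolding hn_def by (rule cInf_greatest) (use C0 in \<open>auto simp: hbound_def\<close>)
  have "cmod (pairing c (\<lambda>x. cnj (u x))) \<le> hn u * F.nrm c" if c: "c \<in> fin_supp X" for c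
  proof (cases "F.nrm c = 0")
    case True
    then show ?thesis using C0 c by (auto simp: hbound_def)
  next
    case False
    then have pos: "F.nrm c > 0" using F.nrm_nonneg[OF c] by simp
    have "cmod (pairing c (\<lambda>x. cnj (u x))) / F.nrm c \<le> hn u"
      unfolding hn_def
      by (rule cInf_greatest) (use C0 c pos in \<open>auto simp: hbound_def divide_le_eq\<close>)
    then show ?thesis using pos by (simp add: divide_le_eq)
  qed
  then show ?thesis using nonneg by (simp add: hbound_def)
qed

lemma hn_nonneg: "u \<in> H \<Longrightarrow> 0 \<le> hn u"
  using hn_bound by (simp add: hbound_def)

lemma pairing_le_hn:
  "u \<in> H \<Longrightarrow> c \<in> fin_supp X \<Longrightarrow> cmod (pairing c (\<lambda>x. cnj (u x))) \<le> hn u * F.nrm c"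
  using hn_bound by (simp add: hbound_def)

lemma hbound_add: "hbound u C \<Longrightarrow> hbound v D \<Longrightarrow> hbound (u + v) (C + D)"
  unfolding hbound_def
proof safe
  fix c assume *: "c \<in> fin_supp X" "\<forall>c\<in>fin_supp X. cmod (pairing c (\<lambda>x. cnj (u x))) \<le> C * F.nrm c"
    "\<forall>c\<in>fin_supp X. cmod (pairing c (\<lambda>x. cnj (v x))) \<le> D * F.nrm c"
  have "pairing c (\<lambda>x. cnj ((u + v) x)) = pairing c (\<lambda>x. cnj (u x)) + pairing c (\<lambda>x. cnj (v x))"
    by (simp add: pairing_add_right)
  also have "cmod \<dots> \<le> C * F.nrm c + D * F.nrm c"
    using * by (intro norm_triangle_mono) auto
  finally show "cmod (pairing c (\<lambda>x. cnj ((u + v) x))) \<le> (C + D) * F.nrm c"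
    by (simp add: algebra_simps)
qed auto

lemma hbound_scale: "hbound u C \<Longrightarrow> hbound (fscale t u) (cmod t * C)"
  unfolding hbound_def
proof safe
  fix c assume *: "c \<in> fin_supp X" "\<forall>c\<in>fin_supp X. cmod (pairing c (\<lambda>x. cnj (u x))) \<le> C * F.nrm c"
  have "pairing c (\<lambda>x. cnj (fscale t u x)) = cnj t * pairing c (\<lambda>x. cnj (u x))"
    by (simp add: fscale_apply pairing_scale_right)
  then show "cmod (pairing c (\<lambda>x. cnj (fscale t u x))) \<le> cmod t * C * F.nrm c"
    using * by (simp add: norm_mult mult_left_mono mult.assoc)
qed auto

lemma H_subspace: "complex_subspace H"
proof -
  have "hbound 0 0" by (simp add: hbound_def pairing_def)
  then have "0 \<in> H" by (auto simp: H_def)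
  moreover have "u + v \<in> H" if "u \<in> H" "v \<in> H" for u v
    using that hbound_add[of u _ v] by (fastforce simp: H_def)
  moreover have "fscale t u \<in> H" if "u \<in> H" for t u
    using that hbound_scale[of u _ t] by (fastforce simp: H_def fscale_apply)
  ultimately show ?thesis by (simp add: complex_subspace_def)
qed

lemmas H_rules = complex_subspaceD[OF H_subspace]

lemma hn_add: "u \<in> H \<Longrightarrow> v \<in> H \<Longrightarrow> hn (u + v) \<le> hn u + hn v"
  by (intro hn_le hbound_add hn_bound)

lemma hn_scale_le: "u \<in> H \<Longrightarrow> hn (fscale t u) \<le> cmod t * hn u"
  by (intro hn_le hbound_scale hn_bound)

lemma hn_minus_commute_le: "u \<in> H \<Longrightarrow> v \<in> H \<Longrightarrow> hn (v - u) \<le> hn (u - v)"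
proof -
  assume uv: "u \<in> H" "v \<in> H"
  have "v - u = fscale (-1) (u - v)" by (rule ext) (simp add: fscale_apply)
  then show ?thesis using hn_scale_le[OF H_rules(4)[OF uv], of "-1"]
    by (simp only: norm_minus_cancel norm_one mult_1)
qed

lemma hn_diff_bound: "u \<in> H \<Longrightarrow> v \<in> H \<Longrightarrow> \<bar>hn u - hn v\<bar> \<le> hn (u - v)"
  using hn_add[of "u - v" v] hn_add[of "v - u" u] hn_minus_commute_le[of u v]
  by (simp add: H_rules)

lemma hn_tendsto:
  assumes "u \<in> H" "\<And>n. w n \<in> H" "(\<lambda>n. hn (u - w n)) \<longlonglongrightarrow> 0"
  shows "(\<lambda>n. hn (w n)) \<longlonglongrightarrow> hn u"
proof (rule LIMSEQ_I)
  fix r :: real assume "r > 0"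
  then obtain N where "\<forall>n\<ge>N. norm (hn (u - w n) - 0) < r"
    using LIMSEQ_D[OF assms(3)] by blast
  moreover have "\<bar>hn (w n) - hn u\<bar> \<le> hn (u - w n)" for n
    using hn_diff_bound[OF assms(1) assms(2)[of n]] by linarith
  ultimately show "\<exists>N. \<forall>n\<ge>N. norm (hn (w n) - hn u) < r"
    by (metis abs_ge_self diff_zero order_le_less_trans real_norm_def)
qed

lemma pairing_J: "c \<in> fin_supp X \<Longrightarrow> pairing c (\<lambda>x. cnj (J d x)) = kform k c d"
  unfolding kform_def
proof (rule pairing_cong, assumption)
  fix x assume "x \<in> X"
  then have "cnj (J d x) = cnj (pairing d (\<lambda>y. cnj (k x y)))" by (simp add: J_def)
  also have "\<dots> = pairing (\<lambda>y. cnj (d y)) (k x)" by (simp add: pairing_cnj[symmetric])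
  finally show "cnj (J d x) = pairing (\<lambda>y. cnj (d y)) (k x)" .
qed

lemma J_add: "c \<in> fin_supp X \<Longrightarrow> d \<in> fin_supp X \<Longrightarrow> J (c + d) = J c + J d"
  by (rule ext) (simp add: J_def pairing_add_left)

lemma J_scale: "J (fscale t c) = fscale t (J c)"
  by (rule ext) (simp add: J_def fscale_apply pairing_scale_left)

lemma hbound_J: "d \<in> fin_supp X \<Longrightarrow> hbound (J d) (F.nrm d)"
  using F.Cauchy_Schwarz[of _ d] F.nrm_nonneg[of d] by (simp add: hbound_def pairing_J mult.commute)

lemma J_in_H: "d \<in> fin_supp X \<Longrightarrow> J d \<in> H"
  using hbound_J by (auto simp: H_def J_def)

text \<open>The upper bound is Cauchy-Schwarz, and testing the functional on \<open>d\<close> itself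
  attains it.\<close>

lemma hn_J: "d \<in> fin_supp X \<Longrightarrow> hn (J d) = F.nrm d"
proof (rule antisym)
  assume d: "d \<in> fin_supp X"
  show "hn (J d) \<le> F.nrm d" by (rule hn_le[OF hbound_J[OF d]])
  have "cmod (kform k d d) \<le> hn (J d) * F.nrm d"
    using pairing_le_hn[OF J_in_H[OF d] d] by (simp add: pairing_J[OF d])
  then have "F.nrm d * F.nrm d \<le> hn (J d) * F.nrm d"
    by (simp add: F.ip_self[OF d] power2_eq_square norm_mult)
  then show "F.nrm d \<le> hn (J d)"
    using F.nrm_nonneg[OF d] hn_nonneg[OF J_in_H[OF d]]
    by (cases "F.nrm d = 0") (auto simp: mult_le_cancel_right)
qed

text \<open>This is \<open>approx_Riesz\<close> on the incomplete space \<open>fin_supp X\<close>: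
  the error estimate it provides is a bound in the sense of \<open>hbound\<close> for the
  difference.\<close>

lemma dense_J:
  assumes u: "u \<in> H" and "e > 0"
  obtains d where "d \<in> fin_supp X" "hn (u - J d) \<le> e"
proof -
  obtain d where d: "d \<in> fin_supp X"
    "\<And>c. c \<in> fin_supp X \<Longrightarrow> cmod (pairing c (\<lambda>x. cnj (u x)) - kform k c d) \<le> e * F.nrm c"
    by (rule F.approx_Riesz[of "\<lambda>c. pairing c (\<lambda>x. cnj (u x))" "hn u" e])
      (use u \<open>e > 0\<close> in \<open>auto simp: pairing_scale_left pairing_le_hn intro: pairing_add_left\<close>)
  have "hbound (u - J d) e"
    unfolding hbound_def
  proof safe
    fix c assume c: "c \<in> fin_supp X"
    have "pairing c (\<lambda>x. cnj ((u - J d) x)) = pairing c (\<lambda>x. cnj (u x)) - kform k c d"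
      unfolding pairing_J[OF c, symmetric] by (simp add: pairing_diff_right)
    then show "cmod (pairing c (\<lambda>x. cnj ((u - J d) x))) \<le> e * F.nrm c"
      using d(2)[OF c] by simp
  qed (use \<open>e > 0\<close> in simp)
  then show thesis using that d(1) hn_le by blast
qed

definition approximates :: "(nat \<Rightarrow> 'a \<Rightarrow> complex) \<Rightarrow> ('a \<Rightarrow> complex) \<Rightarrow> bool" where
  "approximates d u \<longleftrightarrow> (\<forall>n. d n \<in> fin_supp X) \<and> (\<lambda>n. hn (u - J (d n))) \<longlonglongrightarrow> 0"

lemma ex_approximates:
  assumes "u \<in> H"
  obtains d where "approximates d u"
proof -
  have "\<exists>d. d \<in> fin_supp X \<and> hn (u - J d) \<le> inverse (real (Suc n))" for n
    by (rule dense_J[OF assms, of "inverse (real (Suc n))"]) auto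
  then obtain d where d: "\<And>n. d n \<in> fin_supp X" "\<And>n. hn (u - J (d n)) \<le> inverse (real (Suc n))"
    by metis
  have "(\<lambda>n. hn (u - J (d n))) \<longlonglongrightarrow> 0"
    by (rule tendsto_sandwich[OF _ _ tendsto_const LIMSEQ_inverse_real_of_nat])
      (use d assms in \<open>auto simp: hn_nonneg H_rules J_in_H\<close>)
  then have "approximates d u" using d(1) by (simp add: approximates_def)
  then show thesis by (rule that)
qed

lemma approximates_add:
  assumes "approximates d u" "approximates e v" "u \<in> H" "v \<in> H"
  shows "approximates (\<lambda>n. d n + e n) (u + v)"
proof -
  have de: "\<And>n. d n \<in> fin_supp X" "\<And>n. e n \<in> fin_supp X"
    using assms by (simp_all add: approximates_def)
  have "(\<lambda>n. hn (u + v - J (d n + e n))) \<longlonglongrightarrow> 0"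
  proof (rule tendsto_sandwich[OF _ _ tendsto_const])
    show "(\<lambda>n. hn (u - J (d n)) + hn (v - J (e n))) \<longlonglongrightarrow> 0"
      by (rule tendsto_add_zero) (use assms in \<open>simp_all add: approximates_def\<close>)
    have "hn (u + v - J (d n + e n)) \<le> hn (u - J (d n)) + hn (v - J (e n))" for n
    proof -
      have "u + v - J (d n + e n) = (u - J (d n)) + (v - J (e n))"
        unfolding J_add[OF de] by (rule ext) simp
      then show ?thesis using hn_add[of "u - J (d n)" "v - J (e n)"] assms(3,4) de
        by (simp only: H_rules J_in_H)
    qed
    then show "\<forall>\<^sub>F n in sequentially. hn (u + v - J (d n + e n)) \<le> hn (u - J (d n)) + hn (v - J (e n))"
      by simp
    have "0 \<le> hn (u + v - J (d n + e n))" for n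
      using assms(3,4) de by (intro hn_nonneg H_rules J_in_H fin_supp_rules)
    then show "\<forall>\<^sub>F n in sequentially. 0 \<le> hn (u + v - J (d n + e n))" by simp
  qed
  then show ?thesis using de unfolding approximates_def by (blast intro: fin_supp_rules)
qed

lemma approximates_scale:
  assumes "approximates d u" "u \<in> H"
  shows "approximates (\<lambda>n. fscale t (d n)) (fscale t u)"
proof -
  have de: "\<And>n. d n \<in> fin_supp X"
    using assms by (simp add: approximates_def)
  have "(\<lambda>n. hn (fscale t u - J (fscale t (d n)))) \<longlonglongrightarrow> 0"
  proof (rule tendsto_sandwich[OF _ _ tendsto_const])
    show "(\<lambda>n. cmod t * hn (u - J (d n))) \<longlonglongrightarrow> 0"
      by (rule tendsto_mult_right_zero) (use assms in \<open>simp add: approximates_def\<close>)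
    have "hn (fscale t u - J (fscale t (d n))) \<le> cmod t * hn (u - J (d n))" for n
      unfolding J_scale fscale_algebra(6)[symmetric] using assms(2) de
      by (intro hn_scale_le H_rules J_in_H)
    then show "\<forall>\<^sub>F n in sequentially. hn (fscale t u - J (fscale t (d n))) \<le> cmod t * hn (u - J (d n))"
      by simp
    have "0 \<le> hn (fscale t u - J (fscale t (d n)))" for n
      using assms(2) de by (intro hn_nonneg H_rules J_in_H fin_supp_rules)
    then show "\<forall>\<^sub>F n in sequentially. 0 \<le> hn (fscale t u - J (fscale t (d n)))" by simp
  qed
  then show ?thesis using de unfolding approximates_def by (blast intro: fin_supp_rules)
qed

lemma approximates_diff:
  assumes "approximates d u" "approximates e v" "u \<in> H" "v \<in> H"
  shows "approximates (\<lambda>n. d n - e n) (u - v)"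
  using approximates_add[OF assms(1) approximates_scale[OF assms(2,4), of "-1"] assms(3)] assms(4)
  by (simp only: F.diff_conv[symmetric] H_rules)

lemma approximates_nrm:
  assumes "approximates d u" "u \<in> H"
  shows "(\<lambda>n. F.nrm (d n)) \<longlonglongrightarrow> hn u"
proof -
  have "(\<lambda>n. hn (J (d n))) \<longlonglongrightarrow> hn u"
    using assms by (intro hn_tendsto) (auto simp: approximates_def J_in_H)
  then show ?thesis using assms by (simp add: approximates_def hn_J)
qed

text \<open>Approximating sequences depend linearly on the vector and norms converge along them, so
  the polarization formula of \<open>kform\<close> tends to the definition of
  \<open>hip\<close>.\<close>

lemma approximates_hip:
  assumes "approximates d u" "approximates e v" "u \<in> H" "v \<in> H"
  shows "(\<lambda>n. kform k (d n) (e n)) \<longlonglongrightarrow> hip u v"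
proof -
  have de: "\<And>n. d n \<in> fin_supp X" "\<And>n. e n \<in> fin_supp X"
    using assms by (simp_all add: approximates_def)
  note sc = approximates_scale[OF assms(2,4), of "\<i>"] H_rules(3)[OF assms(4), of "\<i>"]
  have "(\<lambda>n. of_real (((F.nrm (d n + e n))\<^sup>2 - (F.nrm (d n - e n))\<^sup>2) / 4)
      + \<i> * of_real (((F.nrm (d n + fscale \<i> (e n)))\<^sup>2 - (F.nrm (d n - fscale \<i> (e n)))\<^sup>2) / 4))
     \<longlonglongrightarrow> hip u v"
    unfolding hip_def using assms sc
    by (intro tendsto_intros tendsto_of_real approximates_nrm approximates_add approximates_diff H_rules) auto
  then show ?thesis by (simp only: F.polarization[OF de, symmetric])
qed

lemma H_semi_ip: "semi_ip H hip"
proof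
  show "complex_subspace H" by (rule H_subspace)
  fix u v w assume uvw: "u \<in> H" "v \<in> H" "w \<in> H"
  obtain d where d: "approximates d u" using ex_approximates[OF uvw(1)] .
  obtain e where e: "approximates e v" using ex_approximates[OF uvw(2)] .
  obtain f where f: "approximates f w" using ex_approximates[OF uvw(3)] .
  have fin: "\<And>n. d n \<in> fin_supp X" "\<And>n. e n \<in> fin_supp X" "\<And>n. f n \<in> fin_supp X"
    using d e f by (simp_all add: approximates_def)
  have "(\<lambda>n. kform k (d n) (f n) + kform k (e n) (f n)) \<longlonglongrightarrow> hip u w + hip v w"
    by (intro tendsto_add approximates_hip d e f uvw)
  moreover have "(\<lambda>n. kform k (d n + e n) (f n)) \<longlonglongrightarrow> hip (u + v) w"
    by (intro approximates_hip approximates_add d e f uvw H_rules)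
  ultimately show "hip (u + v) w = hip u w + hip v w"
    by (simp add: F.ip_add_left fin LIMSEQ_unique)
next
  fix t u v assume uv: "u \<in> H" "v \<in> H"
  obtain d where d: "approximates d u" using ex_approximates[OF uv(1)] .
  obtain e where e: "approximates e v" using ex_approximates[OF uv(2)] .
  have fin: "\<And>n. d n \<in> fin_supp X" "\<And>n. e n \<in> fin_supp X"
    using d e by (simp_all add: approximates_def)
  have lim: "(\<lambda>n. kform k (d n) (e n)) \<longlonglongrightarrow> hip u v"
    by (intro approximates_hip d e uv)
  have "(\<lambda>n. kform k (fscale t (d n)) (e n)) \<longlonglongrightarrow> hip (fscale t u) v"
    by (intro approximates_hip approximates_scale d e uv H_rules)
  with tendsto_mult_left[OF lim, of t] show "hip (fscale t u) v = t * hip u v"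
    by (simp add: F.ip_scale_left fin LIMSEQ_unique)
  have "(\<lambda>n. kform k (e n) (d n)) \<longlonglongrightarrow> hip v u"
    by (intro approximates_hip d e uv)
  moreover have "(\<lambda>n. kform k (e n) (d n)) = (\<lambda>n. cnj (kform k (d n) (e n)))"
    using F.ip_herm fin by blast
  ultimately show "hip v u = cnj (hip u v)"
    using tendsto_cnj[OF lim] LIMSEQ_unique by metis
next
  fix v assume v: "v \<in> H"
  obtain e where e: "approximates e v" using ex_approximates[OF v] .
  have "(\<lambda>n. Re (kform k (e n) (e n))) \<longlonglongrightarrow> Re (hip v v)"
    by (intro tendsto_Re approximates_hip e v)
  then show "0 \<le> Re (hip v v)"
    by (rule LIMSEQ_le_const) (use e F.ip_nonneg in \<open>auto simp: approximates_def\<close>)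
qed

sublocale Hs: semi_ip H hip by (rule H_semi_ip)

lemma hip_norm: "v \<in> H \<Longrightarrow> ip_norm hip v = hn v"
proof -
  assume v: "v \<in> H"
  obtain e where e: "approximates e v" using ex_approximates[OF v] .
  then have fin: "\<And>n. e n \<in> fin_supp X" by (simp add: approximates_def)
  have "(\<lambda>n. Re (kform k (e n) (e n))) \<longlonglongrightarrow> Re (hip v v)"
    by (intro tendsto_Re approximates_hip e v)
  moreover have "(\<lambda>n. Re (kform k (e n) (e n))) \<longlonglongrightarrow> (hn v)\<^sup>2"
    using tendsto_power[OF approximates_nrm[OF e v], of 2] by (simp add: F.nrm_sq fin)
  ultimately have "Re (hip v v) = (hn v)\<^sup>2" by (rule LIMSEQ_unique)
  then show ?thesis using hn_nonneg[OF v] by (simp add: ip_norm_def)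
qed

text \<open>The reproducing property. For \<open>v = J e\<close> it is \<open>pairing_J\<close>, and
  both sides are continuous in \<open>v\<close>.\<close>

lemma hip_J_left:
  assumes d: "d \<in> fin_supp X" and v: "v \<in> H"
  shows "hip (J d) v = pairing d (\<lambda>x. cnj (v x))"
proof -
  obtain e where e: "approximates e v" using ex_approximates[OF v] .
  then have fin: "\<And>n. e n \<in> fin_supp X" by (simp add: approximates_def)
  have "J d - J d = 0" by simp
  then have "hn (J d - J d) = 0" using hn_scale_le[OF J_in_H[OF d], of 0] hn_nonneg[OF H_rules(1)]
    by (simp add: fscale_algebra)
  then have "approximates (\<lambda>n. d) (J d)" using d by (simp add: approximates_def)
  then have "(\<lambda>n. kform k d (e n)) \<longlonglongrightarrow> hip (J d) v"
    by (intro approximates_hip e v J_in_H d)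
  moreover have "(\<lambda>n. kform k d (e n)) \<longlonglongrightarrow> pairing d (\<lambda>x. cnj (v x))"
  proof (rule Lim_null[THEN iffD2], rule Lim_null_comparison)
    have "cmod (kform k d (e n) - pairing d (\<lambda>x. cnj (v x))) \<le> hn (v - J (e n)) * F.nrm d" for n
    proof -
      have "kform k d (e n) - pairing d (\<lambda>x. cnj (v x)) = - pairing d (\<lambda>x. cnj ((v - J (e n)) x))"
        unfolding pairing_J[OF d, symmetric] by (simp add: pairing_diff_right)
      then show ?thesis
        using pairing_le_hn[of "v - J (e n)" d] d v fin by (simp add: H_rules J_in_H)
    qed
    then show "\<forall>\<^sub>F n in sequentially. norm (kform k d (e n) - pairing d (\<lambda>x. cnj (v x)))
        \<le> hn (v - J (e n)) * F.nrm d" by simp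
    show "(\<lambda>n. hn (v - J (e n)) * F.nrm d) \<longlonglongrightarrow> 0"
      using e by (intro tendsto_mult_left_zero) (simp add: approximates_def)
  qed
  ultimately show ?thesis by (rule LIMSEQ_unique)
qed

lemma evaluation_bound: "u \<in> H \<Longrightarrow> x \<in> X \<Longrightarrow> cmod (u x) \<le> hn u * F.nrm (delta x)"
  using pairing_le_hn[of u "delta x"] by (simp add: delta_in_fin_supp)

text \<open>Evaluations are bounded by \<open>hn\<close>, so a Cauchy sequence converges pointwise.
  For each \<open>c\<close> the inequality in \<open>hbound\<close> involves finitely many points
  and therefore survives the pointwise limit.\<close>

lemma H_complete: "complete_on H hn"
  unfolding complete_on_def
proof (intro allI impI)
  fix s :: "nat \<Rightarrow> 'a \<Rightarrow> complex"
  assume *: "(\<forall>n. s n \<in> H) \<and> (\<forall>e>0. \<exists>M. \<forall>i\<ge>M. \<forall>j\<ge>M. hn (s i - s j) < e)"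
  then have s: "\<And>n. s n \<in> H" by blast
  have "\<exists>l. (\<lambda>n. s n x) \<longlonglongrightarrow> l" for x
  proof (cases "x \<in> X")
    case True
    have "Cauchy (\<lambda>n. s n x)"
    proof (rule metric_CauchyI)
      fix e :: real assume e: "e > 0"
      let ?b = "F.nrm (delta x)"
      have b: "?b \<ge> 0" by (rule F.nrm_nonneg[OF delta_in_fin_supp[OF True]])
      then have "e / (?b + 1) > 0" using e by simp
      then obtain M where M: "\<forall>i\<ge>M. \<forall>j\<ge>M. hn (s i - s j) < e / (?b + 1)" using * by blast
      have "dist (s i x) (s j x) < e" if "i \<ge> M" "j \<ge> M" for i j
      proof -
        have "dist (s i x) (s j x) \<le> hn (s i - s j) * ?b"
          using evaluation_bound[OF H_rules(4)[OF s s] True, of i j] by (simp add: dist_norm)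
        also have "\<dots> \<le> e / (?b + 1) * ?b"
          using M that b by (intro mult_right_mono) (auto intro: less_imp_le)
        also have "\<dots> < e" using b e by (simp add: field_simps)
        finally show ?thesis .
      qed
      then show "\<exists>M. \<forall>m\<ge>M. \<forall>n\<ge>M. dist (s m x) (s n x) < e" by blast
    qed
    then show ?thesis by (meson Cauchy_convergent convergent_def)
  next
    case False
    then have "\<And>n. s n x = 0" using s by (simp add: H_def)
    then show ?thesis by (intro exI[of _ 0]) simp
  qed
  then obtain u where u: "\<And>x. (\<lambda>n. s n x) \<longlonglongrightarrow> u x" by metis
  have u0: "u x = 0" if "x \<notin> X" for x
  proof -
    have "\<And>n. s n x = 0" using s that by (simp add: H_def)
    then show ?thesis using u[of x] by (simp add: LIMSEQ_const_iff)
  qed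
  have bound: "hbound (s i - u) e" if M: "\<forall>i\<ge>M. \<forall>j\<ge>M. hn (s i - s j) < e" and "i \<ge> M" "e > 0" for M i e
    unfolding hbound_def
  proof safe
    fix c assume c: "c \<in> fin_supp X"
    have "(\<lambda>j. cmod (pairing c (\<lambda>x. cnj ((s i - s j) x)))) \<longlonglongrightarrow> cmod (pairing c (\<lambda>x. cnj ((s i - u) x)))"
      unfolding pairing_def minus_apply fun_diff_def by (intro tendsto_intros u)
    moreover have "cmod (pairing c (\<lambda>x. cnj ((s i - s j) x))) \<le> e * F.nrm c" if "j \<ge> M" for j
    proof -
      have "cmod (pairing c (\<lambda>x. cnj ((s i - s j) x))) \<le> hn (s i - s j) * F.nrm c"
        by (intro pairing_le_hn H_rules s c)
      also have "\<dots> \<le> e * F.nrm c"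
        using M that \<open>i \<ge> M\<close> F.nrm_nonneg[OF c] by (intro mult_right_mono) (auto intro: less_imp_le)
      finally show ?thesis .
    qed
    ultimately show "cmod (pairing c (\<lambda>x. cnj ((s i - u) x))) \<le> e * F.nrm c"
      by (intro LIMSEQ_le_const2[OF _ exI[of _ M]]) blast+
  qed (use \<open>e > 0\<close> in simp)
  obtain M where M: "\<forall>i\<ge>M. \<forall>j\<ge>M. hn (s i - s j) < 1" using * zero_less_one by blast
  have "s M - u \<in> H"
    using bound[OF M order_refl] u0 s[of M] by (auto simp: H_def)
  then have "s M - (s M - u) \<in> H" by (rule H_rules(4)[OF s])
  moreover have "s M - (s M - u) = u" by (rule ext) simp
  ultimately have "u \<in> H" by simp
  moreover have "(\<lambda>n. hn (s n - u)) \<longlonglongrightarrow> 0"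
  proof (rule LIMSEQ_I)
    fix r :: real assume r: "r > 0"
    then obtain M where M: "\<forall>i\<ge>M. \<forall>j\<ge>M. hn (s i - s j) < r / 2" using * half_gt_zero by blast
    have "norm (hn (s n - u) - 0) < r" if "n \<ge> M" for n
      using hn_le[OF bound[OF M that]] hn_nonneg[OF H_rules(4)[OF s \<open>u \<in> H\<close>], of n] r by simp
    then show "\<exists>N. \<forall>n\<ge>N. norm (hn (s n - u) - 0) < r" by blast
  qed
  ultimately show "\<exists>l\<in>H. (\<lambda>n. hn (s n - l)) \<longlonglongrightarrow> 0" by blast
qed

lemma H_hilbert_space: "hilbert_space H hip"
  unfolding hilbert_space_def
proof (intro conjI ballI allI impI)
  show "complex_subspace H" by (rule H_subspace)
  \<comment> \<open>Bounded evaluations also give definiteness: a null vector vanishes at every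
    point.\<close>
  show "0 < Re (hip v v)" if v: "v \<in> H" "v \<noteq> 0" for v
  proof -
    obtain x where x: "v x \<noteq> 0" using v(2) by (auto simp: fun_eq_iff)
    with v(1) have "x \<in> X" by (auto simp: H_def)
    have "hn v \<noteq> 0" using evaluation_bound[OF v(1) \<open>x \<in> X\<close>] x by auto
    then show ?thesis using hn_nonneg[OF v(1)] hip_norm[OF v(1)] Hs.nrm_sq[OF v(1)]
      by (metis zero_less_power2)
  qed
  show "complete_on H (ip_norm hip)"
    using H_complete H_rules(4) unfolding complete_on_def by (simp add: hip_norm cong: conj_cong)
qed (auto simp: Hs.ip_add_left Hs.ip_scale_left intro: Hs.ip_herm)

end

subsection \<open>The convolution algebra\<close>

definition l1_norm :: "('a, 'm) monoid_scheme \<Rightarrow> ('a \<Rightarrow> complex) \<Rightarrow> real" where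
  "l1_norm G f = (\<Sum>\<^sub>\<infinity>x\<in>carrier G. cmod (f x))"

lemma l1_norm_nonneg: "0 \<le> l1_norm G f"
  by (simp add: l1_norm_def infsum_nonneg)

lemma ell1_cmod_le:
  assumes "f \<in> ell1 G" "x \<in> carrier G"
  shows "cmod (f x) \<le> l1_norm G f"
  using finite_sum_le_infsum[of "\<lambda>x. cmod (f x)" "carrier G" "{x}"] assms
  by (simp add: ell1_def l1_norm_def)

lemma ell1_subspace: "complex_subspace (ell1 G)"
proof -
  have "u + v \<in> ell1 G" if "u \<in> ell1 G" "v \<in> ell1 G" for u v
  proof -
    have "(\<lambda>x. cmod (u x) + cmod (v x)) summable_on carrier G"
      using that by (intro summable_on_add) (auto simp: ell1_def)
    then have "(\<lambda>x. cmod (u x + v x)) summable_on carrier G"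
      by (rule summable_on_comparison_test) (auto simp: norm_triangle_ineq)
    then show ?thesis using that complex_subspaceD(2)[OF functions_on_subspace, of u G v]
      by (simp add: ell1_def)
  qed
  moreover have "fscale c v \<in> ell1 G" if "v \<in> ell1 G" for c v
    using that complex_subspaceD(3)[OF functions_on_subspace, of v G c]
    by (simp add: ell1_def fscale_apply norm_mult summable_on_cmult_right)
  ultimately show ?thesis
    by (auto simp: complex_subspace_def ell1_def functions_on_def)
qed

lemmas ell1_rules = complex_subspaceD[OF ell1_subspace]

lemma ell1_mult_bounded:
  assumes f: "f \<in> ell1 G" and w: "\<And>x. x \<in> carrier G \<Longrightarrow> cmod (w x) \<le> M"
  shows "(\<lambda>x. norm (f x * w x)) summable_on carrier G"
    and "cmod (\<Sum>\<^sub>\<infinity>x\<in>carrier G. f x * w x) \<le> l1_norm G f * M"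
proof -
  have sM: "(\<lambda>x. cmod (f x) * M) summable_on carrier G"
    using f by (intro summable_on_cmult_left) (simp add: ell1_def)
  have le: "cmod (f x * w x) \<le> cmod (f x) * M" if "x \<in> carrier G" for x
    using w[OF that] by (simp add: norm_mult mult_left_mono)
  show s: "(\<lambda>x. norm (f x * w x)) summable_on carrier G"
    by (rule summable_on_comparison_test[OF sM]) (use le in auto)
  have "cmod (\<Sum>\<^sub>\<infinity>x\<in>carrier G. f x * w x) \<le> (\<Sum>\<^sub>\<infinity>x\<in>carrier G. cmod (f x * w x))"
    by (rule norm_infsum_bound[OF s])
  also have "\<dots> \<le> (\<Sum>\<^sub>\<infinity>x\<in>carrier G. cmod (f x) * M)"
    by (rule infsum_mono[OF s sM le])
  also have "\<dots> = l1_norm G f * M"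
    unfolding l1_norm_def by (rule infsum_cmult_left) (use f in \<open>auto simp: ell1_def\<close>)
  finally show "cmod (\<Sum>\<^sub>\<infinity>x\<in>carrier G. f x * w x) \<le> l1_norm G f * M" .
qed

lemma delta_infsum:
  assumes "x \<in> A"
  shows "(\<Sum>\<^sub>\<infinity>y\<in>A. delta x y * F y) = F x"
proof -
  have "(\<Sum>\<^sub>\<infinity>y\<in>A. delta x y * F y) = (\<Sum>\<^sub>\<infinity>y\<in>{x}. delta x y * F y)"
    by (rule infsum_cong_neutral) (use assms in \<open>auto simp: delta_def\<close>)
  then show ?thesis by (simp add: delta_def)
qed

lemma fin_supp_ell1:
  assumes "c \<in> fin_supp (carrier G)"
  shows "c \<in> ell1 G"
proof -
  have "(\<lambda>x. cmod (c x)) summable_on carrier G"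
    by (rule finite_nonzero_values_imp_summable_on)
      (use assms in \<open>auto simp: fin_supp_def elim: rev_finite_subset\<close>)
  then show ?thesis using assms by (auto simp: ell1_def functions_on_def fin_supp_def)
qed

lemma infsum_fin_supp:
  assumes "c \<in> fin_supp A"
  shows "(\<Sum>\<^sub>\<infinity>x\<in>A. c x * F x) = pairing c F"
proof -
  have "(\<Sum>\<^sub>\<infinity>x\<in>A. c x * F x) = (\<Sum>\<^sub>\<infinity>x\<in>{x. c x \<noteq> 0}. c x * F x)"
    by (rule infsum_cong_neutral) (use assms in \<open>auto simp: fin_supp_def\<close>)
  then show ?thesis using assms by (simp add: pairing_def fin_supp_def)
qed

context group
begin

lemma bij_betw_mult_left: "g \<in> carrier G \<Longrightarrow> bij_betw (\<lambda>x. g \<otimes> x) (carrier G) (carrier G)"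
  by (rule bij_betwI[where g = "\<lambda>x. inv g \<otimes> x"]) (auto simp: m_assoc[symmetric])

lemma bij_betw_inv: "bij_betw (\<lambda>x. inv x) (carrier G) (carrier G)"
  by (rule bij_betwI[where g = "\<lambda>x. inv x"]) auto

lemma delta_ell1: "x \<in> carrier G \<Longrightarrow> delta x \<in> ell1 G"
  by (intro fin_supp_ell1 delta_mem)

lemma l1_norm_delta: "x \<in> carrier G \<Longrightarrow> l1_norm G (delta x) = 1"
proof -
  assume x: "x \<in> carrier G"
  have "l1_norm G (delta x) = (\<Sum>\<^sub>\<infinity>y\<in>{x}. cmod (delta x y))"
    unfolding l1_norm_def by (rule infsum_cong_neutral) (use x in \<open>auto simp: delta_def\<close>)
  then show ?thesis by (simp add: delta_def)
qed

text \<open>The bounded weight \<open>w\<close> serves two ends: \<open>w = 1\<close> gives the norm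
  estimate for convolutions, a translate of a bounded function gives
  \<open>convolution_assoc\<close>.\<close>

lemma convolution_double_summable:
  assumes f: "f \<in> ell1 G" and g: "g \<in> ell1 G" and w: "\<And>x. x \<in> carrier G \<Longrightarrow> cmod (w x) \<le> M"
  shows "(\<lambda>(y, x). norm (f y * g (inv y \<otimes> x) * w x)) summable_on (carrier G \<times> carrier G)"
proof -
  have trans: "(\<lambda>x. cmod (g (inv y \<otimes> x))) summable_on carrier G"
    "(\<Sum>\<^sub>\<infinity>x\<in>carrier G. cmod (g (inv y \<otimes> x))) = l1_norm G g" if "y \<in> carrier G" for y
    using summable_on_reindex_bij_betw[OF bij_betw_mult_left[of "inv y"], of "\<lambda>x. cmod (g x)"]
      infsum_reindex_bij_betw[OF bij_betw_mult_left[of "inv y"], of "\<lambda>x. cmod (g x)"] g that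
    by (simp_all add: l1_norm_def ell1_def)
  have "(\<lambda>yx. norm (case yx of (y, x) \<Rightarrow> f y * g (inv y \<otimes> x))) summable_on (carrier G \<times> carrier G)"
    unfolding Infinite_Sum.abs_summable_on_Sigma_iff
  proof (intro conjI ballI)
    fix y assume y: "y \<in> carrier G"
    show "(\<lambda>x. norm (case (y, x) of (y, x) \<Rightarrow> f y * g (inv y \<otimes> x))) summable_on carrier G"
      using trans(1)[OF y] by (simp add: norm_mult summable_on_cmult_right)
  next
    have "(\<lambda>y. cmod (f y) * l1_norm G g) summable_on carrier G"
      using f by (intro summable_on_cmult_left) (simp add: ell1_def)
    then have "(\<lambda>y. (\<Sum>\<^sub>\<infinity>x\<in>carrier G. cmod (case (y, x) of (y, x) \<Rightarrow> f y * g (inv y \<otimes> x)))) summable_on carrier G"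
      by (rule summable_on_cong[THEN iffD1, rotated])
        (simp add: norm_mult infsum_cmult_right' trans)
    then show "(\<lambda>y. norm (\<Sum>\<^sub>\<infinity>x\<in>carrier G. norm (case (y, x) of (y, x) \<Rightarrow> f y * g (inv y \<otimes> x)))) summable_on carrier G"
      by (simp add: infsum_nonneg)
  qed
  then have sum: "(\<lambda>yx. norm (complex_of_real M * (case yx of (y, x) \<Rightarrow> f y * g (inv y \<otimes> x)))) summable_on (carrier G \<times> carrier G)"
    unfolding norm_mult by (rule summable_on_cmult_right)
  have "(\<lambda>yx. norm (case yx of (y, x) \<Rightarrow> f y * g (inv y \<otimes> x) * w x)) summable_on (carrier G \<times> carrier G)"
  proof (rule Infinite_Sum.abs_summable_on_comparison_test[OF sum])
    fix yx assume "yx \<in> carrier G \<times> carrier G"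
    then obtain y x where yx: "yx = (y, x)" "x \<in> carrier G" by blast
    have "cmod (w x) \<le> \<bar>M\<bar>" using w[OF yx(2)] by linarith
    then show "norm (case yx of (y, x) \<Rightarrow> f y * g (inv y \<otimes> x) * w x)
        \<le> norm (complex_of_real M * (case yx of (y, x) \<Rightarrow> f y * g (inv y \<otimes> x)))"
      unfolding yx(1) by (simp add: norm_mult mult_right_mono mult.commute)
  qed
  then show ?thesis by (simp add: case_prod_unfold)
qed

lemma convolution_double_summable':
  assumes "f \<in> ell1 G" "g \<in> ell1 G" "\<And>x. x \<in> carrier G \<Longrightarrow> cmod (w x) \<le> M"
  shows "(\<lambda>(x, y). norm (f y * g (inv y \<otimes> x) * w x)) summable_on (carrier G \<times> carrier G)"
  using convolution_double_summable[OF assms] by (subst summable_on_swap) (simp add: case_prod_unfold)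

lemma convolution_ell1:
  assumes f: "f \<in> ell1 G" and g: "g \<in> ell1 G"
  shows "convolution G f g \<in> ell1 G" "l1_norm G (convolution G f g) \<le> l1_norm G f * l1_norm G g"
proof -
  let ?F = "\<lambda>x y. f y * g (inv y \<otimes> x)"
  have s: "(\<lambda>(x, y). norm (?F x y)) summable_on (carrier G \<times> carrier G)"
    using convolution_double_summable'[OF f g, of "\<lambda>_. 1" 1] by simp
  then have "(\<lambda>xy. norm (case xy of (x, y) \<Rightarrow> ?F x y)) summable_on (carrier G \<times> carrier G)"
    by (simp add: case_prod_unfold)
  then have s1: "\<And>x. x \<in> carrier G \<Longrightarrow> (\<lambda>y. norm (?F x y)) summable_on carrier G"
    and s2: "(\<lambda>x. \<Sum>\<^sub>\<infinity>y\<in>carrier G. norm (?F x y)) summable_on carrier G"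
    unfolding Infinite_Sum.abs_summable_on_Sigma_iff by (auto simp: infsum_nonneg)
  have le: "cmod (convolution G f g x) \<le> (\<Sum>\<^sub>\<infinity>y\<in>carrier G. norm (?F x y))" if "x \<in> carrier G" for x
    using norm_infsum_bound[OF s1[OF that]] that by (simp add: convolution_def)
  have c: "(\<lambda>x. cmod (convolution G f g x)) summable_on carrier G"
    by (rule summable_on_comparison_test[OF s2]) (use le in auto)
  then show "convolution G f g \<in> ell1 G"
    by (simp add: ell1_def functions_on_def convolution_def)
  have "l1_norm G (convolution G f g) \<le> (\<Sum>\<^sub>\<infinity>x\<in>carrier G. \<Sum>\<^sub>\<infinity>y\<in>carrier G. norm (?F x y))"
    unfolding l1_norm_def by (rule infsum_mono[OF c s2 le])
  also have "\<dots> = (\<Sum>\<^sub>\<infinity>y\<in>carrier G. \<Sum>\<^sub>\<infinity>x\<in>carrier G. norm (?F x y))"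
    by (rule infsum_swap_banach[OF s])
  also have "\<dots> = (\<Sum>\<^sub>\<infinity>y\<in>carrier G. cmod (f y) * l1_norm G g)"
  proof (rule infsum_cong)
    fix y assume y: "y \<in> carrier G"
    then show "(\<Sum>\<^sub>\<infinity>x\<in>carrier G. norm (?F x y)) = cmod (f y) * l1_norm G g"
      using infsum_reindex_bij_betw[OF bij_betw_mult_left[of "inv y"], of "\<lambda>x. cmod (g x)"]
      by (simp add: norm_mult infsum_cmult_right' l1_norm_def)
  qed
  also have "\<dots> = l1_norm G f * l1_norm G g"
    by (simp add: infsum_cmult_left' l1_norm_def)
  finally show "l1_norm G (convolution G f g) \<le> l1_norm G f * l1_norm G g" .
qed

lemma convolution_sum:
  assumes f: "f \<in> ell1 G" and g: "g \<in> ell1 G" and w: "\<And>x. x \<in> carrier G \<Longrightarrow> cmod (w x) \<le> M"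
  shows "(\<Sum>\<^sub>\<infinity>x\<in>carrier G. convolution G f g x * w x)
       = (\<Sum>\<^sub>\<infinity>y\<in>carrier G. f y * (\<Sum>\<^sub>\<infinity>x\<in>carrier G. g x * w (y \<otimes> x)))"
proof -
  have "(\<Sum>\<^sub>\<infinity>x\<in>carrier G. convolution G f g x * w x)
      = (\<Sum>\<^sub>\<infinity>x\<in>carrier G. \<Sum>\<^sub>\<infinity>y\<in>carrier G. f y * g (inv y \<otimes> x) * w x)"
    by (intro infsum_cong) (simp add: convolution_def infsum_cmult_left')
  also have "\<dots> = (\<Sum>\<^sub>\<infinity>y\<in>carrier G. \<Sum>\<^sub>\<infinity>x\<in>carrier G. f y * g (inv y \<otimes> x) * w x)"
  proof (rule infsum_swap_banach, rule abs_summable_summable)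
    show "(\<lambda>xy. norm (case xy of (x, y) \<Rightarrow> f y * g (inv y \<otimes> x) * w x)) summable_on carrier G \<times> carrier G"
      using convolution_double_summable'[OF f g w] by (simp add: case_prod_unfold)
  qed
  also have "\<dots> = (\<Sum>\<^sub>\<infinity>y\<in>carrier G. f y * (\<Sum>\<^sub>\<infinity>x\<in>carrier G. g x * w (y \<otimes> x)))"
  proof (rule infsum_cong)
    fix y assume y: "y \<in> carrier G"
    have "(\<Sum>\<^sub>\<infinity>x\<in>carrier G. g (inv y \<otimes> x) * w x)
        = (\<Sum>\<^sub>\<infinity>x\<in>carrier G. g (inv y \<otimes> (y \<otimes> x)) * w (y \<otimes> x))"
      by (rule infsum_reindex_bij_betw[OF bij_betw_mult_left[OF y], symmetric])
    also have "\<dots> = (\<Sum>\<^sub>\<infinity>x\<in>carrier G. g x * w (y \<otimes> x))"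
      by (rule infsum_cong) (use y in \<open>simp add: m_assoc[symmetric]\<close>)
    finally show "(\<Sum>\<^sub>\<infinity>x\<in>carrier G. f y * g (inv y \<otimes> x) * w x)
        = f y * (\<Sum>\<^sub>\<infinity>x\<in>carrier G. g x * w (y \<otimes> x))"
      by (simp add: infsum_cmult_right' mult.assoc)
  qed
  finally show ?thesis .
qed

text \<open>The last factor is only assumed bounded because it will be a vector of a Hilbert space
  of functions on \<open>G\<close>, not an element of \<open>ell1 G\<close>.\<close>

lemma convolution_assoc:
  assumes f: "f \<in> ell1 G" and g: "g \<in> ell1 G" and u: "\<And>x. x \<in> carrier G \<Longrightarrow> cmod (u x) \<le> M"
  shows "convolution G (convolution G f g) u = convolution G f (convolution G g u)"
proof
  fix x
  show "convolution G (convolution G f g) u x = convolution G f (convolution G g u) x"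
  proof (cases "x \<in> carrier G")
    case True
    have "convolution G (convolution G f g) u x
        = (\<Sum>\<^sub>\<infinity>y\<in>carrier G. f y * (\<Sum>\<^sub>\<infinity>z\<in>carrier G. g z * u (inv (y \<otimes> z) \<otimes> x)))"
      using True convolution_sum[OF f g, of "\<lambda>z. u (inv z \<otimes> x)" M] u by (simp add: convolution_def)
    also have "\<dots> = convolution G f (convolution G g u) x"
      unfolding convolution_def using True
      by (auto intro!: infsum_cong simp: inv_mult_group m_assoc)
    finally show ?thesis .
  qed (simp add: convolution_def)
qed

lemma convolution_delta: "g \<in> carrier G \<Longrightarrow> convolution G (delta g) u = left_translate G (inv g) u"
  by (rule ext) (simp add: convolution_def left_translate_def delta_infsum)

lemma convolution_delta_one: "u \<in> functions_on G \<Longrightarrow> convolution G (delta \<one>) u = u"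
  by (rule ext) (simp add: convolution_delta left_translate_def functions_on_def)

lemma convolution_delta_delta:
  "x \<in> carrier G \<Longrightarrow> y \<in> carrier G \<Longrightarrow> convolution G (delta x) (delta y) = delta (x \<otimes> y)"
  unfolding convolution_delta
  by (rule ext) (auto simp: left_translate_def delta_def inv_solve_left' m_assoc[symmetric])

lemma involution_delta: "x \<in> carrier G \<Longrightarrow> involution G (delta x) = delta (inv x)"
  by (rule ext) (auto simp: involution_def delta_def)

lemma involution_ell1:
  assumes "f \<in> ell1 G"
  shows "involution G f \<in> ell1 G" "l1_norm G (involution G f) = l1_norm G f"
proof -
  have eq: "(\<lambda>x. cmod (involution G f x)) summable_on carrier G
      \<longleftrightarrow> (\<lambda>x. cmod (f (inv x))) summable_on carrier G"
    by (rule summable_on_cong) (simp add: involution_def)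
  then show "involution G f \<in> ell1 G"
    using assms summable_on_reindex_bij_betw[OF bij_betw_inv, of "\<lambda>x. cmod (f x)"]
    by (simp add: ell1_def functions_on_def involution_def)
  have "l1_norm G (involution G f) = (\<Sum>\<^sub>\<infinity>x\<in>carrier G. cmod (f (inv x)))"
    unfolding l1_norm_def by (rule infsum_cong) (simp add: involution_def)
  then show "l1_norm G (involution G f) = l1_norm G f"
    using infsum_reindex_bij_betw[OF bij_betw_inv, of "\<lambda>x. cmod (f x)"] by (simp add: l1_norm_def)
qed

lemma involution_involution: "f \<in> functions_on G \<Longrightarrow> involution G (involution G f) = f"
  by (rule ext) (auto simp: involution_def functions_on_def)

text \<open>Neumann series: \<open>g = \<Sum>\<^sub>n a\<^sup>n / M\<^sup>n\<^sup>+\<^sup>1\<close> inverts \<open>M - a\<close>.\<close>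

lemma Neumann_series:
  assumes a: "a \<in> ell1 G" and M: "l1_norm G a < M"
  obtains g where "g \<in> ell1 G" "fscale (of_real M) g - convolution G g a = delta \<one>"
proof -
  \<comment> \<open>\<open>P n\<close> is the n-th convolution power of \<open>a\<close>;
    \<open>Q n\<close> below is the n-th term of the series.\<close>
  define P where "P n = ((\<lambda>f. convolution G f a) ^^ n) (delta \<one>)" for n
  have P0: "P 0 = delta \<one>" and PS: "\<And>n. P (Suc n) = convolution G (P n) a"
    by (simp_all add: P_def)
  have M0: "M > 0" using M l1_norm_nonneg[of G a] by linarith
  have P: "P n \<in> ell1 G \<and> l1_norm G (P n) \<le> l1_norm G a ^ n" for n
  proof (induction n)
    case 0
    then show ?case by (simp add: P0 delta_ell1 l1_norm_delta)
  next
    case (Suc n)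
    then have "l1_norm G (P (Suc n)) \<le> l1_norm G (P n) * l1_norm G a"
      unfolding PS by (intro convolution_ell1 a) simp
    also have "\<dots> \<le> l1_norm G a ^ n * l1_norm G a"
      using Suc by (intro mult_right_mono) (auto simp: l1_norm_nonneg)
    finally show ?case using Suc convolution_ell1(1)[OF _ a] by (simp add: PS mult.commute)
  qed
  define Q where "Q n x = P n x / of_real (M ^ Suc n)" for n x
  have Q_norm: "cmod (Q n x) = cmod (P n x) * (1 / M ^ Suc n)" for n x
    using M0 by (simp add: Q_def norm_divide norm_mult norm_power)
  have Q_sum: "(\<lambda>x. norm (Q n x)) summable_on carrier G"
    "(\<Sum>\<^sub>\<infinity>x\<in>carrier G. norm (Q n x)) = l1_norm G (P n) * (1 / M ^ Suc n)" for n
    unfolding Q_norm using P[of n] summable_on_cmult_left[of "\<lambda>x. cmod (P n x)" "carrier G" "1 / M ^ Suc n"]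
    by (auto simp only: ell1_def l1_norm_def infsum_cmult_left' mem_Collect_eq)
  have geo: "(\<lambda>n. (1 / M) * (l1_norm G a / M) ^ n) summable_on (UNIV :: nat set)"
  proof -
    have "summable (\<lambda>n. (1 / M) * (l1_norm G a / M) ^ n)"
      using M M0 l1_norm_nonneg[of G a] by (intro summable_mult summable_geometric) simp
    then show ?thesis
      using M0 l1_norm_nonneg[of G a] by (subst summable_on_UNIV_nonneg_real_iff) auto
  qed
  \<comment> \<open>Absolute summability over pairs of \<open>n\<close> and \<open>x\<close> both
    puts \<open>g\<close> into \<open>ell1 G\<close> and lets the convolution pass under the
    sum.\<close>
  have Q_double: "(\<lambda>nx. norm (case nx of (n, x) \<Rightarrow> Q n x)) summable_on (UNIV \<times> carrier G)"
    unfolding Infinite_Sum.abs_summable_on_Sigma_iff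
  proof (intro conjI ballI)
    show "(\<lambda>x. norm (case (n, x) of (n, x) \<Rightarrow> Q n x)) summable_on carrier G" for n
      using Q_sum by simp
    have "(\<lambda>n. \<Sum>\<^sub>\<infinity>x\<in>carrier G. norm (Q n x)) summable_on UNIV"
    proof (rule summable_on_comparison_test[OF geo])
      fix n :: nat
      have "l1_norm G (P n) * (1 / M ^ Suc n) \<le> l1_norm G a ^ n * (1 / M ^ Suc n)"
        using P[of n] M0 by (intro mult_right_mono) auto
      then show "(\<Sum>\<^sub>\<infinity>x\<in>carrier G. norm (Q n x)) \<le> (1 / M) * (l1_norm G a / M) ^ n"
        by (simp add: Q_sum power_divide mult.commute)
    qed (simp add: infsum_nonneg)
    then show "(\<lambda>n. norm (\<Sum>\<^sub>\<infinity>x\<in>carrier G. norm (case (n, x) of (n, x) \<Rightarrow> Q n x))) summable_on UNIV"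
      by (simp add: infsum_nonneg)
  qed
  then have Q_double': "(\<lambda>xn. norm (case xn of (x, n) \<Rightarrow> Q n x)) summable_on (carrier G \<times> UNIV)"
    by (subst summable_on_swap) (simp add: case_prod_unfold)
  then have Qx: "(\<lambda>n. norm (Q n x)) summable_on UNIV" if "x \<in> carrier G" for x
    using that unfolding Infinite_Sum.abs_summable_on_Sigma_iff by simp
  define g where "g x = (if x \<in> carrier G then \<Sum>\<^sub>\<infinity>n. Q n x else 0)" for x
  have "(\<lambda>x. \<Sum>\<^sub>\<infinity>n. norm (Q n x)) summable_on carrier G"
    using Q_double' unfolding Infinite_Sum.abs_summable_on_Sigma_iff by (simp add: infsum_nonneg)
  then have "(\<lambda>x. norm (g x)) summable_on carrier G"
    by (rule summable_on_comparison_test) (auto simp: g_def intro!: norm_infsum_bound Qx)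
  then have g: "g \<in> ell1 G" by (simp add: ell1_def functions_on_def g_def)
  have "fscale (of_real M) g - convolution G g a = delta \<one>"
  proof
    fix x
    show "(fscale (of_real M) g - convolution G g a) x = delta \<one> x"
    proof (cases "x \<in> carrier G")
      case x: True
      let ?w = "\<lambda>y. a (inv y \<otimes> x)"
      have w: "cmod (?w y) \<le> l1_norm G a" if "y \<in> carrier G" for y
        using ell1_cmod_le[OF a] that x by simp
      have "convolution G g a x = (\<Sum>\<^sub>\<infinity>y\<in>carrier G. (\<Sum>\<^sub>\<infinity>n. Q n y * ?w y))"
        using x unfolding convolution_def by (auto simp: g_def infsum_cmult_left' intro!: infsum_cong)
      also have "\<dots> = (\<Sum>\<^sub>\<infinity>n. \<Sum>\<^sub>\<infinity>y\<in>carrier G. Q n y * ?w y)"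
      proof (rule infsum_swap_banach, rule abs_summable_summable)
        have "(\<lambda>yn. norm (complex_of_real (l1_norm G a) * (case yn of (y, n) \<Rightarrow> Q n y))) summable_on (carrier G \<times> UNIV)"
          unfolding norm_mult using Q_double' by (rule summable_on_cmult_right)
        then show "(\<lambda>yn. norm (case yn of (y, n) \<Rightarrow> Q n y * ?w y)) summable_on (carrier G \<times> UNIV)"
        proof (rule Infinite_Sum.abs_summable_on_comparison_test)
          fix yn :: "'a \<times> nat" assume "yn \<in> carrier G \<times> UNIV"
          then obtain y n where yn: "yn = (y, n)" "y \<in> carrier G" by blast
          show "norm (case yn of (y, n) \<Rightarrow> Q n y * ?w y)
            \<le> norm (complex_of_real (l1_norm G a) * (case yn of (y, n) \<Rightarrow> Q n y))"
            unfolding yn(1) using w[OF yn(2)]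
            by (simp add: norm_mult l1_norm_nonneg)
              (metis mult.commute mult_left_mono norm_ge_zero)
        qed
      qed
      also have "\<dots> = (\<Sum>\<^sub>\<infinity>n. P (Suc n) x / of_real (M ^ Suc n))"
      proof (rule infsum_cong)
        fix n
        have "(\<Sum>\<^sub>\<infinity>y\<in>carrier G. Q n y * ?w y) = (\<Sum>\<^sub>\<infinity>y\<in>carrier G. (1 / of_real (M ^ Suc n)) * (P n y * ?w y))"
          by (simp add: Q_def)
        also have "\<dots> = (1 / of_real (M ^ Suc n)) * convolution G (P n) a x"
          unfolding infsum_cmult_right' using x by (simp add: convolution_def)
        finally show "(\<Sum>\<^sub>\<infinity>y\<in>carrier G. Q n y * ?w y) = P (Suc n) x / of_real (M ^ Suc n)"
          by (simp add: PS)
      qed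
      finally have conv: "convolution G g a x = (\<Sum>\<^sub>\<infinity>n. P (Suc n) x / of_real (M ^ Suc n))" .
      \<comment> \<open>Up to this normalization, \<open>M\<close> times \<open>g\<close> sums all
        \<open>?R n\<close> and the convolution of \<open>g\<close> with \<open>a\<close> sums all
        \<open>?R (Suc n)\<close>; the difference leaves \<open>?R 0\<close>, which is
        \<open>delta \<one> x\<close>.\<close>
      let ?R = "\<lambda>n. P n x / of_real (M ^ n)"
      have R: "?R n = of_real M * Q n x" for n using M0 by (simp add: Q_def)
      have sR: "(\<lambda>n. norm (?R n)) summable_on UNIV"
        unfolding R norm_mult using Qx[OF x] by (rule summable_on_cmult_right)
      then have sR': "?R summable_on UNIV" by (rule abs_summable_summable)
      have "(\<Sum>\<^sub>\<infinity>n. ?R n) = of_real M * g x"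
        unfolding R using x by (simp add: g_def infsum_cmult_right')
      moreover have "(\<Sum>\<^sub>\<infinity>n. ?R n) = P 0 x + (\<Sum>\<^sub>\<infinity>n. ?R (Suc n))"
      proof -
        have sums: "?R sums (\<Sum>\<^sub>\<infinity>n. ?R n)"
          by (rule has_sum_imp_sums) (use sR' in simp)
        have "(\<lambda>n. ?R (Suc n)) summable_on UNIV"
          using summable_on_subset_banach[OF sR', of "range Suc"] summable_on_reindex[of Suc UNIV ?R]
          by (simp add: o_def)
        then have "(\<lambda>n. ?R (Suc n)) sums (\<Sum>\<^sub>\<infinity>n. ?R (Suc n))"
          by (intro has_sum_imp_sums) simp
        then have "?R sums ((\<Sum>\<^sub>\<infinity>n. ?R (Suc n)) + ?R 0)"
          by (rule sums_Suc)
        then have "(\<Sum>\<^sub>\<infinity>n. ?R n) = (\<Sum>\<^sub>\<infinity>n. ?R (Suc n)) + ?R 0"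
          by (rule sums_unique2[OF sums])
        then show ?thesis by (simp only: power_0 of_real_1 div_by_1 add.commute)
      qed
      ultimately show ?thesis by (simp add: conv P0 fscale_apply)
    next
      case False
      then show ?thesis by (auto simp: fscale_apply g_def convolution_def delta_def)
    qed
  qed
  with g show thesis by (rule that)
qed

end

subsection \<open>Star representations\<close>

locale star_rep = group G for G (structure) +
  fixes V :: "('b \<Rightarrow> complex) set" and ip and \<pi>
  assumes rep: "nondegenerate_star_rep G V ip \<pi>"
begin

lemma hilbert: "hilbert_space V ip"
  using rep by (simp add: nondegenerate_star_rep_def)

sublocale semi_ip V ip
  by (rule hilbert_space_imp_semi_ip) (rule hilbert)

lemma nrm_eq_0: "v \<in> V \<Longrightarrow> nrm v = 0 \<Longrightarrow> v = 0"
proof (rule ccontr)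
  assume "v \<in> V" "nrm v = 0" "v \<noteq> 0"
  moreover from this have "Re (ip v v) > 0" using hilbert unfolding hilbert_space_def by blast
  ultimately show False by (simp add: ip_norm_def)
qed

lemma rep_bounded: "f \<in> ell1 G \<Longrightarrow> bounded_operator V ip (\<pi> f)"
  using rep by (simp add: nondegenerate_star_rep_def)

lemma rep_closed: "f \<in> ell1 G \<Longrightarrow> v \<in> V \<Longrightarrow> \<pi> f v \<in> V"
  using rep_bounded by (simp add: bounded_operator_def)

lemma op_add: "f \<in> ell1 G \<Longrightarrow> u \<in> V \<Longrightarrow> v \<in> V \<Longrightarrow> \<pi> f (u + v) = \<pi> f u + \<pi> f v"
  using rep_bounded by (simp add: bounded_operator_def)

lemma op_scale: "f \<in> ell1 G \<Longrightarrow> v \<in> V \<Longrightarrow> \<pi> f (fscale c v) = fscale c (\<pi> f v)"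
  using rep_bounded by (simp add: bounded_operator_def)

lemma op_diff: "f \<in> ell1 G \<Longrightarrow> u \<in> V \<Longrightarrow> v \<in> V \<Longrightarrow> \<pi> f (u - v) = \<pi> f u - \<pi> f v"
  unfolding diff_conv by (simp only: op_add op_scale mem_rules)

lemma op_zero: "f \<in> ell1 G \<Longrightarrow> \<pi> f 0 = 0"
  using op_scale[of f 0 0] mem_rules(1) by (simp add: fscale_algebra)

lemma op_sum:
  "f \<in> ell1 G \<Longrightarrow> (\<And>i. i \<in> A \<Longrightarrow> w i \<in> V) \<Longrightarrow> \<pi> f (\<Sum>i\<in>A. w i) = (\<Sum>i\<in>A. \<pi> f (w i))"
proof (induction A rule: infinite_finite_induct)
  case (insert x A)
  then show ?case using op_add[of f "w x" "sum w A"] mem_rules(5)[of A w]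
    by (simp only: sum.insert insert_iff simp_thms)
qed (simp_all add: op_zero)

lemma op_bound:
  assumes "f \<in> ell1 G"
  obtains C where "C \<ge> 0" "\<And>v. v \<in> V \<Longrightarrow> nrm (\<pi> f v) \<le> C * nrm v"
proof -
  obtain C where C: "\<And>v. v \<in> V \<Longrightarrow> nrm (\<pi> f v) \<le> C * nrm v"
    using rep_bounded[OF assms] unfolding bounded_operator_def by blast
  have "nrm (\<pi> f v) \<le> \<bar>C\<bar> * nrm v" if "v \<in> V" for v
    using C[OF that] nrm_nonneg[OF that] by (meson abs_ge_self mult_right_mono order_trans)
  then show thesis using that[of "\<bar>C\<bar>"] by simp
qed

lemma rep_add: "f \<in> ell1 G \<Longrightarrow> g \<in> ell1 G \<Longrightarrow> v \<in> V \<Longrightarrow> \<pi> (f + g) v = \<pi> f v + \<pi> g v"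
  using rep unfolding nondegenerate_star_rep_def by blast

lemma rep_scale: "f \<in> ell1 G \<Longrightarrow> v \<in> V \<Longrightarrow> \<pi> (fscale c f) v = fscale c (\<pi> f v)"
  using rep unfolding nondegenerate_star_rep_def by blast

lemma rep_zero: "v \<in> V \<Longrightarrow> \<pi> 0 v = 0"
  using rep_scale[of 0 v 0] ell1_rules(1)[of G] by (simp add: fscale_algebra)

lemma rep_diff: "f \<in> ell1 G \<Longrightarrow> g \<in> ell1 G \<Longrightarrow> v \<in> V \<Longrightarrow> \<pi> (f - g) v = \<pi> f v - \<pi> g v"
proof -
  assume *: "f \<in> ell1 G" "g \<in> ell1 G" "v \<in> V"
  have "f - g = f + fscale (-1) g" by (rule ext) (simp add: fscale_apply)
  then show ?thesis using * unfolding diff_conv[of "\<pi> f v"] by (simp only: rep_add rep_scale ell1_rules)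
qed

lemma rep_sum:
  "(\<And>i. i \<in> A \<Longrightarrow> f i \<in> ell1 G) \<Longrightarrow> v \<in> V \<Longrightarrow> \<pi> (\<Sum>i\<in>A. f i) v = (\<Sum>i\<in>A. \<pi> (f i) v)"
proof (induction A rule: infinite_finite_induct)
  case (insert x A)
  then show ?case using rep_add[of "f x" "sum f A" v] ell1_rules(5)[of A f G]
    by (simp only: sum.insert insert_iff simp_thms)
qed (simp_all add: rep_zero)

lemma rep_conv: "f \<in> ell1 G \<Longrightarrow> g \<in> ell1 G \<Longrightarrow> v \<in> V \<Longrightarrow> \<pi> (convolution G f g) v = \<pi> f (\<pi> g v)"
  using rep unfolding nondegenerate_star_rep_def by blast

lemma rep_adj: "f \<in> ell1 G \<Longrightarrow> u \<in> V \<Longrightarrow> v \<in> V \<Longrightarrow> ip (\<pi> f u) v = ip u (\<pi> (involution G f) v)"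
  using rep unfolding nondegenerate_star_rep_def by blast

text \<open>\<open>delta \<one>\<close> fixes every vector \<open>\<pi> f w\<close>, and by
  non-degeneracy finite sums of these come arbitrarily close to \<open>v\<close>; boundedness of the
  operator controls the remainder.\<close>

lemma rep_one:
  assumes v: "v \<in> V"
  shows "\<pi> (delta \<one>) v = v"
proof -
  note d = delta_ell1[OF one_closed]
  obtain C where C: "C \<ge> 0" "\<And>v. v \<in> V \<Longrightarrow> nrm (\<pi> (delta \<one>) v) \<le> C * nrm v"
    using op_bound[OF d] by blast
  have le: "nrm (\<pi> (delta \<one>) v - v) \<le> (C + 1) * e" if "e > 0" for e
  proof -
    have "\<exists>(k :: nat) f w. (\<forall>i<k. f i \<in> ell1 G \<and> w i \<in> V) \<and> nrm (v - (\<Sum>i<k. \<pi> (f i) (w i))) < e"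
      using rep v that unfolding nondegenerate_star_rep_def by blast
    then obtain k :: nat and f w where
      fw: "\<forall>i<k. f i \<in> ell1 G \<and> w i \<in> V" "nrm (v - (\<Sum>i<k. \<pi> (f i) (w i))) < e" by blast
    define s where "s = (\<Sum>i<k. \<pi> (f i) (w i))"
    have sV: "s \<in> V" unfolding s_def using fw by (intro mem_rules rep_closed) auto
    have "\<pi> (delta \<one>) s = (\<Sum>i<k. \<pi> (delta \<one>) (\<pi> (f i) (w i)))"
      unfolding s_def using fw by (intro op_sum d rep_closed) auto
    also have "\<dots> = s"
      unfolding s_def
    proof (rule sum.cong[OF refl])
      fix i assume "i \<in> {..<k}"
      then have *: "f i \<in> ell1 G" "w i \<in> V" using fw by auto
      have "\<pi> (delta \<one>) (\<pi> (f i) (w i)) = \<pi> (convolution G (delta \<one>) (f i)) (w i)"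
        using rep_conv[OF d *] by simp
      then show "\<pi> (delta \<one>) (\<pi> (f i) (w i)) = \<pi> (f i) (w i)"
        using * by (simp add: convolution_delta_one ell1_def)
    qed
    finally have s: "\<pi> (delta \<one>) s = s" .
    have "\<pi> (delta \<one>) v - v = \<pi> (delta \<one>) (v - s) + (s - v)"
      unfolding op_diff[OF d v sV] s by (rule ext) simp
    then have "nrm (\<pi> (delta \<one>) v - v) \<le> nrm (\<pi> (delta \<one>) (v - s)) + nrm (s - v)"
      using nrm_triangle[of "\<pi> (delta \<one>) (v - s)" "s - v"] v sV d by (simp only: rep_closed mem_rules)
    also have "\<dots> \<le> C * nrm (v - s) + nrm (v - s)"
      using C(2)[of "v - s"] v sV nrm_minus_commute[of s v] by (simp add: mem_rules)
    also have "\<dots> = (C + 1) * nrm (v - s)" by (simp add: algebra_simps)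
    also have "\<dots> \<le> (C + 1) * e" using C(1) fw(2) by (intro mult_left_mono) (auto simp: s_def)
    finally show ?thesis .
  qed
  have "nrm (\<pi> (delta \<one>) v - v) \<le> 0"
  proof (rule field_le_epsilon)
    fix e :: real assume "e > 0"
    then show "nrm (\<pi> (delta \<one>) v - v) \<le> 0 + e"
      using le[of "e / (C + 1)"] C(1) by simp
  qed
  then have "\<pi> (delta \<one>) v - v = 0"
    using v d by (intro nrm_eq_0 antisym nrm_nonneg mem_rules rep_closed)
  then show ?thesis by simp
qed

text \<open>No continuity is part of the definition of a representation: as \<open>\<pi>(h\<^sup>* * h)\<close> is positive, its
  norm \<open>M\<close> is an approximate eigenvalue, whereas \<open>M - h\<^sup>* * h\<close> is invertible in \<open>\<ell>\<^sub>1\<close> once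
  \<open>M > \<parallel>h\<parallel>\<^sub>1\<^sup>2\<close>.\<close>

theorem contractive:
  assumes h: "h \<in> ell1 G" and v: "v \<in> V"
  shows "nrm (\<pi> h v) \<le> l1_norm G h * nrm v"
proof -
  note h' = involution_ell1[OF h]
  \<comment> \<open>\<open>\<pi> a\<close> is a positive operator with
    \<open>ip (\<pi> a u) w = ip (\<pi> h u) (\<pi> h w)\<close>, so \<open>M\<close> below is the
    supremum of its quadratic form on the unit ball.\<close>
  define a where "a = convolution G (involution G h) h"
  have a: "a \<in> ell1 G" "l1_norm G a \<le> (l1_norm G h)\<^sup>2"
    using convolution_ell1[OF h'(1) h] h'(2) by (simp_all add: a_def power2_eq_square)
  have ip_a: "ip (\<pi> a u) w = ip (\<pi> h u) (\<pi> h w)" if "u \<in> V" "w \<in> V" for u w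
    using that h h' by (simp add: a_def rep_conv rep_adj rep_closed involution_involution ell1_def)
  obtain C where C: "C \<ge> 0" "\<And>v. v \<in> V \<Longrightarrow> nrm (\<pi> h v) \<le> C * nrm v"
    using op_bound[OF h] by blast
  define S where "S = {(nrm (\<pi> h v))\<^sup>2 | v. v \<in> V \<and> nrm v \<le> 1}"
  define M where "M = Sup S"
  have bdd: "bdd_above S"
  proof (rule bdd_aboveI)
    fix x assume "x \<in> S"
    then obtain v where v: "x = (nrm (\<pi> h v))\<^sup>2" "v \<in> V" "nrm v \<le> 1" by (auto simp: S_def)
    have "nrm (\<pi> h v) \<le> C * 1" using C(2)[OF v(2)] v(3) C(1) by (meson mult_left_mono order_trans)
    then show "x \<le> C\<^sup>2" unfolding v(1) using nrm_nonneg[OF rep_closed[OF h v(2)]] by (simp add: power_mono)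
  qed
  have "nrm 0 = 0" using mem_rules(1) by (simp add: ip_norm_def ip_zero)
  then have zero_S: "0 \<in> S"
    using mem_rules(1) op_zero[OF h] by (auto simp: S_def intro!: exI[of _ 0])
  have M0: "M \<ge> 0" unfolding M_def by (rule cSup_upper[OF zero_S bdd])
  have M_bound: "(nrm (\<pi> h v))\<^sup>2 \<le> M * (nrm v)\<^sup>2" if v: "v \<in> V" for v
  proof (cases "nrm v = 0")
    case True
    then show ?thesis using C(2)[OF v] nrm_nonneg[OF rep_closed[OF h v]] by simp
  next
    case False
    then have pos: "nrm v > 0" using nrm_nonneg[OF v] by simp
    let ?c = "complex_of_real (1 / nrm v)"
    have "nrm (fscale ?c v) = 1" using pos v by (simp add: nrm_scale norm_divide)
    then have "(nrm (\<pi> h (fscale ?c v)))\<^sup>2 \<in> S" using v by (auto simp: S_def mem_rules intro!: exI[of _ "fscale ?c v"])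
    then have "(nrm (\<pi> h (fscale ?c v)))\<^sup>2 \<le> M" unfolding M_def by (rule cSup_upper[OF _ bdd])
    then have "(1 / nrm v)\<^sup>2 * (nrm (\<pi> h v))\<^sup>2 \<le> M"
      using pos v h by (simp add: op_scale nrm_scale rep_closed power_mult_distrib norm_divide power_divide)
    then show ?thesis using pos by (simp add: power_divide divide_le_eq)
  qed
  have "M \<le> (l1_norm G h)\<^sup>2"
  proof (rule ccontr)
    assume "\<not> M \<le> (l1_norm G h)\<^sup>2"
    then have Ml: "(l1_norm G h)\<^sup>2 < M" by simp
    then have Mpos: "M > 0" using zero_le_power2[of "l1_norm G h"] by linarith
    obtain g where g: "g \<in> ell1 G" "fscale (of_real M) g - convolution G g a = delta \<one>"
      using Neumann_series[OF a(1) order.strict_trans1[OF a(2) Ml]] by blast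
    obtain D where D: "D \<ge> 0" "\<And>v. v \<in> V \<Longrightarrow> nrm (\<pi> g v) \<le> D * nrm v"
      using op_bound[OF g(1)] by blast
    \<comment> \<open>\<open>\<pi> g\<close> is a left inverse of \<open>M - \<pi> a\<close> with
      bound \<open>D\<close>, so \<open>fscale (of_real M) v - \<pi> a v\<close> cannot be short.
      Its squared norm is expanded, the last term being estimated by
      \<open>nrm (\<pi> a v) \<le> M * nrm v\<close>.\<close>
    have key: "(nrm v)\<^sup>2 \<le> D\<^sup>2 * (2 * M\<^sup>2 * (nrm v)\<^sup>2 - 2 * M * (nrm (\<pi> h v))\<^sup>2)" if v: "v \<in> V" for v
    proof -
      note av = rep_closed[OF a(1) v] and hv = rep_closed[OF h v]
      have "v = \<pi> (fscale (of_real M) g - convolution G g a) v" using rep_one[OF v] g(2) by simp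
      also have "\<dots> = fscale (of_real M) (\<pi> g v) - \<pi> g (\<pi> a v)"
        using g(1) a(1) v by (simp add: rep_diff rep_scale rep_conv ell1_rules convolution_ell1)
      also have "\<dots> = \<pi> g (fscale (of_real M) v - \<pi> a v)"
        using g(1) av v by (simp add: op_diff op_scale mem_rules)
      finally have "nrm v \<le> D * nrm (fscale (of_real M) v - \<pi> a v)"
        using D(2)[of "fscale (of_real M) v - \<pi> a v"] av v by (simp add: mem_rules)
      then have 1: "(nrm v)\<^sup>2 \<le> D\<^sup>2 * (nrm (fscale (of_real M) v - \<pi> a v))\<^sup>2"
        using nrm_nonneg[OF v] by (metis power_mono power_mult_distrib)
      have "(nrm (\<pi> a v))\<^sup>2 = Re (ip (\<pi> h v) (\<pi> h (\<pi> a v)))"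
        using av v by (simp add: nrm_sq ip_a)
      also have "\<dots> \<le> nrm (\<pi> h v) * nrm (\<pi> h (\<pi> a v))"
        using Cauchy_Schwarz[OF hv rep_closed[OF h av]] complex_Re_le_cmod order_trans by blast
      finally have "((nrm (\<pi> a v))\<^sup>2)\<^sup>2 \<le> (nrm (\<pi> h v))\<^sup>2 * (nrm (\<pi> h (\<pi> a v)))\<^sup>2"
        by (metis power_mono power_mult_distrib zero_le_power2)
      also have "\<dots> \<le> (M * (nrm v)\<^sup>2) * (M * (nrm (\<pi> a v))\<^sup>2)"
        using M_bound[OF v] M_bound[OF av] M0 by (intro mult_mono) auto
      finally have "(nrm (\<pi> a v))\<^sup>2 * (nrm (\<pi> a v))\<^sup>2 \<le> (M\<^sup>2 * (nrm v)\<^sup>2) * (nrm (\<pi> a v))\<^sup>2"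
        by (simp add: power2_eq_square mult_ac)
      then have 2: "(nrm (\<pi> a v))\<^sup>2 \<le> M\<^sup>2 * (nrm v)\<^sup>2"
        using mult_right_le_imp_le[of "(nrm (\<pi> a v))\<^sup>2" "(nrm (\<pi> a v))\<^sup>2" "M\<^sup>2 * (nrm v)\<^sup>2"]
        by (cases "nrm (\<pi> a v) = 0") auto
      have "(nrm (fscale (of_real M) v - \<pi> a v))\<^sup>2 = M\<^sup>2 * (nrm v)\<^sup>2 - 2 * Re (ip (fscale (of_real M) v) (\<pi> a v)) + (nrm (\<pi> a v))\<^sup>2"
        using v av by (simp add: nrm_diff_sq mem_rules nrm_scale_sq nrm_scale power_mult_distrib)
      also have "Re (ip (fscale (of_real M) v) (\<pi> a v)) = M * (nrm (\<pi> h v))\<^sup>2"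
      proof -
        have "ip v (\<pi> a v) = cnj (ip (\<pi> a v) v)" by (rule ip_herm[OF av v])
        then show ?thesis using v av hv by (simp add: ip_scale_left ip_a ip_self)
      qed
      finally have "(nrm (fscale (of_real M) v - \<pi> a v))\<^sup>2 \<le> 2 * M\<^sup>2 * (nrm v)\<^sup>2 - 2 * M * (nrm (\<pi> h v))\<^sup>2"
        using 2 by linarith
      then have "D\<^sup>2 * (nrm (fscale (of_real M) v - \<pi> a v))\<^sup>2 \<le> D\<^sup>2 * (2 * M\<^sup>2 * (nrm v)\<^sup>2 - 2 * M * (nrm (\<pi> h v))\<^sup>2)"
        by (intro mult_left_mono) auto
      with 1 show ?thesis by linarith
    qed
    \<comment> \<open>From \<open>key\<close>, a vector of squared norm \<open>t\<close> yields a
      value at most \<open>t * (M - r)\<close>, which contradicts that \<open>M\<close> is the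
      supremum. The summand 1 keeps the denominator positive when \<open>D = 0\<close>, and
      \<open>max 0\<close> below covers \<open>M < r\<close>.\<close>
    define r where "r = 1 / (2 * M * (D\<^sup>2 + 1))"
    have r: "r > 0" using Mpos by (simp add: r_def add_nonneg_pos)
    have less: "x \<le> max 0 (M - r)" if xS: "x \<in> S" for x
    proof -
      obtain v where v: "x = (nrm (\<pi> h v))\<^sup>2" "v \<in> V" "nrm v \<le> 1" using xS by (auto simp: S_def)
      define t where "t = (nrm v)\<^sup>2"
      have t: "0 \<le> t" "t \<le> 1" using v nrm_nonneg[OF v(2)] by (auto simp: t_def power_le_one)
      have xM: "x \<le> M * t" using M_bound[OF v(2)] by (simp add: v t_def)
      have "t \<le> D\<^sup>2 * (2 * M * (M * t - x))"
        using key[OF v(2)] by (simp add: v(1) t_def power2_eq_square algebra_simps)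
      also have "\<dots> \<le> (D\<^sup>2 + 1) * (2 * M * (M * t - x))"
        using xM Mpos by (intro mult_right_mono) auto
      also have "\<dots> = (M * t - x) * (2 * M * (D\<^sup>2 + 1))" by (simp add: algebra_simps)
      finally have "t / (2 * M * (D\<^sup>2 + 1)) \<le> M * t - x"
        using Mpos by (subst pos_divide_le_eq) (auto simp: add_nonneg_pos)
      then have "t * r \<le> M * t - x" unfolding r_def by simp
      then have "x \<le> t * (M - r)" by (simp add: algebra_simps)
      also have "\<dots> \<le> t * max 0 (M - r)" using t by (intro mult_left_mono) auto
      also have "\<dots> \<le> 1 * max 0 (M - r)" using t by (intro mult_right_mono) auto
      finally show ?thesis by simp
    qed
    have "M \<le> max 0 (M - r)"
      unfolding M_def using zero_S less by (intro cSup_least) (auto simp: M_def)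
    then show False using r Mpos by linarith
  qed
  then have "(nrm (\<pi> h v))\<^sup>2 \<le> (l1_norm G h)\<^sup>2 * (nrm v)\<^sup>2"
    using M_bound[OF v] by (meson mult_right_mono order_trans zero_le_power2)
  then have "(nrm (\<pi> h v))\<^sup>2 \<le> (l1_norm G h * nrm v)\<^sup>2" by (simp add: power_mult_distrib)
  then show ?thesis by (rule power2_le_imp_le) (use v in \<open>simp add: l1_norm_nonneg nrm_nonneg\<close>)
qed

lemma rep_unitary:
  assumes "x \<in> carrier G" "y \<in> carrier G" "u \<in> V" "v \<in> V"
  shows "ip (\<pi> (delta x) u) (\<pi> (delta y) v) = ip (\<pi> (delta (inv y \<otimes> x)) u) v"
proof -
  have "ip (\<pi> (delta (inv y \<otimes> x)) u) v = ip (\<pi> (delta (inv y)) (\<pi> (delta x) u)) v"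
    using assms by (simp add: rep_conv[symmetric] delta_ell1 convolution_delta_delta)
  then show ?thesis
    using assms by (simp add: rep_adj[of "delta (inv y)"] delta_ell1 rep_closed involution_delta)
qed

definition matrix_coef :: "('b \<Rightarrow> complex) \<Rightarrow> ('b \<Rightarrow> complex) \<Rightarrow> 'a \<Rightarrow> complex" where
  "matrix_coef u v = (\<lambda>x. if x \<in> carrier G then ip (\<pi> (delta x) u) v else 0)"

lemma rep_fin_supp:
  assumes c: "c \<in> fin_supp (carrier G)" and u: "u \<in> V"
  shows "\<pi> c u = (\<Sum>x\<in>{x. c x \<noteq> 0}. fscale (c x) (\<pi> (delta x) u))"
proof -
  let ?A = "{x. c x \<noteq> 0}"
  have A: "finite ?A" "?A \<subseteq> carrier G" using c by (auto simp: fin_supp_def)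
  have "c = (\<Sum>x\<in>?A. fscale (c x) (delta x))"
    by (rule ext) (use A(1) in \<open>auto simp: sum_fun_apply fscale_apply delta_def if_distrib cong: if_cong\<close>)
  then have "\<pi> c u = \<pi> (\<Sum>x\<in>?A. fscale (c x) (delta x)) u" by simp
  also have "\<dots> = (\<Sum>x\<in>?A. \<pi> (fscale (c x) (delta x)) u)"
    by (rule rep_sum) (use A u in \<open>auto intro!: ell1_rules delta_ell1\<close>)
  also have "\<dots> = (\<Sum>x\<in>?A. fscale (c x) (\<pi> (delta x) u))"
    by (rule sum.cong[OF refl], rule rep_scale) (use A u in \<open>auto intro!: delta_ell1\<close>)
  finally show ?thesis .
qed

lemma rep_pairing:
  assumes c: "c \<in> fin_supp (carrier G)" and u: "u \<in> V" and v: "v \<in> V"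
  shows "ip (\<pi> c u) v = pairing c (matrix_coef u v)"
proof -
  let ?A = "{x. c x \<noteq> 0}"
  have A: "finite ?A" "?A \<subseteq> carrier G" using c by (auto simp: fin_supp_def)
  have m: "\<pi> (delta x) u \<in> V" if "x \<in> ?A" for x using that A u by (auto intro: rep_closed delta_ell1)
  have "ip (\<pi> c u) v = (\<Sum>x\<in>?A. ip (fscale (c x) (\<pi> (delta x) u)) v)"
    unfolding rep_fin_supp[OF c u] by (rule ip_sum_left) (use m v in \<open>auto intro: mem_rules\<close>)
  also have "\<dots> = pairing c (matrix_coef u v)"
    unfolding pairing_def by (rule sum.cong[OF refl]) (use m v A in \<open>auto simp: ip_scale_left matrix_coef_def\<close>)
  finally show ?thesis .
qed

text \<open>Hence the diagonal coefficient is positive definite and dominates every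
  \<open>matrix_coef u v\<close>: pairing \<open>c\<close> with the latter gives
  \<open>ip (\<pi> c u) v\<close>, which Cauchy-Schwarz bounds by this norm.\<close>

lemma kform_matrix_coef:
  assumes c: "c \<in> fin_supp (carrier G)" and u: "u \<in> V"
  shows "kform (gker G (matrix_coef u u)) c c = of_real ((nrm (\<pi> c u))\<^sup>2)"
proof -
  let ?A = "{x. c x \<noteq> 0}"
  have A: "finite ?A" "?A \<subseteq> carrier G" using c by (auto simp: fin_supp_def)
  have m: "\<pi> (delta x) u \<in> V" if "x \<in> ?A" for x using that A u by (auto intro: rep_closed delta_ell1)
  note mm = mem_rules(3)[OF m]
  have "ip (\<pi> c u) (\<pi> c u) = (\<Sum>x\<in>?A. ip (fscale (c x) (\<pi> (delta x) u)) (\<Sum>y\<in>?A. fscale (c y) (\<pi> (delta y) u)))"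
    unfolding rep_fin_supp[OF c u] by (rule ip_sum_left) (use mm in \<open>auto intro: mem_rules(5)\<close>)
  also have "\<dots> = (\<Sum>x\<in>?A. \<Sum>y\<in>?A. ip (fscale (c x) (\<pi> (delta x) u)) (fscale (c y) (\<pi> (delta y) u)))"
    by (rule sum.cong[OF refl], rule ip_sum_right) (use mm in auto)
  also have "\<dots> = (\<Sum>x\<in>?A. \<Sum>y\<in>?A. c x * cnj (c y) * gker G (matrix_coef u u) x y)"
  proof (intro sum.cong refl)
    fix x y assume xy: "x \<in> ?A" "y \<in> ?A"
    then have xy': "x \<in> carrier G" "y \<in> carrier G" using A by auto
    show "ip (fscale (c x) (\<pi> (delta x) u)) (fscale (c y) (\<pi> (delta y) u)) = c x * cnj (c y) * gker G (matrix_coef u u) x y"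
      using m[OF xy(1)] m[OF xy(2)] xy' u
      by (simp add: ip_scale_left ip_scale_right mem_rules rep_unitary gker_def matrix_coef_def)
  qed
  also have "\<dots> = kform (gker G (matrix_coef u u)) c c"
    by (rule kform_superset[symmetric]) (use A in auto)
  finally show ?thesis using ip_self[OF rep_closed[OF fin_supp_ell1[OF c] u]] by simp
qed

lemma positive_definite_matrix_coef:
  assumes "u \<in> V"
  shows "positive_definite G (matrix_coef u u)"
  unfolding positive_definite_iff psd_kernel_def
  by (simp add: kform_matrix_coef[OF _ assms] del: of_real_power)
    (simp add: functions_on_def matrix_coef_def)

lemma matrix_coef_in_coef:
  assumes u: "u \<in> V" "nrm u \<le> 1" and v: "v \<in> V" "nrm v \<le> 1"
  shows "matrix_coef u v \<in> coef G 1"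
proof -
  have "dominates G 1 (matrix_coef u u) (matrix_coef u v)"
    unfolding dominates_def
  proof (intro conjI ballI)
    show "positive_definite G (matrix_coef u u)" by (rule positive_definite_matrix_coef[OF u(1)])
    have "Re (matrix_coef u u \<one>) = (nrm u)\<^sup>2"
      using u by (simp add: matrix_coef_def rep_one nrm_sq)
    then show "Re (matrix_coef u u \<one>) \<le> 1"
      using u nrm_nonneg[OF u(1)] by (simp add: power_le_one)
    fix c assume c: "c \<in> fin_supp (carrier G)"
    note cu = rep_closed[OF fin_supp_ell1[OF c] u(1)]
    have "cmod (pairing c (matrix_coef u v)) \<le> nrm (\<pi> c u) * nrm v"
      using Cauchy_Schwarz[OF cu v(1)] by (simp add: rep_pairing[OF c u(1) v(1)])
    also have "\<dots> \<le> nrm (\<pi> c u)"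
      using v(2) nrm_nonneg[OF cu] by (simp add: mult_left_le)
    finally show "(cmod (pairing c (matrix_coef u v)))\<^sup>2 \<le> 1 * Re (kform (gker G (matrix_coef u u)) c c)"
      unfolding kform_matrix_coef[OF c u(1)] by (simp add: power_mono)
  qed
  moreover have "matrix_coef u v \<in> functions_on G" by (simp add: functions_on_def matrix_coef_def)
  ultimately show ?thesis by (auto simp: coef_def)
qed

lemma operator_norm_bdd: "f \<in> ell1 G \<Longrightarrow> bdd_above {nrm (\<pi> f v) | v. v \<in> V \<and> nrm v \<le> 1}"
  by (rule bdd_aboveI[of _ "l1_norm G f"])
    (auto intro: order_trans[OF contractive] simp: mult_left_le l1_norm_nonneg)

lemma operator_norm_upper: "f \<in> ell1 G \<Longrightarrow> v \<in> V \<Longrightarrow> nrm v \<le> 1 \<Longrightarrow> nrm (\<pi> f v) \<le> operator_norm V ip (\<pi> f)"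
  unfolding operator_norm_def by (rule cSup_upper[OF _ operator_norm_bdd]) auto

lemma operator_norm_least:
  assumes "\<And>v. v \<in> V \<Longrightarrow> nrm v \<le> 1 \<Longrightarrow> nrm (\<pi> f v) \<le> C"
  shows "operator_norm V ip (\<pi> f) \<le> C"
  unfolding operator_norm_def
proof (rule cSup_least)
  have "nrm 0 = 0" using mem_rules(1) by (simp add: ip_norm_def ip_zero)
  then show "{nrm (\<pi> f v) | v. v \<in> V \<and> nrm v \<le> 1} \<noteq> {}" using mem_rules(1) by force
qed (use assms in auto)

lemma operator_norm_le_l1: "f \<in> ell1 G \<Longrightarrow> operator_norm V ip (\<pi> f) \<le> l1_norm G f"
  by (rule operator_norm_least) (auto intro: order_trans[OF contractive] simp: mult_left_le l1_norm_nonneg)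

text \<open>The norm of \<open>\<pi> c v\<close> is attained by testing against the normalized
  \<open>\<pi> c v\<close>, and the resulting coefficient lies in \<open>coef G 1\<close>. So one
  bound over \<open>coef G 1\<close> serves all representations.\<close>

lemma operator_norm_le_coef:
  assumes c: "c \<in> fin_supp (carrier G)" and bound: "\<And>\<phi>. \<phi> \<in> coef G 1 \<Longrightarrow> cmod (pairing c \<phi>) \<le> C"
  shows "operator_norm V ip (\<pi> c) \<le> C"
proof (rule operator_norm_least)
  fix v assume v: "v \<in> V" "nrm v \<le> 1"
  note cv = rep_closed[OF fin_supp_ell1[OF c] v(1)]
  have C: "0 \<le> C" using bound[OF coef_zero] by (simp add: pairing_def)
  show "nrm (\<pi> c v) \<le> C"
  proof (cases "nrm (\<pi> c v) = 0")
    case False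
    then have pos: "nrm (\<pi> c v) > 0" using nrm_nonneg[OF cv] by simp
    define w where "w = fscale (of_real (1 / nrm (\<pi> c v))) (\<pi> c v)"
    have w: "w \<in> V" "nrm w \<le> 1" using cv pos by (simp_all add: w_def mem_rules nrm_scale norm_divide)
    have "ip (\<pi> c v) w = of_real (nrm (\<pi> c v))"
      using pos cv by (simp add: w_def ip_scale_right ip_self power2_eq_square)
    then have "cmod (pairing c (matrix_coef v w)) = nrm (\<pi> c v)"
      using rep_pairing[OF c v(1) w(1)] pos by simp
    then show ?thesis using bound[OF matrix_coef_in_coef[OF v w]] by simp
  qed (simp add: C)
qed

end

subsection \<open>The representation given by a positive definite function\<close>

lemma infsum_sum_swap:
  fixes F :: "'i \<Rightarrow> 'a \<Rightarrow> complex"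
  assumes "finite A" "\<And>z. z \<in> A \<Longrightarrow> F z summable_on X"
  shows "(\<lambda>y. \<Sum>z\<in>A. F z y) summable_on X \<and> (\<Sum>\<^sub>\<infinity>y\<in>X. \<Sum>z\<in>A. F z y) = (\<Sum>z\<in>A. \<Sum>\<^sub>\<infinity>y\<in>X. F z y)"
  using assms by (induction A rule: finite_induct) (auto simp: summable_on_add infsum_add)

context star_rep
begin

lemma operator_norm_bound:
  assumes f: "f \<in> ell1 G" and v: "v \<in> V"
  shows "nrm (\<pi> f v) \<le> operator_norm V ip (\<pi> f) * nrm v"
proof (cases "nrm v = 0")
  case True
  then have "v = 0" using v nrm_eq_0 by blast
  then show ?thesis using True op_zero[OF f] by simp
next
  case False
  then have pos: "nrm v > 0" using nrm_nonneg[OF v] by simp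
  let ?c = "complex_of_real (1 / nrm v)"
  have "nrm (\<pi> f (fscale ?c v)) \<le> operator_norm V ip (\<pi> f)"
    using pos v by (intro operator_norm_upper f) (simp_all add: mem_rules nrm_scale norm_divide)
  then have "nrm (\<pi> f v) / nrm v \<le> operator_norm V ip (\<pi> f)"
    using pos v f by (simp add: op_scale nrm_scale rep_closed norm_divide)
  then show ?thesis using pos by (simp add: divide_le_eq)
qed

lemma matrix_coef_B_discrete:
  assumes u: "u \<in> V" and v: "v \<in> V"
  shows "matrix_coef u v \<in> B_discrete G"
proof -
  \<comment> \<open>Polarization: the weights \<open>\<i> ^ k / 4\<close> single out the term that
    is linear in \<open>u\<close> and conjugate linear in \<open>v\<close>.\<close>
  define w where "w k = u + fscale (\<i> ^ k) v" for k :: nat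
  have w: "w k \<in> V" for k using u v by (simp add: w_def mem_rules)
  have expand: "matrix_coef (w k) (w k) x = ip (\<pi> (delta x) u) u + cnj (\<i> ^ k) * ip (\<pi> (delta x) u) v
      + \<i> ^ k * ip (\<pi> (delta x) v) u + \<i> ^ k * cnj (\<i> ^ k) * ip (\<pi> (delta x) v) v"
    if x: "x \<in> carrier G" for k x
    using u v delta_ell1[OF x] x
    by (simp add: matrix_coef_def w_def op_add op_scale ip_add_left ip_add_right ip_scale_left
        ip_scale_right mem_rules rep_closed algebra_simps del: complex_cnj_power)
  have "matrix_coef u v = (\<Sum>k<4. fscale (\<i> ^ k / 4) (matrix_coef (w k) (w k)))"
  proof
    fix x
    show "matrix_coef u v x = (\<Sum>k<4. fscale (\<i> ^ k / 4) (matrix_coef (w k) (w k))) x"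
    proof (cases "x \<in> carrier G")
      case True
      then show ?thesis
        unfolding sum_fun_apply fscale_apply expand[OF True]
        by (simp add: numeral_eq_Suc lessThan_Suc matrix_coef_def field_simps)
    next
      case False
      then show ?thesis by (simp add: sum_fun_apply fscale_apply matrix_coef_def)
    qed
  qed
  then show ?thesis
    unfolding B_discrete_def mem_Collect_eq using positive_definite_matrix_coef[OF w]
    by (intro exI[of _ "4 :: nat"] exI[of _ "\<lambda>k. \<i> ^ k / 4"] exI[of _ "\<lambda>k. matrix_coef (w k) (w k)"]) simp
qed

end

context group
begin

lemma left_translate_fin_supp:
  assumes x: "x \<in> carrier G" and c: "c \<in> fin_supp (carrier G)"
  shows "left_translate G x c \<in> fin_supp (carrier G)"
proof -
  have "{y. left_translate G x c y \<noteq> 0} \<subseteq> (\<lambda>z. inv x \<otimes> z) ` {y. c y \<noteq> 0}"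
  proof
    fix y assume "y \<in> {y. left_translate G x c y \<noteq> 0}"
    then have y: "y \<in> carrier G" "c (x \<otimes> y) \<noteq> 0" by (auto simp: left_translate_def split: if_splits)
    then have "y = inv x \<otimes> (x \<otimes> y)" using x by (simp add: m_assoc[symmetric])
    with y(2) show "y \<in> (\<lambda>z. inv x \<otimes> z) ` {y. c y \<noteq> 0}" by blast
  qed
  then have "finite {y. left_translate G x c y \<noteq> 0}"
    by (rule finite_subset) (use c in \<open>simp add: fin_supp_def\<close>)
  then show ?thesis by (auto simp: fin_supp_def left_translate_def split: if_splits)
qed

lemma pairing_left_translate:
  assumes x: "x \<in> carrier G" and c: "c \<in> fin_supp (carrier G)"
  shows "pairing (left_translate G (inv x) c) F = pairing c (\<lambda>y. F (x \<otimes> y))"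
proof -
  have "pairing (left_translate G (inv x) c) F = (\<Sum>\<^sub>\<infinity>y\<in>carrier G. left_translate G (inv x) c y * F y)"
    by (rule infsum_fin_supp[symmetric]) (use x c in \<open>simp add: left_translate_fin_supp\<close>)
  also have "\<dots> = (\<Sum>\<^sub>\<infinity>y\<in>carrier G. left_translate G (inv x) c (x \<otimes> y) * F (x \<otimes> y))"
    by (rule infsum_reindex_bij_betw[OF bij_betw_mult_left[OF x], symmetric])
  also have "\<dots> = (\<Sum>\<^sub>\<infinity>y\<in>carrier G. c y * F (x \<otimes> y))"
    by (rule infsum_cong) (use x in \<open>simp add: left_translate_def m_assoc[symmetric]\<close>)
  also have "\<dots> = pairing c (\<lambda>y. F (x \<otimes> y))"
    by (rule infsum_fin_supp[OF c])
  finally show ?thesis .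
qed

lemma kform_left_translate:
  assumes x: "x \<in> carrier G" and c: "c \<in> fin_supp (carrier G)" and d: "d \<in> fin_supp (carrier G)"
  shows "kform (gker G p) (left_translate G (inv x) c) (left_translate G (inv x) d) = kform (gker G p) c d"
proof -
  have d': "(\<lambda>y. cnj (d y)) \<in> fin_supp (carrier G)" using d by (simp add: fin_supp_def)
  have "(\<lambda>y. cnj (left_translate G (inv x) d y)) = left_translate G (inv x) (\<lambda>y. cnj (d y))"
    by (rule ext) (simp add: left_translate_def)
  then have "kform (gker G p) (left_translate G (inv x) c) (left_translate G (inv x) d)
      = pairing c (\<lambda>a. pairing (\<lambda>y. cnj (d y)) (\<lambda>b. gker G p (x \<otimes> a) (x \<otimes> b)))"
    unfolding kform_def by (simp add: pairing_left_translate x c d')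
  also have "\<dots> = kform (gker G p) c d"
    unfolding kform_def
  proof (intro pairing_cong[OF c] pairing_cong[OF d'])
    fix a b assume ab: "a \<in> carrier G" "b \<in> carrier G"
    have "inv (x \<otimes> b) \<otimes> (x \<otimes> a) = inv b \<otimes> (inv x \<otimes> x) \<otimes> a"
      using x ab by (simp only: inv_mult_group m_assoc m_closed inv_closed)
    then show "gker G p (x \<otimes> a) (x \<otimes> b) = gker G p a b" using x ab by (simp add: gker_def)
  qed
  finally show ?thesis .
qed

end

text \<open>The cyclic representation of \<open>p\<close>, realised on functions on
  \<open>G\<close>: \<open>delta x\<close> acts by \<open>left_translate G (inv x)\<close> and a
  general element of \<open>ell1 G\<close> by convolution. Its vectors have the type required in
  \<open>cstar_norm\<close>.\<close>

locale gns = group G for G (structure) +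
  fixes p :: "'a \<Rightarrow> complex"
  assumes p: "positive_definite G p"
begin

sublocale rkhs "carrier G" "gker G p"
  by unfold_locales (rule psd_gker[OF p])

lemma H_functions_on: "u \<in> H \<Longrightarrow> u \<in> functions_on G"
  by (simp add: H_def functions_on_def)

lemma hbound_left_translate:
  assumes x: "x \<in> carrier G" and u: "hbound u C"
  shows "hbound (left_translate G x u) C"
  unfolding hbound_def
proof (intro conjI ballI)
  show "0 \<le> C" using u by (simp add: hbound_def)
  fix c assume c: "c \<in> fin_supp (carrier G)"
  have "pairing c (\<lambda>y. cnj (left_translate G x u y)) = pairing c (\<lambda>y. cnj (u (x \<otimes> y)))"
    by (rule pairing_cong[OF c]) (simp add: left_translate_def)
  also have "\<dots> = pairing (left_translate G (inv x) c) (\<lambda>y. cnj (u y))"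
    using x c by (simp add: pairing_left_translate)
  also have "cmod \<dots> \<le> C * F.nrm (left_translate G (inv x) c)"
    using u x c by (simp add: hbound_def left_translate_fin_supp)
  also have "F.nrm (left_translate G (inv x) c) = F.nrm c"
    using x c by (simp add: ip_norm_def kform_left_translate)
  finally show "cmod (pairing c (\<lambda>y. cnj (left_translate G x u y))) \<le> C * F.nrm c" .
qed

lemma left_translate_H: "x \<in> carrier G \<Longrightarrow> u \<in> H \<Longrightarrow> left_translate G x u \<in> H"
  using hbound_left_translate by (auto simp: H_def left_translate_def)

lemma left_translate_inv_cancel:
  "x \<in> carrier G \<Longrightarrow> u \<in> functions_on G \<Longrightarrow> left_translate G x (left_translate G (inv x) u) = u"
  by (rule ext) (auto simp: left_translate_def functions_on_def m_assoc[symmetric])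

lemma hn_left_translate:
  assumes x: "x \<in> carrier G" and u: "u \<in> H"
  shows "hn (left_translate G x u) = hn u"
proof (rule antisym)
  show "hn (left_translate G x u) \<le> hn u"
    by (intro hn_le hbound_left_translate x hn_bound u)
  have "u = left_translate G (inv x) (left_translate G x u)"
    using left_translate_inv_cancel[of "inv x" u] x H_functions_on[OF u] by simp
  then have "hn u = hn (left_translate G (inv x) (left_translate G x u))" by simp
  also have "\<dots> \<le> hn (left_translate G x u)"
    using x by (intro hn_le hbound_left_translate hn_bound left_translate_H u) auto
  finally show "hn u \<le> hn (left_translate G x u)" .
qed

lemma left_translate_linear:
  "left_translate G x (u + v) = left_translate G x u + left_translate G x v"
  "left_translate G x (u - v) = left_translate G x u - left_translate G x v"
  "left_translate G x (fscale t u) = fscale t (left_translate G x u)"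
  by (rule ext, simp add: left_translate_def fscale_apply)+

lemma hip_left_translate:
  assumes "x \<in> carrier G" "u \<in> H" "v \<in> H"
  shows "hip (left_translate G x u) (left_translate G x v) = hip u v"
  unfolding hip_def left_translate_linear[symmetric] using assms
  by (simp only: hn_left_translate H_rules)

lemma H_bounded:
  assumes u: "u \<in> H" and x: "x \<in> carrier G"
  shows "cmod (u x) \<le> hn u * sqrt (Re (p \<one>))"
  using evaluation_bound[OF u x] x by (simp add: ip_norm_def gker_def)

lemma convolution_summable:
  assumes h: "h \<in> ell1 G" and u: "u \<in> H" and z: "z \<in> carrier G"
  shows "(\<lambda>y. h y * u (inv y \<otimes> z)) summable_on carrier G"
  by (rule abs_summable_summable, rule ell1_mult_bounded(1)[OF h, of _ "hn u * sqrt (Re (p \<one>))"])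
    (use H_bounded[OF u] z in auto)

lemma pairing_convolution:
  assumes h: "h \<in> ell1 G" and u: "u \<in> H" and c: "c \<in> fin_supp (carrier G)"
  shows "pairing c (convolution G h u) = (\<Sum>\<^sub>\<infinity>y\<in>carrier G. h y * pairing c (left_translate G (inv y) u))"
proof -
  let ?A = "{z. c z \<noteq> 0}"
  have A: "finite ?A" "?A \<subseteq> carrier G" using c by (auto simp: fin_supp_def)
  have "pairing c (convolution G h u) = (\<Sum>z\<in>?A. \<Sum>\<^sub>\<infinity>y\<in>carrier G. c z * (h y * u (inv y \<otimes> z)))"
    unfolding pairing_def using A
    by (intro sum.cong refl) (auto simp: convolution_def infsum_cmult_right')
  also have "\<dots> = (\<Sum>\<^sub>\<infinity>y\<in>carrier G. \<Sum>z\<in>?A. c z * (h y * u (inv y \<otimes> z)))"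
  proof (rule infsum_sum_swap[OF A(1), THEN conjunct2, symmetric])
    fix z assume "z \<in> ?A"
    then have "z \<in> carrier G" using A by auto
    then show "(\<lambda>y. c z * (h y * u (inv y \<otimes> z))) summable_on carrier G"
      by (intro summable_on_cmult_right convolution_summable h u)
  qed
  also have "\<dots> = (\<Sum>\<^sub>\<infinity>y\<in>carrier G. h y * pairing c (left_translate G (inv y) u))"
    unfolding pairing_def sum_distrib_left
    by (intro infsum_cong sum.cong refl) (use A in \<open>auto simp: left_translate_def mult_ac\<close>)
  finally show ?thesis .
qed

lemma hbound_convolution:
  assumes h: "h \<in> ell1 G" and u: "u \<in> H"
  shows "hbound (convolution G h u) (l1_norm G h * hn u)"
  unfolding hbound_def
proof (intro conjI ballI)
  show "0 \<le> l1_norm G h * hn u" by (simp add: l1_norm_nonneg hn_nonneg u)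
  fix c assume c: "c \<in> fin_supp (carrier G)"
  let ?c = "\<lambda>x. cnj (c x)"
  have c': "?c \<in> fin_supp (carrier G)" using c by (simp add: fin_supp_def)
  have swap: "cmod (pairing c (\<lambda>x. cnj (w x))) = cmod (pairing ?c w)" for w
    using pairing_cnj[of ?c w] by simp
  have "cmod (\<Sum>\<^sub>\<infinity>y\<in>carrier G. h y * pairing ?c (left_translate G (inv y) u)) \<le> l1_norm G h * (hn u * F.nrm c)"
  proof (rule ell1_mult_bounded(2)[OF h])
    fix y assume y: "y \<in> carrier G"
    have "cmod (pairing c (\<lambda>x. cnj (left_translate G (inv y) u x))) \<le> hn (left_translate G (inv y) u) * F.nrm c"
      using y by (intro pairing_le_hn left_translate_H u c) auto
    then show "cmod (pairing ?c (left_translate G (inv y) u)) \<le> hn u * F.nrm c"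
      using y u by (simp add: swap hn_left_translate)
  qed
  then show "cmod (pairing c (\<lambda>x. cnj (convolution G h u x))) \<le> l1_norm G h * hn u * F.nrm c"
    unfolding swap pairing_convolution[OF h u c'] by (simp add: mult.assoc)
qed

lemma convolution_H: "h \<in> ell1 G \<Longrightarrow> u \<in> H \<Longrightarrow> convolution G h u \<in> H"
  using hbound_convolution by (auto simp: H_def convolution_def)

lemma hn_convolution: "h \<in> ell1 G \<Longrightarrow> u \<in> H \<Longrightarrow> hn (convolution G h u) \<le> l1_norm G h * hn u"
  by (intro hn_le hbound_convolution)

text \<open>Convolution is a weak infinite sum of translates. For \<open>v = J d\<close> this is
  \<open>pairing_convolution\<close>; both sides are bounded in \<open>v\<close>, so density of the
  vectors \<open>J d\<close> extends it.\<close>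

lemma hip_convolution:
  assumes h: "h \<in> ell1 G" and u: "u \<in> H" and v: "v \<in> H"
  shows "hip (convolution G h u) v = (\<Sum>\<^sub>\<infinity>y\<in>carrier G. h y * hip (left_translate G (inv y) u) v)"
proof -
  let ?S = "\<lambda>v. \<Sum>\<^sub>\<infinity>y\<in>carrier G. h y * hip (left_translate G (inv y) u) v"
  note hu = convolution_H[OF h u] hn_convolution[OF h u]
  have CS: "cmod (hip (left_translate G (inv y) u) v) \<le> hn u * hn v" if "y \<in> carrier G" "v \<in> H" for y v
    using Hs.Cauchy_Schwarz[OF left_translate_H[of "inv y", OF _ u] that(2)] that u
    by (simp add: hip_norm left_translate_H hn_left_translate)
  have J: "hip (convolution G h u) (J d) = ?S (J d)" if d: "d \<in> fin_supp (carrier G)" for d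
  proof -
    have d': "(\<lambda>x. cnj (d x)) \<in> fin_supp (carrier G)" using d by (simp add: fin_supp_def)
    have right: "hip w (J d) = pairing (\<lambda>x. cnj (d x)) w" if w: "w \<in> H" for w
    proof -
      have "hip w (J d) = cnj (pairing d (\<lambda>x. cnj (w x)))"
        using Hs.ip_herm[OF J_in_H[OF d] w] hip_J_left[OF d w] by simp
      then show ?thesis using pairing_cnj[of d "\<lambda>x. cnj (w x)"] by simp
    qed
    have "hip (convolution G h u) (J d) = pairing (\<lambda>x. cnj (d x)) (convolution G h u)"
      by (rule right[OF hu(1)])
    also have "\<dots> = (\<Sum>\<^sub>\<infinity>y\<in>carrier G. h y * pairing (\<lambda>x. cnj (d x)) (left_translate G (inv y) u))"
      by (rule pairing_convolution[OF h u d'])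
    also have "\<dots> = ?S (J d)"
      by (rule infsum_cong) (simp add: right left_translate_H u)
    finally show ?thesis .
  qed
  define L where "L = l1_norm G h * hn u"
  have L: "L \<ge> 0" by (simp add: L_def l1_norm_nonneg hn_nonneg u)
  have close: "cmod (hip (convolution G h u) v - ?S v) \<le> 2 * L * e" if e: "e > 0" for e
  proof -
    obtain d where d: "d \<in> fin_supp (carrier G)" "hn (v - J d) \<le> e" using dense_J[OF v e] .
    note Jd = J_in_H[OF d(1)]
    note vd = H_rules(4)[OF v Jd]
    have 1: "cmod (hip (convolution G h u) (v - J d)) \<le> L * e"
    proof -
      have "cmod (hip (convolution G h u) (v - J d)) \<le> hn (convolution G h u) * hn (v - J d)"
        using Hs.Cauchy_Schwarz[OF hu(1) vd] by (simp only: hip_norm hu(1) vd)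
      also have "\<dots> \<le> L * e"
        unfolding L_def by (intro mult_mono hu(2) d(2) mult_nonneg_nonneg l1_norm_nonneg hn_nonneg u vd)
      finally show ?thesis .
    qed
    have 2: "cmod (?S (v - J d)) \<le> L * e"
    proof -
      have "cmod (?S (v - J d)) \<le> l1_norm G h * (hn u * hn (v - J d))"
        by (rule ell1_mult_bounded(2)[OF h]) (rule CS[OF _ vd])
      also have "\<dots> \<le> l1_norm G h * (hn u * e)"
        by (intro mult_left_mono d(2) l1_norm_nonneg hn_nonneg u)
      finally show ?thesis by (simp add: L_def mult.assoc)
    qed
    have "?S (v - J d) = ?S v - ?S (J d)"
    proof -
      have s: "(\<lambda>y. h y * hip (left_translate G (inv y) u) w) summable_on carrier G" if "w \<in> H" for w
        by (rule abs_summable_summable, rule ell1_mult_bounded(1)[OF h]) (rule CS[OF _ that])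
      have "?S (v - J d) = (\<Sum>\<^sub>\<infinity>y\<in>carrier G. h y * hip (left_translate G (inv y) u) v
            + - (h y * hip (left_translate G (inv y) u) (J d)))"
        by (rule infsum_cong) (simp add: Hs.ip_diff_right v Jd left_translate_H u algebra_simps)
      also have "\<dots> = ?S v - ?S (J d)"
        using s[OF v] s[OF Jd] infsum_add[OF s[OF v] summable_on_uminus[THEN iffD2, OF s[OF Jd]]]
        by (simp only: infsum_uminus) simp
      finally show ?thesis .
    qed
    then have "hip (convolution G h u) v - ?S v = hip (convolution G h u) (v - J d) - ?S (v - J d)"
      using J[OF d(1)] by (simp only: Hs.ip_diff_right[OF v Jd hu(1)]) simp
    then show ?thesis
      using 1 2 norm_triangle_ineq4[of "hip (convolution G h u) (v - J d)" "?S (v - J d)"] by simp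
  qed
  have "cmod (hip (convolution G h u) v - ?S v) \<le> 0"
  proof (rule field_le_epsilon)
    fix e :: real assume e: "e > 0"
    have "2 * L * (e / (2 * L + 1)) \<le> e" using L e by (simp add: field_simps)
    then show "cmod (hip (convolution G h u) v - ?S v) \<le> 0 + e"
      using close[of "e / (2 * L + 1)"] L e by (simp add: add_nonneg_pos)
  qed
  then show ?thesis by simp
qed

text \<open>Translations are unitary, so the adjoint of translation by \<open>inv y\<close> is
  translation by \<open>y\<close>; substituting \<open>inv y\<close> for \<open>y\<close> in the sum
  then produces the involution.\<close>

lemma hip_convolution_adj:
  assumes h: "h \<in> ell1 G" and u: "u \<in> H" and v: "v \<in> H"
  shows "hip (convolution G h u) v = hip u (convolution G (involution G h) v)"
proof -
  have adj: "hip (left_translate G (inv y) u) v = cnj (hip (left_translate G y v) u)" if y: "y \<in> carrier G" for y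
  proof -
    have "hip (left_translate G (inv y) u) v
        = hip (left_translate G y (left_translate G (inv y) u)) (left_translate G y v)"
      using y by (intro hip_left_translate[symmetric] left_translate_H u v) auto
    also have "\<dots> = hip u (left_translate G y v)"
      using y H_functions_on[OF u] by (simp add: left_translate_inv_cancel)
    finally show ?thesis using Hs.ip_herm[OF left_translate_H[OF y v] u] by simp
  qed
  have "hip u (convolution G (involution G h) v) = cnj (hip (convolution G (involution G h) v) u)"
    by (intro Hs.ip_herm convolution_H involution_ell1 h u v)
  also have "\<dots> = cnj (\<Sum>\<^sub>\<infinity>y\<in>carrier G. involution G h y * hip (left_translate G (inv y) v) u)"
    by (simp add: hip_convolution involution_ell1 h u v)
  also have "\<dots> = (\<Sum>\<^sub>\<infinity>y\<in>carrier G. cnj (involution G h y * hip (left_translate G (inv y) v) u))"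
    by (rule infsum_cnj[symmetric])
  also have "\<dots> = (\<Sum>\<^sub>\<infinity>y\<in>carrier G. cnj (involution G h (inv y) * hip (left_translate G (inv (inv y)) v) u))"
    by (rule infsum_reindex_bij_betw[OF bij_betw_inv, symmetric])
  also have "\<dots> = (\<Sum>\<^sub>\<infinity>y\<in>carrier G. h y * hip (left_translate G (inv y) u) v)"
    by (rule infsum_cong) (simp add: involution_def adj)
  finally show ?thesis by (simp add: hip_convolution h u v)
qed

lemma convolution_star_rep: "nondegenerate_star_rep G H hip (convolution G)"
  unfolding nondegenerate_star_rep_def
proof (intro conjI ballI allI impI)
  show "hilbert_space H hip" by (rule H_hilbert_space)
next
  fix f assume f: "f \<in> ell1 G"
  show "bounded_operator H hip (convolution G f)"
    unfolding bounded_operator_def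
  proof (intro conjI ballI allI)
    show "convolution G f v \<in> H" if "v \<in> H" for v using convolution_H[OF f that] .
    fix u v assume uv: "u \<in> H" "v \<in> H"
    show "convolution G f (u + v) = convolution G f u + convolution G f v"
      using convolution_summable[OF f uv(1)] convolution_summable[OF f uv(2)]
      by (intro ext) (simp add: convolution_def distrib_left infsum_add)
  next
    fix c v
    show "convolution G f (fscale c v) = fscale c (convolution G f v)"
      by (intro ext) (simp add: convolution_def fscale_apply mult.left_commute[of _ c] infsum_cmult_right')
  next
    show "\<exists>C. \<forall>v\<in>H. ip_norm hip (convolution G f v) \<le> C * ip_norm hip v"
      by (rule exI[of _ "l1_norm G f"]) (simp add: hip_norm convolution_H f hn_convolution)
  qed
next
  fix f g v assume *: "f \<in> ell1 G" "g \<in> ell1 G" "v \<in> H"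
  show "convolution G (f + g) v = convolution G f v + convolution G g v"
    using convolution_summable[OF *(1,3)] convolution_summable[OF *(2,3)]
    by (intro ext) (simp add: convolution_def distrib_right infsum_add)
  show "convolution G (convolution G f g) v = convolution G f (convolution G g v)"
    by (rule convolution_assoc[OF *(1,2) H_bounded[OF *(3)]])
next
  fix c f v
  show "convolution G (fscale c f) v = fscale c (convolution G f v)"
    by (intro ext) (simp add: convolution_def fscale_apply mult.assoc infsum_cmult_right')
next
  fix f u v assume "f \<in> ell1 G" "u \<in> H" "v \<in> H"
  then show "hip (convolution G f u) v = hip u (convolution G (involution G f) v)"
    by (rule hip_convolution_adj)
next
  fix v and e :: real assume v: "v \<in> H" and e: "e > 0"
  have "v - convolution G (delta \<one>) v = 0"
    using H_functions_on[OF v] by (simp add: convolution_delta_one)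
  then have "ip_norm hip (v - (\<Sum>i<1::nat. convolution G (delta \<one>) v)) < e"
    using e H_rules(1) by (simp add: ip_norm_def Hs.ip_zero)
  then show "\<exists>(k :: nat) f w. (\<forall>i<k. f i \<in> ell1 G \<and> w i \<in> H) \<and> ip_norm hip (v - (\<Sum>i<k. convolution G (f i) (w i))) < e"
    using delta_ell1[OF one_closed] v
    by (intro exI[of _ "1 :: nat"] exI[of _ "\<lambda>_. delta \<one>"] exI[of _ "\<lambda>_. v"]) simp
qed

sublocale R: star_rep G H hip "convolution G"
  by unfold_locales (rule convolution_star_rep)

text \<open>The vector \<xi>. Its translates are the vectors \<open>J (delta x)\<close>, whose inner
  products with \<open>v\<close> are the conjugated values of \<open>v\<close>.\<close>

abbreviation cyclic :: "'a \<Rightarrow> complex" where "cyclic \<equiv> J (delta \<one>)"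

lemma cyclic_H: "cyclic \<in> H" and hn_cyclic: "hn cyclic = sqrt (Re (p \<one>))"
  by (simp_all add: J_in_H hn_J delta_mem ip_norm_def gker_def)

lemma left_translate_cyclic: "x \<in> carrier G \<Longrightarrow> left_translate G (inv x) cyclic = J (delta x)"
  by (rule ext) (simp add: left_translate_def J_def gker_def inv_mult_group)

text \<open>The conjugate of \<phi> is the vector \<eta>: domination by \<open>p\<close> is the
  inequality of \<open>hbound\<close> with constant \<open>sqrt C\<close>.\<close>

lemma dominated_H:
  assumes "dominates G C p \<phi>" "\<phi> \<in> functions_on G"
  shows "(\<lambda>x. cnj (\<phi> x)) \<in> H" "hn (\<lambda>x. cnj (\<phi> x)) \<le> sqrt C"
proof -
  have "hbound (\<lambda>x. cnj (\<phi> x)) (sqrt C)"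
    unfolding hbound_def
  proof (intro conjI ballI)
    show "0 \<le> sqrt C" using dominates_nonneg[OF assms(1)] by simp
    fix c assume c: "c \<in> fin_supp (carrier G)"
    have "(cmod (pairing c \<phi>))\<^sup>2 \<le> C * (F.nrm c)\<^sup>2"
      using assms(1) c by (simp add: dominates_def F.nrm_sq)
    then have "(cmod (pairing c \<phi>))\<^sup>2 \<le> (sqrt C * F.nrm c)\<^sup>2"
      using dominates_nonneg[OF assms(1)] by (simp add: power_mult_distrib)
    then have "cmod (pairing c \<phi>) \<le> sqrt C * F.nrm c"
      by (rule power2_le_imp_le) (use dominates_nonneg[OF assms(1)] F.nrm_nonneg[OF c] in simp)
    then show "cmod (pairing c (\<lambda>x. cnj (cnj (\<phi> x)))) \<le> sqrt C * F.nrm c" by simp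
  qed
  then show "(\<lambda>x. cnj (\<phi> x)) \<in> H" "hn (\<lambda>x. cnj (\<phi> x)) \<le> sqrt C"
    using assms(2) by (auto simp: H_def functions_on_def hn_le)
qed

lemma cyclic_coef:
  assumes "(\<lambda>x. cnj (\<phi> x)) \<in> H" "x \<in> carrier G"
  shows "hip (left_translate G (inv x) cyclic) (\<lambda>x. cnj (\<phi> x)) = \<phi> x"
  using hip_J_left[OF delta_mem[OF assms(2)] assms(1)] by (simp add: left_translate_cyclic assms(2))

lemma dominated_matrix_coef:
  assumes "(\<lambda>x. cnj (\<phi> x)) \<in> H"
  shows "R.matrix_coef cyclic (\<lambda>x. cnj (\<phi> x)) = \<phi>"
proof -
  have "\<phi> x = 0" if "x \<notin> carrier G" for x
    using assms that by (simp add: H_def)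
  then show ?thesis
    using cyclic_coef[OF assms] by (intro ext) (simp add: R.matrix_coef_def convolution_delta)
qed

end

context group
begin

text \<open>In the representation of a dominating \<open>p\<close> the function is a coefficient of
  two vectors, which polarization writes with four positive definite functions.\<close>

lemma coef_imp_B_discrete:
  assumes "\<phi> \<in> coef G C"
  shows "\<phi> \<in> B_discrete G"
proof -
  obtain p where dom: "dominates G C p \<phi>" "\<phi> \<in> functions_on G" using assms by (auto simp: coef_def)
  interpret gns G p by unfold_locales (use dom in \<open>simp add: dominates_def\<close>)
  have "(\<lambda>x. cnj (\<phi> x)) \<in> H" by (rule dominated_H[OF dom])
  then show ?thesis
    using R.matrix_coef_B_discrete[OF cyclic_H] dominated_matrix_coef by metis
qed

lemma B_discrete_iff_coef: "f \<in> B_discrete G \<longleftrightarrow> (\<exists>C. f \<in> coef G C)"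
  using B_discrete_imp_coef coef_imp_B_discrete by metis

lemma cstar_norm_bdd:
  assumes f: "f \<in> ell1 G"
  shows "bdd_above {operator_norm V ip (\<pi> f) |
            (V :: ('a \<Rightarrow> complex) set) ip \<pi>. nondegenerate_star_rep G V ip \<pi>}"
proof (rule bdd_aboveI[of _ "l1_norm G f"])
  fix r assume "r \<in> {operator_norm V ip (\<pi> f) |
            (V :: ('a \<Rightarrow> complex) set) ip \<pi>. nondegenerate_star_rep G V ip \<pi>}"
  then obtain V :: "('a \<Rightarrow> complex) set" and ip \<pi> where
    r: "r = operator_norm V ip (\<pi> f)" "nondegenerate_star_rep G V ip \<pi>" by blast
  interpret star_rep G V ip \<pi> by unfold_locales (rule r(2))
  show "r \<le> l1_norm G f" unfolding r(1) by (rule operator_norm_le_l1[OF f])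
qed

lemma operator_norm_le_cstar_norm:
  fixes V :: "('a \<Rightarrow> complex) set"
  assumes "f \<in> ell1 G" "nondegenerate_star_rep G V ip \<pi>"
  shows "operator_norm V ip (\<pi> f) \<le> cstar_norm G f"
  unfolding cstar_norm_def by (rule cSup_upper[OF _ cstar_norm_bdd[OF assms(1)]]) (use assms(2) in blast)

lemma cstar_norm_least:
  assumes "\<And>(V :: ('a \<Rightarrow> complex) set) ip \<pi>. nondegenerate_star_rep G V ip \<pi> \<Longrightarrow> operator_norm V ip (\<pi> f) \<le> C"
  shows "cstar_norm G f \<le> C"
proof -
  \<comment> \<open>The zero function supplies a representation, on the zero space, so the supremum
    runs over a nonempty set.\<close>
  interpret gns G 0 by unfold_locales (rule positive_definite_zero)
  show ?thesis
    unfolding cstar_norm_def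
    by (rule cSup_least) (use convolution_star_rep assms in blast)+
qed

lemma cstar_norm_le_l1: "f \<in> ell1 G \<Longrightarrow> cstar_norm G f \<le> l1_norm G f"
proof (rule cstar_norm_least)
  fix V :: "('a \<Rightarrow> complex) set" and ip \<pi>
  assume f: "f \<in> ell1 G" and "nondegenerate_star_rep G V ip \<pi>"
  then interpret star_rep G V ip \<pi> by unfold_locales
  show "operator_norm V ip (\<pi> f) \<le> l1_norm G f" by (rule operator_norm_le_l1[OF f])
qed

lemma cstar_norm_le_coef:
  assumes c: "c \<in> fin_supp (carrier G)" and "\<And>\<phi>. \<phi> \<in> coef G 1 \<Longrightarrow> cmod (pairing c \<phi>) \<le> C"
  shows "cstar_norm G c \<le> C"
proof (rule cstar_norm_least)
  fix V :: "('a \<Rightarrow> complex) set" and ip \<pi>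
  assume "nondegenerate_star_rep G V ip \<pi>"
  then interpret star_rep G V ip \<pi> by unfold_locales
  show "operator_norm V ip (\<pi> c) \<le> C" by (rule operator_norm_le_coef[OF assms])
qed

text \<open>The easy half of the duality. In the representation of a dominating \<open>p\<close> the
  sum is the inner product of \<open>convolution G h cyclic\<close> with \<eta>, where \<xi> and
  \<eta> both have norm at most \<open>sqrt C\<close>.\<close>

lemma coef_functional_le:
  assumes \<phi>: "\<phi> \<in> coef G C" and h: "h \<in> ell1 G"
  shows "cmod (\<Sum>\<^sub>\<infinity>x\<in>carrier G. \<phi> x * h x) \<le> C * cstar_norm G h"
proof -
  obtain p where dom: "dominates G C p \<phi>" "\<phi> \<in> functions_on G" using \<phi> by (auto simp: coef_def)
  interpret gns G p by unfold_locales (use dom in \<open>simp add: dominates_def\<close>)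
  let ?v = "\<lambda>x. cnj (\<phi> x)"
  note v = dominated_H[OF dom]
  have C: "C \<ge> 0" by (rule coef_nonneg[OF \<phi>])
  have "(\<Sum>\<^sub>\<infinity>x\<in>carrier G. \<phi> x * h x) = (\<Sum>\<^sub>\<infinity>x\<in>carrier G. h x * hip (left_translate G (inv x) cyclic) ?v)"
    by (rule infsum_cong) (simp add: cyclic_coef[OF v(1)] mult.commute)
  then have eq: "(\<Sum>\<^sub>\<infinity>x\<in>carrier G. \<phi> x * h x) = hip (convolution G h cyclic) ?v"
    using hip_convolution[OF h cyclic_H v(1)] by simp
  have "cmod (hip (convolution G h cyclic) ?v) \<le> ip_norm hip (convolution G h cyclic) * ip_norm hip ?v"
    by (rule Hs.Cauchy_Schwarz[OF convolution_H[OF h cyclic_H] v(1)])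
  also have "\<dots> \<le> (operator_norm H hip (convolution G h) * ip_norm hip cyclic) * ip_norm hip ?v"
    by (intro mult_right_mono R.operator_norm_bound h cyclic_H) (simp add: hip_norm v hn_nonneg)
  also have "\<dots> = operator_norm H hip (convolution G h) * (hn cyclic * hn ?v)"
    by (simp add: hip_norm cyclic_H v)
  also have "\<dots> \<le> cstar_norm G h * (hn cyclic * hn ?v)"
    by (intro mult_right_mono operator_norm_le_cstar_norm h convolution_star_rep mult_nonneg_nonneg
        hn_nonneg cyclic_H v)
  also have "\<dots> \<le> cstar_norm G h * (sqrt C * sqrt C)"
  proof (intro mult_left_mono mult_mono)
    show "hn cyclic \<le> sqrt C" using dom by (simp add: hn_cyclic dominates_def)
    have "0 \<le> operator_norm H hip (convolution G h)"
      using R.operator_norm_upper[OF h H_rules(1)] H_rules(1) R.op_zero[OF h]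
      by (simp add: ip_norm_def Hs.ip_zero)
    also have "\<dots> \<le> cstar_norm G h"
      by (rule operator_norm_le_cstar_norm[OF h convolution_star_rep])
    finally show "0 \<le> cstar_norm G h" .
  qed (use C v in \<open>auto simp: hn_nonneg\<close>)
  finally show ?thesis using C by (simp add: eq mult.commute)
qed

end

subsection \<open>The norm of the Fourier--Stieltjes algebra\<close>

lemma continuous_on_fst_eval: "continuous_on S (\<lambda>w :: ('a \<Rightarrow> complex) \<times> ('a \<Rightarrow> complex). fst w x)"
  by (rule continuous_on_product_then_coordinatewise[OF continuous_on_fst[OF continuous_on_id]])

lemma continuous_on_snd_eval: "continuous_on S (\<lambda>w :: ('a \<Rightarrow> complex) \<times> ('a \<Rightarrow> complex). snd w x)"
  by (rule continuous_on_product_then_coordinatewise[OF continuous_on_snd[OF continuous_on_id]])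

lemma compact_bounded_functions: "compact {f :: 'a \<Rightarrow> complex. \<forall>x. cmod (f x) \<le> M}"
proof -
  have "{f :: 'a \<Rightarrow> complex. \<forall>x. cmod (f x) \<le> M} = PiE UNIV (\<lambda>_. cball 0 M)"
    by (auto simp: PiE_iff)
  moreover have "compactin (product_topology (\<lambda>_ :: 'a. euclidean :: complex topology) UNIV) (PiE UNIV (\<lambda>_. cball 0 M))"
    by (subst compactin_PiE) auto
  ultimately show ?thesis by (simp add: euclidean_product_topology)
qed

context group
begin

text \<open>The witness is kept because for pairs all conditions are closed under pointwise
  convergence, whereas \<open>coef G C\<close> is only a projection of this set.\<close>

definition dominating_pairs :: "real \<Rightarrow> (('a \<Rightarrow> complex) \<times> ('a \<Rightarrow> complex)) set" where
  "dominating_pairs C = {w. dominates G C (fst w) (snd w) \<and> snd w \<in> functions_on G}"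

lemma closed_functions_on:
  fixes F :: "'c :: topological_space \<Rightarrow> 'a \<Rightarrow> complex"
  assumes "\<And>x. continuous_on UNIV (\<lambda>w. F w x)"
  shows "closed {w. F w \<in> functions_on G}"
proof -
  have "{w. F w \<in> functions_on G} = (\<Inter>x\<in>- carrier G. {w. F w x = 0})"
    by (auto simp: functions_on_def)
  then show ?thesis using assms by (auto intro!: closed_Collect_eq)
qed

lemma closed_dominating_pairs: "closed (dominating_pairs C)"
proof -
  have kf: "continuous_on UNIV (\<lambda>w :: ('a \<Rightarrow> complex) \<times> ('a \<Rightarrow> complex). kform (gker G (fst w)) c c)" for c
    unfolding kform_def pairing_def gker_def
    by (intro continuous_intros continuous_on_fst_eval)
  have pr: "continuous_on UNIV (\<lambda>w :: ('a \<Rightarrow> complex) \<times> ('a \<Rightarrow> complex). pairing c (snd w))" for c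
    unfolding pairing_def by (intro continuous_intros continuous_on_snd_eval)
  have "dominating_pairs C = {w. fst w \<in> functions_on G} \<inter> {w. snd w \<in> functions_on G}
      \<inter> {w. Re (fst w \<one>) \<le> C}
      \<inter> (\<Inter>c\<in>fin_supp (carrier G). {w. Im (kform (gker G (fst w)) c c) = 0}
          \<inter> {w. 0 \<le> Re (kform (gker G (fst w)) c c)}
          \<inter> {w. (cmod (pairing c (snd w)))\<^sup>2 \<le> C * Re (kform (gker G (fst w)) c c)})"
    unfolding dominating_pairs_def dominates_def positive_definite_iff psd_kernel_def nonneg_Reals_iff
    by blast
  also have "closed \<dots>"
    by (intro closed_Int closed_INT ballI closed_functions_on closed_Collect_le closed_Collect_eq
        continuous_intros kf pr continuous_on_fst_eval continuous_on_snd_eval)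
  finally show ?thesis .
qed

text \<open>Both components are bounded by \<open>C\<close> at every point, so this is a closed
  subset of a product of discs.\<close>

lemma compact_dominating_pairs: "compact (dominating_pairs C)"
proof -
  let ?B = "{f :: 'a \<Rightarrow> complex. \<forall>x. cmod (f x) \<le> C}"
  have "dominating_pairs C \<subseteq> ?B \<times> ?B"
  proof
    fix w assume w: "w \<in> dominating_pairs C"
    then have p: "positive_definite G (fst w)" "Re (fst w \<one>) \<le> C"
      by (auto simp: dominating_pairs_def dominates_def)
    have "cmod (fst w x) \<le> C" for x
    proof (cases "x \<in> carrier G")
      case True
      then show ?thesis using positive_definite_cmod_le[OF p(1) True] p(2) by simp
    next
      case False
      then have "fst w x = 0" using p(1) by (simp add: positive_definite_def functions_on_def)
      then show ?thesis using p positive_definite_one(2)[OF p(1)] by simp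
    qed
    moreover have "cmod (snd w x) \<le> C" for x
      using w by (intro coef_cmod_le) (auto simp: dominating_pairs_def coef_def)
    ultimately show "w \<in> ?B \<times> ?B" by (simp add: mem_Times_iff)
  qed
  then have "dominating_pairs C = dominating_pairs C \<inter> (?B \<times> ?B)" by blast
  also have "compact \<dots>"
    by (intro closed_Int_compact closed_dominating_pairs compact_Times compact_bounded_functions)
  finally show ?thesis .
qed

lemma coef_iff_pairs: "\<phi> \<in> coef G C \<longleftrightarrow> (\<exists>w\<in>dominating_pairs C. snd w = \<phi>)"
  by (auto simp: coef_def dominating_pairs_def)

lemma coef_convex:
  assumes "\<phi> \<in> coef G C" "\<psi> \<in> coef G C" "0 \<le> r" "r \<le> 1"
  shows "\<phi> + fscale (of_real r) (\<psi> - \<phi>) \<in> coef G C"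
proof -
  have "\<phi> + fscale (of_real r) (\<psi> - \<phi>) = fscale (of_real (1 - r)) \<phi> + fscale (of_real r) \<psi>"
    by (rule ext) (simp add: fscale_apply algebra_simps)
  moreover have "fscale (of_real (1 - r)) \<phi> + fscale (of_real r) \<psi> \<in> coef G (cmod (of_real (1 - r)) * C + cmod (of_real r) * C)"
    by (intro coef_add coef_scale assms)
  moreover have "cmod (of_real (1 - r)) * C + cmod (of_real r) * C = C"
  proof -
    have "cmod (of_real (1 - r)) = 1 - r" "cmod (of_real r) = r"
      using assms(3,4) by (simp_all only: norm_of_real abs_of_nonneg diff_ge_0_iff_ge)
    then show ?thesis by (simp only:) (simp add: algebra_simps)
  qed
  ultimately show ?thesis by (simp only:)
qed

text \<open>The separating functional is the conjugate of \<open>f - \<phi>\<^sub>0\<close>, where \<open>\<phi>\<^sub>0\<close> minimizes the distance to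
  \<open>f\<close> on a finite set that distinguishes \<open>f\<close> from all members of the compact convex set.\<close>

theorem coef_separation:
  assumes f: "f \<in> functions_on G" "f \<notin> coef G C" and "C \<ge> 0"
  obtains c \<beta> where "c \<in> fin_supp (carrier G)" "\<And>\<phi>. \<phi> \<in> coef G C \<Longrightarrow> Re (pairing c \<phi>) \<le> \<beta>"
    "\<beta> < Re (pairing c f)"
proof -
  \<comment> \<open>If on every finite set some member of \<open>coef G C\<close> agreed with
    \<open>f\<close>, the finite intersection property would produce one that agrees with
    \<open>f\<close> everywhere.\<close>
  have "\<exists>A. finite A \<and> A \<subseteq> carrier G \<and> (\<forall>\<phi>\<in>coef G C. \<exists>x\<in>A. \<phi> x \<noteq> f x)"
  proof (rule ccontr)
    assume neg: "\<not> ?thesis"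
    have agree: "\<exists>\<phi>\<in>coef G C. \<forall>x\<in>A. \<phi> x = f x" if "finite A" "A \<subseteq> carrier G" for A
      using neg[unfolded not_ex, rule_format, of A] that by blast
    let ?T = "\<lambda>x. {w :: ('a \<Rightarrow> complex) \<times> ('a \<Rightarrow> complex). snd w x = f x}"
    have "dominating_pairs C \<inter> \<Inter>(?T ` carrier G) \<noteq> {}"
    proof (rule compact_imp_fip[OF compact_dominating_pairs])
      show "closed T" if "T \<in> ?T ` carrier G" for T
        using that by (auto intro!: closed_Collect_eq continuous_on_snd_eval continuous_on_const)
      fix F' assume "finite F'" "F' \<subseteq> ?T ` carrier G"
      then obtain A where A: "A \<subseteq> carrier G" "finite A" "F' = ?T ` A"
        using finite_subset_image by meson
      then obtain \<phi> where "\<phi> \<in> coef G C" "\<forall>x\<in>A. \<phi> x = f x" using agree by blast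
      then obtain w where "w \<in> dominating_pairs C" "\<forall>x\<in>A. snd w x = f x"
        using coef_iff_pairs by auto
      then show "dominating_pairs C \<inter> \<Inter>F' \<noteq> {}" using A(3) by blast
    qed
    then obtain w where w: "w \<in> dominating_pairs C" "\<forall>x\<in>carrier G. snd w x = f x" by blast
    then have "snd w = f"
      using f(1) by (intro ext) (auto simp: dominating_pairs_def functions_on_def)
    then show False using w(1) f(2) coef_iff_pairs by blast
  qed
  then obtain A where A: "finite A" "A \<subseteq> carrier G" "\<And>\<phi>. \<phi> \<in> coef G C \<Longrightarrow> \<exists>x\<in>A. \<phi> x \<noteq> f x" by blast
  define D where "D \<phi> = (\<Sum>x\<in>A. (cmod (\<phi> x - f x))\<^sup>2)" for \<phi>
  have "continuous_on (dominating_pairs C) (\<lambda>w. D (snd w))"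
    unfolding D_def by (intro continuous_intros continuous_on_snd_eval)
  moreover have "dominating_pairs C \<noteq> {}" using coef_zero[OF \<open>C \<ge> 0\<close>] coef_iff_pairs by auto
  ultimately obtain w0 where w0: "w0 \<in> dominating_pairs C" "\<And>w. w \<in> dominating_pairs C \<Longrightarrow> D (snd w0) \<le> D (snd w)"
    using continuous_attains_inf[OF compact_dominating_pairs] by blast
  define \<phi>0 where "\<phi>0 = snd w0"
  have \<phi>0: "\<phi>0 \<in> coef G C" "\<And>\<phi>. \<phi> \<in> coef G C \<Longrightarrow> D \<phi>0 \<le> D \<phi>"
    using w0 coef_iff_pairs by (auto simp: \<phi>0_def)
  define c where "c x = (if x \<in> A then cnj (f x - \<phi>0 x) else 0)" for x
  have supp: "{x. c x \<noteq> 0} \<subseteq> A" by (auto simp: c_def)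
  have c: "c \<in> fin_supp (carrier G)"
    using A supp by (auto simp: fin_supp_def finite_subset)
  have pair: "pairing c \<phi> = (\<Sum>x\<in>A. cnj (f x - \<phi>0 x) * \<phi> x)" for \<phi>
    unfolding pairing_superset[OF A(1) supp] by (rule sum.cong) (auto simp: c_def)
  have le: "Re (pairing c \<phi>) \<le> Re (pairing c \<phi>0)" if \<phi>: "\<phi> \<in> coef G C" for \<phi>
  proof -
    define E where "E = (\<Sum>x\<in>A. (cmod (\<phi> x - \<phi>0 x))\<^sup>2)"
    \<comment> \<open>First variation of the distance at its minimizer, along the segment towards
      \<phi>; by convexity the segment stays in \<open>coef G C\<close> for
      \<open>r \<le> 1\<close>.\<close>
    have expand: "2 * Re (pairing c \<phi> - pairing c \<phi>0) \<le> r * E" if r: "0 < r" "r \<le> 1" for r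
    proof -
      have "D \<phi>0 \<le> D (\<phi>0 + fscale (of_real r) (\<phi> - \<phi>0))"
        using r by (intro \<phi>0(2) coef_convex \<phi> \<phi>0(1)) auto
      also have "\<dots> = (\<Sum>x\<in>A. (cmod (\<phi>0 x - f x))\<^sup>2 - 2 * r * Re (cnj (f x - \<phi>0 x) * (\<phi> x - \<phi>0 x)) + r\<^sup>2 * (cmod (\<phi> x - \<phi>0 x))\<^sup>2)"
        unfolding D_def
      proof (rule sum.cong[OF refl])
        fix x
        have e: "(\<phi>0 + fscale (of_real r) (\<phi> - \<phi>0)) x - f x = (\<phi>0 x - f x) + of_real r * (\<phi> x - \<phi>0 x)"
          by (simp add: fscale_apply)
        show "(cmod ((\<phi>0 + fscale (of_real r) (\<phi> - \<phi>0)) x - f x))\<^sup>2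
          = (cmod (\<phi>0 x - f x))\<^sup>2 - 2 * r * Re (cnj (f x - \<phi>0 x) * (\<phi> x - \<phi>0 x)) + r\<^sup>2 * (cmod (\<phi> x - \<phi>0 x))\<^sup>2"
          unfolding e by (simp add: cmod_power2) (simp add: power2_eq_square algebra_simps)
      qed
      also have "\<dots> = D \<phi>0 - 2 * r * Re (pairing c \<phi> - pairing c \<phi>0) + r\<^sup>2 * E"
        by (simp only: D_def E_def pair sum.distrib sum_subtractf sum_distrib_left Re_sum
            right_diff_distrib minus_complex.sel)
      finally have "r * (2 * Re (pairing c \<phi> - pairing c \<phi>0)) \<le> r * (r * E)"
        by (simp add: power2_eq_square algebra_simps)
      then show ?thesis using r(1) by (simp only: mult_le_cancel_left_pos)
    qed
    have E: "E \<ge> 0" by (simp add: E_def sum_nonneg)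
    have "2 * Re (pairing c \<phi> - pairing c \<phi>0) \<le> 0"
    proof (rule field_le_epsilon)
      fix e :: real assume e: "e > 0"
      let ?r = "min 1 (e / (E + 1))"
      have "?r * E \<le> e / (E + 1) * E" using E by (intro mult_right_mono) auto
      also have "\<dots> \<le> e" using e E by (simp add: field_simps)
      finally show "2 * Re (pairing c \<phi> - pairing c \<phi>0) \<le> 0 + e"
        using expand[of ?r] e E by simp
    qed
    then show ?thesis by simp
  qed
  have "Re (pairing c f - pairing c \<phi>0) = D \<phi>0"
  proof -
    have "pairing c f - pairing c \<phi>0 = (\<Sum>x\<in>A. of_real ((cmod (\<phi>0 x - f x))\<^sup>2))"
      unfolding pair sum_subtractf[symmetric]
    proof (rule sum.cong[OF refl])
      fix x
      have "cnj (f x - \<phi>0 x) * f x - cnj (f x - \<phi>0 x) * \<phi>0 x = (f x - \<phi>0 x) * cnj (f x - \<phi>0 x)"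
        by (simp add: algebra_simps)
      also have "\<dots> = of_real ((cmod (f x - \<phi>0 x))\<^sup>2)" by (rule complex_norm_square[symmetric])
      finally show "cnj (f x - \<phi>0 x) * f x - cnj (f x - \<phi>0 x) * \<phi>0 x = of_real ((cmod (\<phi>0 x - f x))\<^sup>2)"
        by (simp add: norm_minus_commute)
    qed
    then show ?thesis by (simp add: D_def del: of_real_power)
  qed
  moreover have "D \<phi>0 > 0"
  proof -
    obtain x where x: "x \<in> A" "\<phi>0 x \<noteq> f x" using A(3)[OF \<phi>0(1)] by blast
    have "0 < (cmod (\<phi>0 x - f x))\<^sup>2" using x(2) by simp
    also have "\<dots> \<le> D \<phi>0" unfolding D_def by (rule member_le_sum) (use A(1) x(1) in auto)
    finally show ?thesis .
  qed
  ultimately have "Re (pairing c \<phi>0) < Re (pairing c f)" by simp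
  with c le show thesis by (rule that)
qed

text \<open>A separating functional has finite support, so its inequality passes to pointwise
  limits.\<close>

lemma coef_limit:
  assumes \<phi>: "\<And>n. \<phi> n \<in> coef G C" and lim: "\<And>x. (\<lambda>n. \<phi> n x) \<longlonglongrightarrow> f x"
  shows "f \<in> coef G C"
proof (rule ccontr)
  assume nf: "f \<notin> coef G C"
  have "f x = 0" if "x \<notin> carrier G" for x
  proof -
    have "\<And>n. \<phi> n x = 0" using coef_functions_on[OF \<phi>] that by (simp add: functions_on_def)
    then show ?thesis using lim[of x] by (simp add: LIMSEQ_const_iff)
  qed
  then have "f \<in> functions_on G" by (simp add: functions_on_def)
  then obtain c \<beta> where c: "c \<in> fin_supp (carrier G)" "\<And>\<phi>. \<phi> \<in> coef G C \<Longrightarrow> Re (pairing c \<phi>) \<le> \<beta>"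
    "\<beta> < Re (pairing c f)"
    using coef_separation[OF _ nf coef_nonneg[OF \<phi>]] by blast
  have "(\<lambda>n. Re (pairing c (\<phi> n))) \<longlonglongrightarrow> Re (pairing c f)"
    unfolding pairing_def by (intro tendsto_intros lim)
  then have "Re (pairing c f) \<le> \<beta>"
    by (rule LIMSEQ_le_const2) (use c(2)[OF \<phi>] in blast)
  with c(3) show False by simp
qed

lemma coef_functional_le':
  assumes "f \<in> coef G C" "h \<in> ell1 G" "cstar_norm G h \<le> 1"
  shows "cmod (\<Sum>\<^sub>\<infinity>x\<in>carrier G. f x * h x) \<le> C"
proof -
  have "C * cstar_norm G h \<le> C * 1"
    using assms(3) coef_nonneg[OF assms(1)] by (rule mult_left_mono)
  then show ?thesis using coef_functional_le[OF assms(1,2)] by simp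
qed

lemma B_norm_set_bdd:
  assumes "f \<in> coef G C"
  shows "bdd_above {cmod (\<Sum>\<^sub>\<infinity>x\<in>carrier G. f x * h x) | h. h \<in> ell1 G \<and> cstar_norm G h \<le> 1}"
  by (rule bdd_aboveI[of _ C]) (use coef_functional_le'[OF assms] in blast)

lemma B_norm_set_bdd':
  assumes "f \<in> B_discrete G"
  shows "bdd_above {cmod (\<Sum>\<^sub>\<infinity>x\<in>carrier G. f x * h x) | h. h \<in> ell1 G \<and> cstar_norm G h \<le> 1}"
proof -
  obtain C where "f \<in> coef G C" using assms by (rule B_discrete_imp_coef)
  then show ?thesis by (rule B_norm_set_bdd)
qed

lemma B_norm_set_zero:
  "0 \<in> {cmod (\<Sum>\<^sub>\<infinity>x\<in>carrier G. f x * h x) | h. h \<in> ell1 G \<and> cstar_norm G h \<le> 1}"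
proof -
  have "cstar_norm G 0 \<le> 1"
    using cstar_norm_le_l1[OF ell1_rules(1)] by (simp add: l1_norm_def)
  then show ?thesis using ell1_rules(1)[of G] by (auto intro!: exI[of _ 0])
qed

lemma B_norm_le_coef: "f \<in> coef G C \<Longrightarrow> B_norm G f \<le> C"
  unfolding B_norm_def
proof (rule cSup_least)
  assume f: "f \<in> coef G C"
  show "r \<le> C" if "r \<in> {cmod (\<Sum>\<^sub>\<infinity>x\<in>carrier G. f x * h x) | h. h \<in> ell1 G \<and> cstar_norm G h \<le> 1}" for r
    using that coef_functional_le'[OF f] by blast
qed (use B_norm_set_zero in blast)

lemma B_norm_nonneg: "f \<in> B_discrete G \<Longrightarrow> 0 \<le> B_norm G f"
  unfolding B_norm_def
  by (rule cSup_upper[OF B_norm_set_zero B_norm_set_bdd'])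

lemma B_norm_upper:
  assumes "f \<in> B_discrete G" "h \<in> ell1 G" "cstar_norm G h \<le> 1"
  shows "cmod (\<Sum>\<^sub>\<infinity>x\<in>carrier G. f x * h x) \<le> B_norm G f"
  unfolding B_norm_def
  by (rule cSup_upper[OF _ B_norm_set_bdd'[OF assms(1)]]) (use assms(2,3) in blast)

lemma B_norm_cmod_le: "f \<in> B_discrete G \<Longrightarrow> cmod (f x) \<le> B_norm G f"
proof (cases "x \<in> carrier G")
  case True
  assume f: "f \<in> B_discrete G"
  have "cstar_norm G (delta x) \<le> 1"
    using cstar_norm_le_l1[OF delta_ell1[OF True]] l1_norm_delta[OF True] by simp
  then have "cmod (\<Sum>\<^sub>\<infinity>y\<in>carrier G. f y * delta x y) \<le> B_norm G f"
    by (rule B_norm_upper[OF f delta_ell1[OF True]])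
  then show ?thesis using delta_infsum[OF True, of f] by (simp add: mult.commute)
next
  case False
  assume f: "f \<in> B_discrete G"
  then have "f x = 0" using False coef_functions_on B_discrete_iff_coef by (auto simp: functions_on_def)
  then show ?thesis using B_norm_nonneg[OF f] by simp
qed

text \<open>The bipolar argument. If \<open>c\<close> separates \<open>f\<close> from
  \<open>coef G C\<close>, then its bound on \<open>coef G C\<close> limits its C*-norm through
  \<open>cstar_norm_le_coef\<close>; normalized, it would take a value larger than
  \<open>B_norm G f\<close> on \<open>f\<close>.\<close>

lemma coef_if_B_norm_less:
  assumes f: "f \<in> B_discrete G" and C: "B_norm G f \<le> C" "0 < C"
  shows "f \<in> coef G C"
proof (rule ccontr)
  assume nf: "f \<notin> coef G C"
  have "f \<in> functions_on G" using f B_discrete_iff_coef coef_functions_on by blast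
  then obtain c \<beta> where c: "c \<in> fin_supp (carrier G)" "\<And>\<phi>. \<phi> \<in> coef G C \<Longrightarrow> Re (pairing c \<phi>) \<le> \<beta>"
    "\<beta> < Re (pairing c f)"
    using coef_separation[OF _ nf] C by (metis less_imp_le)
  \<comment> \<open>\<open>coef G C\<close> is stable under multiplication by phases, which upgrades
    the bound on real parts to a bound on moduli.\<close>
  have bound: "cmod (pairing c \<phi>) \<le> \<beta>" if \<phi>: "\<phi> \<in> coef G C" for \<phi>
  proof (cases "pairing c \<phi> = 0")
    case True
    then show ?thesis using c(2)[OF \<phi>] by simp
  next
    case False
    let ?t = "cnj (pairing c \<phi>) / of_real (cmod (pairing c \<phi>))"
    have "cmod ?t = 1" using False by (simp add: norm_divide)
    then have "fscale ?t \<phi> \<in> coef G C" using coef_scale[OF \<phi>, of ?t] by simp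
    then have "Re (pairing c (fscale ?t \<phi>)) \<le> \<beta>" by (rule c(2))
    moreover have "pairing c (fscale ?t \<phi>) = of_real (cmod (pairing c \<phi>))"
    proof -
      have "pairing c (fscale ?t \<phi>) = (pairing c \<phi> * cnj (pairing c \<phi>)) / of_real (cmod (pairing c \<phi>))"
        unfolding fscale_def pairing_scale_right by simp
      then show ?thesis using False by (simp add: complex_norm_square[symmetric] power2_eq_square)
    qed
    ultimately show ?thesis by simp
  qed
  define t where "t = Re (pairing c f)"
  have "0 \<le> \<beta>" using bound[OF coef_zero] C by (simp add: pairing_def)
  then have t: "t > 0" "\<beta> < t" using c(3) by (auto simp: t_def)
  \<comment> \<open>The midpoint of \<beta> and \<open>t\<close>, divided by \<open>C\<close>,
    instead of \<open>\<beta> / C\<close>: it is positive even when \<beta> is 0, so that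
    \<open>c\<close> can be divided by it.\<close>
  define s where "s = (\<beta> + t) / (2 * C)"
  have s: "s > 0" "s * C < t" using t C \<open>0 \<le> \<beta>\<close> by (auto simp: s_def)
  let ?h = "fscale (of_real (1 / s)) c"
  have h: "?h \<in> fin_supp (carrier G)" by (intro fin_supp_rules c)
  have "cstar_norm G ?h \<le> 1"
  proof (rule cstar_norm_le_coef[OF h])
    fix \<phi> assume "\<phi> \<in> coef G 1"
    then have "fscale (of_real C) \<phi> \<in> coef G C" using coef_scale[of \<phi> 1 "of_real C"] C by simp
    then have "cmod (pairing c (fscale (of_real C) \<phi>)) \<le> \<beta>" by (rule bound)
    then have "C * cmod (pairing c \<phi>) \<le> \<beta>"
      unfolding fscale_def pairing_scale_right using C by (simp add: norm_mult)
    also have "\<beta> \<le> s * C" using C t by (simp add: s_def)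
    finally have "cmod (pairing c \<phi>) \<le> s" using C by (simp add: mult.commute)
    then show "cmod (pairing ?h \<phi>) \<le> 1"
      using s by (simp add: pairing_scale_left norm_mult norm_divide)
  qed
  then have "cmod (\<Sum>\<^sub>\<infinity>x\<in>carrier G. f x * ?h x) \<le> B_norm G f"
    by (rule B_norm_upper[OF f fin_supp_ell1[OF h]])
  also have "(\<Sum>\<^sub>\<infinity>x\<in>carrier G. f x * ?h x) = pairing ?h f"
    using infsum_fin_supp[OF h, of f] by (simp add: mult.commute)
  also have "cmod (pairing ?h f) = cmod (pairing c f) / s"
    using s by (simp add: pairing_scale_left norm_mult norm_divide)
  finally have "cmod (pairing c f) / s \<le> C" using C(1) by linarith
  then have "cmod (pairing c f) \<le> C * s" using s by (simp add: divide_le_eq)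
  then show False using s complex_Re_le_cmod[of "pairing c f"] by (simp add: t_def mult.commute)
qed

theorem B_norm_le_iff:
  assumes f: "f \<in> B_discrete G" and C: "0 \<le> C"
  shows "B_norm G f \<le> C \<longleftrightarrow> f \<in> coef G C"
proof
  assume le: "B_norm G f \<le> C"
  show "f \<in> coef G C"
  proof (cases "C = 0")
    case True
    have "f x = 0" for x
      using order_trans[OF B_norm_cmod_le[OF f, of x] le] True by simp
    then have "f = 0" by (intro ext) simp
    then show ?thesis using coef_zero[OF C] by simp
  next
    case False
    then show ?thesis using coef_if_B_norm_less[OF f le] C by simp
  qed
qed (rule B_norm_le_coef)

lemma B_discrete_coef: "f \<in> B_discrete G \<Longrightarrow> f \<in> coef G (B_norm G f)"
  using B_norm_le_iff B_norm_nonneg by blast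

lemma B_discrete_subspace: "complex_subspace (B_discrete G)"
proof -
  have "0 \<in> B_discrete G" by (rule coef_imp_B_discrete[OF coef_zero[OF order_refl]])
  moreover have "u + v \<in> B_discrete G" if "u \<in> B_discrete G" "v \<in> B_discrete G" for u v
    using that coef_imp_B_discrete[OF coef_add] by (metis B_discrete_iff_coef)
  moreover have "fscale c v \<in> B_discrete G" if "v \<in> B_discrete G" for c v
    using that coef_imp_B_discrete[OF coef_scale] by (metis B_discrete_iff_coef)
  ultimately show ?thesis by (simp add: complex_subspace_def)
qed

lemmas B_discrete_rules = complex_subspaceD[OF B_discrete_subspace]

lemma B_discrete_mult: "f \<in> B_discrete G \<Longrightarrow> g \<in> B_discrete G \<Longrightarrow> f * g \<in> B_discrete G"
  using coef_imp_B_discrete[OF coef_mult] by (metis B_discrete_iff_coef)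

lemma B_norm_mult:
  "f \<in> B_discrete G \<Longrightarrow> g \<in> B_discrete G \<Longrightarrow> B_norm G (f * g) \<le> B_norm G f * B_norm G g"
  by (intro B_norm_le_coef coef_mult B_discrete_coef)

lemma B_norm_add:
  "f \<in> B_discrete G \<Longrightarrow> g \<in> B_discrete G \<Longrightarrow> B_norm G (f + g) \<le> B_norm G f + B_norm G g"
  by (intro B_norm_le_coef coef_add B_discrete_coef)

lemma B_norm_scale_le: "f \<in> B_discrete G \<Longrightarrow> B_norm G (fscale t f) \<le> cmod t * B_norm G f"
  by (intro B_norm_le_coef coef_scale B_discrete_coef)

lemma B_norm_scale:
  assumes f: "f \<in> B_discrete G"
  shows "B_norm G (fscale t f) = cmod t * B_norm G f"
proof (rule antisym[OF B_norm_scale_le[OF f]])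
  show "cmod t * B_norm G f \<le> B_norm G (fscale t f)"
  proof (cases "t = 0")
    case True
    then show ?thesis using B_norm_nonneg[OF B_discrete_rules(3)[OF f], of t] by simp
  next
    case False
    have "f = fscale (inverse t) (fscale t f)" using False by (simp add: fscale_algebra)
    then have "B_norm G f \<le> B_norm G (fscale t f) / cmod t"
      using B_norm_scale_le[OF B_discrete_rules(3)[OF f, of t], of "inverse t"]
      by (simp add: norm_inverse divide_inverse mult.commute)
    then show ?thesis using False by (simp add: le_divide_eq mult.commute)
  qed
qed

lemma B_norm_minus_commute:
  "f \<in> B_discrete G \<Longrightarrow> g \<in> B_discrete G \<Longrightarrow> B_norm G (f - g) = B_norm G (g - f)"
proof -
  assume "f \<in> B_discrete G" "g \<in> B_discrete G"
  moreover have "f - g = fscale (-1) (g - f)" by (rule ext) (simp add: fscale_apply)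
  ultimately show ?thesis using B_norm_scale[of "g - f" "-1"] B_discrete_rules(4)[of g f] by simp
qed

lemma B_norm_norm_on: "norm_on (B_discrete G) (B_norm G)"
  unfolding norm_on_def
proof (intro conjI ballI allI)
  fix v assume v: "v \<in> B_discrete G"
  show "B_norm G v = 0 \<longleftrightarrow> v = 0"
  proof
    assume "B_norm G v = 0"
    then have "v x = 0" for x using B_norm_cmod_le[OF v, of x] by simp
    then show "v = 0" by (intro ext) simp
  next
    assume "v = 0"
    then show "B_norm G v = 0"
      using B_norm_le_coef[OF coef_zero[OF order_refl]] B_norm_nonneg[OF v] by simp
  qed
qed (auto simp: B_norm_nonneg B_norm_scale B_norm_add)

text \<open>The limit is taken pointwise. Since the balls are closed under pointwise limits, the
  Cauchy estimate for a tail holds for the limit too, which gives membership and norm convergence at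
  once.\<close>

lemma B_discrete_complete:
  fixes s :: "nat \<Rightarrow> 'a \<Rightarrow> complex"
  assumes s: "\<And>k. s k \<in> B_discrete G" and cauchy: "\<forall>e>0. \<exists>M. \<forall>j\<ge>M. \<forall>k\<ge>M. B_norm G (s j - s k) < e"
  obtains l where "l \<in> B_discrete G" "(\<lambda>k. B_norm G (s k - l)) \<longlonglongrightarrow> 0"
proof -
  have "Cauchy (\<lambda>n. s n x)" for x
  proof (rule metric_CauchyI)
    fix e :: real assume "e > 0"
    then obtain M where M: "\<forall>j\<ge>M. \<forall>k\<ge>M. B_norm G (s j - s k) < e" using cauchy by blast
    have "dist (s j x) (s k x) < e" if "j \<ge> M" "k \<ge> M" for j k
      using B_norm_cmod_le[OF B_discrete_rules(4)[OF s s], of j k x] M that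
      by (auto simp: dist_norm intro: order_le_less_trans)
    then show "\<exists>M. \<forall>m\<ge>M. \<forall>n\<ge>M. dist (s m x) (s n x) < e" by blast
  qed
  then have "\<forall>x. \<exists>l. (\<lambda>n. s n x) \<longlonglongrightarrow> l" by (meson Cauchy_convergent convergent_def)
  then obtain l where l: "\<And>x. (\<lambda>n. s n x) \<longlonglongrightarrow> l x" by metis
  have tail: "s j - l \<in> coef G e" if M: "\<forall>j\<ge>M. \<forall>k\<ge>M. B_norm G (s j - s k) < e" and "j \<ge> M" for M j e
  proof (rule coef_limit)
    show "s j - s (n + M) \<in> coef G e" for n
      using M \<open>j \<ge> M\<close> by (intro coef_mono[OF B_discrete_coef] B_discrete_rules s) (simp add: less_imp_le)
    show "(\<lambda>n. (s j - s (n + M)) x) \<longlonglongrightarrow> (s j - l) x" for x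
      using tendsto_diff[OF tendsto_const LIMSEQ_ignore_initial_segment[OF l[of x], of M]] by simp
  qed
  obtain M where M: "\<forall>j\<ge>M. \<forall>k\<ge>M. B_norm G (s j - s k) < 1" using cauchy zero_less_one by blast
  have "s M - l \<in> B_discrete G"
    using tail[OF M order_refl] coef_imp_B_discrete by blast
  then have "s M - (s M - l) \<in> B_discrete G" by (rule B_discrete_rules(4)[OF s])
  moreover have "s M - (s M - l) = l" by (rule ext) simp
  ultimately have lB: "l \<in> B_discrete G" by simp
  have "(\<lambda>k. B_norm G (s k - l)) \<longlonglongrightarrow> 0"
  proof (rule LIMSEQ_I)
    fix r :: real assume r: "r > 0"
    then obtain M where M: "\<forall>j\<ge>M. \<forall>k\<ge>M. B_norm G (s j - s k) < r / 2" using cauchy half_gt_zero by blast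
    have "norm (B_norm G (s n - l) - 0) < r" if "n \<ge> M" for n
      using B_norm_le_coef[OF tail[OF M that]] B_norm_nonneg[OF B_discrete_rules(4)[OF s lB], of n] r by simp
    then show "\<exists>N. \<forall>n\<ge>N. norm (B_norm G (s n - l) - 0) < r" by blast
  qed
  with lB show thesis by (rule that)
qed

end

subsection \<open>Translations, averages and homomorphisms\<close>

lemma kform_deltas2:
  assumes "\<And>i. i \<in> I \<Longrightarrow> x i \<in> X" "\<And>j. j \<in> I \<Longrightarrow> z j \<in> X"
  shows "kform k (\<Sum>i\<in>I. fscale (c i) (delta (x i))) (\<Sum>j\<in>I. fscale (d j) (delta (z j)))
       = (\<Sum>i\<in>I. \<Sum>j\<in>I. c i * cnj (d j) * k (x i) (z j))"
proof -
  have "kform k (\<Sum>i\<in>I. fscale (c i) (delta (x i))) (\<Sum>j\<in>I. fscale (d j) (delta (z j)))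
      = (\<Sum>i\<in>I. kform k (fscale (c i) (delta (x i))) (\<Sum>j\<in>I. fscale (d j) (delta (z j))))"
    by (rule kform_sum_left[of _ _ X]) (intro fin_supp_rules delta_in_fin_supp assms)
  also have "\<dots> = (\<Sum>i\<in>I. \<Sum>j\<in>I. kform k (fscale (c i) (delta (x i))) (fscale (d j) (delta (z j))))"
    by (intro sum.cong refl kform_sum_right[of _ _ X] fin_supp_rules delta_in_fin_supp assms)
  finally show ?thesis by (simp add: kform_scale_left kform_scale_right mult_ac)
qed

lemma pairing_deltas:
  assumes "\<And>i. i \<in> I \<Longrightarrow> x i \<in> X"
  shows "pairing (\<Sum>i\<in>I. fscale (c i) (delta (x i))) F = (\<Sum>i\<in>I. c i * F (x i))"
  by (subst pairing_sum_left[of _ _ X])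
    (use assms in \<open>auto simp: pairing_scale_left intro!: fin_supp_rules delta_in_fin_supp\<close>)

context gns
begin

lemma left_translate_J:
  assumes x: "x \<in> carrier G" and d: "d \<in> fin_supp (carrier G)"
  shows "left_translate G (inv x) (J d) = J (left_translate G (inv x) d)"
proof
  fix z
  show "left_translate G (inv x) (J d) z = J (left_translate G (inv x) d) z"
  proof (cases "z \<in> carrier G")
    case True
    have "pairing d (\<lambda>y. cnj (gker G p (inv x \<otimes> z) y)) = pairing d (\<lambda>y. cnj (gker G p z (x \<otimes> y)))"
      by (rule pairing_cong[OF d]) (use x True in \<open>simp add: gker_def inv_mult_group m_assoc\<close>)
    then show ?thesis using True x d by (simp add: left_translate_def[of G "inv x" "J d"] J_def pairing_left_translate)
  next
    case False
    then show ?thesis by (simp add: left_translate_def J_def)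
  qed
qed

text \<open>The square is expanded; since translations are unitary, only the diagonal coefficient of
  \<open>v\<close> remains.\<close>

lemma translate_distance:
  assumes v: "v \<in> H" and s: "s \<in> carrier G" and t: "t \<in> carrier G"
  shows "(hn (left_translate G (inv s) v - left_translate G (inv t) v))\<^sup>2
      = 2 * (Re (R.matrix_coef v v \<one>) - Re (R.matrix_coef v v (inv s \<otimes> t)))"
proof -
  have st: "left_translate G (inv s) v \<in> H" "left_translate G (inv t) v \<in> H"
    using s t v by (simp_all add: left_translate_H)
  have "hip (left_translate G (inv s) v) (left_translate G (inv t) v) = R.matrix_coef v v (inv t \<otimes> s)"
    using R.rep_unitary[OF s t v v] s t by (simp add: convolution_delta R.matrix_coef_def)
  also have "\<dots> = cnj (R.matrix_coef v v (inv s \<otimes> t))"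
    using positive_definite_inv[OF R.positive_definite_matrix_coef[OF v], of "inv s \<otimes> t"] s t
    by (simp add: inv_mult_group)
  finally have "Re (hip (left_translate G (inv s) v) (left_translate G (inv t) v)) = Re (R.matrix_coef v v (inv s \<otimes> t))"
    by simp
  moreover have "R.matrix_coef v v \<one> = of_real ((hn v)\<^sup>2)"
    using Hs.ip_self[OF v] hip_norm[OF v] R.rep_one[OF v] by (simp add: R.matrix_coef_def)
  ultimately show ?thesis
    using Hs.nrm_diff_sq[OF st] s t v
    by (simp add: hip_norm st H_rules(4)[OF st] hn_left_translate)
qed

end

context group
begin

text \<open>With \<open>f x = \<langle>\<pi>(x) \<xi>, \<eta>\<rangle>\<close> and \<open>\<xi>\<close> cyclic, \<open>q\<close> is the diagonal coefficient of \<open>\<eta>\<close>.\<close>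

theorem B_discrete_equicontinuous:
  assumes "f \<in> B_discrete G"
  obtains q K where "positive_definite G q" "K \<ge> 0"
    "\<And>s t y. \<lbrakk>s \<in> carrier G; t \<in> carrier G; y \<in> carrier G\<rbrakk> \<Longrightarrow>
       (cmod (f (inv s \<otimes> y) - f (inv t \<otimes> y)))\<^sup>2 \<le> K * (Re (q \<one>) - Re (q (inv s \<otimes> t)))"
    "\<And>e. e > 0 \<Longrightarrow> \<exists>d\<in>fin_supp (carrier G). \<forall>x\<in>carrier G. cmod (q x - pairing d (\<lambda>y. f (x \<otimes> y))) \<le> e"
proof -
  obtain C where "f \<in> coef G C" using assms by (rule B_discrete_imp_coef)
  then obtain p where dom: "dominates G C p f" "f \<in> functions_on G" by (auto simp: coef_def)
  interpret gns G p by unfold_locales (use dom in \<open>simp add: dominates_def\<close>)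
  define v where "v = (\<lambda>x. cnj (f x))"
  have v: "v \<in> H" unfolding v_def by (rule dominated_H[OF dom])
  define q where "q = R.matrix_coef v v"
  have 1: "positive_definite G q" unfolding q_def by (rule R.positive_definite_matrix_coef[OF v])
  have p1: "0 \<le> Re (p \<one>)" by (rule positive_definite_one(2)[OF p])
  \<comment> \<open>The left side is a value of the difference of two translates of \<eta>, and
    evaluation has the same bound \<open>sqrt (Re (p \<one>))\<close> at every
    \<open>y\<close>.\<close>
  have 2: "(cmod (f (inv s \<otimes> y) - f (inv t \<otimes> y)))\<^sup>2 \<le> (2 * Re (p \<one>)) * (Re (q \<one>) - Re (q (inv s \<otimes> t)))"
    if sty: "s \<in> carrier G" "t \<in> carrier G" "y \<in> carrier G" for s t y
  proof -
    let ?w = "left_translate G (inv s) v - left_translate G (inv t) v"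
    have w: "?w \<in> H" by (intro H_rules left_translate_H v inv_closed sty)
    have "f (inv s \<otimes> y) - f (inv t \<otimes> y) = cnj (?w y)"
      using sty by (simp add: left_translate_def v_def)
    then have "cmod (f (inv s \<otimes> y) - f (inv t \<otimes> y)) = cmod (?w y)" by (simp only: complex_mod_cnj)
    also have "\<dots> \<le> hn ?w * sqrt (Re (p \<one>))" by (rule H_bounded[OF w sty(3)])
    finally have "(cmod (f (inv s \<otimes> y) - f (inv t \<otimes> y)))\<^sup>2 \<le> (hn ?w * sqrt (Re (p \<one>)))\<^sup>2"
      by (rule power_mono) simp
    also have "\<dots> = (hn ?w)\<^sup>2 * Re (p \<one>)" using p1 by (simp add: power_mult_distrib)
    finally show ?thesis unfolding translate_distance[OF v sty(1,2)] q_def by (simp add: algebra_simps)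
  qed
  \<comment> \<open>One of the two vectors \<eta> in \<open>q\<close> is replaced by a nearby
    \<open>J d\<close>, a finite combination of translates of \<xi>; unitarity makes the error
    independent of \<open>x\<close>.\<close>
  have 3: "\<exists>d\<in>fin_supp (carrier G). \<forall>x\<in>carrier G. cmod (q x - pairing d (\<lambda>y. f (x \<otimes> y))) \<le> e" if e: "e > 0" for e
  proof -
    have "e / (hn v + 1) > 0" using e hn_nonneg[OF v] by simp
    then obtain d where d: "d \<in> fin_supp (carrier G)" "hn (v - J d) \<le> e / (hn v + 1)" using dense_J[OF v] by blast
    have "cmod (q x - pairing d (\<lambda>y. f (x \<otimes> y))) \<le> e" if x: "x \<in> carrier G" for x
    proof -
      note Jd = J_in_H[OF d(1)]
      have dx: "left_translate G (inv x) d \<in> fin_supp (carrier G)" using x d by (simp add: left_translate_fin_supp)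
      have "pairing d (\<lambda>y. f (x \<otimes> y)) = hip (left_translate G (inv x) (J d)) v"
        unfolding left_translate_J[OF x d(1)] hip_J_left[OF dx v]
        using pairing_left_translate[OF x d(1), of f] by (simp add: v_def)
      then have "q x - pairing d (\<lambda>y. f (x \<otimes> y)) = hip (left_translate G (inv x) (v - J d)) v"
        using x v Jd by (simp add: q_def R.matrix_coef_def convolution_delta left_translate_linear Hs.ip_diff_left left_translate_H)
      also have "cmod \<dots> \<le> hn (v - J d) * hn v"
        using Hs.Cauchy_Schwarz[OF left_translate_H[of "inv x" "v - J d"] v] x v Jd
        by (simp add: hip_norm left_translate_H hn_left_translate H_rules)
      also have "\<dots> \<le> e / (hn v + 1) * hn v" using d(2) hn_nonneg[OF v] by (rule mult_right_mono)
      also have "\<dots> \<le> e" using e hn_nonneg[OF v] by (simp add: field_simps)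
      finally show ?thesis .
    qed
    then show ?thesis using d(1) by blast
  qed
  show thesis by (rule that[OF 1 _ 2 3]) (use p1 in simp_all)
qed

lemma coef_left_translate:
  assumes f: "f \<in> coef G C" and g: "g \<in> carrier G"
  shows "left_translate G g f \<in> coef G C"
proof -
  obtain p where p: "dominates G C p f" using f by (auto simp: coef_def)
  have "dominates G C p (left_translate G g f)"
    unfolding dominates_def
  proof (intro conjI ballI)
    fix c assume c: "c \<in> fin_supp (carrier G)"
    have "pairing c (left_translate G g f) = pairing c (\<lambda>y. f (g \<otimes> y))"
      by (rule pairing_cong[OF c]) (simp add: left_translate_def)
    then have eq: "pairing c (left_translate G g f) = pairing (left_translate G (inv g) c) f"
      using pairing_left_translate[OF g c] by simp
    have "left_translate G (inv g) c \<in> fin_supp (carrier G)" using g c by (simp add: left_translate_fin_supp)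
    then show "(cmod (pairing c (left_translate G g f)))\<^sup>2 \<le> C * Re (kform (gker G p) c c)"
      using p unfolding eq dominates_def kform_left_translate[OF g c c, symmetric] by blast
  qed (use p in \<open>auto simp: dominates_def\<close>)
  then show ?thesis by (auto simp: coef_def functions_on_def left_translate_def)
qed

text \<open>The image under \<open>h\<close> of \<open>c\<close>, seen as a measure of finite
  support: coefficients of points with the same image add up.\<close>

definition push :: "('a \<Rightarrow> 'c) \<Rightarrow> ('a \<Rightarrow> complex) \<Rightarrow> 'c \<Rightarrow> complex" where
  "push h c = (\<Sum>x\<in>{x. c x \<noteq> 0}. fscale (c x) (delta (h x)))"

lemma
  assumes c: "c \<in> fin_supp (carrier G)" and h: "h \<in> carrier G \<rightarrow> X"
  shows push_fin_supp: "push h c \<in> fin_supp X"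
    and pairing_push: "pairing (push h c) F = pairing c (\<lambda>x. F (h x))"
    and kform_push: "kform k (push h c) (push h c) = kform (\<lambda>x y. k (h x) (h y)) c c"
proof -
  have A: "finite {x. c x \<noteq> 0}" "\<And>x. x \<in> {x. c x \<noteq> 0} \<Longrightarrow> h x \<in> X"
    using c h by (auto simp: fin_supp_def)
  show "push h c \<in> fin_supp X" unfolding push_def by (rule deltas_in_fin_supp[OF A(2)])
  show "pairing (push h c) F = pairing c (\<lambda>x. F (h x))"
    unfolding push_def by (subst pairing_deltas[OF A(2)]) (simp_all add: pairing_def)
  show "kform k (push h c) (push h c) = kform (\<lambda>x y. k (h x) (h y)) c c"
    unfolding push_def
    by (subst kform_deltas[OF A(2)]) (simp_all add: kform_superset[OF A(1) order_refl A(1) order_refl])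
qed

text \<open>Right translation moves \<xi> by the action of \<open>g\<close>, hence replaces
  \<open>p\<close> by its conjugate under \<open>g\<close>; left translation moves only \<eta> and
  keeps \<open>p\<close>.\<close>

lemma coef_right_translate:
  assumes f: "f \<in> coef G C" and g: "g \<in> carrier G"
  shows "right_translate G g f \<in> coef G C"
proof -
  obtain p where p: "dominates G C p f" using f by (auto simp: coef_def)
  define p' where "p' x = (if x \<in> carrier G then p (inv g \<otimes> x \<otimes> g) else 0)" for x
  have h: "(\<lambda>x. x \<otimes> g) \<in> carrier G \<rightarrow> carrier G" using g by simp
  have kf: "kform (gker G p') c c = kform (gker G p) (push (\<lambda>x. x \<otimes> g) c) (push (\<lambda>x. x \<otimes> g) c)"
    if c: "c \<in> fin_supp (carrier G)" for c
    unfolding kform_push[OF c h]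
    by (rule kform_cong[OF c c]) (use g in \<open>simp add: gker_def p'_def inv_mult_group m_assoc\<close>)
  have "dominates G C p' (right_translate G g f)"
    unfolding dominates_def
  proof (intro conjI ballI)
    show "positive_definite G p'"
      unfolding positive_definite_iff psd_kernel_def
    proof (intro conjI ballI)
      show "p' \<in> functions_on G" by (simp add: functions_on_def p'_def)
      fix c assume c: "c \<in> fin_supp (carrier G)"
      have "positive_definite G p" using p by (simp add: dominates_def)
      then show "kform (gker G p') c c \<in> \<real>\<^sub>\<ge>\<^sub>0"
        unfolding kf[OF c] using push_fin_supp[OF c h] psd_gker unfolding psd_kernel_def by blast
    qed
    show "Re (p' \<one>) \<le> C" using p g by (simp add: p'_def dominates_def)
    fix c assume c: "c \<in> fin_supp (carrier G)"
    have "pairing c (right_translate G g f) = pairing c (\<lambda>x. f (x \<otimes> g))"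
      by (rule pairing_cong[OF c]) (simp add: right_translate_def)
    then have eq: "pairing c (right_translate G g f) = pairing (push (\<lambda>x. x \<otimes> g) c) f"
      using pairing_push[OF c h] by simp
    show "(cmod (pairing c (right_translate G g f)))\<^sup>2 \<le> C * Re (kform (gker G p') c c)"
      using p push_fin_supp[OF c h] unfolding eq dominates_def kf[OF c] by blast
  qed
  then show ?thesis by (auto simp: coef_def functions_on_def right_translate_def)
qed

lemma B_discrete_left_translate:
  "f \<in> B_discrete G \<Longrightarrow> g \<in> carrier G \<Longrightarrow> left_translate G g f \<in> B_discrete G"
  using coef_imp_B_discrete[OF coef_left_translate] by (metis B_discrete_iff_coef)

lemma B_discrete_right_translate:
  "f \<in> B_discrete G \<Longrightarrow> g \<in> carrier G \<Longrightarrow> right_translate G g f \<in> B_discrete G"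
  using coef_imp_B_discrete[OF coef_right_translate] by (metis B_discrete_iff_coef)

lemma B_norm_right_translate:
  "f \<in> B_discrete G \<Longrightarrow> g \<in> carrier G \<Longrightarrow> B_norm G (right_translate G g f) \<le> B_norm G f"
  by (intro B_norm_le_coef coef_right_translate B_discrete_coef)

text \<open>Passing from \<open>\<xi>\<close> to \<open>(\<xi> + \<pi>(n) \<xi>) / 2\<close>.\<close>

lemma dominates_average:
  assumes dom: "dominates G C p f" and n: "n \<in> carrier G"
    and inv: "\<And>x. x \<in> carrier G \<Longrightarrow> f (x \<otimes> n) = f x"
  obtains p' where "dominates G C p' f" "Re (p' \<one>) = (Re (p \<one>) + Re (p n)) / 2"
proof -
  have p: "positive_definite G p" using dom by (simp add: dominates_def)
  interpret semi_ip "fin_supp (carrier G)" "kform (gker G p)" by (rule positive_definite_semi_ip[OF p])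
  \<comment> \<open>The diagonal coefficient of the averaged vector, multiplied out.
    \<open>av\<close> is the corresponding average on coefficients: it turns the form of
    \<open>p\<close> into that of \<open>p'\<close> and, by the invariance of \<open>f\<close>, does
    not change the pairing with \<open>f\<close>.\<close>
  define p' where "p' x = (if x \<in> carrier G then
      (p x + p (x \<otimes> n) + p (inv n \<otimes> x) + p (inv n \<otimes> x \<otimes> n)) / 4 else 0)" for x
  define av where "av c = fscale (1/2) (push (\<lambda>x. x) c + push (\<lambda>x. x \<otimes> n) c)" for c
  have h: "(\<lambda>x. x \<otimes> n) \<in> carrier G \<rightarrow> carrier G" using n by simp
  have id: "(\<lambda>x. x) \<in> carrier G \<rightarrow> carrier G" by simp
  have av: "av c \<in> fin_supp (carrier G)" if c: "c \<in> fin_supp (carrier G)" for c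
    unfolding av_def by (intro fin_supp_rules push_fin_supp[OF c id] push_fin_supp[OF c h])
  have pair: "pairing (av c) f = pairing c f" if c: "c \<in> fin_supp (carrier G)" for c
  proof -
    have "pairing (av c) f = (pairing c f + pairing c (\<lambda>x. f (x \<otimes> n))) / 2"
      unfolding av_def pairing_scale_left pairing_add_left[OF push_fin_supp[OF c id] push_fin_supp[OF c h]]
        pairing_push[OF c id] pairing_push[OF c h] by simp
    also have "pairing c (\<lambda>x. f (x \<otimes> n)) = pairing c f" by (rule pairing_cong[OF c inv])
    finally show ?thesis by simp
  qed
  have kf: "kform (gker G p') c c = kform (gker G p) (av c) (av c)" if c: "c \<in> fin_supp (carrier G)" for c
  proof -
    let ?A = "{x. c x \<noteq> 0}"
    have A: "finite ?A" "?A \<subseteq> carrier G" using c by (auto simp: fin_supp_def)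
    have k2: "kform (gker G p) (push a c) (push b c) = (\<Sum>x\<in>?A. \<Sum>y\<in>?A. c x * cnj (c y) * gker G p (a x) (b y))"
      if "a \<in> carrier G \<rightarrow> carrier G" "b \<in> carrier G \<rightarrow> carrier G" for a b
      unfolding push_def by (rule kform_deltas2[of _ _ "carrier G"]) (use that A in auto)
    note pf = push_fin_supp[OF c id] push_fin_supp[OF c h]
    have "kform (gker G p) (av c) (av c) = (1/4) * (kform (gker G p) (push (\<lambda>x. x) c) (push (\<lambda>x. x) c)
        + kform (gker G p) (push (\<lambda>x. x) c) (push (\<lambda>x. x \<otimes> n) c)
        + kform (gker G p) (push (\<lambda>x. x \<otimes> n) c) (push (\<lambda>x. x) c)
        + kform (gker G p) (push (\<lambda>x. x \<otimes> n) c) (push (\<lambda>x. x \<otimes> n) c))"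
      unfolding av_def kform_scale_left kform_scale_right kform_add_left[OF pf] kform_add_right[OF pf]
      by (simp add: field_simps)
    also have "\<dots> = (\<Sum>x\<in>?A. \<Sum>y\<in>?A. c x * cnj (c y) * gker G p' x y)"
      unfolding k2[OF id id] k2[OF id h]
        k2[OF h id] k2[OF h h] sum.distrib[symmetric] sum_distrib_left
    proof (intro sum.cong refl)
      fix x y assume "x \<in> ?A" "y \<in> ?A"
      then have xy: "x \<in> carrier G" "y \<in> carrier G" using A by auto
      show "1 / 4 * (c x * cnj (c y) * gker G p x y + c x * cnj (c y) * gker G p x (y \<otimes> n)
          + c x * cnj (c y) * gker G p (x \<otimes> n) y + c x * cnj (c y) * gker G p (x \<otimes> n) (y \<otimes> n))
        = c x * cnj (c y) * gker G p' x y"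
        using xy n by (simp add: gker_def p'_def inv_mult_group m_assoc algebra_simps)
    qed
    also have "\<dots> = kform (gker G p') c c"
      by (rule kform_superset[symmetric]) (use A in auto)
    finally show ?thesis by simp
  qed
  have Re_p': "Re (p' \<one>) = (Re (p \<one>) + Re (p n)) / 2"
    using n positive_definite_inv[OF p n] by (simp add: p'_def)
  have "dominates G C p' f"
    unfolding dominates_def
  proof (intro conjI ballI)
    show "positive_definite G p'"
      unfolding positive_definite_iff psd_kernel_def
    proof (intro conjI ballI)
      show "p' \<in> functions_on G" by (simp add: functions_on_def p'_def)
      fix c assume c: "c \<in> fin_supp (carrier G)"
      show "kform (gker G p') c c \<in> \<real>\<^sub>\<ge>\<^sub>0"
        unfolding kf[OF c] using psd_gker[OF p] av[OF c] unfolding psd_kernel_def by blast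
    qed
    show "Re (p' \<one>) \<le> C"
    proof -
      have "Re (p n) \<le> Re (p \<one>)"
        using complex_Re_le_cmod[of "p n"] positive_definite_cmod_le[OF p n] by linarith
      moreover have "Re (p \<one>) \<le> C" using dom by (simp add: dominates_def)
      ultimately show ?thesis unfolding Re_p' by simp
    qed
    fix c assume c: "c \<in> fin_supp (carrier G)"
    show "(cmod (pairing c f))\<^sup>2 \<le> C * Re (kform (gker G p') c c)"
      using dom av[OF c] unfolding kf[OF c] pair[OF c, symmetric] dominates_def by blast
  qed
  then show thesis using Re_p' by (rule that)
qed

text \<open>Replacing \<open>\<xi>\<close> by its projection to the vectors fixed by \<open>N\<close>, found as the vector of least
  norm.\<close>

lemma invariant_dominating:
  assumes f: "f \<in> coef G C" and N: "N \<subseteq> carrier G"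
    and inv: "\<And>x n. x \<in> carrier G \<Longrightarrow> n \<in> N \<Longrightarrow> f (x \<otimes> n) = f x"
  obtains p where "dominates G C p f" "\<And>x n. x \<in> carrier G \<Longrightarrow> n \<in> N \<Longrightarrow> p (n \<otimes> x) = p x"
proof -
  define S where "S = dominating_pairs C \<inter> (\<Inter>x. {w. snd w x = f x})"
  have S: "w \<in> S \<longleftrightarrow> w \<in> dominating_pairs C \<and> snd w = f" for w
    by (auto simp: S_def fun_eq_iff)
  have "compact S"
    unfolding S_def
    by (intro compact_Int_closed compact_dominating_pairs closed_INT ballI closed_Collect_eq
        continuous_on_snd_eval continuous_on_const)
  moreover have "S \<noteq> {}" using f S coef_iff_pairs by blast
  moreover have "continuous_on S (\<lambda>w. Re (fst w \<one>))"
    by (intro continuous_intros continuous_on_fst_eval)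
  ultimately have "\<exists>w\<in>S. \<forall>w'\<in>S. Re (fst w \<one>) \<le> Re (fst w' \<one>)"
    by (rule continuous_attains_inf)
  then obtain w where w: "w \<in> S" "\<And>w'. w' \<in> S \<Longrightarrow> Re (fst w \<one>) \<le> Re (fst w' \<one>)" by blast
  define p where "p = fst w"
  have dom: "dominates G C p f" using w(1) S by (auto simp: p_def dominating_pairs_def)
  have f0: "f \<in> functions_on G" by (rule coef_functions_on[OF f])
  have p: "positive_definite G p" using dom by (simp add: dominates_def)
  have "p (n \<otimes> x) = p x" if x: "x \<in> carrier G" and n: "n \<in> N" for x n
  proof -
    have nG: "n \<in> carrier G" using n N by blast
    obtain p' where p': "dominates G C p' f" "Re (p' \<one>) = (Re (p \<one>) + Re (p n)) / 2"
      using dominates_average[OF dom nG] inv n by metis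
    \<comment> \<open>Averaging cannot shorten a vector of least norm, so \<open>Re (p n)\<close> is
      at least \<open>Re (p \<one>)\<close>; the right side of Krein's inequality then vanishes and
      \<open>p\<close> is invariant under \<open>n\<close>.\<close>
    have "(p', f) \<in> S" using p'(1) f0 S by (simp add: dominating_pairs_def)
    then have "Re (p \<one>) \<le> Re (p' \<one>)" using w(2)[of "(p', f)"] by (simp add: p_def)
    then have le: "Re (p \<one>) \<le> Re (p n)" using p'(2) by simp
    have "(cmod (p (inv \<one> \<otimes> x) - p (inv (inv n) \<otimes> x)))\<^sup>2
        \<le> 2 * Re (p \<one>) * (Re (p \<one>) - Re (p (inv \<one> \<otimes> inv n)))"
      using nG by (intro Krein[OF p x]) auto
    also have "\<dots> = 2 * Re (p \<one>) * (Re (p \<one>) - Re (p n))"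
      using nG positive_definite_inv[OF p nG] by simp
    also have "\<dots> \<le> 0"
      using le positive_definite_one(2)[OF p] by (simp add: mult_nonneg_nonpos)
    finally show ?thesis using x nG by simp
  qed
  with dom show thesis by (rule that)
qed

end

section \<open>Pulling coefficients back along a surjective homomorphism\<close>

locale surj_hom = group_hom G K h for G (structure) and K (structure) and h +
  assumes surj: "h ` carrier G = carrier K"
begin

definition pull :: "('c \<Rightarrow> complex) \<Rightarrow> 'a \<Rightarrow> complex" where
  "pull f x = (if x \<in> carrier G then f (h x) else 0)"

definition rep_pt :: "'c \<Rightarrow> 'a" where
  "rep_pt y = (SOME x. x \<in> carrier G \<and> h x = y)"

lemma rep_pt: "y \<in> carrier K \<Longrightarrow> rep_pt y \<in> carrier G" "y \<in> carrier K \<Longrightarrow> h (rep_pt y) = y"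
proof -
  assume "y \<in> carrier K"
  then have "\<exists>x. x \<in> carrier G \<and> h x = y" using surj by (metis imageE)
  then have "rep_pt y \<in> carrier G \<and> h (rep_pt y) = y" unfolding rep_pt_def by (rule someI_ex)
  then show "rep_pt y \<in> carrier G" "h (rep_pt y) = y" by auto
qed

lemma hom_Pi: "h \<in> carrier G \<rightarrow> carrier K" and rep_pt_Pi: "rep_pt \<in> carrier K \<rightarrow> carrier G"
  by (auto simp: rep_pt)

lemma coef_pull:
  assumes "f \<in> coef K C"
  shows "pull f \<in> coef G C"
proof -
  obtain p where p: "dominates K C p f" using assms by (auto simp: coef_def)
  have kf: "kform (gker G (pull p)) c c = kform (gker K p) (G.push h c) (G.push h c)"
    if c: "c \<in> fin_supp (carrier G)" for c
    unfolding G.kform_push[OF c hom_Pi]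
    by (rule kform_cong[OF c c]) (simp add: gker_def pull_def)
  have "dominates G C (pull p) (pull f)"
    unfolding dominates_def
  proof (intro conjI ballI)
    show "positive_definite G (pull p)"
      unfolding G.positive_definite_iff psd_kernel_def
    proof (intro conjI ballI)
      show "pull p \<in> functions_on G" by (simp add: functions_on_def pull_def)
      fix c assume c: "c \<in> fin_supp (carrier G)"
      have "positive_definite K p" using p by (simp add: dominates_def)
      then show "kform (gker G (pull p)) c c \<in> \<real>\<^sub>\<ge>\<^sub>0"
        unfolding kf[OF c] using G.push_fin_supp[OF c hom_Pi] H.psd_gker unfolding psd_kernel_def by blast
    qed
    show "Re (pull p \<one>) \<le> C" using p by (simp add: pull_def dominates_def)
    fix c assume c: "c \<in> fin_supp (carrier G)"
    have "pairing c (pull f) = pairing c (\<lambda>x. f (h x))"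
      by (rule pairing_cong[OF c]) (simp add: pull_def)
    then have eq: "pairing c (pull f) = pairing (G.push h c) f"
      using G.pairing_push[OF c hom_Pi] by simp
    show "(cmod (pairing c (pull f)))\<^sup>2 \<le> C * Re (kform (gker G (pull p)) c c)"
      using p G.push_fin_supp[OF c hom_Pi] unfolding eq dominates_def kf[OF c] by blast
  qed
  then show ?thesis by (auto simp: coef_def functions_on_def pull_def)
qed

text \<open>A function dominating \<open>pull f\<close> need not factor through \<open>h\<close>.
  But \<open>pull f\<close> is invariant under the kernel of \<open>h\<close>, so
  \<open>invariant_dominating\<close> provides one that is invariant too and can be read on
  \<open>K\<close>.\<close>

lemma coef_descend:
  assumes f: "f \<in> functions_on K" and F: "pull f \<in> coef G C"
  shows "f \<in> coef K C"
proof -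
  let ?N = "{x \<in> carrier G. h x = \<one>\<^bsub>K\<^esub>}"
  obtain p where dom: "dominates G C p (pull f)"
    and inv: "\<And>x n. x \<in> carrier G \<Longrightarrow> n \<in> ?N \<Longrightarrow> p (n \<otimes> x) = p x"
  proof (rule G.invariant_dominating[OF F, of ?N])
    show "?N \<subseteq> carrier G" by blast
    show "pull f (x \<otimes> n) = pull f x" if "x \<in> carrier G" "n \<in> ?N" for x n
      using that by (simp add: pull_def)
  qed blast
  have p: "positive_definite G p" using dom by (simp add: dominates_def)
  have cong: "p x = p y" if xy: "x \<in> carrier G" "y \<in> carrier G" "h x = h y" for x y
  proof -
    have "x \<otimes> inv y \<in> ?N" using xy by simp
    then have "p ((x \<otimes> inv y) \<otimes> y) = p y" by (intro inv xy)
    then show ?thesis using xy by (simp add: G.m_assoc)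
  qed
  define p' where "p' y = (if y \<in> carrier K then p (rep_pt y) else 0)" for y
  have kf: "kform (gker K p') c c = kform (gker G p) (H.push rep_pt c) (H.push rep_pt c)"
    if c: "c \<in> fin_supp (carrier K)" for c
    unfolding H.kform_push[OF c rep_pt_Pi]
  proof (rule kform_cong[OF c c])
    fix x y assume xy: "x \<in> carrier K" "y \<in> carrier K"
    then show "gker K p' x y = gker G p (rep_pt x) (rep_pt y)"
      unfolding gker_def p'_def by (simp add: rep_pt cong)
  qed
  have "dominates K C p' f"
    unfolding dominates_def
  proof (intro conjI ballI)
    show "positive_definite K p'"
      unfolding H.positive_definite_iff psd_kernel_def
    proof (intro conjI ballI)
      show "p' \<in> functions_on K" by (simp add: functions_on_def p'_def)
      fix c assume c: "c \<in> fin_supp (carrier K)"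
      show "kform (gker K p') c c \<in> \<real>\<^sub>\<ge>\<^sub>0"
        unfolding kf[OF c] using H.push_fin_supp[OF c rep_pt_Pi] G.psd_gker[OF p] unfolding psd_kernel_def by blast
    qed
    have "p (rep_pt \<one>\<^bsub>K\<^esub>) = p \<one>" by (rule cong) (simp_all add: rep_pt)
    then show "Re (p' \<one>\<^bsub>K\<^esub>) \<le> C" using dom by (simp add: p'_def dominates_def)
    fix c assume c: "c \<in> fin_supp (carrier K)"
    have "pairing c f = pairing c (\<lambda>y. pull f (rep_pt y))"
      by (rule pairing_cong[OF c]) (simp add: pull_def rep_pt)
    then have eq: "pairing c f = pairing (H.push rep_pt c) (pull f)"
      using H.pairing_push[OF c rep_pt_Pi] by simp
    show "(cmod (pairing c f))\<^sup>2 \<le> C * Re (kform (gker K p') c c)"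
      using dom H.push_fin_supp[OF c rep_pt_Pi] unfolding eq dominates_def kf[OF c] by blast
  qed
  then show ?thesis using f by (auto simp: coef_def)
qed

lemma B_discrete_pull: "f \<in> B_discrete K \<Longrightarrow> pull f \<in> B_discrete G"
  using G.coef_imp_B_discrete[OF coef_pull] by (metis H.B_discrete_iff_coef)

lemma B_discrete_descend: "f \<in> functions_on K \<Longrightarrow> pull f \<in> B_discrete G \<Longrightarrow> f \<in> B_discrete K"
  using H.coef_imp_B_discrete[OF coef_descend] by (metis G.B_discrete_iff_coef)

lemma B_norm_pull:
  assumes f: "f \<in> B_discrete K"
  shows "B_norm G (pull f) = B_norm K f"
proof (rule antisym)
  show "B_norm G (pull f) \<le> B_norm K f"
    by (intro G.B_norm_le_coef coef_pull H.B_discrete_coef f)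
  have "f \<in> functions_on K" using H.B_discrete_coef[OF f] by (rule H.coef_functions_on)
  then show "B_norm K f \<le> B_norm G (pull f)"
    by (intro H.B_norm_le_coef coef_descend G.B_discrete_coef B_discrete_pull f)
qed

end

subsection \<open>The sigma-topology\<close>

lemma continuous_map_normD:
  fixes f :: "'a \<Rightarrow> 'b :: real_normed_vector"
  assumes "continuous_map X euclidean f" "x \<in> topspace X" "e > 0"
  obtains U where "openin X U" "x \<in> U" "\<And>y. y \<in> U \<Longrightarrow> norm (f y - f x) < e"
proof -
  have "openin X {y \<in> topspace X. f y \<in> ball (f x) e}"
    using assms(1) by (auto simp: continuous_map_def)
  moreover have "x \<in> {y \<in> topspace X. f y \<in> ball (f x) e}" using assms by simp
  ultimately show thesis by (rule that) (simp add: dist_norm norm_minus_commute)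
qed

lemma continuous_map_normI:
  fixes f :: "'a \<Rightarrow> 'b :: real_normed_vector"
  assumes "\<And>x e. x \<in> topspace X \<Longrightarrow> e > 0 \<Longrightarrow> \<exists>U. openin X U \<and> x \<in> U \<and> (\<forall>y\<in>U. norm (f y - f x) < e)"
  shows "continuous_map X euclidean f"
  unfolding continuous_map_def
proof (intro conjI allI impI)
  fix V :: "'b set" assume V: "openin euclidean V"
  show "openin X {x \<in> topspace X. f x \<in> V}"
  proof (subst openin_subopen, intro ballI)
    fix x assume x: "x \<in> {x \<in> topspace X. f x \<in> V}"
    then obtain e where e: "e > 0" "ball (f x) e \<subseteq> V" using V by (auto simp: open_contains_ball)
    obtain U where U: "openin X U" "x \<in> U" "\<forall>y\<in>U. norm (f y - f x) < e" using assms[of x e] x e by auto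
    have "U \<subseteq> {x \<in> topspace X. f x \<in> V}"
      using U(3) e(2) openin_subset[OF U(1)] by (auto simp: dist_norm norm_minus_commute subset_iff)
    then show "\<exists>T. openin X T \<and> x \<in> T \<and> T \<subseteq> {x \<in> topspace X. f x \<in> V}" using U by blast
  qed
qed auto

lemma continuous_map_complex_uniform:
  fixes f :: "'a \<Rightarrow> complex"
  assumes "\<And>e. e > 0 \<Longrightarrow> \<exists>g. continuous_map X euclidean g \<and> (\<forall>x\<in>topspace X. cmod (f x - g x) \<le> e)"
  shows "continuous_map X euclidean f"
proof (rule continuous_map_normI)
  fix x and e :: real assume x: "x \<in> topspace X" and e: "e > 0"
  obtain g where g: "continuous_map X euclidean g" "\<forall>x\<in>topspace X. cmod (f x - g x) \<le> e / 3"
    using assms[of "e / 3"] e by auto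
  obtain U where U: "openin X U" "x \<in> U" "\<And>y. y \<in> U \<Longrightarrow> cmod (g y - g x) < e / 3"
    using continuous_map_normD[OF g(1) x, of "e / 3"] e by auto
  have "cmod (f y - f x) < e" if y: "y \<in> U" for y
  proof -
    have "f y - f x = (f y - g y) + (g y - g x) - (f x - g x)" by simp
    then have "cmod (f y - f x) \<le> cmod (f y - g y) + cmod (g y - g x) + cmod (f x - g x)"
      by (metis norm_triangle_ineq norm_triangle_ineq4 add_right_mono order_trans)
    moreover have "y \<in> topspace X" using openin_subset[OF U(1)] y by blast
    then have "cmod (f y - g y) \<le> e / 3" "cmod (f x - g x) \<le> e / 3" using g(2) x by blast+
    ultimately show ?thesis using U(3)[OF y] by linarith
  qed
  then show "\<exists>U. openin X U \<and> x \<in> U \<and> (\<forall>y\<in>U. cmod (f y - f x) < e)" using U by blast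
qed

lemma continuous_map_complex_mult:
  fixes f :: "'a \<Rightarrow> complex"
  shows "continuous_map X euclidean f \<Longrightarrow> continuous_map X euclidean g \<Longrightarrow> continuous_map X euclidean (\<lambda>x. f x * g x)"
  by (simp add: continuous_map_atin tendsto_mult)

lemma continuous_map_complex_cong:
  fixes f :: "'a \<Rightarrow> complex"
  assumes "continuous_map X euclidean f" "\<And>x. x \<in> topspace X \<Longrightarrow> f x = g x"
  shows "continuous_map X euclidean g"
  using continuous_map_eq assms by blast

locale right_top_group = group G for G (structure) +
  fixes T :: "'a topology"
  assumes rtg: "right_topological_group G T"
begin

lemma topspace_T [simp]: "topspace T = carrier G"
  using rtg by (simp add: right_topological_group_def)

lemma right_continuous: "x \<in> carrier G \<Longrightarrow> continuous_map T T (\<lambda>g. g \<otimes> x)"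
  using rtg by (simp add: right_topological_group_def)

abbreviation \<sigma> where "\<sigma> \<equiv> sigma_topology G T"

lemma sigma_quotient: "quotient_map (prod_topology T T) \<sigma> (\<lambda>(x, y). inv x \<otimes> y)"
  unfolding sigma_topology_def by (rule quotient_map_quotient_topology)

lemma topspace_sigma [simp]: "topspace \<sigma> = carrier G"
proof -
  have "topspace \<sigma> = (\<lambda>(x, y). inv x \<otimes> y) ` (carrier G \<times> carrier G)"
    using sigma_quotient by (simp add: quotient_map_def)
  also have "\<dots> = carrier G"
  proof
    show "carrier G \<subseteq> (\<lambda>(x, y). inv x \<otimes> y) ` (carrier G \<times> carrier G)"
      by (rule subsetI, rule image_eqI[where x = "(\<one>, _)"]) auto
  qed auto
  finally show ?thesis .
qed

lemma sigma_continuous_iff: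
  "continuous_map \<sigma> Y f \<longleftrightarrow> continuous_map (prod_topology T T) Y (\<lambda>(x, y). f (inv x \<otimes> y))"
  using continuous_compose_quotient_map_eq[OF sigma_quotient, of Y f] by (simp add: o_def case_prod_unfold)

lemma sigma_right:
  assumes g: "g \<in> carrier G"
  shows "continuous_map \<sigma> \<sigma> (\<lambda>z. z \<otimes> g)"
  unfolding sigma_continuous_iff
proof (rule continuous_map_eq)
  show "continuous_map (prod_topology T T) \<sigma> ((\<lambda>(x, y). inv x \<otimes> y) \<circ> (\<lambda>w. (fst w, snd w \<otimes> g)))"
    using continuous_map_compose[OF continuous_map_snd right_continuous[OF g], of T]
    by (intro continuous_map_compose[OF _ quotient_imp_continuous_map[OF sigma_quotient]]
        continuous_map_pairedI continuous_map_fst) (simp add: o_def)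
qed (use g in \<open>auto simp: m_assoc\<close>)

text \<open>\<open>g \<otimes> (inv x \<otimes> y) = inv (x \<otimes> inv g) \<otimes> y\<close>:
  left multiplication lifts to a right multiplication in the first factor, which is continuous for
  every \<open>g\<close>. So \<sigma> admits translations on both sides although \<open>T\<close>
  need not.\<close>

lemma sigma_left:
  assumes g: "g \<in> carrier G"
  shows "continuous_map \<sigma> \<sigma> (\<lambda>z. g \<otimes> z)"
  unfolding sigma_continuous_iff
proof (rule continuous_map_eq)
  show "continuous_map (prod_topology T T) \<sigma> ((\<lambda>(x, y). inv x \<otimes> y) \<circ> (\<lambda>w. (fst w \<otimes> inv g, snd w)))"
    using continuous_map_compose[OF continuous_map_fst right_continuous[OF inv_closed[OF g]], of T]
    by (intro continuous_map_compose[OF _ quotient_imp_continuous_map[OF sigma_quotient]]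
        continuous_map_pairedI continuous_map_snd) (simp add: o_def)
qed (use g in \<open>auto simp: m_assoc inv_mult_group\<close>)

text \<open>Inversion lifts to the exchange of the two factors.\<close>

lemma sigma_inv: "continuous_map \<sigma> \<sigma> (\<lambda>z. inv z)"
  unfolding sigma_continuous_iff
proof (rule continuous_map_eq)
  show "continuous_map (prod_topology T T) \<sigma> ((\<lambda>(x, y). inv x \<otimes> y) \<circ> (\<lambda>w. (snd w, fst w)))"
    by (intro continuous_map_compose[OF _ quotient_imp_continuous_map[OF sigma_quotient]]
        continuous_map_pairedI continuous_map_fst continuous_map_snd)
qed (auto simp: inv_mult_group)

abbreviation N where "N \<equiv> N_subgroup G T"

text \<open>The complement of a closed neighbourhood is open, so lying in all of them means having
  no open set disjoint from one around the unit. This form can be pulled back along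
  \<sigma>-continuous maps.\<close>

lemma N_iff:
  "n \<in> N \<longleftrightarrow> n \<in> carrier G \<and> (\<forall>U V. openin \<sigma> U \<and> openin \<sigma> V \<and> \<one> \<in> U \<and> n \<in> V \<longrightarrow> U \<inter> V \<noteq> {})"
    (is "_ \<longleftrightarrow> _ \<and> ?R n")
proof (intro iffI conjI)
  assume n: "n \<in> N"
  have whole: "closedin \<sigma> (carrier G)" "openin \<sigma> (carrier G)"
    using closedin_topspace[of \<sigma>] openin_topspace[of \<sigma>] by simp_all
  then show "n \<in> carrier G" using n by (auto simp: N_subgroup_def)
  show "?R n"
  proof (intro allI impI)
    fix U V assume UV: "openin \<sigma> U \<and> openin \<sigma> V \<and> \<one> \<in> U \<and> n \<in> V"
    show "U \<inter> V \<noteq> {}"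
    proof
      assume "U \<inter> V = {}"
      then have "U \<subseteq> carrier G - V" using UV openin_subset[of \<sigma> U] by auto
      moreover have "closedin \<sigma> (carrier G - V)" using UV closedin_diff[of \<sigma> "carrier G" V] whole by simp
      ultimately have "n \<in> carrier G - V" using n UV unfolding N_subgroup_def by blast
      then show False using UV by blast
    qed
  qed
next
  assume n: "n \<in> carrier G \<and> ?R n"
  show "n \<in> N"
    unfolding N_subgroup_def
  proof (rule InterI)
    fix V assume "V \<in> {V. closedin \<sigma> V \<and> (\<exists>U. openin \<sigma> U \<and> \<one> \<in> U \<and> U \<subseteq> V)}"
    then obtain U where U: "closedin \<sigma> V" "openin \<sigma> U" "\<one> \<in> U" "U \<subseteq> V" by blast
    have "openin \<sigma> (carrier G - V)" using openin_diff[of \<sigma> "carrier G" V] openin_topspace[of \<sigma>] U(1) by simp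
    moreover have "U \<inter> (carrier G - V) = {}" using U(4) by blast
    ultimately have "n \<notin> carrier G - V" using n U(2,3) by blast
    then show "n \<in> V" using n by blast
  qed
qed

lemma sigma_preimage:
  assumes "continuous_map \<sigma> \<sigma> f" "openin \<sigma> U"
  shows "openin \<sigma> {x \<in> carrier G. f x \<in> U}"
  using openin_continuous_map_preimage[OF assms] by simp

text \<open>Only separate continuity of the multiplication of \<open>(G, \<sigma>)\<close> is available.\<close>

lemma N_normal: "N \<lhd> G"
  unfolding normal_inv_iff
proof (intro conjI ballI)
  have sub: "N \<subseteq> carrier G" using N_iff by blast
  show "subgroup N G"
  proof
    show "N \<subseteq> carrier G" by (rule sub)
    show "\<one> \<in> N" by (auto simp: N_iff)
  next
    fix n m assume n: "n \<in> N" and m: "m \<in> N"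
    then have nm: "n \<in> carrier G" "m \<in> carrier G" using sub by auto
    show "n \<otimes> m \<in> N"
      unfolding N_iff
    proof (intro conjI allI impI)
      show "n \<otimes> m \<in> carrier G" using nm by simp
      fix U V assume UV: "openin \<sigma> U \<and> openin \<sigma> V \<and> \<one> \<in> U \<and> n \<otimes> m \<in> V"
      then have "openin \<sigma> {x \<in> carrier G. x \<otimes> m \<in> V}" by (intro sigma_preimage sigma_right nm) auto
      moreover have "n \<in> {x \<in> carrier G. x \<otimes> m \<in> V}" using UV nm by simp
      ultimately have "U \<inter> {x \<in> carrier G. x \<otimes> m \<in> V} \<noteq> {}" using n UV unfolding N_iff by blast
      then obtain u where u: "u \<in> U" "u \<in> carrier G" "u \<otimes> m \<in> V" by blast
      \<comment> \<open>The factors are treated one after the other: \<open>u\<close> has replaced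
        \<open>n\<close>, and for this fixed \<open>u\<close> left multiplication is continuous, so
        the neighbourhoods are pulled back along it before \<open>m\<close> is used.\<close>
      have "openin \<sigma> {x \<in> carrier G. u \<otimes> x \<in> U}" "openin \<sigma> {x \<in> carrier G. u \<otimes> x \<in> V}"
        using UV by (intro sigma_preimage sigma_left u(2); simp)+
      moreover have "\<one> \<in> {x \<in> carrier G. u \<otimes> x \<in> U}" "m \<in> {x \<in> carrier G. u \<otimes> x \<in> V}"
        using u nm by simp_all
      ultimately have "{x \<in> carrier G. u \<otimes> x \<in> U} \<inter> {x \<in> carrier G. u \<otimes> x \<in> V} \<noteq> {}"
        using m unfolding N_iff by blast
      then show "U \<inter> V \<noteq> {}" by blast
    qed
  next
    fix n assume n: "n \<in> N"
    then have nG: "n \<in> carrier G" using sub by auto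
    show "inv n \<in> N"
      unfolding N_iff
    proof (intro conjI allI impI)
      show "inv n \<in> carrier G" using nG by simp
      fix U V assume UV: "openin \<sigma> U \<and> openin \<sigma> V \<and> \<one> \<in> U \<and> inv n \<in> V"
      have "openin \<sigma> {x \<in> carrier G. inv x \<in> U}" "openin \<sigma> {x \<in> carrier G. inv x \<in> V}"
        using UV by (intro sigma_preimage sigma_inv; simp)+
      moreover have "\<one> \<in> {x \<in> carrier G. inv x \<in> U}" "n \<in> {x \<in> carrier G. inv x \<in> V}" using UV nG by auto
      ultimately have "{x \<in> carrier G. inv x \<in> U} \<inter> {x \<in> carrier G. inv x \<in> V} \<noteq> {}"
        using n unfolding N_iff by blast
      then show "U \<inter> V \<noteq> {}" by blast
    qed
  qed
  fix x n assume x: "x \<in> carrier G" and n: "n \<in> N"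
  then have nG: "n \<in> carrier G" using sub by auto
  have conj: "continuous_map \<sigma> \<sigma> (\<lambda>z. x \<otimes> z \<otimes> inv x)"
    using continuous_map_compose[OF sigma_left[OF x] sigma_right[OF inv_closed[OF x]]] by (simp add: o_def)
  show "x \<otimes> n \<otimes> inv x \<in> N"
    unfolding N_iff
  proof (intro conjI allI impI)
    show "x \<otimes> n \<otimes> inv x \<in> carrier G" using x nG by simp
    fix U V assume UV: "openin \<sigma> U \<and> openin \<sigma> V \<and> \<one> \<in> U \<and> x \<otimes> n \<otimes> inv x \<in> V"
    have "openin \<sigma> {z \<in> carrier G. x \<otimes> z \<otimes> inv x \<in> U}" "openin \<sigma> {z \<in> carrier G. x \<otimes> z \<otimes> inv x \<in> V}"
      using UV by (intro sigma_preimage conj; simp)+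
    moreover have "\<one> \<in> {z \<in> carrier G. x \<otimes> z \<otimes> inv x \<in> U}" "n \<in> {z \<in> carrier G. x \<otimes> z \<otimes> inv x \<in> V}"
      using UV x nG by auto
    ultimately have "{z \<in> carrier G. x \<otimes> z \<otimes> inv x \<in> U} \<inter> {z \<in> carrier G. x \<otimes> z \<otimes> inv x \<in> V} \<noteq> {}"
      using n unfolding N_iff by blast
    then show "U \<inter> V \<noteq> {}" by blast
  qed
qed

text \<open>Disjoint neighbourhoods of two different values would pull back, along right
  multiplication by \<open>x\<close> followed by \<open>f\<close>, to disjoint
  \<sigma>-neighbourhoods of the unit and \<open>n\<close>.\<close>

lemma sigma_continuous_N_invariant:
  fixes f :: "'a \<Rightarrow> complex"
  assumes f: "continuous_map \<sigma> euclidean f" and n: "n \<in> N" and x: "x \<in> carrier G"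
  shows "f (n \<otimes> x) = f x"
proof (rule ccontr)
  assume "f (n \<otimes> x) \<noteq> f x"
  then obtain A B where AB: "open A" "open B" "f x \<in> A" "f (n \<otimes> x) \<in> B" "A \<inter> B = {}"
    using hausdorff by metis
  have c: "continuous_map \<sigma> euclidean (\<lambda>z. f (z \<otimes> x))"
    using continuous_map_compose[OF sigma_right[OF x] f] by (simp add: o_def)
  have "openin \<sigma> {z \<in> carrier G. f (z \<otimes> x) \<in> A}" "openin \<sigma> {z \<in> carrier G. f (z \<otimes> x) \<in> B}"
    using openin_continuous_map_preimage[OF c, of A] openin_continuous_map_preimage[OF c, of B] AB(1,2) by simp_all
  moreover have "\<one> \<in> {z \<in> carrier G. f (z \<otimes> x) \<in> A}" "n \<in> {z \<in> carrier G. f (z \<otimes> x) \<in> B}"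
    using AB x n N_iff by auto
  ultimately have "{z \<in> carrier G. f (z \<otimes> x) \<in> A} \<inter> {z \<in> carrier G. f (z \<otimes> x) \<in> B} \<noteq> {}"
    using n unfolding N_iff by blast
  then show False using AB(5) by blast
qed

text \<open>The identity from \<sigma> to \<open>T\<close> is then continuous, and by the quotient
  property this is joint continuity of \<open>inv x \<otimes> y\<close>, from which inversion and
  multiplication are recovered.\<close>

lemma topological_group_if_sigma_finer:
  assumes "\<And>U. openin T U \<Longrightarrow> openin \<sigma> U"
  shows "topological_group G T"
proof -
  have "continuous_map \<sigma> T (\<lambda>x. x)"
    unfolding continuous_map_def
  proof (intro conjI allI impI)
    fix U assume "openin T U"
    moreover from this have "{x \<in> topspace \<sigma>. x \<in> U} = U" using openin_subset[of T U] by auto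
    ultimately show "openin \<sigma> {x \<in> topspace \<sigma>. x \<in> U}" using assms by simp
  qed simp
  then have div: "continuous_map (prod_topology T T) T (\<lambda>(x, y). inv x \<otimes> y)"
    unfolding sigma_continuous_iff .
  have inv: "continuous_map T T (\<lambda>x. inv x)"
  proof (rule continuous_map_eq)
    show "continuous_map T T ((\<lambda>(x, y). inv x \<otimes> y) \<circ> (\<lambda>x. (x, \<one>)))"
      by (intro continuous_map_compose[OF _ div] continuous_map_pairedI) auto
  qed auto
  have "continuous_map (prod_topology T T) T (\<lambda>(x, y). x \<otimes> y)"
  proof (rule continuous_map_eq)
    show "continuous_map (prod_topology T T) T ((\<lambda>(x, y). inv x \<otimes> y) \<circ> (\<lambda>w. (inv (fst w), snd w)))"
      using continuous_map_compose[OF continuous_map_fst inv, of T]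
      by (intro continuous_map_compose[OF _ div] continuous_map_pairedI continuous_map_snd) (simp add: o_def)
  qed auto
  with inv show ?thesis by (simp add: topological_group_def is_group)
qed

text \<open>Boundedness is automatic, since \<open>B_norm\<close> dominates the supremum
  norm.\<close>

lemma B_alg_iff: "f \<in> B_alg G T \<longleftrightarrow> f \<in> B_discrete G \<and> continuous_map T euclidean f"
proof -
  have "bounded (f ` topspace T)" if "f \<in> B_discrete G"
    using B_norm_cmod_le[OF that] by (auto simp: bounded_iff)
  then show ?thesis
    by (auto simp: B_alg_def bounded_continuous_functions_def continuous_functions_def)
qed


end

subsection \<open>The algebras of continuous coefficients\<close>

context right_top_group
begin

lemma B_alg_sub: "B_alg G T \<subseteq> B_discrete G"
  using B_alg_iff by blast

lemma B_alg_subspace: "complex_subspace (B_alg G T)"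
proof -
  have "0 \<in> B_alg G T" by (simp add: B_alg_iff B_discrete_rules zero_fun_def[symmetric]) (simp add: zero_fun_def)
  moreover have "u + v \<in> B_alg G T" if "u \<in> B_alg G T" "v \<in> B_alg G T" for u v
    using that continuous_map_add[of T u v] by (auto simp: B_alg_iff plus_fun_def intro: B_discrete_rules(2)[unfolded plus_fun_def])
  moreover have "fscale c v \<in> B_alg G T" if "v \<in> B_alg G T" for c v
  proof -
    have "continuous_map T euclidean (\<lambda>x. c * v x)"
      using that by (intro continuous_map_complex_mult) (simp_all add: B_alg_iff)
    then show ?thesis using that B_discrete_rules(3) unfolding B_alg_iff fscale_def by blast
  qed
  ultimately show ?thesis by (simp add: complex_subspace_def)
qed

lemmas B_alg_rules = complex_subspaceD[OF B_alg_subspace]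

lemma B_alg_mult: "f \<in> B_alg G T \<Longrightarrow> g \<in> B_alg G T \<Longrightarrow> f * g \<in> B_alg G T"
  using continuous_map_complex_mult[of T f g] B_discrete_mult[of f g] by (simp add: B_alg_iff times_fun_def)

text \<open>Norm approximation is uniform approximation, which preserves continuity.\<close>

lemma B_alg_closed:
  assumes f: "f \<in> B_discrete G" and approx: "\<And>e. e > 0 \<Longrightarrow> \<exists>g\<in>B_alg G T. B_norm G (f - g) \<le> e"
  shows "f \<in> B_alg G T"
  unfolding B_alg_iff
proof
  show "continuous_map T euclidean f"
  proof (rule continuous_map_complex_uniform)
    fix e :: real assume "e > 0"
    then obtain g where g: "g \<in> B_alg G T" "B_norm G (f - g) \<le> e" using approx by blast
    have "cmod (f x - g x) \<le> e" for x
      using B_norm_cmod_le[of "f - g" x] g f B_alg_sub B_discrete_rules(4)[of f g] by auto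
    then show "\<exists>g. continuous_map T euclidean g \<and> (\<forall>x\<in>topspace T. cmod (f x - g x) \<le> e)"
      using g(1) B_alg_iff by blast
  qed
qed (rule f)

lemma norm_on_subset: "norm_on V n \<Longrightarrow> U \<subseteq> V \<Longrightarrow> norm_on U n"
  unfolding norm_on_def by (meson subsetD)

text \<open>Completeness and submultiplicativity come from the discrete group; this isolates what
  remains to be checked for \<open>B(G)\<close> and \<open>A(G)\<close>.\<close>

lemma banach_algebra_if_closed:
  assumes V: "V \<subseteq> B_discrete G" "complex_subspace V" "\<And>f g. f \<in> V \<Longrightarrow> g \<in> V \<Longrightarrow> f * g \<in> V"
    and closed: "\<And>f. f \<in> B_discrete G \<Longrightarrow> (\<And>e. e > 0 \<Longrightarrow> \<exists>g\<in>V. B_norm G (f - g) \<le> e) \<Longrightarrow> f \<in> V"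
  shows "commutative_banach_algebra V (B_norm G)"
  unfolding commutative_banach_algebra_def
proof (intro conjI ballI)
  show "complex_subspace V" by (rule V)
  show "norm_on V (B_norm G)" by (rule norm_on_subset[OF B_norm_norm_on V(1)])
  show "complete_on V (B_norm G)"
    unfolding complete_on_def
  proof (intro allI impI)
    fix s :: "nat \<Rightarrow> 'a \<Rightarrow> complex"
    assume s: "(\<forall>k. s k \<in> V) \<and> (\<forall>e>0. \<exists>M. \<forall>j\<ge>M. \<forall>k\<ge>M. B_norm G (s j - s k) < e)"
    have sB: "\<And>k. s k \<in> B_discrete G" using s V(1) by blast
    obtain l where l: "l \<in> B_discrete G" "(\<lambda>k. B_norm G (s k - l)) \<longlonglongrightarrow> 0"
      using B_discrete_complete[OF sB conjunct2[OF s]] .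
    have "l \<in> V"
    proof (rule closed[OF l(1)])
      fix e :: real assume "e > 0"
      then obtain k where "norm (B_norm G (s k - l) - 0) < e" using LIMSEQ_D[OF l(2)] by blast
      then have "B_norm G (l - s k) \<le> e"
        using B_norm_minus_commute[OF l(1) sB, of k] by simp
      then show "\<exists>g\<in>V. B_norm G (l - g) \<le> e" using s by blast
    qed
    then show "\<exists>l\<in>V. (\<lambda>k. B_norm G (s k - l)) \<longlonglongrightarrow> 0" using l(2) by blast
  qed
  fix f g assume fg: "f \<in> V" "g \<in> V"
  show "f * g \<in> V" by (rule V(3)[OF fg])
  show "B_norm G (f * g) \<le> B_norm G f * B_norm G g" using fg V(1) by (intro B_norm_mult) auto
qed

theorem B_alg_banach: "commutative_banach_algebra (B_alg G T) (B_norm G)"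
  by (rule banach_algebra_if_closed[OF B_alg_sub B_alg_subspace B_alg_mult B_alg_closed])

lemma A_alg_sub: "A_alg G T \<subseteq> B_alg G T"
  by (auto simp: A_alg_def)

lemma A_alg_approx:
  "f \<in> A_alg G T \<Longrightarrow> e > 0 \<Longrightarrow> \<exists>g\<in>B_discrete G \<inter> compactly_supported_functions T. B_norm G (f - g) < e"
  by (auto simp: A_alg_def)

lemma B_discrete_zero_off: "f \<in> B_discrete G \<Longrightarrow> x \<notin> carrier G \<Longrightarrow> f x = 0"
  using B_discrete_coef coef_functions_on unfolding functions_on_def by blast

text \<open>The points at which a separating \<open>f\<close> avoids the closure of its values off
  \<open>U\<close> form a set inside \<open>U\<close> that is \<sigma>-open, because
  \<open>f\<close> is \<sigma>-continuous. Thus \<sigma> refines \<open>T\<close>.\<close>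

theorem separates_closed_imp_topological_group:
  assumes cont: "\<And>f. f \<in> B_alg G T \<Longrightarrow> continuous_map \<sigma> euclidean f"
    and sep: "separates_points_from_closed_sets T (B_alg G T)"
  shows "topological_group G T"
proof (rule topological_group_if_sigma_finer)
  fix U assume U: "openin T U"
  show "openin \<sigma> U"
  proof (subst openin_subopen, intro ballI)
    fix x assume x: "x \<in> U"
    have UG: "U \<subseteq> carrier G" using openin_subset[OF U] by simp
    have "closedin T (carrier G - U)" using closedin_diff[of T "carrier G" U] U closedin_topspace[of T] by simp
    moreover have "x \<in> topspace T - (carrier G - U)" using x UG by auto
    ultimately obtain f where f: "f \<in> B_alg G T" "f x \<notin> closure (f ` (carrier G - U))"
      using sep unfolding separates_points_from_closed_sets_def by blast
    let ?O = "{z \<in> topspace \<sigma>. f z \<in> - closure (f ` (carrier G - U))}"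
    have "openin \<sigma> ?O"
      by (rule openin_continuous_map_preimage[OF cont[OF f(1)]]) (simp add: open_Compl)
    moreover have "x \<in> ?O" using f(2) x UG by auto
    moreover have "?O \<subseteq> U"
      using closure_subset[of "f ` (carrier G - U)"] by auto
    ultimately show "\<exists>V. openin \<sigma> V \<and> x \<in> V \<and> V \<subseteq> U" by blast
  qed
qed

end

section \<open>Coefficients of compact support and their norm closure\<close>

locale hausdorff_rtg = right_top_group +
  assumes Hausdorff: "Hausdorff_space T"
begin

text \<open>In a Hausdorff space a compact \<open>K\<close> is closed and so contains the closure of
  the support. Vanishing off some compact set is the form that combines well with sums, products and
  translations.\<close>

lemma compactly_supported_iff:
  "f \<in> compactly_supported_functions T \<longleftrightarrow>
     continuous_map T euclidean f \<and> (\<exists>K. compactin T K \<and> (\<forall>x\<in>carrier G - K. f x = 0))"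
proof (intro iffI conjI)
  let ?S = "{x \<in> topspace T. f x \<noteq> 0}"
  assume f: "f \<in> compactly_supported_functions T"
  then show "continuous_map T euclidean f"
    by (simp add: compactly_supported_functions_def continuous_functions_def)
  have "?S \<subseteq> T closure_of ?S" by (rule closure_of_subset) auto
  then show "\<exists>K. compactin T K \<and> (\<forall>x\<in>carrier G - K. f x = 0)"
    using f by (intro exI[of _ "T closure_of ?S"]) (auto simp: compactly_supported_functions_def)
next
  let ?S = "{x \<in> topspace T. f x \<noteq> 0}"
  assume f: "continuous_map T euclidean f \<and> (\<exists>K. compactin T K \<and> (\<forall>x\<in>carrier G - K. f x = 0))"
  then obtain K where K: "compactin T K" "\<forall>x\<in>carrier G - K. f x = 0" by blast
  have "closedin T K" by (rule compactin_imp_closedin[OF Hausdorff K(1)])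
  moreover have "?S \<subseteq> K" using K(2) by auto
  ultimately have "T closure_of ?S \<subseteq> K" by (simp add: closure_of_minimal)
  then have "compactin T (T closure_of ?S)" using K(1) by (simp add: closed_compactin)
  then show "f \<in> compactly_supported_functions T"
    using f by (simp add: compactly_supported_functions_def continuous_functions_def)
qed

abbreviation Bc where "Bc \<equiv> B_discrete G \<inter> compactly_supported_functions T"

lemma Bc_sub: "Bc \<subseteq> B_alg G T"
  using B_alg_iff compactly_supported_iff by blast

lemma Bc_iff: "f \<in> Bc \<longleftrightarrow> f \<in> B_alg G T \<and> (\<exists>K. compactin T K \<and> (\<forall>x\<in>carrier G - K. f x = 0))"
  using B_alg_iff compactly_supported_iff by blast

lemma Bc_subspace: "complex_subspace Bc"
proof -
  have "0 \<in> Bc" unfolding Bc_iff using B_alg_rules(1) by (auto intro!: exI[of _ "{}"])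
  moreover have "u + v \<in> Bc" if uv: "u \<in> Bc" "v \<in> Bc" for u v
  proof -
    obtain K L where "compactin T K" "\<forall>x\<in>carrier G - K. u x = 0" "compactin T L" "\<forall>x\<in>carrier G - L. v x = 0"
      using uv Bc_iff by meson
    then have "compactin T (K \<union> L) \<and> (\<forall>x\<in>carrier G - (K \<union> L). (u + v) x = 0)"
      by (auto intro: compactin_Un)
    then show ?thesis using uv Bc_iff B_alg_rules(2) by blast
  qed
  moreover have "fscale c v \<in> Bc" if v: "v \<in> Bc" for c v
  proof -
    obtain K where "compactin T K" "\<forall>x\<in>carrier G - K. v x = 0" using v Bc_iff by meson
    then have "compactin T K \<and> (\<forall>x\<in>carrier G - K. fscale c v x = 0)" by (simp add: fscale_apply)
    then show ?thesis using v Bc_iff B_alg_rules(3) by blast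
  qed
  ultimately show ?thesis by (simp add: complex_subspace_def)
qed

lemmas Bc_rules = complex_subspaceD[OF Bc_subspace]

lemma Bc_mult: "f \<in> Bc \<Longrightarrow> g \<in> B_alg G T \<Longrightarrow> f * g \<in> Bc"
proof -
  assume f: "f \<in> Bc" and g: "g \<in> B_alg G T"
  obtain K where "compactin T K" "\<forall>x\<in>carrier G - K. f x = 0" using f Bc_iff by meson
  then have "compactin T K \<and> (\<forall>x\<in>carrier G - K. (f * g) x = 0)" by simp
  then show ?thesis using f g Bc_iff B_alg_mult by blast
qed

text \<open>Norm limits of continuous members are continuous by \<open>B_alg_closed\<close>, so
  approximation by \<open>Bc\<close> already yields membership in \<open>B_alg G T\<close>.\<close>

lemma A_alg_iff: "f \<in> A_alg G T \<longleftrightarrow> f \<in> B_discrete G \<and> (\<forall>e>0. \<exists>g\<in>Bc. B_norm G (f - g) \<le> e)"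
proof
  assume "f \<in> A_alg G T"
  then show "f \<in> B_discrete G \<and> (\<forall>e>0. \<exists>g\<in>Bc. B_norm G (f - g) \<le> e)"
    using A_alg_approx A_alg_sub B_alg_sub by (meson less_imp_le subsetD)
next
  assume f: "f \<in> B_discrete G \<and> (\<forall>e>0. \<exists>g\<in>Bc. B_norm G (f - g) \<le> e)"
  have "f \<in> B_alg G T"
    by (rule B_alg_closed) (use f Bc_sub in blast)+
  moreover have "\<exists>g\<in>Bc. B_norm G (f - g) < e" if "e > 0" for e
    using f that by (metis dense order_le_less_trans)
  ultimately show "f \<in> A_alg G T" by (simp add: A_alg_def)
qed

lemma Bc_A_alg: "f \<in> Bc \<Longrightarrow> f \<in> A_alg G T"
proof -
  assume f: "f \<in> Bc"
  have "f - f = 0" by simp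
  then have "B_norm G (f - f) = 0" using B_norm_norm_on B_discrete_rules(1) unfolding norm_on_def by metis
  then show ?thesis unfolding A_alg_iff using f by (auto intro!: bexI[of _ f])
qed

lemma A_alg_subspace: "complex_subspace (A_alg G T)"
proof -
  have "0 \<in> A_alg G T" by (rule Bc_A_alg[OF Bc_rules(1)])
  moreover have "u + v \<in> A_alg G T" if uv: "u \<in> A_alg G T" "v \<in> A_alg G T" for u v
    unfolding A_alg_iff
  proof (intro conjI allI impI)
    show "u + v \<in> B_discrete G" using uv A_alg_iff B_discrete_rules(2) by blast
    fix e :: real assume "e > 0"
    then obtain g h where gh: "g \<in> Bc" "h \<in> Bc" "B_norm G (u - g) \<le> e / 2" "B_norm G (v - h) \<le> e / 2"
      using uv A_alg_iff half_gt_zero by meson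
    have eq: "u + v - (g + h) = (u - g) + (v - h)" by (rule ext) simp
    have "B_norm G ((u - g) + (v - h)) \<le> B_norm G (u - g) + B_norm G (v - h)"
      using uv gh A_alg_iff by (intro B_norm_add B_discrete_rules(4)) auto
    then have "B_norm G (u + v - (g + h)) \<le> e" unfolding eq using gh(3,4) by linarith
    then show "\<exists>g\<in>Bc. B_norm G (u + v - g) \<le> e" using Bc_rules(2)[OF gh(1,2)] by blast
  qed
  moreover have "fscale c v \<in> A_alg G T" if v: "v \<in> A_alg G T" for c v
    unfolding A_alg_iff
  proof (intro conjI allI impI)
    show "fscale c v \<in> B_discrete G" using v A_alg_iff B_discrete_rules(3) by blast
    fix e :: real assume e: "e > 0"
    have "e / (cmod c + 1) > 0" using e by (simp add: add_nonneg_pos)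
    then obtain g where g: "g \<in> Bc" "B_norm G (v - g) \<le> e / (cmod c + 1)" using v A_alg_iff by meson
    have "B_norm G (fscale c v - fscale c g) = cmod c * B_norm G (v - g)"
      unfolding fscale_algebra(6)[symmetric] using v g A_alg_iff by (intro B_norm_scale B_discrete_rules(4)) auto
    also have "\<dots> \<le> cmod c * (e / (cmod c + 1))" using g(2) by (intro mult_left_mono) auto
    also have "\<dots> \<le> e" using e using mult_left_mono[of "cmod c" "cmod c + 1" e]
      by (simp add: divide_le_eq add_nonneg_pos mult.commute)
    finally show "\<exists>g\<in>Bc. B_norm G (fscale c v - g) \<le> e" using Bc_rules(3)[OF g(1)] by blast
  qed
  ultimately show ?thesis by (simp add: complex_subspace_def)
qed

lemma A_alg_mult: "f \<in> A_alg G T \<Longrightarrow> g \<in> B_alg G T \<Longrightarrow> f * g \<in> A_alg G T"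
  unfolding A_alg_iff[of "f * g"]
proof (intro conjI allI impI)
  assume f: "f \<in> A_alg G T" and g: "g \<in> B_alg G T"
  have fB: "f \<in> B_discrete G" and gB: "g \<in> B_discrete G" using f g A_alg_iff B_alg_iff by auto
  show "f * g \<in> B_discrete G" by (rule B_discrete_mult[OF fB gB])
  fix e :: real assume e: "e > 0"
  note n = B_norm_nonneg[OF gB]
  have "e / (B_norm G g + 1) > 0" using e n by simp
  then obtain k where k: "k \<in> Bc" "B_norm G (f - k) \<le> e / (B_norm G g + 1)" using f A_alg_iff by meson
  have eq: "f * g - k * g = (f - k) * g" by (rule ext) (simp add: left_diff_distrib)
  have "B_norm G ((f - k) * g) \<le> B_norm G (f - k) * B_norm G g"
    using fB gB k by (intro B_norm_mult B_discrete_rules(4)) auto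
  moreover have "B_norm G (f - k) * B_norm G g \<le> e / (B_norm G g + 1) * B_norm G g"
    using k(2) n by (rule mult_right_mono)
  moreover have "e / (B_norm G g + 1) * B_norm G g \<le> e" using e n by (simp add: field_simps)
  ultimately have "B_norm G (f * g - k * g) \<le> e" unfolding eq by linarith
  then show "\<exists>k\<in>Bc. B_norm G (f * g - k) \<le> e" using Bc_mult[OF k(1) g] by blast
qed

theorem A_alg_banach: "commutative_banach_algebra (A_alg G T) (B_norm G)"
proof (rule banach_algebra_if_closed)
  show "A_alg G T \<subseteq> B_discrete G" using A_alg_iff by blast
  show "complex_subspace (A_alg G T)" by (rule A_alg_subspace)
  show "f * g \<in> A_alg G T" if "f \<in> A_alg G T" "g \<in> A_alg G T" for f g
    using that A_alg_mult A_alg_sub by blast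
  fix f assume f: "f \<in> B_discrete G" and approx: "\<And>e. e > 0 \<Longrightarrow> \<exists>g\<in>A_alg G T. B_norm G (f - g) \<le> e"
  show "f \<in> A_alg G T"
    unfolding A_alg_iff
  proof (intro conjI allI impI f)
    fix e :: real assume "e > 0"
    then obtain g where g: "g \<in> A_alg G T" "B_norm G (f - g) \<le> e / 2" using approx[of "e / 2"] by auto
    then obtain k where k: "k \<in> Bc" "B_norm G (g - k) \<le> e / 2" using A_alg_iff \<open>e > 0\<close> half_gt_zero by meson
    have eq: "f - k = (f - g) + (g - k)" by (rule ext) simp
    have "B_norm G ((f - g) + (g - k)) \<le> B_norm G (f - g) + B_norm G (g - k)"
      using f g k A_alg_iff by (intro B_norm_add B_discrete_rules(4)) auto
    then have "B_norm G (f - k) \<le> e" unfolding eq using g(2) k(2) by linarith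
    then show "\<exists>g\<in>Bc. B_norm G (f - g) \<le> e" using k(1) by blast
  qed
qed

lemma B_alg_right_translate:
  assumes f: "f \<in> B_alg G T" and g: "g \<in> carrier G"
  shows "right_translate G g f \<in> B_alg G T"
  unfolding B_alg_iff
proof
  show "right_translate G g f \<in> B_discrete G" using f g B_discrete_right_translate B_alg_iff by blast
  have "continuous_map T euclidean (\<lambda>x. f (x \<otimes> g))"
    using continuous_map_compose[OF right_continuous[OF g]] f B_alg_iff unfolding o_def by blast
  then show "continuous_map T euclidean (right_translate G g f)"
    by (rule continuous_map_complex_cong) (simp add: right_translate_def)
qed

lemma Bc_right_translate:
  assumes f: "f \<in> Bc" and g: "g \<in> carrier G"
  shows "right_translate G g f \<in> Bc"
proof -
  obtain K where K: "compactin T K" "\<forall>x\<in>carrier G - K. f x = 0" using f Bc_iff by meson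
  have KG: "K \<subseteq> carrier G" using compactin_subset_topspace[OF K(1)] by simp
  have "compactin T ((\<lambda>x. x \<otimes> inv g) ` K)"
    by (rule image_compactin[OF K(1) right_continuous]) (use g in simp)
  moreover have "right_translate G g f x = 0" if "x \<in> carrier G - (\<lambda>x. x \<otimes> inv g) ` K" for x
  proof -
    have "x = x \<otimes> g \<otimes> inv g" using that g by (simp add: m_assoc)
    then have "x \<otimes> g \<notin> K" using that by blast
    then show ?thesis using K(2) that g by (simp add: right_translate_def)
  qed
  ultimately show ?thesis unfolding Bc_iff using B_alg_right_translate[OF _ g] f Bc_sub by blast
qed

lemma A_alg_right_translate:
  assumes f: "f \<in> A_alg G T" and g: "g \<in> carrier G"
  shows "right_translate G g f \<in> A_alg G T"
  unfolding A_alg_iff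
proof (intro conjI allI impI)
  have fB: "f \<in> B_discrete G" using f A_alg_iff by blast
  show "right_translate G g f \<in> B_discrete G" by (rule B_discrete_right_translate[OF fB g])
  fix e :: real assume "e > 0"
  then obtain k where k: "k \<in> Bc" "B_norm G (f - k) \<le> e" using f A_alg_iff by meson
  have eq: "right_translate G g f - right_translate G g k = right_translate G g (f - k)"
    by (rule ext) (simp add: right_translate_def)
  have "B_norm G (right_translate G g (f - k)) \<le> B_norm G (f - k)"
    using fB k g by (intro B_norm_right_translate B_discrete_rules(4)) auto
  then have "B_norm G (right_translate G g f - right_translate G g k) \<le> e" unfolding eq using k(2) by linarith
  then show "\<exists>k\<in>Bc. B_norm G (right_translate G g f - k) \<le> e" using Bc_right_translate[OF k(1) g] by blast
qed

text \<open>Functions of \<open>A(G)\<close> vanish at infinity, so finitely many of them cut a neighbourhood out of a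
  compact set.\<close>

theorem separates_points_imp_topological_group:
  assumes cont: "\<And>f. f \<in> B_alg G T \<Longrightarrow> continuous_map \<sigma> euclidean f"
    and sep: "separates_points (carrier G) (A_alg G T)"
  shows "topological_group G T"
proof (rule topological_group_if_sigma_finer)
  fix U assume U: "openin T U"
  have UG: "U \<subseteq> carrier G" using openin_subset[OF U] by simp
  have cont_sigma: "continuous_map \<sigma> euclidean f" if "f \<in> A_alg G T" for f
    using cont A_alg_sub that by blast
  have cont_T: "continuous_map T euclidean f" if "f \<in> A_alg G T" for f
    using A_alg_sub that B_alg_iff by blast
  show "openin \<sigma> U"
  proof (subst openin_subopen, intro ballI)
    fix x assume x: "x \<in> U"
    with UG have xG: "x \<in> carrier G" by blast
    show "\<exists>V. openin \<sigma> V \<and> x \<in> V \<and> V \<subseteq> U"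
    proof (cases "carrier G \<subseteq> U")
      case True
      then have "U = topspace \<sigma>" using UG by auto
      then show ?thesis using x openin_topspace[of \<sigma>] by blast
    next
      case False
      then obtain y where y: "y \<in> carrier G" "y \<noteq> x" using x by blast
      then obtain f1 where f1: "f1 \<in> A_alg G T" "f1 x \<noteq> f1 y" using sep xG unfolding separates_points_def by metis
      then obtain z where z: "z \<in> carrier G" "f1 z \<noteq> 0" using xG y by metis
      \<comment> \<open>\<open>f1\<close> is nonzero somewhere because it separates two points;
        right translation brings its nonzero value at \<open>z\<close> to \<open>x\<close>.\<close>
      define f0 where "f0 = right_translate G (inv x \<otimes> z) f1"
      have f0: "f0 \<in> A_alg G T" unfolding f0_def using f1 xG z by (intro A_alg_right_translate) auto
      have f0x: "f0 x \<noteq> 0" using xG z by (simp add: f0_def right_translate_def m_assoc[symmetric])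
      \<comment> \<open>Half the modulus at \<open>x\<close>: where \<open>f0\<close> exceeds
        \<open>r\<close> in modulus, an approximation \<open>g\<close> within \<open>r\<close>
        cannot vanish, so such points lie in the compact set \<open>K\<close>.\<close>
      define r where "r = cmod (f0 x) / 2"
      have r: "r > 0" using f0x by (simp add: r_def)
      then obtain g where g: "g \<in> Bc" "B_norm G (f0 - g) < r" using A_alg_approx[OF f0] by blast
      then obtain K where K: "compactin T K" "\<forall>x\<in>carrier G - K. g x = 0" using Bc_iff by meson
      have large: "w \<in> K" if w: "w \<in> carrier G" "cmod (f0 w) > r" for w
      proof (rule ccontr)
        assume "w \<notin> K"
        then have "g w = 0" using K(2) w by blast
        moreover have "cmod ((f0 - g) w) \<le> B_norm G (f0 - g)"
          using f0 g A_alg_iff by (intro B_norm_cmod_le B_discrete_rules(4)) auto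
        ultimately show False using g(2) w(2) by simp
      qed
      have compact: "compactin T (K \<inter> (topspace T - U))"
        using K(1) U by (intro compact_Int_closedin closedin_diff closedin_topspace)
      define P where "P f w = (f \<in> A_alg G T \<and> f w \<noteq> f x)" for f w
      have ex: "\<exists>f. P f w" if "w \<in> K \<inter> (topspace T - U)" for w
      proof -
        have "w \<in> carrier G" "w \<noteq> x" using that x by auto
        then show ?thesis using sep xG unfolding separates_points_def P_def by blast
      qed
      define F where "F w = (SOME f. P f w)" for w
      have F: "F w \<in> A_alg G T" "F w w \<noteq> F w x" if "w \<in> K \<inter> (topspace T - U)" for w
      proof -
        have "P (F w) w" unfolding F_def by (rule someI_ex[OF ex[OF that]])
        then show "F w \<in> A_alg G T" "F w w \<noteq> F w x" by (auto simp: P_def)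
      qed
      define e where "e w = cmod (F w w - F w x) / 2" for w
      have e: "e w > 0" if "w \<in> K \<inter> (topspace T - U)" for w using F[OF that] by (simp add: e_def)
      define Nb where "Nb w = {v \<in> topspace T. F w v \<in> ball (F w w) (e w)}" for w
      have Nb: "openin T (Nb w)" "w \<in> Nb w" if "w \<in> K \<inter> (topspace T - U)" for w
        unfolding Nb_def using openin_continuous_map_preimage[OF cont_T[OF F(1)[OF that]], of "ball (F w w) (e w)"] that e[OF that] by auto
      have "\<exists>W. finite W \<and> W \<subseteq> Nb ` (K \<inter> (topspace T - U)) \<and> K \<inter> (topspace T - U) \<subseteq> \<Union>W"
        by (rule compactinD[OF compact]) (use Nb in blast)+
      then obtain W where W: "finite W" "W \<subseteq> Nb ` (K \<inter> (topspace T - U))" "K \<inter> (topspace T - U) \<subseteq> \<Union>W"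
        by blast
      then obtain A where A: "A \<subseteq> K \<inter> (topspace T - U)" "finite A" "W = Nb ` A"
        using finite_subset_image by meson
      \<comment> \<open>The first condition forces points of \<open>Q\<close> into \<open>K\<close>.
        The others keep them out of \<open>K\<close> minus \<open>U\<close>: the balls around
        \<open>F w x\<close> and \<open>F w w\<close> have half the distance of their centres as
        radius, hence are disjoint.\<close>
      define Q where "Q = {v \<in> topspace \<sigma>. f0 v \<in> - cball 0 r} \<inter> (\<Inter>w\<in>A. {v \<in> topspace \<sigma>. F w v \<in> ball (F w x) (e w)})"
      have out: "openin \<sigma> {v \<in> topspace \<sigma>. f0 v \<in> - cball 0 r}"
        by (rule openin_continuous_map_preimage[OF cont_sigma[OF f0]]) (simp add: open_Compl)
      have "openin \<sigma> Q"
      proof (cases "A = {}")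
        case True
        then show ?thesis unfolding Q_def using out by simp
      next
        case False
        show ?thesis unfolding Q_def
        proof (intro openin_Int openin_INT2 A(2) False out)
          show "openin \<sigma> {v \<in> topspace \<sigma>. F w v \<in> ball (F w x) (e w)}" if "w \<in> A" for w
            by (rule openin_continuous_map_preimage[OF cont_sigma[OF F(1)]]) (use that A in auto)
        qed
      qed
      moreover have "x \<in> Q" using xG f0x A e by (auto simp: Q_def r_def)
      moreover have "Q \<subseteq> U"
      proof (rule subsetI, rule ccontr)
        fix v assume v: "v \<in> Q" "v \<notin> U"
        then have "v \<in> K \<inter> (topspace T - U)" using large by (auto simp: Q_def)
        then obtain w where w: "w \<in> A" "v \<in> Nb w" using W(3) A(3) by blast
        have "dist (F w w) (F w v) < e w" using w(2) by (simp add: Nb_def)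
        moreover have "dist (F w x) (F w v) < e w" using v(1) w(1) by (simp add: Q_def)
        ultimately have "dist (F w w) (F w x) < e w + e w"
          by (metis add_strict_mono dist_commute dist_triangle order_le_less_trans)
        then show False by (simp add: e_def dist_norm)
      qed
      ultimately show ?thesis by blast
    qed
  qed
qed

end

section \<open>Groups with a dense topological center\<close>

locale admissible_group = hausdorff_rtg +
  assumes adm: "admissible G T"
begin

lemma center_dense: "openin T U \<Longrightarrow> U \<noteq> {} \<Longrightarrow> \<exists>l\<in>topological_center G T. l \<in> U"
  using adm unfolding admissible_def dense_intersects_open by blast

text \<open>Left translates of \<open>f\<close> are uniform limits of left translates by elements of the center.\<close>

lemma left_translate_continuous:
  assumes f: "continuous_map T euclidean f" and q: "continuous_map T euclidean q" and K: "K \<ge> (0 :: real)"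
    and eq: "\<And>s t y. \<lbrakk>s \<in> carrier G; t \<in> carrier G; y \<in> carrier G\<rbrakk> \<Longrightarrow>
       (cmod (f (inv s \<otimes> y) - f (inv t \<otimes> y)))\<^sup>2 \<le> K * (Re (q \<one>) - Re (q (inv s \<otimes> t)))"
    and g: "g \<in> carrier G"
  shows "continuous_map T euclidean (\<lambda>x. f (g \<otimes> x))"
proof (rule continuous_map_complex_uniform)
  fix e :: real assume e: "e > 0"
  \<comment> \<open>Chosen so that \<open>K * d \<le> e\<^sup>2\<close>; the summand 1 covers
    \<open>K = 0\<close>.\<close>
  define d where "d = e\<^sup>2 / (K + 1)"
  have d: "d > 0" using e K by (simp add: d_def)
  have q': "continuous_map T euclidean (\<lambda>x. q (x \<otimes> inv g))"
    using continuous_map_compose[OF right_continuous[OF inv_closed[OF g]] q] by (simp add: o_def)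
  obtain U where U: "openin T U" "g \<in> U" "\<And>y. y \<in> U \<Longrightarrow> cmod (q (y \<otimes> inv g) - q (g \<otimes> inv g)) < d"
    using continuous_map_normD[OF q' _ d, of g] g by auto
  obtain l where l: "l \<in> topological_center G T" "l \<in> U" using center_dense[OF U(1)] U(2) by blast
  then have lG: "l \<in> carrier G" and lc: "continuous_map T T (\<lambda>x. l \<otimes> x)" by (auto simp: topological_center_def)
  have "continuous_map T euclidean (\<lambda>x. f (l \<otimes> x))"
    using continuous_map_compose[OF lc f] by (simp add: o_def)
  moreover have "cmod (f (g \<otimes> x) - f (l \<otimes> x)) \<le> e" if x: "x \<in> topspace T" for x
  proof -
    have "(cmod (f (inv (inv l) \<otimes> x) - f (inv (inv g) \<otimes> x)))\<^sup>2 \<le> K * (Re (q \<one>) - Re (q (inv (inv l) \<otimes> inv g)))"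
      using lG g x by (intro eq) auto
    then have "(cmod (f (l \<otimes> x) - f (g \<otimes> x)))\<^sup>2 \<le> K * (Re (q \<one>) - Re (q (l \<otimes> inv g)))"
      using lG g by simp
    also have "\<dots> \<le> K * d"
    proof (rule mult_left_mono[OF _ K])
      have "cmod (q (l \<otimes> inv g) - q \<one>) < d" using U(3)[OF l(2)] g by simp
      then show "Re (q \<one>) - Re (q (l \<otimes> inv g)) \<le> d"
        using abs_Re_le_cmod[of "q (l \<otimes> inv g) - q \<one>"] by simp
    qed
    also have "\<dots> \<le> e\<^sup>2" using K e unfolding d_def by (simp add: field_simps)
    finally have "cmod (f (l \<otimes> x) - f (g \<otimes> x)) \<le> e" by (rule power2_le_imp_le) (use e in simp)
    then show ?thesis by (simp add: norm_minus_commute)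
  qed
  ultimately show "\<exists>h. continuous_map T euclidean h \<and> (\<forall>x\<in>topspace T. cmod (f (g \<otimes> x) - h x) \<le> e)" by blast
qed

theorem B_alg_sigma_continuous:
  assumes fB: "f \<in> B_alg G T"
  shows "continuous_map \<sigma> euclidean f"
proof -
  have f: "f \<in> B_discrete G" "continuous_map T euclidean f" using fB B_alg_iff by auto
  obtain q K where q: "positive_definite G q" and K: "K \<ge> 0"
    and eq: "\<And>s t y. \<lbrakk>s \<in> carrier G; t \<in> carrier G; y \<in> carrier G\<rbrakk> \<Longrightarrow>
       (cmod (f (inv s \<otimes> y) - f (inv t \<otimes> y)))\<^sup>2 \<le> K * (Re (q \<one>) - Re (q (inv s \<otimes> t)))"
    and approx: "\<And>e. e > 0 \<Longrightarrow> \<exists>d\<in>fin_supp (carrier G). \<forall>x\<in>carrier G. cmod (q x - pairing d (\<lambda>y. f (x \<otimes> y))) \<le> e"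
    using B_discrete_equicontinuous[OF f(1)] by metis
  \<comment> \<open>Right translations are continuous for \<open>T\<close>, hence so are the
    combinations of right translates of \<open>f\<close> that approximate \<open>q\<close>
    uniformly.\<close>
  have qc: "continuous_map T euclidean q"
  proof (rule continuous_map_complex_uniform)
    fix e :: real assume "e > 0"
    then obtain d where d: "d \<in> fin_supp (carrier G)" "\<forall>x\<in>carrier G. cmod (q x - pairing d (\<lambda>y. f (x \<otimes> y))) \<le> e"
      using approx by blast
    have "continuous_map T euclidean (\<lambda>x. f (x \<otimes> y))" if "y \<in> carrier G" for y
      using continuous_map_compose[OF right_continuous[OF that] f(2)] by (simp add: o_def)
    then have "continuous_map T euclidean (\<lambda>x. pairing d (\<lambda>y. f (x \<otimes> y)))"
      unfolding pairing_def using d(1)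
      by (intro continuous_map_sum continuous_map_complex_mult) (auto simp: fin_supp_def)
    then show "\<exists>g. continuous_map T euclidean g \<and> (\<forall>x\<in>topspace T. cmod (q x - g x) \<le> e)" using d(2) by auto
  qed
  \<comment> \<open>Krein's inequality for \<open>q\<close> has the shape of the equicontinuity
    estimate, so \<open>q\<close> can take the place of \<open>f\<close> as well.\<close>
  have q_left: "continuous_map T euclidean (\<lambda>x. q (g \<otimes> x))" if "g \<in> carrier G" for g
    by (rule left_translate_continuous[OF qc qc _ _ that, of "2 * Re (q \<one>)"])
      (use Krein[OF q] positive_definite_one(2)[OF q] in auto)
  have f_left: "continuous_map T euclidean (\<lambda>x. f (g \<otimes> x))" if "g \<in> carrier G" for g
    by (rule left_translate_continuous[OF f(2) qc K eq that])
  show ?thesis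
    unfolding sigma_continuous_iff
  proof (rule continuous_map_normI)
    fix w and e :: real assume w: "w \<in> topspace (prod_topology T T)" and e: "e > 0"
    obtain a b where ab: "w = (a, b)" "a \<in> carrier G" "b \<in> carrier G" using w by auto
    define d where "d = (e / 2)\<^sup>2 / (K + 1)"
    have d: "d > 0" using e K by (simp add: d_def)
    obtain U where U: "openin T U" "a \<in> U" "\<And>y. y \<in> U \<Longrightarrow> cmod (q (inv a \<otimes> y) - q (inv a \<otimes> a)) < d"
      using continuous_map_normD[OF q_left[of "inv a"] _ d, of a] ab by auto
    obtain V where V: "openin T V" "b \<in> V" "\<And>y. y \<in> V \<Longrightarrow> cmod (f (inv a \<otimes> y) - f (inv a \<otimes> b)) < e / 2"
      using continuous_map_normD[OF f_left[of "inv a"], of b "e / 2"] ab e by auto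
    \<comment> \<open>First \<open>x\<close> moves to \<open>a\<close> with \<open>y\<close>
      arbitrary in \<open>V\<close>, where uniformity in \<open>y\<close> is essential; then only
      the fixed left translate of \<open>f\<close> by \<open>inv a\<close> is compared at
      \<open>y\<close> and \<open>b\<close>.\<close>
    have "cmod (f (inv x \<otimes> y) - f (inv a \<otimes> b)) < e" if xy: "x \<in> U" "y \<in> V" for x y
    proof -
      have G: "x \<in> carrier G" "y \<in> carrier G"
        using xy openin_subset[OF U(1)] openin_subset[OF V(1)] by auto
      have "(cmod (f (inv a \<otimes> y) - f (inv x \<otimes> y)))\<^sup>2 \<le> K * (Re (q \<one>) - Re (q (inv a \<otimes> x)))"
        by (rule eq[OF ab(2) G])
      also have "\<dots> \<le> K * d"
      proof (rule mult_left_mono[OF _ K])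
        have "cmod (q (inv a \<otimes> x) - q \<one>) < d" using U(3)[OF xy(1)] ab by simp
        then show "Re (q \<one>) - Re (q (inv a \<otimes> x)) \<le> d"
          using abs_Re_le_cmod[of "q (inv a \<otimes> x) - q \<one>"] by simp
      qed
      also have "\<dots> \<le> (e / 2)\<^sup>2" using K e unfolding d_def by (simp add: field_simps)
      finally have "cmod (f (inv a \<otimes> y) - f (inv x \<otimes> y)) \<le> e / 2" by (rule power2_le_imp_le) (use e in simp)
      then have "cmod (f (inv x \<otimes> y) - f (inv a \<otimes> y)) \<le> e / 2" by (simp add: norm_minus_commute)
      moreover have "cmod (f (inv x \<otimes> y) - f (inv a \<otimes> b)) \<le> cmod (f (inv x \<otimes> y) - f (inv a \<otimes> y)) + cmod (f (inv a \<otimes> y) - f (inv a \<otimes> b))"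
        using norm_triangle_ineq[of "f (inv x \<otimes> y) - f (inv a \<otimes> y)" "f (inv a \<otimes> y) - f (inv a \<otimes> b)"] by simp
      ultimately show ?thesis using V(3)[OF xy(2)] by linarith
    qed
    then have "\<forall>v\<in>U \<times> V. cmod ((\<lambda>(x, y). f (inv x \<otimes> y)) v - (\<lambda>(x, y). f (inv x \<otimes> y)) w) < e"
      by (auto simp: ab)
    moreover have "openin (prod_topology T T) (U \<times> V)" using U V by (simp add: openin_prod_Times_iff)
    ultimately show "\<exists>S. openin (prod_topology T T) S \<and> w \<in> S \<and>
        (\<forall>v\<in>S. cmod ((\<lambda>(x, y). f (inv x \<otimes> y)) v - (\<lambda>(x, y). f (inv x \<otimes> y)) w) < e)"
      using U(2) V(2) ab by (intro exI[of _ "U \<times> V"]) auto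
  qed
qed

lemma B_alg_left_translate:
  assumes f: "f \<in> B_alg G T" and g: "g \<in> carrier G"
  shows "left_translate G g f \<in> B_alg G T"
  unfolding B_alg_iff
proof
  show "left_translate G g f \<in> B_discrete G" using f g B_discrete_left_translate B_alg_iff by blast
  have "continuous_map T euclidean ((\<lambda>(x, y). f (inv x \<otimes> y)) \<circ> (\<lambda>y. (inv g, y)))"
    using B_alg_sigma_continuous[OF f] g unfolding sigma_continuous_iff
    by (intro continuous_map_compose[of _ "prod_topology T T"] continuous_map_pairedI) auto
  then show "continuous_map T euclidean (left_translate G g f)"
    by (rule continuous_map_complex_cong) (use g in \<open>simp add: left_translate_def\<close>)
qed

lemma B_sigma_eq: "B_sigma G T = B_alg G T"
  using B_alg_sigma_continuous by (auto simp: B_sigma_def continuous_functions_def)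

lemma A_sigma_eq: "A_sigma G T = A_alg G T"
  using B_alg_sigma_continuous A_alg_sub by (auto simp: A_sigma_def continuous_functions_def)

section \<open>The quotient by \<open>N\<close>\<close>

sublocale Nn: normal N G by (rule N_normal)

sublocale Q: surj_hom G "G Mod N" "\<lambda>x. N #> x"
proof -
  have "group_hom G (G Mod N) (\<lambda>x. N #> x)"
    by (intro group_hom.intro group_hom_axioms.intro is_group Nn.factorgroup_is_group Nn.r_coset_hom_Mod)
  then show "surj_hom G (G Mod N) (\<lambda>x. N #> x)"
    by (intro surj_hom.intro surj_hom_axioms.intro) (simp_all add: carrier_FactGroup)
qed

lemma pullback_eq: "pullback_quotient G N f = Q.pull f"
  by (rule ext) (simp add: pullback_quotient_def Q.pull_def)

abbreviation TQ where "TQ \<equiv> quotient_group_topology G T N"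

lemma quotient_map_TQ: "quotient_map T TQ (\<lambda>x. N #> x)"
  unfolding quotient_group_topology_def by (rule quotient_map_quotient_topology)

lemma continuous_pull_iff: "continuous_map T euclidean (Q.pull f) \<longleftrightarrow> continuous_map TQ euclidean f"
proof -
  have "continuous_map T euclidean (Q.pull f) \<longleftrightarrow> continuous_map T euclidean (f \<circ> (\<lambda>x. N #> x))"
    by (auto simp: Q.pull_def elim!: continuous_map_complex_cong)
  then show ?thesis using continuous_compose_quotient_map_eq[OF quotient_map_TQ] by blast
qed

lemma B_alg_quotient_iff:
  "f \<in> B_alg (G Mod N) TQ \<longleftrightarrow> f \<in> B_discrete (G Mod N) \<and> continuous_map TQ euclidean f"
proof -
  have "bounded (f ` topspace TQ)" if "f \<in> B_discrete (G Mod N)"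
    using Q.H.B_norm_cmod_le[OF that] by (auto simp: bounded_iff)
  then show ?thesis
    by (auto simp: B_alg_def bounded_continuous_functions_def continuous_functions_def)
qed

lemma B_quotient_functions_on: "f \<in> B_discrete (G Mod N) \<Longrightarrow> f \<in> functions_on (G Mod N)"
  using Q.H.B_discrete_coef Q.H.coef_functions_on by blast

theorem B_sigma_quotient:
  "bij_betw (pullback_quotient G N) (B_alg (G Mod N) TQ) (B_sigma G T)"
  unfolding bij_betw_def
proof
  show "inj_on (pullback_quotient G N) (B_alg (G Mod N) TQ)"
  proof (rule inj_onI)
    fix f g assume fg: "f \<in> B_alg (G Mod N) TQ" "g \<in> B_alg (G Mod N) TQ"
      and eq: "pullback_quotient G N f = pullback_quotient G N g"
    show "f = g"
    proof
      fix c
      show "f c = g c"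
      proof (cases "c \<in> carrier (G Mod N)")
        case True
        then obtain x where "x \<in> carrier G" "c = N #> x" by (auto simp: carrier_FactGroup)
        then show ?thesis using fun_cong[OF eq, of x] by (simp add: pullback_quotient_def)
      next
        case False
        have "f \<in> functions_on (G Mod N)" "g \<in> functions_on (G Mod N)"
          using fg B_quotient_functions_on unfolding B_alg_quotient_iff by blast+
        then show ?thesis using False by (simp add: functions_on_def)
      qed
    qed
  qed
  show "pullback_quotient G N ` B_alg (G Mod N) TQ = B_sigma G T"
    unfolding B_sigma_eq
  proof (intro equalityI subsetI)
    fix F assume "F \<in> pullback_quotient G N ` B_alg (G Mod N) TQ"
    then show "F \<in> B_alg G T"
      using Q.B_discrete_pull continuous_pull_iff by (auto simp: pullback_eq B_alg_iff B_alg_quotient_iff)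
  next
    fix F assume F: "F \<in> B_alg G T"
    \<comment> \<open>Two representatives of a coset differ by a left factor in \<open>N\<close>,
      under which the \<sigma>-continuous \<open>F\<close> is invariant, so any choice of
      representatives serves.\<close>
    define f where "f c = (if c \<in> carrier (G Mod N) then F (Q.rep_pt c) else 0)" for c
    have "Q.pull f = F"
    proof
      fix x
      show "Q.pull f x = F x"
      proof (cases "x \<in> carrier G")
        case True
        then have c: "N #> x \<in> carrier (G Mod N)" by (auto simp: carrier_FactGroup)
        let ?y = "Q.rep_pt (N #> x)"
        have y: "?y \<in> carrier G" "N #> ?y = N #> x" using Q.rep_pt[OF c] by auto
        then have "?y \<in> N #> x" using rcos_self[OF y(1) Nn.is_subgroup] by simp
        then obtain n where "n \<in> N" "?y = n \<otimes> x" by (auto simp: r_coset_def)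
        then have "F ?y = F x" using sigma_continuous_N_invariant[OF B_alg_sigma_continuous[OF F] _ True] by simp
        then show ?thesis using True c by (simp add: Q.pull_def f_def)
      next
        case False
        then show ?thesis using F B_discrete_zero_off B_alg_iff by (simp add: Q.pull_def)
      qed
    qed
    moreover have "f \<in> functions_on (G Mod N)" by (simp add: functions_on_def f_def)
    ultimately have "f \<in> B_alg (G Mod N) TQ"
      using F Q.B_discrete_descend[of f] continuous_pull_iff[of f] by (simp add: B_alg_iff B_alg_quotient_iff)
    then show "F \<in> pullback_quotient G N ` B_alg (G Mod N) TQ"
      using \<open>Q.pull f = F\<close> pullback_eq[of f] by (metis imageI)
  qed
qed

lemma B_norm_quotient:
  "f \<in> B_alg (G Mod N) TQ \<Longrightarrow> B_norm G (pullback_quotient G N f) = B_norm (G Mod N) f"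
  unfolding pullback_eq B_alg_quotient_iff by (simp add: Q.B_norm_pull)

end

section \<open>Locally compact Hausdorff topological groups\<close>

locale lc_group = group G for G (structure) +
  fixes T :: "'a topology"
  assumes tg: "topological_group G T" and T_Hausdorff: "Hausdorff_space T"
    and lc: "locally_compact_space T"
begin

lemma tg_topspace: "topspace T = carrier G"
  using tg by (simp add: topological_group_def)

lemma tg_mult: "continuous_map (prod_topology T T) T (\<lambda>(x, y). x \<otimes> y)"
  using tg by (simp add: topological_group_def)

lemma tg_inv: "continuous_map T T (\<lambda>x. inv x)"
  using tg by (simp add: topological_group_def)

lemma tg_mult_compose:
  "continuous_map X T f \<Longrightarrow> continuous_map X T g \<Longrightarrow> continuous_map X T (\<lambda>x. f x \<otimes> g x)"
  using continuous_map_compose[OF continuous_map_pairedI tg_mult, of X f g] by (simp add: o_def)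

lemma tg_left: "g \<in> carrier G \<Longrightarrow> continuous_map T T (\<lambda>x. g \<otimes> x)"
  and tg_right: "g \<in> carrier G \<Longrightarrow> continuous_map T T (\<lambda>x. x \<otimes> g)"
  by (intro tg_mult_compose; simp add: tg_topspace continuous_map_id[unfolded id_def])+

sublocale hausdorff_rtg G T
  by unfold_locales
    (use tg_right T_Hausdorff tg_topspace in \<open>auto simp: right_topological_group_def is_group\<close>)

lemma carrier_open: "openin T (carrier G)"
  using openin_topspace[of T] by simp

lemma preimage_open: "continuous_map T T f \<Longrightarrow> openin T U \<Longrightarrow> openin T {x \<in> carrier G. f x \<in> U}"
  using openin_continuous_map_preimage[of T T f U] by simp

subsection \<open>Nonnegative functions of compact support\<close>

definition Cp :: "('a \<Rightarrow> real) set" where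
  "Cp = {f. continuous_map T euclideanreal f \<and> (\<forall>x. 0 \<le> f x) \<and> (\<exists>K. compactin T K \<and> (\<forall>x. x \<notin> K \<longrightarrow> f x = 0))}"

definition trans :: "'a \<Rightarrow> ('a \<Rightarrow> real) \<Rightarrow> 'a \<Rightarrow> real" where
  "trans s f x = (if x \<in> carrier G then f (inv s \<otimes> x) else 0)"

lemma compact_carrier: "compactin T K \<Longrightarrow> K \<subseteq> carrier G"
  using compactin_subset_topspace[of T K] by simp

lemma Cp_nonneg: "f \<in> Cp \<Longrightarrow> 0 \<le> f x"
  by (simp add: Cp_def)

lemma Cp_continuous: "f \<in> Cp \<Longrightarrow> continuous_map T euclideanreal f"
  by (simp add: Cp_def)

lemma Cp_support:
  assumes "f \<in> Cp"
  obtains K where "compactin T K" "\<And>x. x \<notin> K \<Longrightarrow> f x = 0"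
  using assms unfolding Cp_def by blast

lemma Cp_off: "f \<in> Cp \<Longrightarrow> x \<notin> carrier G \<Longrightarrow> f x = 0"
  using compact_carrier unfolding Cp_def by blast

lemma CpI:
  assumes "continuous_map T euclideanreal f" "\<And>x. 0 \<le> f x" "compactin T K" "\<And>x. x \<notin> K \<Longrightarrow> f x = 0"
  shows "f \<in> Cp"
  using assms unfolding Cp_def by blast

lemma Cp_zero: "(\<lambda>x. 0) \<in> Cp"
  by (rule CpI[of _ "{}"]) auto

lemma Cp_add:
  assumes f: "f \<in> Cp" and g: "g \<in> Cp"
  shows "(\<lambda>x. f x + g x) \<in> Cp"
proof -
  obtain K L where KL: "compactin T K" "\<And>x. x \<notin> K \<Longrightarrow> f x = 0" "compactin T L" "\<And>x. x \<notin> L \<Longrightarrow> g x = 0"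
  proof -
    obtain K where "compactin T K" "\<And>x. x \<notin> K \<Longrightarrow> f x = 0" using Cp_support[OF f] by blast
    moreover obtain L where "compactin T L" "\<And>x. x \<notin> L \<Longrightarrow> g x = 0" using Cp_support[OF g] by blast
    ultimately show thesis by (rule that)
  qed
  show ?thesis
  proof (rule CpI[of _ "K \<union> L"])
    show "continuous_map T euclideanreal (\<lambda>x. f x + g x)"
      by (intro continuous_map_add Cp_continuous f g)
    show "compactin T (K \<union> L)" by (rule compactin_Un[OF KL(1,3)])
  qed (use KL(2,4) f g in \<open>auto simp: Cp_nonneg\<close>)
qed

lemma Cp_mult_bounded:
  assumes f: "f \<in> Cp" and g: "continuous_map T euclideanreal g" "\<And>x. x \<in> carrier G \<Longrightarrow> 0 \<le> g x"
  shows "(\<lambda>x. f x * g x) \<in> Cp"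
proof -
  obtain K where K: "compactin T K" "\<And>x. x \<notin> K \<Longrightarrow> f x = 0" using Cp_support[OF f] by blast
  have "0 \<le> f x * g x" for x
  proof (cases "x \<in> carrier G")
    case True
    then show ?thesis by (intro mult_nonneg_nonneg Cp_nonneg f g(2))
  next
    case False
    then show ?thesis by (simp add: Cp_off[OF f])
  qed
  moreover have "continuous_map T euclideanreal (\<lambda>x. f x * g x)"
    by (intro continuous_map_real_mult Cp_continuous f g)
  ultimately show ?thesis by (intro CpI[OF _ _ K(1)]) (simp_all add: K(2))
qed

lemma Cp_mult: "f \<in> Cp \<Longrightarrow> g \<in> Cp \<Longrightarrow> (\<lambda>x. f x * g x) \<in> Cp"
  by (intro Cp_mult_bounded) (auto simp: Cp_continuous Cp_nonneg)

lemma Cp_scale: "f \<in> Cp \<Longrightarrow> 0 \<le> r \<Longrightarrow> (\<lambda>x. r * f x) \<in> Cp"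
  using Cp_mult_bounded[of f "\<lambda>_. r"] by (simp add: mult.commute)

lemma Cp_trans:
  assumes f: "f \<in> Cp" and s: "s \<in> carrier G"
  shows "trans s f \<in> Cp"
proof -
  obtain K where K: "compactin T K" "\<And>x. x \<notin> K \<Longrightarrow> f x = 0" using Cp_support[OF f] by blast
  have "continuous_map T euclideanreal (\<lambda>x. f (inv s \<otimes> x))"
    using continuous_map_compose[OF tg_left[of "inv s"] Cp_continuous[OF f]] s by (simp add: o_def)
  then have c: "continuous_map T euclideanreal (trans s f)"
    by (rule continuous_map_eq) (simp add: trans_def)
  have "compactin T ((\<lambda>x. s \<otimes> x) ` K)" by (rule image_compactin[OF K(1) tg_left[OF s]])
  moreover have "trans s f x = 0" if "x \<notin> (\<lambda>x. s \<otimes> x) ` K" for x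
  proof (cases "x \<in> carrier G")
    case True
    then have "x = s \<otimes> (inv s \<otimes> x)" using s by (simp add: m_assoc[symmetric])
    then have "inv s \<otimes> x \<notin> K" using that by blast
    then show ?thesis using K(2) by (simp add: trans_def)
  qed (simp add: trans_def)
  moreover have "0 \<le> trans s f x" for x by (simp add: trans_def Cp_nonneg[OF f])
  ultimately show ?thesis by (intro CpI[OF c])
qed

lemma Cp_bounded:
  assumes f: "f \<in> Cp"
  obtains M where "M > 0" "\<And>x. f x \<le> M"
proof -
  obtain K where K: "compactin T K" "\<And>x. x \<notin> K \<Longrightarrow> f x = 0" using Cp_support[OF f] by blast
  have "compact (f ` K)" using image_compactin[OF K(1) Cp_continuous[OF f]] by simp
  then have "bounded (f ` K)" by (rule compact_imp_bounded)
  then obtain M where M: "\<And>x. x \<in> K \<Longrightarrow> \<bar>f x\<bar> \<le> M" unfolding bounded_real by blast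
  have "f x \<le> \<bar>M\<bar> + 1" for x
  proof (cases "x \<in> K")
    case True
    then show ?thesis using M[OF True] by linarith
  next
    case False
    then show ?thesis using K(2) by simp
  qed
  then show thesis by (intro that[of "\<bar>M\<bar> + 1"]) auto
qed

text \<open>Local compactness provides a compact set to carry the support, complete regularity a
  function that separates \<open>x\<close> from the complement of a smaller open set.\<close>

lemma Cp_bump:
  assumes U: "openin T U" and x: "x \<in> U"
  obtains f where "f \<in> Cp" "f x = 1" "\<And>y. y \<notin> U \<Longrightarrow> f y = 0"
proof -
  have xG: "x \<in> carrier G" using openin_subset[OF U] x by auto
  obtain W K where W: "openin T W" "compactin T K" "x \<in> W" "W \<subseteq> K"
    using lc xG unfolding locally_compact_space_def by auto
  have "completely_regular_space T"
    using locally_compact_regular_imp_completely_regular_space[OF lc] T_Hausdorff by blast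
  moreover have "closedin T (carrier G - (U \<inter> W))"
    using U W closedin_diff[of T "carrier G" "U \<inter> W"] closedin_topspace[of T] by auto
  moreover have "x \<in> topspace T - (carrier G - (U \<inter> W))" using x W xG by auto
  ultimately have "\<exists>h. continuous_map T euclideanreal h \<and> h x = 0 \<and> h ` (carrier G - (U \<inter> W)) \<subseteq> {1}"
    unfolding completely_regular_space_alt by simp
  then obtain h where h: "continuous_map T euclideanreal h" "h x = 0" "h ` (carrier G - (U \<inter> W)) \<subseteq> {1}"
    by blast
  define f where "f y = (if y \<in> carrier G then max 0 (1 - h y) else 0)" for y
  have "continuous_map T euclideanreal (\<lambda>y. max 0 (1 - h y))"
    using h(1) by (intro continuous_intros) auto
  then have f_cont: "continuous_map T euclideanreal f"
    by (rule continuous_map_eq) (simp add: f_def)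
  have zero: "f y = 0" if "y \<notin> U \<inter> W" for y
    using h(3) that by (auto simp: f_def)
  have "f \<in> Cp"
  proof (rule CpI[OF f_cont _ W(2)])
    show "0 \<le> f y" for y by (simp add: f_def)
    show "f y = 0" if "y \<notin> K" for y using zero that W(4) by blast
  qed
  moreover have "f x = 1" using h(2) xG by (simp add: f_def)
  moreover have "\<And>y. y \<notin> U \<Longrightarrow> f y = 0" using zero by blast
  ultimately show thesis by (rule that)
qed

lemma Cp_above_one:
  assumes K: "compactin T K"
  obtains g where "g \<in> Cp" "\<And>x. x \<in> K \<Longrightarrow> 1 \<le> g x"
proof -
  have "\<exists>f. f \<in> Cp \<and> f x = 1" if "x \<in> K" for x
  proof -
    have "openin T (carrier G)" using openin_topspace[of T] by simp
    moreover have "x \<in> carrier G" using that compact_carrier[OF K] by blast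
    ultimately obtain f where "f \<in> Cp" "f x = 1" by (rule Cp_bump)
    then show ?thesis by blast
  qed
  then obtain b where b: "\<And>x. x \<in> K \<Longrightarrow> b x \<in> Cp \<and> b x x = 1" by metis
  \<comment> \<open>Where a bump exceeds 1/2, twice the bump exceeds 1; finitely many of these sets
    cover \<open>K\<close>.\<close>
  define Ob where "Ob x = {y \<in> topspace T. b x y \<in> {1/2<..}}" for x
  have Ob: "openin T (Ob x)" "x \<in> Ob x" if "x \<in> K" for x
    unfolding Ob_def
    using openin_continuous_map_preimage[OF Cp_continuous, of "b x" "{1/2<..}"] b[OF that] compact_carrier[OF K] that by auto
  have "\<exists>F. finite F \<and> F \<subseteq> Ob ` K \<and> K \<subseteq> \<Union>F"
    by (rule compactinD[OF K]) (use Ob in blast)+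
  then obtain F where F: "finite F" "F \<subseteq> Ob ` K" "K \<subseteq> \<Union>F" by blast
  then obtain A where A: "A \<subseteq> K" "finite A" "F = Ob ` A" using finite_subset_image by meson
  define g where "g y = (\<Sum>x\<in>A. 2 * b x y)" for y
  have "(\<lambda>y. \<Sum>x\<in>A. 2 * b x y) \<in> Cp"
    using A(2,1)
  proof (induction A rule: finite_induct)
    case (insert x A)
    then have "(\<lambda>y. 2 * b x y + (\<Sum>x\<in>A. 2 * b x y)) \<in> Cp"
      by (intro Cp_add Cp_scale) (auto simp: b)
    then show ?case using insert by simp
  qed (simp add: Cp_zero)
  then have "g \<in> Cp" by (simp add: g_def[abs_def])
  moreover have "1 \<le> g y" if yK: "y \<in> K" for y
  proof -
    obtain x where x: "x \<in> A" "y \<in> Ob x" using F(3) A(3) yK by blast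
    have "1 \<le> 2 * b x y" using x(2) by (simp add: Ob_def)
    also have "\<dots> \<le> g y"
      unfolding g_def by (rule member_le_sum[OF x(1)]) (use A b Cp_nonneg in auto)
    finally show ?thesis .
  qed
  ultimately show thesis by (rule that)
qed

text \<open>Stated for an abstract action \<open>m\<close> to cover multiplication on either side:
  \<open>y \<otimes> z\<close> is needed for covering numbers and \<open>z \<otimes> y\<close> for
  the autocorrelation.\<close>

lemma uniform_continuity:
  assumes m: "continuous_map (prod_topology T T) T (\<lambda>(z, y). m z y)"
    and m1: "\<And>y. y \<in> carrier G \<Longrightarrow> m \<one> y = y"
    and minv: "\<And>z y. z \<in> carrier G \<Longrightarrow> y \<in> carrier G \<Longrightarrow> m (inv z) (m z y) = y"
    and k: "continuous_map T euclideanreal k" and K: "compactin T K" "\<And>x. x \<notin> K \<Longrightarrow> k x = 0" and e: "e > 0"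
  obtains V where "openin T V" "\<one> \<in> V" "\<And>z y. z \<in> V \<Longrightarrow> y \<in> carrier G \<Longrightarrow> \<bar>k (m z y) - k y\<bar> < e"
proof -
  have KG: "K \<subseteq> carrier G" by (rule compact_carrier[OF K(1)])
  have mG: "m z y \<in> carrier G" if "z \<in> carrier G" "y \<in> carrier G" for z y
    using continuous_map_image_subset_topspace[OF m] that by auto
  have km: "continuous_map (prod_topology T T) euclideanreal (\<lambda>w. k (m (fst w) (snd w)))"
    using continuous_map_compose[OF m k] by (simp add: o_def case_prod_unfold)
  define P where "P s A B \<longleftrightarrow> openin T A \<and> openin T B \<and> \<one> \<in> A \<and> s \<in> B \<and> (\<forall>z\<in>A. \<forall>y\<in>B. \<bar>k (m z y) - k s\<bar> < e / 2)" for s A B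
  have ex: "\<exists>A B. P s A B" if s: "s \<in> K" for s
  proof -
    have top: "(\<one>, s) \<in> topspace (prod_topology T T)" using s KG by auto
    obtain S where S: "openin (prod_topology T T) S" "(\<one>, s) \<in> S"
      "\<And>w. w \<in> S \<Longrightarrow> norm (k (m (fst w) (snd w)) - k (m (fst (\<one>, s)) (snd (\<one>, s)))) < e / 2"
      using continuous_map_normD[OF km top half_gt_zero[OF e]] by blast
    obtain A B where AB: "openin T A" "openin T B" "\<one> \<in> A" "s \<in> B" "A \<times> B \<subseteq> S"
      using openin_prod_topology_alt[THEN iffD1, rule_format, OF S(1,2)] by blast
    have "\<bar>k (m z y) - k s\<bar> < e / 2" if "z \<in> A" "y \<in> B" for z y
    proof -
      have "(z, y) \<in> S" using AB(5) that by blast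
      from S(3)[OF this] have "\<bar>k (m z y) - k (m \<one> s)\<bar> < e / 2" by (simp only: fst_conv snd_conv real_norm_def)
      moreover have "s \<in> carrier G" using s KG by blast
      ultimately show ?thesis by (simp only: m1)
    qed
    then show ?thesis using AB unfolding P_def by blast
  qed
  define A where "A s = (SOME A. \<exists>B. P s A B)" for s
  define B where "B s = (SOME B. P s (A s) B)" for s
  have AB: "openin T (A s) \<and> openin T (B s) \<and> \<one> \<in> A s \<and> s \<in> B s \<and>
      (\<forall>z\<in>A s. \<forall>y\<in>B s. \<bar>k (m z y) - k s\<bar> < e / 2)" if "s \<in> K" for s
  proof -
    have "\<exists>B. P s (A s) B" unfolding A_def by (rule someI_ex[OF ex[OF that]])
    then have "P s (A s) (B s)" unfolding B_def by (rule someI_ex)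
    then show ?thesis unfolding P_def .
  qed
  have "\<exists>F. finite F \<and> F \<subseteq> B ` K \<and> K \<subseteq> \<Union>F"
    by (rule compactinD[OF K(1)]) (use AB in blast)+
  then obtain F where F: "finite F" "F \<subseteq> B ` K" "K \<subseteq> \<Union>F" by blast
  then obtain S where S: "S \<subseteq> K" "finite S" "F = B ` S" using finite_subset_image by meson
  define V0 where "V0 = topspace T \<inter> (\<Inter>s\<in>S. A s)"
  have V0: "openin T V0"
    unfolding V0_def using S AB carrier_open by (cases "S = {}") (auto intro!: openin_Int openin_INT2)
  \<comment> \<open>Closed under inversion, so that the case where only \<open>m z y\<close> lies in
    \<open>K\<close> reduces to the other one by moving back with \<open>inv z\<close>.\<close>
  define V where "V = V0 \<inter> {z \<in> carrier G. inv z \<in> V0}"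
  have V: "openin T V" unfolding V_def by (intro openin_Int V0 preimage_open tg_inv)
  have "\<one> \<in> V0" using S AB by (auto simp: V0_def)
  then have "\<one> \<in> V" by (simp add: V_def)
  have on_K: "\<bar>k (m z y) - k y\<bar> < e" if z: "z \<in> V0" and y: "y \<in> K" for z y
  proof -
    obtain s where s: "s \<in> S" "y \<in> B s" using F(3) S(3) y by blast
    then have sK: "s \<in> K" using S by blast
    have "z \<in> A s" using z s by (simp add: V0_def)
    then have "\<bar>k (m z y) - k s\<bar> < e / 2" using AB[OF sK] s by blast
    moreover have "\<bar>k (m \<one> y) - k s\<bar> < e / 2" using AB[OF sK] s by blast
    then have "\<bar>k y - k s\<bar> < e / 2" using m1 y KG by auto
    ultimately show ?thesis by linarith
  qed
  have "\<bar>k (m z y) - k y\<bar> < e" if z: "z \<in> V" and y: "y \<in> carrier G" for z y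
  proof -
    have zG: "z \<in> carrier G" and z0: "z \<in> V0" "inv z \<in> V0" using z openin_subset[OF V] by (auto simp: V_def)
    consider "y \<in> K" | "m z y \<in> K" | "y \<notin> K" "m z y \<notin> K" by blast
    then show ?thesis
    proof cases
      case 1
      then show ?thesis by (rule on_K[OF z0(1)])
    next
      case 2
      have "\<bar>k (m (inv z) (m z y)) - k (m z y)\<bar> < e" by (rule on_K[OF z0(2) 2])
      then show ?thesis using minv[OF zG y] by (simp add: abs_minus_commute)
    next
      case 3
      then show ?thesis using K(2) e by simp
    qed
  qed
  with V \<open>\<one> \<in> V\<close> show thesis by (rule that)
qed

subsection \<open>Covering numbers\<close>

definition comb :: "('a \<Rightarrow> real) \<Rightarrow> (real \<times> 'a) list \<Rightarrow> 'a \<Rightarrow> real" where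
  "comb \<phi> xs x = (\<Sum>(c, s)\<leftarrow>xs. c * trans s \<phi> x)"

definition weight :: "(real \<times> 'a) list \<Rightarrow> real" where
  "weight xs = sum_list (map fst xs)"

definition admiss :: "(real \<times> 'a) list \<Rightarrow> bool" where
  "admiss xs \<longleftrightarrow> (\<forall>(c, s)\<in>set xs. 0 \<le> c \<and> s \<in> carrier G)"

definition covers :: "('a \<Rightarrow> real) \<Rightarrow> ('a \<Rightarrow> real) \<Rightarrow> (real \<times> 'a) list \<Rightarrow> bool" where
  "covers \<phi> f xs \<longleftrightarrow> admiss xs \<and> (\<forall>x. f x \<le> comb \<phi> xs x)"

text \<open>Haar's covering number, usually written (f : \<phi>). Divided by that of a fixed
  \<open>f0\<close>, it behaves more and more like a left invariant integral as the support of
  \<phi> shrinks.\<close>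

definition cov :: "('a \<Rightarrow> real) \<Rightarrow> ('a \<Rightarrow> real) \<Rightarrow> real" where
  "cov \<phi> f = Inf {weight xs | xs. covers \<phi> f xs}"

lemma comb_simps [simp]:
  "comb \<phi> [] x = 0" "comb \<phi> ((c, s) # xs) x = c * trans s \<phi> x + comb \<phi> xs x"
  "comb \<phi> (xs @ ys) x = comb \<phi> xs x + comb \<phi> ys x"
  by (simp_all add: comb_def)

lemma weight_simps [simp]:
  "weight [] = 0" "weight ((c, s) # xs) = c + weight xs" "weight (xs @ ys) = weight xs + weight ys"
  by (simp_all add: weight_def)

lemma admiss_simps [simp]:
  "admiss []" "admiss ((c, s) # xs) \<longleftrightarrow> 0 \<le> c \<and> s \<in> carrier G \<and> admiss xs"
  "admiss (xs @ ys) \<longleftrightarrow> admiss xs \<and> admiss ys"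
  by (auto simp: admiss_def)

lemma weight_nonneg: "admiss xs \<Longrightarrow> 0 \<le> weight xs"
  by (induction xs) auto

lemma cov_le: "covers \<phi> f xs \<Longrightarrow> cov \<phi> f \<le> weight xs"
  unfolding cov_def
  by (rule cInf_lower) (auto simp: covers_def weight_nonneg intro!: bdd_belowI[of _ 0])

definition nz :: "('a \<Rightarrow> real) \<Rightarrow> bool" where
  "nz f \<longleftrightarrow> f \<in> Cp \<and> (\<exists>x. f x \<noteq> 0)"

text \<open>Translates of the set where \<phi> exceeds half of \<open>\<phi> a\<close> cover the
  compact support of \<open>f\<close>.\<close>

lemma covers_exists:
  assumes f: "f \<in> Cp" and \<phi>: "nz \<phi>"
  obtains xs where "covers \<phi> f xs"
proof -
  have \<phi>C: "\<phi> \<in> Cp" using \<phi> by (simp add: nz_def)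
  obtain a where a: "\<phi> a \<noteq> 0" using \<phi> by (auto simp: nz_def)
  then have a0: "\<phi> a > 0" and aG: "a \<in> carrier G" using Cp_nonneg[OF \<phi>C, of a] Cp_off[OF \<phi>C, of a] by auto
  obtain K where K: "compactin T K" "\<And>x. x \<notin> K \<Longrightarrow> f x = 0" using Cp_support[OF f] by blast
  obtain M where M: "M > 0" "\<And>x. f x \<le> M" using Cp_bounded[OF f] by blast
  \<comment> \<open>Translation by \<open>x \<otimes> inv a\<close> carries \<open>a\<close> to
    \<open>x\<close>, so the translate takes the value \<open>\<phi> a\<close> at
    \<open>x\<close>.\<close>
  define Ob where "Ob x = {y \<in> topspace T. trans (x \<otimes> inv a) \<phi> y \<in> {\<phi> a / 2<..}}" for x
  have Ob: "openin T (Ob x)" "x \<in> Ob x" if "x \<in> K" for x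
  proof -
    have xG: "x \<in> carrier G" using that compact_carrier[OF K(1)] by blast
    show "openin T (Ob x)"
      unfolding Ob_def
      by (rule openin_continuous_map_preimage[OF Cp_continuous[OF Cp_trans[OF \<phi>C]]]) (use xG aG in auto)
    have "inv (x \<otimes> inv a) \<otimes> x = a" using xG aG by (simp add: inv_mult_group m_assoc)
    then show "x \<in> Ob x" using xG a0 by (simp add: Ob_def trans_def)
  qed
  have "\<exists>F. finite F \<and> F \<subseteq> Ob ` K \<and> K \<subseteq> \<Union>F"
    by (rule compactinD[OF K(1)]) (use Ob in blast)+
  then obtain F where F: "finite F" "F \<subseteq> Ob ` K" "K \<subseteq> \<Union>F" by blast
  then obtain A where A: "A \<subseteq> K" "finite A" "F = Ob ` A" using finite_subset_image by meson
  obtain as where as: "set as = A" using finite_list[OF A(2)] by blast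
  \<comment> \<open>On \<open>Ob x\<close> the translate exceeds \<open>\<phi> a / 2\<close>, so
    \<open>c\<close> times it exceeds the bound \<open>M\<close> of \<open>f\<close>.\<close>
  define c where "c = 2 * M / \<phi> a"
  have c: "c > 0" using M a0 by (simp add: c_def)
  define xs where "xs = map (\<lambda>x. (c, x \<otimes> inv a)) as"
  have adm: "admiss xs" using c as A(1) compact_carrier[OF K(1)] aG by (auto simp: admiss_def xs_def)
  have nonneg: "0 \<le> comb \<phi> ys y" if "admiss ys" for ys y
    using that by (induction ys) (auto simp: trans_def Cp_nonneg[OF \<phi>C])
  have member: "c * trans (x \<otimes> inv a) \<phi> y \<le> comb \<phi> (map (\<lambda>x. (c, x \<otimes> inv a)) bs) y" if "x \<in> set bs" "set bs \<subseteq> A" for x y bs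
    using that
  proof (induction bs)
    case (Cons b bs)
    have "admiss (map (\<lambda>x. (c, x \<otimes> inv a)) bs)"
      using Cons.prems c A(1) compact_carrier[OF K(1)] aG by (auto simp: admiss_def)
    then have 1: "0 \<le> comb \<phi> (map (\<lambda>x. (c, x \<otimes> inv a)) bs) y" by (rule nonneg)
    have 2: "0 \<le> c * trans (b \<otimes> inv a) \<phi> y" using c by (simp add: trans_def Cp_nonneg[OF \<phi>C])
    show ?case
    proof (cases "x = b")
      case True
      then show ?thesis using 1 by simp
    next
      case False
      then show ?thesis using Cons 2 by force
    qed
  qed simp
  have "f y \<le> comb \<phi> xs y" for y
  proof (cases "y \<in> K")
    case True
    then obtain x where x: "x \<in> A" "y \<in> Ob x" using F(3) A(3) by blast
    have "\<phi> a / 2 < trans (x \<otimes> inv a) \<phi> y" using x(2) by (simp add: Ob_def)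
    then have "c * (\<phi> a / 2) \<le> c * trans (x \<otimes> inv a) \<phi> y" using c by (intro mult_left_mono) auto
    moreover have "c * (\<phi> a / 2) = M" using a0 by (simp add: c_def)
    ultimately show ?thesis using M(2)[of y] member[of x as y] x(1) as unfolding xs_def by simp
  next
    case False
    then show ?thesis using K(2) nonneg[OF adm] by simp
  qed
  then have "covers \<phi> f xs" using adm by (simp add: covers_def)
  then show thesis by (rule that)
qed

lemma cov_greatest:
  assumes f: "f \<in> Cp" and \<phi>: "nz \<phi>" and "\<And>xs. covers \<phi> f xs \<Longrightarrow> r \<le> weight xs"
  shows "r \<le> cov \<phi> f"
  unfolding cov_def using covers_exists[OF f \<phi>] assms(3) by (intro cInf_greatest) auto

lemma cov_nonneg: "f \<in> Cp \<Longrightarrow> nz \<phi> \<Longrightarrow> 0 \<le> cov \<phi> f"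
  by (rule cov_greatest) (auto simp: covers_def weight_nonneg)

lemma cov_mono: "g \<in> Cp \<Longrightarrow> nz \<phi> \<Longrightarrow> (\<And>x. f x \<le> g x) \<Longrightarrow> cov \<phi> f \<le> cov \<phi> g"
  by (rule cov_greatest) (auto intro!: cov_le simp: covers_def, meson order_trans)

text \<open>Covers are concatenated. The reverse inequality holds only approximately and for small
  supports, see \<open>approx_additive\<close>.\<close>

lemma cov_add:
  assumes f: "f \<in> Cp" and g: "g \<in> Cp" and \<phi>: "nz \<phi>"
  shows "cov \<phi> (\<lambda>x. f x + g x) \<le> cov \<phi> f + cov \<phi> g"
proof -
  have "cov \<phi> (\<lambda>x. f x + g x) - weight ys \<le> cov \<phi> f" if ys: "covers \<phi> g ys" for ys
  proof (rule cov_greatest[OF f \<phi>])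
    fix xs assume "covers \<phi> f xs"
    then have "covers \<phi> (\<lambda>x. f x + g x) (xs @ ys)" using ys by (auto simp: covers_def intro: add_mono)
    then show "cov \<phi> (\<lambda>x. f x + g x) - weight ys \<le> weight xs" using cov_le by fastforce
  qed
  then have "cov \<phi> (\<lambda>x. f x + g x) - cov \<phi> f \<le> weight ys" if "covers \<phi> g ys" for ys
    using that by (simp add: algebra_simps)
  then have "cov \<phi> (\<lambda>x. f x + g x) - cov \<phi> f \<le> cov \<phi> g" by (rule cov_greatest[OF g \<phi>])
  then show ?thesis by simp
qed

lemma comb_scale: "comb \<phi> (map (\<lambda>(c, s). (r * c, s)) xs) x = r * comb \<phi> xs x"
  and weight_scale: "weight (map (\<lambda>(c, s). (r * c, s)) xs) = r * weight xs"
  by (induction xs) (auto simp: algebra_simps)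

lemma cov_scale_le:
  assumes f: "f \<in> Cp" and \<phi>: "nz \<phi>" and r: "r > 0"
  shows "cov \<phi> (\<lambda>x. r * f x) \<le> r * cov \<phi> f"
proof -
  have "cov \<phi> (\<lambda>x. r * f x) / r \<le> cov \<phi> f"
  proof (rule cov_greatest[OF f \<phi>])
    fix xs assume xs: "covers \<phi> f xs"
    have "admiss (map (\<lambda>(c, s). (r * c, s)) xs)" using xs r by (auto simp: covers_def admiss_def)
    then have "covers \<phi> (\<lambda>x. r * f x) (map (\<lambda>(c, s). (r * c, s)) xs)"
      using xs r by (auto simp: covers_def comb_scale)
    from cov_le[OF this] have "cov \<phi> (\<lambda>x. r * f x) \<le> r * weight xs"
      unfolding weight_scale .
    then show "cov \<phi> (\<lambda>x. r * f x) / r \<le> weight xs"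
      using r by (simp add: divide_le_eq mult.commute)
  qed
  then show ?thesis using r by (simp add: divide_le_eq mult.commute)
qed

lemma cov_zero: "nz \<phi> \<Longrightarrow> cov \<phi> (\<lambda>x. 0) = 0"
  using cov_le[of \<phi> "\<lambda>x. 0" "[]"] cov_nonneg[OF Cp_zero] by (fastforce simp: covers_def)

lemma cov_scale:
  assumes f: "f \<in> Cp" and \<phi>: "nz \<phi>" and r: "r \<ge> 0"
  shows "cov \<phi> (\<lambda>x. r * f x) = r * cov \<phi> f"
proof (cases "r = 0")
  case True
  then show ?thesis using cov_zero[OF \<phi>] by simp
next
  case False
  then have r': "r > 0" using r by simp
  have "cov \<phi> (\<lambda>x. inverse r * (r * f x)) \<le> inverse r * cov \<phi> (\<lambda>x. r * f x)"
    by (rule cov_scale_le[OF Cp_scale[OF f r] \<phi>]) (use r' in simp)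
  moreover have "(\<lambda>x. inverse r * (r * f x)) = f" using r' by auto
  ultimately have "r * cov \<phi> f \<le> cov \<phi> (\<lambda>x. r * f x)" using r' by (simp add: field_simps)
  then show ?thesis using cov_scale_le[OF f \<phi> r'] by simp
qed

lemma trans_trans: "s \<in> carrier G \<Longrightarrow> t \<in> carrier G \<Longrightarrow> trans s (trans t f) = trans (s \<otimes> t) f"
  by (rule ext) (simp add: trans_def inv_mult_group m_assoc)

lemma comb_trans:
  "s \<in> carrier G \<Longrightarrow> admiss xs \<Longrightarrow> comb \<phi> (map (\<lambda>(c, t). (c, s \<otimes> t)) xs) x = trans s (comb \<phi> xs) x"
  by (induction xs) (auto simp: trans_def inv_mult_group m_assoc)

lemma weight_trans: "weight (map (\<lambda>(c, t). (c, s \<otimes> t)) xs) = weight xs"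
  by (induction xs) auto

lemma cov_trans_le:
  assumes f: "f \<in> Cp" and \<phi>: "nz \<phi>" and s: "s \<in> carrier G"
  shows "cov \<phi> (trans s f) \<le> cov \<phi> f"
proof (rule cov_greatest[OF f \<phi>])
  fix xs assume xs: "covers \<phi> f xs"
  have "admiss (map (\<lambda>(c, t). (c, s \<otimes> t)) xs)" using xs s by (auto simp: covers_def admiss_def)
  moreover have "trans s f x \<le> comb \<phi> (map (\<lambda>(c, t). (c, s \<otimes> t)) xs) x" for x
    using xs s comb_trans[of s xs \<phi> x] by (simp add: covers_def trans_def)
  ultimately have "covers \<phi> (trans s f) (map (\<lambda>(c, t). (c, s \<otimes> t)) xs)" by (simp add: covers_def)
  from cov_le[OF this] show "cov \<phi> (trans s f) \<le> weight xs" by (simp add: weight_trans)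
qed

lemma cov_trans:
  assumes f: "f \<in> Cp" and \<phi>: "nz \<phi>" and s: "s \<in> carrier G"
  shows "cov \<phi> (trans s f) = cov \<phi> f"
proof (rule antisym[OF cov_trans_le[OF assms]])
  have "trans (inv s) (trans s f) = f"
    using s Cp_off[OF f] by (intro ext) (simp add: trans_trans trans_def)
  then show "cov \<phi> f \<le> cov \<phi> (trans s f)"
    using cov_trans_le[OF Cp_trans[OF f s] \<phi> inv_closed[OF s]] by simp
qed

text \<open>Evaluating a cover at a point \<open>a\<close> with \<open>f a > 0\<close> bounds its
  weight below by \<open>f a / M\<close>, where \<open>M\<close> bounds \<phi>.\<close>

lemma cov_pos:
  assumes f: "nz f" and \<phi>: "nz \<phi>"
  shows "0 < cov \<phi> f"
proof -
  have C: "f \<in> Cp" "\<phi> \<in> Cp" using f \<phi> by (auto simp: nz_def)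
  obtain a where "f a \<noteq> 0" using f by (auto simp: nz_def)
  then have a: "f a > 0" using Cp_nonneg[OF C(1), of a] by simp
  obtain M where M: "M > 0" "\<And>x. \<phi> x \<le> M" using Cp_bounded[OF C(2)] by blast
  have "f a / M \<le> cov \<phi> f"
  proof (rule cov_greatest[OF C(1) \<phi>])
    fix xs assume xs: "covers \<phi> f xs"
    have "comb \<phi> ys a \<le> M * weight ys" if "admiss ys" for ys
      using that
    proof (induction ys)
      case (Cons y ys)
      obtain c s where y: "y = (c, s)" by fastforce
      have "c * trans s \<phi> a \<le> c * M"
        using Cons.prems M y by (intro mult_left_mono) (auto simp: trans_def less_imp_le)
      then show ?case using Cons y by (simp add: algebra_simps)
    qed simp
    then have "f a \<le> M * weight xs" using xs unfolding covers_def by (meson order_trans)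
    then show "f a / M \<le> weight xs" using M by (simp add: divide_le_eq mult.commute)
  qed
  then show ?thesis using a M by (meson divide_pos_pos order_less_le_trans)
qed

lemma comb_Cp: "g \<in> Cp \<Longrightarrow> admiss xs \<Longrightarrow> comb g xs \<in> Cp"
proof (induction xs)
  case Nil
  then show ?case using Cp_zero by (simp add: comb_def[abs_def])
next
  case (Cons y xs)
  obtain c s where y: "y = (c, s)" by fastforce
  have "comb g (y # xs) = (\<lambda>x. c * trans s g x + comb g xs x)" by (rule ext) (simp add: y)
  then show ?case using Cons y by (auto intro!: Cp_add Cp_scale Cp_trans)
qed

text \<open>Covers are composed. Applied to \<open>f\<close> and \<open>f0\<close> in both orders,
  this confines \<open>cov \<phi> f / cov \<phi> f0\<close> to an interval that does not depend on
  \<phi>.\<close>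

lemma cov_submult:
  assumes f: "f \<in> Cp" and g: "nz g" and \<phi>: "nz \<phi>"
  shows "cov \<phi> f \<le> cov g f * cov \<phi> g"
proof -
  have gC: "g \<in> Cp" using g by (simp add: nz_def)
  have comb: "cov \<phi> (comb g xs) \<le> weight xs * cov \<phi> g" if "admiss xs" for xs
    using that
  proof (induction xs)
    case Nil
    then show ?case using cov_zero[OF \<phi>] by (simp add: comb_def[abs_def])
  next
    case (Cons y xs)
    obtain c s where y: "y = (c, s)" by fastforce
    have cs: "0 \<le> c" "s \<in> carrier G" "admiss xs" using Cons.prems y by auto
    have "comb g (y # xs) = (\<lambda>x. c * trans s g x + comb g xs x)" by (rule ext) (simp add: y)
    then have "cov \<phi> (comb g (y # xs)) \<le> cov \<phi> (\<lambda>x. c * trans s g x) + cov \<phi> (comb g xs)"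
      using cov_add[OF Cp_scale[OF Cp_trans[OF gC cs(2)] cs(1)] comb_Cp[OF gC cs(3)] \<phi>] by simp
    also have "cov \<phi> (\<lambda>x. c * trans s g x) = c * cov \<phi> g"
      by (simp add: cov_scale Cp_trans gC cs \<phi> cov_trans)
    finally show ?case using Cons.IH[OF cs(3)] by (simp add: y algebra_simps)
  qed
  have pos: "cov \<phi> g > 0" by (rule cov_pos[OF g \<phi>])
  have "cov \<phi> f / cov \<phi> g \<le> cov g f"
  proof (rule cov_greatest[OF f g])
    fix xs assume xs: "covers g f xs"
    then have "cov \<phi> f \<le> cov \<phi> (comb g xs)"
      by (intro cov_mono comb_Cp gC \<phi>) (auto simp: covers_def)
    also have "\<dots> \<le> weight xs * cov \<phi> g" using xs by (intro comb) (simp add: covers_def)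
    finally show "cov \<phi> f / cov \<phi> g \<le> weight xs" using pos by (simp add: divide_le_eq)
  qed
  then show ?thesis using pos by (simp add: divide_le_eq)
qed

end

lemma continuous_on_eval: "continuous_on S (\<lambda>I :: 'b \<Rightarrow> real. I f)"
  by (rule continuous_on_product_then_coordinatewise[OF continuous_on_id])

context lc_group
begin

subsection \<open>The Haar functional\<close>

text \<open>Let \<open>h\<close> be \<open>f1 + f2\<close> plus a small multiple of
  \<open>g\<close>. A cover of \<open>h\<close> becomes one of \<open>f1\<close> when the
  coefficient at \<open>s\<close> is multiplied by about \<open>f1 s / h s\<close>, a quotient that
  hardly varies on the small support of the translate; likewise for \<open>f2\<close>. The two
  quotients add up to at most 1, so little total weight is lost.\<close>

lemma approx_additive:
  assumes f: "f1 \<in> Cp" "f2 \<in> Cp" and f0: "nz f0" and e: "e > 0"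
  obtains V where "openin T V" "\<one> \<in> V"
    "\<And>\<phi>. nz \<phi> \<Longrightarrow> (\<And>x. x \<notin> V \<Longrightarrow> \<phi> x = 0) \<Longrightarrow>
      cov \<phi> f1 + cov \<phi> f2 \<le> cov \<phi> (\<lambda>x. f1 x + f2 x) + e * cov \<phi> f0"
proof -
  obtain K1 where K1: "compactin T K1" "\<And>x. x \<notin> K1 \<Longrightarrow> f1 x = 0" using Cp_support[OF f(1)] by blast
  obtain K2 where K2: "compactin T K2" "\<And>x. x \<notin> K2 \<Longrightarrow> f2 x = 0" using Cp_support[OF f(2)] by blast
  have K: "compactin T (K1 \<union> K2)" by (rule compactin_Un[OF K1(1) K2(1)])
  obtain g where g: "g \<in> Cp" "\<And>x. x \<in> K1 \<union> K2 \<Longrightarrow> 1 \<le> g x" using Cp_above_one[OF K] by blast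
  note f12 = Cp_add[OF f]
  define A where "A = cov f0 (\<lambda>x. f1 x + f2 x)"
  define B where "B = cov f0 g"
  have AB: "A \<ge> 0" "B \<ge> 0" using cov_nonneg[OF f12 f0] cov_nonneg[OF g(1) f0] by (simp_all add: A_def B_def)
  \<comment> \<open>Makes the final error \<open>d * (2 * A + 2 * B)\<close> at most
    \<open>e\<close>; the cap 1/2 gives \<open>1 + 2 * d \<le> 2\<close>.\<close>
  define d where "d = min (1/2) (e / (2 * A + 2 * B + 1))"
  have d: "d > 0" using e AB by (simp add: d_def add_nonneg_pos)
  have d_half: "d \<le> 1/2" unfolding d_def by (rule min.cobounded1)
  have de: "d * (2 * A + 2 * B) \<le> e"
  proof -
    have "d * (2 * A + 2 * B) \<le> e / (2 * A + 2 * B + 1) * (2 * A + 2 * B)"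
      using AB by (intro mult_right_mono) (auto simp: d_def)
    also have "\<dots> \<le> e" using e AB by (simp add: field_simps)
    finally show ?thesis .
  qed
  define h where "h x = f1 x + f2 x + d * g x" for x
  have dg: "(\<lambda>x. d * g x) \<in> Cp" by (rule Cp_scale[OF g(1)]) (use d in simp)
  have h: "h \<in> Cp" using Cp_add[OF f12 dg] by (simp add: h_def[abs_def])
  \<comment> \<open>A denominator that is positive everywhere. On \<open>K1 \<union> K2\<close>,
    where \<open>g \<ge> 1\<close>, it equals \<open>h\<close>; elsewhere the numerators
    vanish.\<close>
  define m where "m x = max (h x) d" for x
  have m: "m x > 0" "d \<le> m x" "h x \<le> m x" for x using d by (auto simp: m_def)
  have mc: "continuous_map T euclideanreal m"
    unfolding m_def using Cp_continuous[OF h] by (intro continuous_intros) auto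
  have hi: "continuous_map T euclideanreal (\<lambda>x. f' x / m x)" "\<And>x. 0 \<le> f' x / m x"
    "\<And>x. x \<notin> K1 \<union> K2 \<Longrightarrow> f' x / m x = 0" "\<And>x. f' x = h x * (f' x / m x)"
    if f': "f' \<in> Cp" "\<And>x. x \<notin> K1 \<union> K2 \<Longrightarrow> f' x = 0" for f'
  proof -
    show "continuous_map T euclideanreal (\<lambda>x. f' x / m x)"
      using m(1) by (intro continuous_map_real_divide Cp_continuous f' mc) (simp add: less_imp_neq[symmetric])
    show "\<And>x. 0 \<le> f' x / m x" using m(1) Cp_nonneg[OF f'(1)] by (simp add: less_imp_le)
    show "\<And>x. x \<notin> K1 \<union> K2 \<Longrightarrow> f' x / m x = 0" using f'(2) by simp
    show "f' x = h x * (f' x / m x)" for x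
    proof (cases "x \<in> K1 \<union> K2")
      case True
      have "d * 1 \<le> d * g x" using g(2)[OF True] d by (intro mult_left_mono) auto
      then have "d \<le> h x" using Cp_nonneg[OF f(1), of x] Cp_nonneg[OF f(2), of x] by (simp add: h_def)
      then show ?thesis using d by (simp add: m_def max_def)
    next
      case False
      then show ?thesis using f'(2) by simp
    qed
  qed
  \<comment> \<open>The quotients are compared at \<open>s\<close> and at
    \<open>s \<otimes> z\<close> with \<open>z\<close> in the support of \<phi>, hence
    multiplication on the right.\<close>
  have mult_cont: "continuous_map (prod_topology T T) T (\<lambda>(z, y). y \<otimes> z)"
    unfolding case_prod_unfold by (intro tg_mult_compose continuous_map_fst continuous_map_snd)
  have ex: "\<exists>V. openin T V \<and> \<one> \<in> V \<and> (\<forall>z\<in>V. \<forall>y\<in>carrier G. \<bar>f' (y \<otimes> z) / m (y \<otimes> z) - f' y / m y\<bar> < d)"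
    if f': "f' \<in> Cp" "\<And>x. x \<notin> K1 \<union> K2 \<Longrightarrow> f' x = 0" for f'
  proof -
    obtain V where V: "openin T V" "\<one> \<in> V" "\<And>z y. z \<in> V \<Longrightarrow> y \<in> carrier G \<Longrightarrow> \<bar>f' (y \<otimes> z) / m (y \<otimes> z) - f' y / m y\<bar> < d"
      using uniform_continuity[OF mult_cont _ _ hi(1)[OF f'] K hi(3)[OF f'] d(1)] by (auto simp: m_assoc)
    then show ?thesis by blast
  qed
  have f1': "\<And>x. x \<notin> K1 \<union> K2 \<Longrightarrow> f1 x = 0" and f2': "\<And>x. x \<notin> K1 \<union> K2 \<Longrightarrow> f2 x = 0"
    using K1 K2 by auto
  obtain V1 where V1: "openin T V1" "\<one> \<in> V1" "\<forall>z\<in>V1. \<forall>y\<in>carrier G. \<bar>f1 (y \<otimes> z) / m (y \<otimes> z) - f1 y / m y\<bar> < d"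
    using ex[OF f(1) f1'] by blast
  obtain V2 where V2: "openin T V2" "\<one> \<in> V2" "\<forall>z\<in>V2. \<forall>y\<in>carrier G. \<bar>f2 (y \<otimes> z) / m (y \<otimes> z) - f2 y / m y\<bar> < d"
    using ex[OF f(2) f2'] by blast
  have "cov \<phi> f1 + cov \<phi> f2 \<le> cov \<phi> (\<lambda>x. f1 x + f2 x) + e * cov \<phi> f0"
    if \<phi>: "nz \<phi>" and supp: "\<And>x. x \<notin> V1 \<inter> V2 \<Longrightarrow> \<phi> x = 0" for \<phi>
  proof -
    have \<phi>C: "\<phi> \<in> Cp" using \<phi> by (simp add: nz_def)
    have weights: "cov \<phi> f' \<le> weight (map (\<lambda>(c, s). (c * (f' s / m s + d), s)) xs)"
      if f': "f' \<in> Cp" "\<And>x. x \<notin> K1 \<union> K2 \<Longrightarrow> f' x = 0" and xs: "covers \<phi> h xs"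
        and u: "\<forall>z\<in>V1 \<inter> V2. \<forall>y\<in>carrier G. \<bar>f' (y \<otimes> z) / m (y \<otimes> z) - f' y / m y\<bar> < d" for f' xs
    proof (rule cov_le)
      let ?m = "\<lambda>(c, s). (c * (f' s / m s + d), s)"
      have comb: "comb \<phi> ys x * (f' x / m x) \<le> comb \<phi> (map ?m ys) x" if "admiss ys" for ys x
        using that
      proof (induction ys)
        case (Cons y ys)
        obtain c s where y: "y = (c, s)" by fastforce
        have cs: "0 \<le> c" "s \<in> carrier G" "admiss ys" using Cons.prems y by auto
        have tp: "0 \<le> trans s \<phi> x" by (simp add: trans_def Cp_nonneg[OF \<phi>C])
        have "trans s \<phi> x * (f' x / m x) \<le> trans s \<phi> x * (f' s / m s + d)"
        proof (cases "trans s \<phi> x = 0")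
          case False
          then have x: "x \<in> carrier G" "\<phi> (inv s \<otimes> x) \<noteq> 0" by (auto simp: trans_def split: if_splits)
          then have "inv s \<otimes> x \<in> V1 \<inter> V2" using supp by blast
          then have "\<bar>f' (s \<otimes> (inv s \<otimes> x)) / m (s \<otimes> (inv s \<otimes> x)) - f' s / m s\<bar> < d" using u cs(2) by blast
          moreover have "s \<otimes> (inv s \<otimes> x) = x" using cs(2) x(1) by (simp add: m_assoc[symmetric])
          ultimately have "f' x / m x \<le> f' s / m s + d" by simp
          then show ?thesis using tp by (rule mult_left_mono)
        qed simp
        then have "c * (trans s \<phi> x * (f' x / m x)) \<le> c * (trans s \<phi> x * (f' s / m s + d))"
          using cs(1) by (rule mult_left_mono)
        moreover have "comb \<phi> ys x * (f' x / m x) \<le> comb \<phi> (map ?m ys) x" by (rule Cons.IH[OF cs(3)])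
        ultimately have "c * (trans s \<phi> x * (f' x / m x)) + comb \<phi> ys x * (f' x / m x)
          \<le> c * (trans s \<phi> x * (f' s / m s + d)) + comb \<phi> (map ?m ys) x" by (rule add_mono)
        moreover have "comb \<phi> (y # ys) x * (f' x / m x)
          = c * (trans s \<phi> x * (f' x / m x)) + comb \<phi> ys x * (f' x / m x)"
          by (simp only: y comb_def list.map sum_list.Cons prod.case distrib_right mult.assoc)
        moreover have "comb \<phi> (map ?m (y # ys)) x
          = c * (trans s \<phi> x * (f' s / m s + d)) + comb \<phi> (map ?m ys) x"
          by (simp add: y comb_def mult_ac)
        ultimately show ?case by simp
      qed simp
      have "admiss (map ?m xs)"
        using xs d hi(2)[OF f'] by (auto simp: covers_def admiss_def intro!: mult_nonneg_nonneg add_nonneg_nonneg)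
      moreover have "f' x \<le> comb \<phi> (map ?m xs) x" for x
      proof -
        have "f' x = h x * (f' x / m x)" by (rule hi(4)[OF f'])
        also have "\<dots> \<le> comb \<phi> xs x * (f' x / m x)"
          using xs hi(2)[OF f'] by (intro mult_right_mono) (auto simp: covers_def)
        also have "\<dots> \<le> comb \<phi> (map ?m xs) x" using xs by (intro comb) (simp add: covers_def)
        finally show ?thesis .
      qed
      ultimately show "covers \<phi> f' (map ?m xs)" by (simp add: covers_def)
    qed
    have total: "weight (map (\<lambda>(c, s). (c * (f1 s / m s + d), s)) xs) + weight (map (\<lambda>(c, s). (c * (f2 s / m s + d), s)) xs)
        \<le> (1 + 2 * d) * weight xs" if "admiss xs" for xs
      using that
    proof (induction xs)
      case (Cons y ys)
      obtain c s where y: "y = (c, s)" by fastforce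
      have cs: "0 \<le> c" "admiss ys" using Cons.prems y by auto
      have "0 \<le> d * g s" using d Cp_nonneg[OF g(1)] by simp
      then have "f1 s + f2 s \<le> m s" using m(3)[of s] unfolding h_def by linarith
      then have "f1 s / m s + f2 s / m s \<le> 1" using m(1)[of s] by (simp add: add_divide_distrib[symmetric])
      then have "c * ((f1 s / m s + d) + (f2 s / m s + d)) \<le> c * (1 + 2 * d)"
        using cs(1) by (intro mult_left_mono) auto
      with Cons.IH[OF cs(2)] show ?case by (simp add: y algebra_simps)
    qed simp
    have "(cov \<phi> f1 + cov \<phi> f2) / (1 + 2 * d) \<le> cov \<phi> h"
    proof (rule cov_greatest[OF h \<phi>])
      fix xs assume xs: "covers \<phi> h xs"
      have "cov \<phi> f1 + cov \<phi> f2 \<le> (1 + 2 * d) * weight xs"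
        using weights[OF f(1) f1' xs] weights[OF f(2) f2' xs] V1(3) V2(3) total[of xs] xs
        by (fastforce simp: covers_def)
      then show "(cov \<phi> f1 + cov \<phi> f2) / (1 + 2 * d) \<le> weight xs"
        using d by (simp add: divide_le_eq mult.commute)
    qed
    also have "cov \<phi> h \<le> cov \<phi> (\<lambda>x. f1 x + f2 x) + d * cov \<phi> g"
      using cov_add[OF f12 dg \<phi>] cov_scale[OF g(1) \<phi>, of d] d by (simp add: h_def[abs_def])
    finally have "cov \<phi> f1 + cov \<phi> f2 \<le> (1 + 2 * d) * (cov \<phi> (\<lambda>x. f1 x + f2 x) + d * cov \<phi> g)"
      using d by (simp add: divide_le_eq mult.commute)
    also have "\<dots> = cov \<phi> (\<lambda>x. f1 x + f2 x) + d * (2 * cov \<phi> (\<lambda>x. f1 x + f2 x) + (1 + 2 * d) * cov \<phi> g)"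
      by (simp add: algebra_simps)
    also have "\<dots> \<le> cov \<phi> (\<lambda>x. f1 x + f2 x) + d * (2 * (A * cov \<phi> f0) + 2 * (B * cov \<phi> f0))"
    proof -
      have a: "cov \<phi> (\<lambda>x. f1 x + f2 x) \<le> A * cov \<phi> f0" unfolding A_def by (rule cov_submult[OF f12 f0 \<phi>])
      have b: "cov \<phi> g \<le> B * cov \<phi> f0" unfolding B_def by (rule cov_submult[OF g(1) f0 \<phi>])
      have "(1 + 2 * d) * cov \<phi> g \<le> 2 * cov \<phi> g"
        using d_half d cov_nonneg[OF g(1) \<phi>] by (intro mult_right_mono) auto
      with a b have "2 * cov \<phi> (\<lambda>x. f1 x + f2 x) + (1 + 2 * d) * cov \<phi> g \<le> 2 * (A * cov \<phi> f0) + 2 * (B * cov \<phi> f0)"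
        by linarith
      then show ?thesis using d by (intro add_left_mono mult_left_mono) auto
    qed
    also have "\<dots> = cov \<phi> (\<lambda>x. f1 x + f2 x) + (d * (2 * A + 2 * B)) * cov \<phi> f0" by (simp add: algebra_simps)
    also have "\<dots> \<le> cov \<phi> (\<lambda>x. f1 x + f2 x) + e * cov \<phi> f0"
      using de cov_pos[OF f0 \<phi>] by (intro add_left_mono mult_right_mono) auto
    finally show ?thesis .
  qed
  moreover have "openin T (V1 \<inter> V2)" "\<one> \<in> V1 \<inter> V2" using V1 V2 by auto
  ultimately show thesis using that by blast
qed

text \<open>Strict positivity on nonzero functions is included; it keeps the autocorrelation from
  vanishing at the unit.\<close>

definition Haar :: "(('a \<Rightarrow> real) \<Rightarrow> real) \<Rightarrow> bool" where
  "Haar I \<longleftrightarrow> (\<forall>f\<in>Cp. 0 \<le> I f) \<and> (\<forall>f. nz f \<longrightarrow> 0 < I f) \<and>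
     (\<forall>f\<in>Cp. \<forall>g\<in>Cp. I (\<lambda>x. f x + g x) = I f + I g) \<and>
     (\<forall>f\<in>Cp. \<forall>r\<ge>0. I (\<lambda>x. r * f x) = r * I f) \<and>
     (\<forall>f\<in>Cp. \<forall>s\<in>carrier G. I (trans s f) = I f)"

lemma HaarD:
  assumes "Haar I"
  shows Haar_nonneg: "f \<in> Cp \<Longrightarrow> 0 \<le> I f"
    and Haar_pos: "nz f \<Longrightarrow> 0 < I f"
    and Haar_add: "f \<in> Cp \<Longrightarrow> g \<in> Cp \<Longrightarrow> I (\<lambda>x. f x + g x) = I f + I g"
    and Haar_scale: "f \<in> Cp \<Longrightarrow> 0 \<le> r \<Longrightarrow> I (\<lambda>x. r * f x) = r * I f"
    and Haar_trans: "f \<in> Cp \<Longrightarrow> s \<in> carrier G \<Longrightarrow> I (trans s f) = I f"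
proof -
  have *: "\<forall>f\<in>Cp. 0 \<le> I f" "\<forall>f. nz f \<longrightarrow> 0 < I f"
    "\<forall>f\<in>Cp. \<forall>g\<in>Cp. I (\<lambda>x. f x + g x) = I f + I g"
    "\<forall>f\<in>Cp. \<forall>r\<ge>0. I (\<lambda>x. r * f x) = r * I f"
    "\<forall>f\<in>Cp. \<forall>s\<in>carrier G. I (trans s f) = I f"
    using assms unfolding Haar_def by - (elim conjE, assumption)+
  show "f \<in> Cp \<Longrightarrow> 0 \<le> I f" using *(1) by (rule bspec)
  show "nz f \<Longrightarrow> 0 < I f" by (rule mp[OF *(2)[THEN spec]])
  show "f \<in> Cp \<Longrightarrow> g \<in> Cp \<Longrightarrow> I (\<lambda>x. f x + g x) = I f + I g" by (rule bspec[OF bspec[OF *(3)]])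
  show "f \<in> Cp \<Longrightarrow> 0 \<le> r \<Longrightarrow> I (\<lambda>x. r * f x) = r * I f" by (rule mp[OF spec[OF bspec[OF *(4)]]])
  show "f \<in> Cp \<Longrightarrow> s \<in> carrier G \<Longrightarrow> I (trans s f) = I f" by (rule bspec[OF bspec[OF *(5)]])
qed

lemma nz_bump:
  assumes "openin T U" "\<one> \<in> U"
  obtains f where "nz f" "f \<one> = 1" "\<And>y. y \<notin> U \<Longrightarrow> f y = 0"
proof -
  obtain f where f: "f \<in> Cp" "f \<one> = 1" "\<And>y. y \<notin> U \<Longrightarrow> f y = 0" using Cp_bump[OF assms] by blast
  then have "nz f" unfolding nz_def by (metis zero_neq_one)
  then show thesis using f(2,3) by (rule that)
qed

text \<open>A common point of the closed sets that the normalized covering functionals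
  \<open>cov \<phi> / cov \<phi> f\<^sub>0\<close> reach as the support of \<open>\<phi>\<close> shrinks to the unit.\<close>

theorem Haar_exists: "\<exists>I. Haar I"
proof -
  obtain f0 where f0: "nz f0" using nz_bump[OF carrier_open] by auto
  have f0C: "f0 \<in> Cp" using f0 by (simp add: nz_def)
  \<comment> \<open>Bounds for the normalized functionals, both from \<open>cov_submult\<close>.
    They span a compact box, and \<open>lo f > 0\<close> for nonzero \<open>f\<close> keeps the
    limit strictly positive.\<close>
  define lo where "lo f = (if nz f then 1 / cov f f0 else 0)" for f
  define hi where "hi f = (if f \<in> Cp then cov f0 f else 0)" for f
  define J where "J \<phi> f = (if f \<in> Cp then cov \<phi> f / cov \<phi> f0 else 0)" for \<phi> f
  define X where "X = {I. \<forall>f. I f \<in> {lo f..hi f}}"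
  \<comment> \<open>\<open>E\<close> collects closed conditions that every normalized functional
    satisfies exactly; \<open>D\<close> those that hold up to an error \<open>e\<close> once the
    support of \<phi> is small.\<close>
  define E where "E = (\<Inter>f\<in>Cp. \<Inter>g\<in>Cp. {I :: ('a \<Rightarrow> real) \<Rightarrow> real. I (\<lambda>x. f x + g x) \<le> I f + I g})
    \<inter> (\<Inter>f\<in>Cp. \<Inter>r\<in>{0..}. {I. I (\<lambda>x. r * f x) = r * I f})
    \<inter> (\<Inter>f\<in>Cp. \<Inter>s\<in>carrier G. {I. I (trans s f) = I f})"
  define D where "D w = (case w of (f, g, e) \<Rightarrow> {I :: ('a \<Rightarrow> real) \<Rightarrow> real. I f + I g \<le> I (\<lambda>x. f x + g x) + e})" for w
  define W where "W = Cp \<times> Cp \<times> {0 :: real<..}"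
  have "compact X"
  proof -
    have "X = PiE UNIV (\<lambda>f. {lo f..hi f})" by (auto simp: X_def PiE_iff)
    moreover have "compactin (product_topology (\<lambda>_ :: 'a \<Rightarrow> real. euclideanreal) UNIV) (PiE UNIV (\<lambda>f. {lo f..hi f}))"
      by (subst compactin_PiE) auto
    ultimately show ?thesis by (simp add: euclidean_product_topology)
  qed
  moreover have "closed E"
    unfolding E_def
    by (intro closed_Int closed_INT ballI closed_Collect_le closed_Collect_eq continuous_intros continuous_on_eval)
  ultimately have XE: "compact (X \<inter> E)" by (rule compact_Int_closed)
  have J: "J \<phi> \<in> X \<inter> E" if \<phi>: "nz \<phi>" for \<phi>
  proof
    have c0: "cov \<phi> f0 > 0" by (rule cov_pos[OF f0 \<phi>])
    show "J \<phi> \<in> X"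
    proof -
      have "lo f \<le> J \<phi> f" for f
      proof (cases "nz f")
        case True
        then have fC: "f \<in> Cp" by (simp add: nz_def)
        have "cov \<phi> f0 \<le> cov f f0 * cov \<phi> f" by (rule cov_submult[OF f0C True \<phi>])
        then show ?thesis using True fC c0 cov_pos[OF f0 True]
          by (simp add: lo_def J_def divide_le_eq le_divide_eq mult.commute)
      next
        case False
        then show ?thesis using cov_nonneg[OF _ \<phi>, of f] c0 by (simp add: lo_def J_def)
      qed
      moreover have "J \<phi> f \<le> hi f" for f
        using cov_submult[OF _ f0 \<phi>, of f] c0 by (simp add: hi_def J_def divide_le_eq)
      ultimately show ?thesis by (simp add: X_def)
    qed
    show "J \<phi> \<in> E"
      unfolding E_def
    proof (intro IntI INT_I CollectI)
      show "J \<phi> (\<lambda>x. f x + g x) \<le> J \<phi> f + J \<phi> g" if "f \<in> Cp" "g \<in> Cp" for f g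
        using that cov_add[OF that \<phi>] c0 Cp_add[OF that] by (simp add: J_def add_divide_distrib[symmetric] divide_right_mono)
      show "J \<phi> (\<lambda>x. r * f x) = r * J \<phi> f" if "f \<in> Cp" "r \<in> {0..}" for f r
        using that cov_scale[OF that(1) \<phi>, of r] Cp_scale[OF that(1), of r] by (simp add: J_def)
      show "J \<phi> (trans s f) = J \<phi> f" if "f \<in> Cp" "s \<in> carrier G" for f s
        using that cov_trans[OF that(1) \<phi> that(2)] Cp_trans[OF that] by (simp add: J_def)
    qed
  qed
  \<comment> \<open>Finitely many conditions \<open>D\<close> hold together for all \<phi> supported
    in one common neighbourhood of the unit, which exists because open sets have open finite
    intersections.\<close>
  have fin: "\<exists>V. openin T V \<and> \<one> \<in> V \<and> (\<forall>\<phi>. nz \<phi> \<and> (\<forall>x. x \<notin> V \<longrightarrow> \<phi> x = 0) \<longrightarrow> J \<phi> \<in> \<Inter>(D ` W'))"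
    if "finite W'" "W' \<subseteq> W" for W'
    using that
  proof (induction W' rule: finite_induct)
    case empty
    then show ?case using carrier_open by (intro exI[of _ "carrier G"]) auto
  next
    case (insert w W')
    then obtain V where V: "openin T V" "\<one> \<in> V" "\<forall>\<phi>. nz \<phi> \<and> (\<forall>x. x \<notin> V \<longrightarrow> \<phi> x = 0) \<longrightarrow> J \<phi> \<in> \<Inter>(D ` W')" by auto
    obtain f g e where w: "w = (f, g, e)" "f \<in> Cp" "g \<in> Cp" "e > 0" using insert.prems by (auto simp: W_def)
    obtain U where U: "openin T U" "\<one> \<in> U"
      "\<And>\<phi>. nz \<phi> \<Longrightarrow> (\<And>x. x \<notin> U \<Longrightarrow> \<phi> x = 0) \<Longrightarrow> cov \<phi> f + cov \<phi> g \<le> cov \<phi> (\<lambda>x. f x + g x) + e * cov \<phi> f0"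
      using approx_additive[OF w(2,3) f0 w(4)] by blast
    have "J \<phi> \<in> \<Inter>(D ` insert w W')" if \<phi>: "nz \<phi>" "\<forall>x. x \<notin> V \<inter> U \<longrightarrow> \<phi> x = 0" for \<phi>
    proof -
      have c0: "cov \<phi> f0 > 0" by (rule cov_pos[OF f0 \<phi>(1)])
      have "cov \<phi> f + cov \<phi> g \<le> cov \<phi> (\<lambda>x. f x + g x) + e * cov \<phi> f0" using \<phi> by (intro U(3)) auto
      then have "(cov \<phi> f + cov \<phi> g) / cov \<phi> f0 \<le> (cov \<phi> (\<lambda>x. f x + g x) + e * cov \<phi> f0) / cov \<phi> f0"
        using c0 by (intro divide_right_mono) auto
      then have "J \<phi> \<in> D w" using c0 w Cp_add[OF w(2,3)] by (simp add: D_def J_def add_divide_distrib)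
      then show ?thesis using V(3) \<phi> by auto
    qed
    then show ?case using V U by (intro exI[of _ "V \<inter> U"]) auto
  qed
  have "(X \<inter> E) \<inter> \<Inter>(D ` W) \<noteq> {}"
  proof (rule compact_imp_fip[OF XE])
    show "closed S" if "S \<in> D ` W" for S
      using that unfolding D_def
      by (auto intro!: closed_Collect_le continuous_intros continuous_on_eval)
    fix F' assume "finite F'" "F' \<subseteq> D ` W"
    then obtain W' where W': "W' \<subseteq> W" "finite W'" "F' = D ` W'" using finite_subset_image by meson
    then obtain V where V: "openin T V" "\<one> \<in> V" "\<forall>\<phi>. nz \<phi> \<and> (\<forall>x. x \<notin> V \<longrightarrow> \<phi> x = 0) \<longrightarrow> J \<phi> \<in> \<Inter>(D ` W')"
      using fin[OF W'(2,1)] by blast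
    obtain \<phi> where "nz \<phi>" "\<And>x. x \<notin> V \<Longrightarrow> \<phi> x = 0" using nz_bump[OF V(1,2)] by blast
    then have "J \<phi> \<in> (X \<inter> E) \<inter> \<Inter>F'" using V(3) J W'(3) by blast
    then show "(X \<inter> E) \<inter> \<Inter>F' \<noteq> {}" by blast
  qed
  then obtain I where I: "I \<in> X" "I \<in> E" "I \<in> \<Inter>(D ` W)" by blast
  have lo: "lo f \<le> I f" for f using I(1) by (auto simp: X_def)
  have lo0: "0 \<le> lo f" for f using cov_pos[OF f0, of f] by (cases "nz f") (simp_all add: lo_def less_imp_le)
  have "Haar I"
    unfolding Haar_def
  proof (intro conjI ballI allI impI)
    show "0 \<le> I f" for f using lo[of f] lo0[of f] by linarith
    show "0 < I f" if "nz f" for f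
    proof -
      have "0 < lo f" using cov_pos[OF f0 that] that by (simp add: lo_def)
      then show ?thesis using lo[of f] by linarith
    qed
    fix f assume f: "f \<in> Cp"
    show "I (\<lambda>x. f x + g x) = I f + I g" if g: "g \<in> Cp" for g
    proof (rule antisym)
      show "I (\<lambda>x. f x + g x) \<le> I f + I g" using I(2) f g by (auto simp: E_def)
      show "I f + I g \<le> I (\<lambda>x. f x + g x)"
      proof (rule field_le_epsilon)
        fix e :: real assume "e > 0"
        then have "(f, g, e) \<in> W" using f g by (simp add: W_def)
        then have "I \<in> D (f, g, e)" using I(3) by blast
        then show "I f + I g \<le> I (\<lambda>x. f x + g x) + e" by (simp add: D_def)
      qed
    qed
    show "I (\<lambda>x. r * f x) = r * I f" if "0 \<le> r" for r using I(2) f that by (auto simp: E_def)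
    show "I (trans s f) = I f" if "s \<in> carrier G" for s using I(2) f that by (auto simp: E_def)
  qed
  then show ?thesis by blast
qed

subsection \<open>Positive definite functions of small support\<close>

lemma
  assumes I: "Haar I" and A: "finite A" "\<And>i. i \<in> A \<Longrightarrow> f i \<in> Cp"
  shows Cp_sum: "(\<lambda>x. \<Sum>i\<in>A. f i x) \<in> Cp" and Haar_sum: "I (\<lambda>x. \<Sum>i\<in>A. f i x) = (\<Sum>i\<in>A. I (f i))"
proof -
  have zero: "I (\<lambda>x. 0) = 0"
    using Haar_scale[OF I Cp_zero, of 0] by simp
  have "(\<lambda>x. \<Sum>i\<in>A. f i x) \<in> Cp \<and> I (\<lambda>x. \<Sum>i\<in>A. f i x) = (\<Sum>i\<in>A. I (f i))"
    using A
  proof (induction A rule: finite_induct)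
    case empty
    then show ?case using zero Cp_zero by simp
  next
    case (insert j A)
    then have *: "f j \<in> Cp" "(\<lambda>x. \<Sum>i\<in>A. f i x) \<in> Cp" "I (\<lambda>x. \<Sum>i\<in>A. f i x) = (\<Sum>i\<in>A. I (f i))" by auto
    have "I (\<lambda>x. f j x + (\<Sum>i\<in>A. f i x)) = I (f j) + I (\<lambda>x. \<Sum>i\<in>A. f i x)"
      by (rule Haar_add[OF I *(1,2)])
    then show ?case using insert.hyps * Cp_add[OF *(1,2)] by simp
  qed
  then show "(\<lambda>x. \<Sum>i\<in>A. f i x) \<in> Cp" "I (\<lambda>x. \<Sum>i\<in>A. f i x) = (\<Sum>i\<in>A. I (f i))" by auto
qed

text \<open>The difference is again in \<open>Cp\<close>: it vanishes wherever \<open>g\<close>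
  does.\<close>

lemma Haar_mono:
  assumes I: "Haar I" and f: "f \<in> Cp" and g: "g \<in> Cp" and le: "\<And>x. f x \<le> g x"
  shows "I f \<le> I g"
proof -
  obtain K where K: "compactin T K" "\<And>x. x \<notin> K \<Longrightarrow> g x = 0" using Cp_support[OF g] by blast
  have D: "(\<lambda>x. g x - f x) \<in> Cp"
  proof (rule CpI[OF _ _ K(1)])
    show "continuous_map T euclideanreal (\<lambda>x. g x - f x)" by (intro continuous_map_diff Cp_continuous f g)
    show "0 \<le> g x - f x" for x using le by simp
    show "g x - f x = 0" if "x \<notin> K" for x using K(2)[OF that] le[of x] Cp_nonneg[OF f, of x] by simp
  qed
  have "I (\<lambda>x. f x + (g x - f x)) = I f + I (\<lambda>x. g x - f x)"
    by (rule Haar_add[OF I f D])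
  moreover have "0 \<le> I (\<lambda>x. g x - f x)" by (rule Haar_nonneg[OF I D])
  ultimately show ?thesis by simp
qed

definition corr :: "(('a \<Rightarrow> real) \<Rightarrow> real) \<Rightarrow> ('a \<Rightarrow> real) \<Rightarrow> 'a \<Rightarrow> 'a \<Rightarrow> real" where
  "corr I k s t = I (\<lambda>y. trans s k y * trans t k y)"

lemma corr_sym: "corr I k s t = corr I k t s"
  by (simp add: corr_def mult.commute)

text \<open>The left integrand is the translate by \<open>t\<close> of the right one, and
  \<open>I\<close> is invariant.\<close>

lemma corr_translate:
  assumes I: "Haar I" and k: "k \<in> Cp" and s: "s \<in> carrier G" and t: "t \<in> carrier G"
  shows "corr I k s t = corr I k (inv t \<otimes> s) \<one>"
proof -
  let ?f = "\<lambda>y. trans (inv t \<otimes> s) k y * trans \<one> k y"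
  have f: "?f \<in> Cp" using k s t by (intro Cp_mult Cp_trans) auto
  have "trans t ?f = (\<lambda>y. trans s k y * trans t k y)"
  proof
    fix y
    have "trans t (trans (inv t \<otimes> s) k) = trans s k" "trans t (trans \<one> k) = trans t k"
      using s t by (simp_all add: trans_trans m_assoc[symmetric])
    moreover have "trans t (\<lambda>y. u y * v y) y = trans t u y * trans t v y" for u v
      by (simp add: trans_def)
    ultimately show "trans t ?f y = trans s k y * trans t k y" by simp
  qed
  moreover have "I (trans t ?f) = I ?f" by (rule Haar_trans[OF I f t])
  ultimately show ?thesis by (simp add: corr_def)
qed

text \<open>The form is the integral of the square of the function with value
  \<open>\<Sum>i<n. a i * trans (x i) k y\<close> at \<open>y\<close>.\<close>

lemma corr_quadratic_nonneg:
  fixes n :: nat and a :: "nat \<Rightarrow> real"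
  assumes I: "Haar I" and k: "k \<in> Cp" and x: "\<And>i. i < n \<Longrightarrow> x i \<in> carrier G"
  shows "0 \<le> (\<Sum>i<n. \<Sum>j<n. a i * a j * corr I k (x i) (x j))"
proof -
  let ?A = "{..<n} \<times> {..<n}"
  define g where "g w y = trans (x (fst w)) k y * trans (x (snd w)) k y" for w y
  \<comment> \<open>Additivity of \<open>I\<close> is available for nonnegative functions only, so
    the products of coefficients are split into positive and negative parts and the two integrals
    are compared.\<close>
  define p where "p w = max (a (fst w) * a (snd w)) 0" for w
  define q where "q w = max (- (a (fst w) * a (snd w))) 0" for w
  have pq: "0 \<le> p w" "0 \<le> q w" "p w - q w = a (fst w) * a (snd w)" for w by (auto simp: p_def q_def max_def)
  have g: "g w \<in> Cp" if "w \<in> ?A" for w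
    unfolding g_def using that x k by (intro Cp_mult Cp_trans) auto
  have Ig: "I (\<lambda>y. r * g w y) = r * corr I k (x (fst w)) (x (snd w))" if "w \<in> ?A" "0 \<le> r" for w r
  proof -
    have "I (\<lambda>y. r * g w y) = r * I (g w)" by (rule Haar_scale[OF I g[OF that(1)] that(2)])
    then show ?thesis by (simp add: corr_def g_def[abs_def])
  qed
  have mem: "(\<lambda>y. p w * g w y) \<in> Cp" "(\<lambda>y. q w * g w y) \<in> Cp" if "w \<in> ?A" for w
    by (rule Cp_scale[OF g[OF that] pq(1)], rule Cp_scale[OF g[OF that] pq(2)])
  have fin: "finite ?A" by simp
  have P: "(\<lambda>y. \<Sum>w\<in>?A. p w * g w y) \<in> Cp"
    "I (\<lambda>y. \<Sum>w\<in>?A. p w * g w y) = (\<Sum>w\<in>?A. I (\<lambda>y. p w * g w y))"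
    by (rule Cp_sum[OF I fin mem(1)], assumption, rule Haar_sum[OF I fin mem(1)])
  have Q: "(\<lambda>y. \<Sum>w\<in>?A. q w * g w y) \<in> Cp"
    "I (\<lambda>y. \<Sum>w\<in>?A. q w * g w y) = (\<Sum>w\<in>?A. I (\<lambda>y. q w * g w y))"
    by (rule Cp_sum[OF I fin mem(2)], assumption, rule Haar_sum[OF I fin mem(2)])
  have "I (\<lambda>y. \<Sum>w\<in>?A. q w * g w y) \<le> I (\<lambda>y. \<Sum>w\<in>?A. p w * g w y)"
  proof (rule Haar_mono[OF I Q(1) P(1)])
    fix y
    have "(\<Sum>w\<in>?A. p w * g w y) - (\<Sum>w\<in>?A. q w * g w y) = (\<Sum>w\<in>?A. a (fst w) * a (snd w) * g w y)"
      by (simp only: sum_subtractf[symmetric] left_diff_distrib[symmetric] pq)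
    also have "\<dots> = (\<Sum>i<n. \<Sum>j<n. (a i * trans (x i) k y) * (a j * trans (x j) k y))"
      unfolding sum.cartesian_product by (rule sum.cong) (auto simp: g_def mult_ac)
    also have "\<dots> = (\<Sum>i<n. a i * trans (x i) k y)\<^sup>2"
      by (simp add: power2_eq_square sum_product)
    finally show "(\<Sum>w\<in>?A. q w * g w y) \<le> (\<Sum>w\<in>?A. p w * g w y)"
      using zero_le_power2[of "\<Sum>i<n. a i * trans (x i) k y"] by linarith
  qed
  then have "0 \<le> (\<Sum>w\<in>?A. I (\<lambda>y. p w * g w y)) - (\<Sum>w\<in>?A. I (\<lambda>y. q w * g w y))"
    by (simp only: P(2) Q(2) diff_ge_0_iff_ge)
  also have "\<dots> = (\<Sum>w\<in>?A. a (fst w) * a (snd w) * corr I k (x (fst w)) (x (snd w)))"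
    unfolding sum_subtractf[symmetric]
    by (rule sum.cong[OF refl]) (simp only: Ig pq(1,2) left_diff_distrib[symmetric] pq(3))
  also have "\<dots> = (\<Sum>i<n. \<Sum>j<n. a i * a j * corr I k (x i) (x j))"
    unfolding sum.cartesian_product by (rule sum.cong) auto
  finally show ?thesis .
qed

definition autocorr :: "(('a \<Rightarrow> real) \<Rightarrow> real) \<Rightarrow> ('a \<Rightarrow> real) \<Rightarrow> 'a \<Rightarrow> complex" where
  "autocorr I k x = (if x \<in> carrier G then of_real (corr I k x \<one>) else 0)"

text \<open>Real and imaginary parts of the coefficients each contribute a real quadratic form, and
  the symmetry of \<open>corr\<close> cancels the cross terms.\<close>

lemma positive_definite_autocorr:
  assumes I: "Haar I" and k: "k \<in> Cp"
  shows "positive_definite G (autocorr I k)"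
  unfolding positive_definite_def
proof (intro conjI allI impI)
  show "autocorr I k \<in> functions_on G" by (simp add: functions_on_def autocorr_def)
  fix n :: nat and c x assume x: "\<forall>i<n. x i \<in> carrier G"
  let ?M = "\<lambda>i j. corr I k (x i) (x j)"
  have M: "autocorr I k (inv (x j) \<otimes> x i) = of_real (?M i j)" if "i < n" "j < n" for i j
    using x that corr_translate[OF I k, of "x i" "x j"] by (simp add: autocorr_def)
  have eq: "(\<Sum>i<n. \<Sum>j<n. c i * cnj (c j) * autocorr I k (inv (x j) \<otimes> x i))
      = (\<Sum>i<n. \<Sum>j<n. c i * cnj (c j) * of_real (?M i j))"
    by (intro sum.cong refl) (simp add: M)
  have "Re (\<Sum>i<n. \<Sum>j<n. c i * cnj (c j) * of_real (?M i j))
      = (\<Sum>i<n. \<Sum>j<n. Re (c i) * Re (c j) * ?M i j) + (\<Sum>i<n. \<Sum>j<n. Im (c i) * Im (c j) * ?M i j)"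
    unfolding Re_sum sum.distrib[symmetric] by (intro sum.cong refl) (simp add: algebra_simps)
  moreover have "0 \<le> (\<Sum>i<n. \<Sum>j<n. Re (c i) * Re (c j) * ?M i j)" "0 \<le> (\<Sum>i<n. \<Sum>j<n. Im (c i) * Im (c j) * ?M i j)"
    using corr_quadratic_nonneg[OF I k, of n x "\<lambda>i. Re (c i)"] corr_quadratic_nonneg[OF I k, of n x "\<lambda>i. Im (c i)"] x by auto
  moreover have "Im (\<Sum>i<n. \<Sum>j<n. c i * cnj (c j) * of_real (?M i j)) = 0"
  proof -
    have "Im (\<Sum>i<n. \<Sum>j<n. c i * cnj (c j) * of_real (?M i j))
        = (\<Sum>i<n. \<Sum>j<n. Im (c i) * Re (c j) * ?M i j) - (\<Sum>i<n. \<Sum>j<n. Re (c i) * Im (c j) * ?M i j)"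
      unfolding Im_sum sum_subtractf[symmetric] by (intro sum.cong refl) (simp add: algebra_simps)
    also have "(\<Sum>i<n. \<Sum>j<n. Re (c i) * Im (c j) * ?M i j) = (\<Sum>j<n. \<Sum>i<n. Re (c i) * Im (c j) * ?M i j)"
      by (rule sum.swap)
    also have "\<dots> = (\<Sum>i<n. \<Sum>j<n. Im (c i) * Re (c j) * ?M i j)"
    proof (intro sum.cong refl)
      fix j i
      show "Re (c i) * Im (c j) * ?M i j = Im (c j) * Re (c i) * ?M j i"
        by (subst corr_sym) simp
    qed
    finally show ?thesis by simp
  qed
  ultimately show "(\<Sum>i<n. \<Sum>j<n. c i * cnj (c j) * autocorr I k (inv (x j) \<otimes> x i)) \<in> \<real>\<^sub>\<ge>\<^sub>0"
    unfolding eq nonneg_Reals_iff by simp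
qed

text \<open>Krein's inequality reduces continuity to continuity at the unit.\<close>

lemma autocorr_continuous:
  assumes I: "Haar I" and k: "k \<in> Cp"
  shows "continuous_map T euclidean (autocorr I k)"
proof -
  let ?\<psi> = "autocorr I k"
  have pd: "positive_definite G ?\<psi>" by (rule positive_definite_autocorr[OF I k])
  note one0 = positive_definite_one(2)[OF pd]
  obtain K where K: "compactin T K" "\<And>x. x \<notin> K \<Longrightarrow> k x = 0" using Cp_support[OF k] by blast
  \<comment> \<open>If \<open>k (inv x \<otimes> y)\<close> is within \<open>e\<close> of
    \<open>k y\<close> for all \<open>y\<close>, the correlation drops by at most
    \<open>e * I k\<close> from the unit to \<open>x\<close>; this explains the choice of
    \<open>e\<close>.\<close>
  have at_one: "\<exists>V. openin T V \<and> \<one> \<in> V \<and> (\<forall>x\<in>V. Re (?\<psi> \<one>) - Re (?\<psi> x) \<le> d)" if d: "d > 0" for d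
  proof -
    have Ik: "0 \<le> I k" by (rule Haar_nonneg[OF I k])
    define e where "e = d / (I k + 1)"
    have e: "e > 0" using d Ik by (simp add: e_def)
    have mult: "continuous_map (prod_topology T T) T (\<lambda>(z, y). z \<otimes> y)" by (rule tg_mult)
    obtain V where V: "openin T V" "\<one> \<in> V" "\<And>z y. z \<in> V \<Longrightarrow> y \<in> carrier G \<Longrightarrow> \<bar>k (z \<otimes> y) - k y\<bar> < e"
      using uniform_continuity[OF mult _ _ Cp_continuous[OF k] K e] by (auto simp: m_assoc[symmetric])
    have "Re (?\<psi> \<one>) - Re (?\<psi> x) \<le> d" if x: "x \<in> carrier G" "inv x \<in> V" for x
    proof -
      note kx = Cp_trans[OF k x(1)] and k1 = Cp_trans[OF k one_closed]
      have "trans \<one> k y * trans \<one> k y \<le> trans x k y * trans \<one> k y + e * trans \<one> k y" for y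
      proof (cases "y \<in> carrier G")
        case True
        have "k y \<le> k (inv x \<otimes> y) + e" using V(3)[OF x(2) True] by linarith
        then have "k y * k y \<le> (k (inv x \<otimes> y) + e) * k y"
          using Cp_nonneg[OF k] by (intro mult_right_mono) auto
        then show ?thesis using True by (simp add: trans_def distrib_right)
      qed (simp add: trans_def)
      then have "corr I k \<one> \<one> \<le> I (\<lambda>y. trans x k y * trans \<one> k y + e * trans \<one> k y)"
        unfolding corr_def using e by (intro Haar_mono[OF I] Cp_mult Cp_add Cp_scale kx k1) auto
      also have "\<dots> = corr I k x \<one> + I (\<lambda>y. e * trans \<one> k y)"
        unfolding corr_def
        by (rule Haar_add[OF I Cp_mult[OF kx k1] Cp_scale[OF k1 less_imp_le[OF e]]])
      also have "I (\<lambda>y. e * trans \<one> k y) = e * I k"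
        using Haar_scale[OF I k1 less_imp_le[OF e]] Haar_trans[OF I k one_closed] by simp
      also have "e * I k \<le> d" using d Ik by (simp add: e_def field_simps)
      finally show ?thesis using x(1) by (simp add: autocorr_def)
    qed
    moreover have "openin T {x \<in> carrier G. inv x \<in> V}" by (rule preimage_open[OF tg_inv V(1)])
    moreover have "\<one> \<in> {x \<in> carrier G. inv x \<in> V}" using V(2) by simp
    ultimately show ?thesis by blast
  qed
  show ?thesis
  proof (rule continuous_map_normI)
    fix b and e :: real assume b: "b \<in> topspace T" and e: "e > 0"
    then have bG: "b \<in> carrier G" by simp
    define L where "L = 2 * Re (?\<psi> \<one>) + 1"
    have L: "L > 0" using one0 by (simp add: L_def)
    define d where "d = (e / 2)\<^sup>2 / L"
    have d: "d > 0" using e L by (simp add: d_def)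
    obtain V where V: "openin T V" "\<one> \<in> V" "\<forall>x\<in>V. Re (?\<psi> \<one>) - Re (?\<psi> x) \<le> d" using at_one[OF d] by blast
    let ?U = "{x \<in> carrier G. x \<otimes> inv b \<in> V}"
    have "openin T ?U" by (rule preimage_open[OF tg_right[OF inv_closed[OF bG]] V(1)])
    moreover have "b \<in> ?U" using bG V(2) by simp
    moreover have "cmod (?\<psi> x - ?\<psi> b) < e" if x: "x \<in> ?U" for x
    proof -
      have xG: "x \<in> carrier G" using x by simp
      have "(cmod (?\<psi> (inv (inv x) \<otimes> \<one>) - ?\<psi> (inv (inv b) \<otimes> \<one>)))\<^sup>2
          \<le> 2 * Re (?\<psi> \<one>) * (Re (?\<psi> \<one>) - Re (?\<psi> (inv (inv x) \<otimes> inv b)))"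
        using xG bG by (intro Krein[OF pd]) auto
      then have "(cmod (?\<psi> x - ?\<psi> b))\<^sup>2 \<le> 2 * Re (?\<psi> \<one>) * (Re (?\<psi> \<one>) - Re (?\<psi> (x \<otimes> inv b)))"
        using xG bG by simp
      also have "\<dots> \<le> 2 * Re (?\<psi> \<one>) * d" using V(3) x one0 by (intro mult_left_mono) auto
      also have "\<dots> \<le> L * d" using d by (intro mult_right_mono) (auto simp: L_def)
      also have "\<dots> = (e / 2)\<^sup>2" using L by (simp add: d_def)
      finally have "cmod (?\<psi> x - ?\<psi> b) \<le> e / 2" by (rule power2_le_imp_le) (use e in simp)
      then show ?thesis using e by linarith
    qed
    ultimately show "\<exists>U. openin T U \<and> b \<in> U \<and> (\<forall>y\<in>U. cmod (?\<psi> y - ?\<psi> b) < e)" by blast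
  qed
qed

text \<open>A nonzero integral needs a point \<open>y\<close> where both \<open>k\<close> and its
  translate by \<open>x\<close> are nonzero; then \<open>y\<close> and
  \<open>inv x \<otimes> y\<close> serve as \<open>a\<close> and \<open>b\<close>.\<close>

lemma autocorr_support:
  assumes I: "Haar I" and k: "k \<in> Cp" and W: "\<And>y. y \<notin> W \<Longrightarrow> k y = 0" and x: "autocorr I k x \<noteq> 0"
  obtains a b where "a \<in> W" "b \<in> W" "a \<in> carrier G" "b \<in> carrier G" "x = a \<otimes> inv b"
proof -
  have xG: "x \<in> carrier G" and c: "corr I k x \<one> \<noteq> 0" using x by (auto simp: autocorr_def split: if_splits)
  have "\<exists>y. trans x k y * trans \<one> k y \<noteq> 0"
  proof (rule ccontr)
    assume "\<not> ?thesis"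
    then have "(\<lambda>y. trans x k y * trans \<one> k y) = (\<lambda>y. 0)" by auto
    moreover have "I (\<lambda>y. 0) = 0" using Haar_sum[OF I, of "{}"] by simp
    ultimately show False using c by (simp add: corr_def)
  qed
  then obtain y where "trans x k y \<noteq> 0" "trans \<one> k y \<noteq> 0" by auto
  then have y: "y \<in> carrier G" "k (inv x \<otimes> y) \<noteq> 0" "k y \<noteq> 0" by (auto simp: trans_def split: if_splits)
  have "x = y \<otimes> inv (inv x \<otimes> y)" using xG y(1) by (simp add: inv_mult_group m_assoc[symmetric])
  then show thesis using y W xG by (intro that[of y "inv x \<otimes> y"]) auto
qed

text \<open>An autocorrelation is nonzero at the unit and lives on quotients of points of the
  support of \<open>k\<close>. For small support these quotients stay in \<open>U\<close>, the
  complement of \<open>M\<close> moved by \<open>inv x\<close>, and a right translation brings the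
  unit to \<open>x\<close>.\<close>

theorem separating_function:
  assumes M: "closedin T M" and x: "x \<in> carrier G - M"
  obtains f where "f \<in> Bc" "f x \<noteq> 0" "\<And>y. y \<in> M \<Longrightarrow> f y = 0"
proof -
  have xG: "x \<in> carrier G" using x by simp
  obtain I where I: "Haar I" using Haar_exists by blast
  define U where "U = {u \<in> carrier G. u \<otimes> x \<in> carrier G - M}"
  have "openin T (carrier G - M)" using M openin_diff[OF carrier_open M] by simp
  then have U: "openin T U" unfolding U_def by (rule preimage_open[OF tg_right[OF xG]])
  have "\<one> \<in> U" using x by (simp add: U_def)
  have div: "continuous_map (prod_topology T T) T (\<lambda>w. fst w \<otimes> inv (snd w))"
    using continuous_map_compose[OF continuous_map_snd tg_inv, of T]
    by (intro tg_mult_compose continuous_map_fst) (simp add: o_def)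
  have op: "openin (prod_topology T T) {w \<in> topspace (prod_topology T T). fst w \<otimes> inv (snd w) \<in> U}"
    by (rule openin_continuous_map_preimage[OF div U])
  have mem: "(\<one>, \<one>) \<in> {w \<in> topspace (prod_topology T T). fst w \<otimes> inv (snd w) \<in> U}"
    using \<open>\<one> \<in> U\<close> by simp
  obtain A B where AB: "openin T A" "openin T B" "\<one> \<in> A" "\<one> \<in> B"
    "A \<times> B \<subseteq> {w \<in> topspace (prod_topology T T). fst w \<otimes> inv (snd w) \<in> U}"
    using openin_prod_topology_alt[THEN iffD1, rule_format, OF op mem] by (elim exE conjE) (rule that)
  obtain k where k: "nz k" "k \<one> = 1" "\<And>y. y \<notin> A \<inter> B \<Longrightarrow> k y = 0" 
    by (rule nz_bump[of "A \<inter> B", OF openin_Int[OF AB(1,2)] IntI[OF AB(3,4)]]) (rule that)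
  have kC: "k \<in> Cp" using k by (simp add: nz_def)
  let ?\<psi> = "autocorr I k"
  have in_U: "y \<in> U" if ne: "?\<psi> y \<noteq> 0" for y
  proof -
    obtain a b where ab: "a \<in> A \<inter> B" "b \<in> A \<inter> B" "a \<in> carrier G" "b \<in> carrier G" "y = a \<otimes> inv b"
      by (rule autocorr_support[where W="A \<inter> B", OF I kC k(3) ne]) (assumption, rule that)
    then have "(a, b) \<in> A \<times> B" by simp
    from subsetD[OF AB(5) this] show ?thesis by (simp add: ab(5))
  qed
  obtain K where K: "compactin T K" "\<And>y. y \<notin> K \<Longrightarrow> k y = 0" using Cp_support[OF kC] by blast
  have "compactin T ((\<lambda>w. fst w \<otimes> inv (snd w)) ` (K \<times> K))"
    using K(1) by (intro image_compactin[OF _ div]) (simp add: compactin_Times)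
  moreover have "?\<psi> y = 0" if "y \<in> carrier G - (\<lambda>w. fst w \<otimes> inv (snd w)) ` (K \<times> K)" for y
  proof (rule ccontr)
    assume ne: "?\<psi> y \<noteq> 0"
    obtain a b where ab: "a \<in> K" "b \<in> K" "y = a \<otimes> inv b"
      by (rule autocorr_support[where W=K, OF I kC K(2) ne]) (assumption, rule that)
    then have "y \<in> (\<lambda>w. fst w \<otimes> inv (snd w)) ` (K \<times> K)" by (intro image_eqI[of _ _ "(a, b)"]) auto
    then show False using that by blast
  qed
  moreover have "?\<psi> \<in> B_discrete G"
    by (rule coef_imp_B_discrete[OF positive_definite_coef[OF positive_definite_autocorr[OF I kC]]])
  ultimately have \<psi>: "?\<psi> \<in> Bc"
    unfolding Bc_iff B_alg_iff using autocorr_continuous[OF I kC] by blast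
  have "?\<psi> \<one> \<noteq> 0"
  proof -
    have k1: "trans \<one> k = k" using Cp_off[OF kC] by (intro ext) (simp add: trans_def)
    obtain y where "k y \<noteq> 0" using k(1) by (auto simp: nz_def)
    then have "nz (\<lambda>y. k y * k y)" using Cp_mult[OF kC kC] unfolding nz_def by auto
    then have "0 < I (\<lambda>y. k y * k y)" by (rule Haar_pos[OF I])
    then show ?thesis by (simp add: autocorr_def corr_def k1)
  qed
  then have "right_translate G (inv x) ?\<psi> x \<noteq> 0" using xG by (simp add: right_translate_def)
  moreover have "right_translate G (inv x) ?\<psi> y = 0" if y: "y \<in> M" for y
  proof (rule ccontr)
    assume "right_translate G (inv x) ?\<psi> y \<noteq> 0"
    then have yG: "y \<in> carrier G" "?\<psi> (y \<otimes> inv x) \<noteq> 0" by (auto simp: right_translate_def split: if_splits)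
    then have "y \<otimes> inv x \<in> U" by (intro in_U)
    then show False using yG xG y by (simp add: U_def m_assoc)
  qed
  ultimately show thesis using Bc_right_translate[OF \<psi> inv_closed[OF xG]] that by blast
qed

lemma separates_closed: "separates_points_from_closed_sets T (B_alg G T)"
  unfolding separates_points_from_closed_sets_def
proof (intro allI impI)
  fix M x assume "closedin T M \<and> x \<in> topspace T - M"
  then obtain f where f: "f \<in> Bc" "f x \<noteq> 0" "\<And>y. y \<in> M \<Longrightarrow> f y = 0"
    using separating_function[of M x] by auto
  have "closure (f ` M) \<subseteq> {0}" by (rule closure_minimal) (use f(3) in auto)
  then show "\<exists>f\<in>B_alg G T. f x \<notin> closure (f ` M)" using f(1,2) Bc_sub by blast
qed

lemma separates_points_A: "separates_points (carrier G) (A_alg G T)"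
  unfolding separates_points_def
proof (intro ballI impI)
  fix x y assume xy: "x \<in> carrier G" "y \<in> carrier G" "x \<noteq> y"
  have "closedin T {y}" using T_Hausdorff xy(2) by (simp add: closedin_Hausdorff_singleton)
  then obtain f where "f \<in> Bc" "f x \<noteq> 0" "f y = 0" using separating_function[of "{y}" x] xy by auto
  then show "\<exists>f\<in>A_alg G T. f x \<noteq> f y" using Bc_A_alg by (intro bexI[of _ f]) auto
qed

end

theorem corollary3p9:
  fixes G :: "('a, 'm) monoid_scheme" and T :: "'a topology"
  assumes "right_topological_group G T"
    and "Hausdorff_space T"
    and "admissible G T"
    and "sigma_locally_compact T"
  shows
    "commutative_banach_algebra (B_alg G T) (B_norm G) \<and>
     commutative_banach_algebra (A_alg G T) (B_norm G) \<and>
     (\<forall>f \<in> B_alg G T. \<forall>g \<in> carrier G.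
        left_translate G g f \<in> B_alg G T \<and> right_translate G g f \<in> B_alg G T) \<and>
     bij_betw (pullback_quotient G (N_subgroup G T))
       (B_alg (G Mod N_subgroup G T) (quotient_group_topology G T (N_subgroup G T)))
       (B_sigma G T) \<and>
     (\<forall>f \<in> B_alg (G Mod N_subgroup G T) (quotient_group_topology G T (N_subgroup G T)).
        B_norm G (pullback_quotient G (N_subgroup G T) f) = B_norm (G Mod N_subgroup G T) f) \<and>
     A_alg G T = A_sigma G T \<and>
     (separates_points_from_closed_sets T (B_alg G T) \<longleftrightarrow> topological_group G T) \<and>
     (separates_points (carrier G) (A_alg G T) \<longleftrightarrow> topological_group G T)"
proof -
  interpret group G using assms(1) by (simp add: right_topological_group_def)
  interpret admissible_group G T by unfold_locales (rule assms)+
  \<comment> \<open>The two converse directions construct an integral, for which the locally compact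
    group is available under the assumption \<open>topological_group G T\<close>.\<close>
  have lc: "lc_group G T" if "topological_group G T"
    by unfold_locales (use that assms in \<open>auto simp: sigma_locally_compact_def\<close>)
  show ?thesis
    using B_alg_banach A_alg_banach B_alg_left_translate B_alg_right_translate B_sigma_quotient
      B_norm_quotient A_sigma_eq separates_closed_imp_topological_group[OF B_alg_sigma_continuous]
      separates_points_imp_topological_group[OF B_alg_sigma_continuous]
      lc_group.separates_closed[OF lc] lc_group.separates_points_A[OF lc]
    by blast
qed

end
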